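(* Let $p=(p^1,p^2)$ be a continuous semi-martingale on $[0,2\pi]$ satisfying $dp^j(t)=\sum_{l=1}^{d}\sigma_l^j(t)\,dW^l(t)+b^j(t)\,dt$, $j=1,2$, where $W=(W^1,\dots,W^d)$ are independent Brownian motions on a filtered probability space satisfying the usual conditions, and $\sigma_l^j$, $b^j$ are adapted random processes with $$E\Big[\int_0^{2\pi}(b^j(t))^2\,dt\Big]<\infty,\qquad E\Big[\int_0^{2\pi}(\sigma_l^j(t))^4\,dt\Big]<\infty,\qquad l=1,\dots,d,\ j=1,2.$$ Let $\Sigma^{ij}(t)=\sum_{l=1}^{d}\sigma_l^i(t)\sigma_l^j(t)$. Then for $i,j=1,2$ $$\frac{1}{2\pi}\mathcal{F}(\Sigma^{ij})=\mathcal{F}(dp^i)*_B\mathcal{F}(dp^j),$$ where the convergence of the convolution product is attained in probability; that is, for every integer $k$, $$\frac{1}{2\pi}\mathcal{F}(\Sigma^{ij})(k)=\lim_{N\to\infty}\frac{1}{2N+1}\sum_{s=-N}^{N}\mathcal{F}(dp^i)(s)\,\mathcal{F}(dp^j)(k-s)\quad\text{in probability}.$$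
   Context: For a function $\phi$ on $[0,2\pi]$ (the circle) and $k\in\mathbf{Z}$, $\mathcal{F}(\phi)(k):=\frac{1}{2\pi}\int_0^{2\pi}\phi(\vartheta)e^{-\mathrm{i}k\vartheta}\,d\vartheta$. For a semi-martingale $p^j$, $\mathcal{F}(dp^j)(k):=\frac{1}{2\pi}\int_{]0,2\pi[}e^{-\mathrm{i}k\vartheta}\,dp^j(\vartheta)$ (stochastic integral). Given two functions $\Phi,\Psi$ on $\mathbf{Z}$, the Bohr convolution product is $(\Phi*_B\Psi)(k):=\lim_{N\to\infty}\frac{1}{2N+1}\sum_{s=-N}^{N}\Phi(s)\Psi(k-s)$, and is said to exist if the limit exists for all integers $k$. *)

theory Defs
  imports "HOL-Probability.Probability"
begin

section \<open>Filtered probability spaces and processes on a compact time interval\<close>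

text \<open>The time set is \<open>[0, T]\<close>. The library locale \<^locale>\<open>filtration\<close> indexes by a whole type; only the
  \<open>F t\<close> with \<open>0 \<le> t \<le> T\<close> matter, and a filtration on \<open>[0, T]\<close> extends to all reals by constants.
  The assumption \<open>F_complete\<close> makes \<open>M\<close> complete and puts all its null sets into \<open>F 0\<close>.\<close>

locale usual_filtered_prob_space =
  prob_space M + filtration "space M" F
  for M :: "'a measure" and F :: "real \<Rightarrow> 'a measure" and T :: real +
  assumes F_subalgebra: "\<And>t. t \<in> {0..T} \<Longrightarrow> subalgebra M (F t)"
    and F_complete: "\<And>N A. N \<in> null_sets M \<Longrightarrow> A \<subseteq> N \<Longrightarrow> A \<in> sets (F 0)"
    and F_right_continuous: "\<And>t. t \<in> {0..<T} \<Longrightarrow> sets (F t) = (\<Inter>u\<in>{t<..T}. sets (F u))"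

definition adapted_process ::
  "(real \<Rightarrow> 'a measure) \<Rightarrow> real \<Rightarrow> (real \<Rightarrow> 'a \<Rightarrow> real) \<Rightarrow> bool" where
  "adapted_process F T X \<longleftrightarrow> (\<forall>t\<in>{0..T}. X t \<in> borel_measurable (F t))"

text \<open>Joint measurability in \<open>(t, \<omega>)\<close> is what gives a meaning to the time integrals of a process.\<close>

definition measurable_process :: "'a measure \<Rightarrow> real \<Rightarrow> (real \<Rightarrow> 'a \<Rightarrow> real) \<Rightarrow> bool" where
  "measurable_process M T X \<longleftrightarrow>
     (\<lambda>(t, \<omega>). X t \<omega>) \<in> borel_measurable (restrict_space borel {0..T} \<Otimes>\<^sub>M M)"

definition continuous_process :: "'a measure \<Rightarrow> real \<Rightarrow> (real \<Rightarrow> 'a \<Rightarrow> real) \<Rightarrow> bool" where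
  "continuous_process M T X \<longleftrightarrow> (AE \<omega> in M. continuous_on {0..T} (\<lambda>t. X t \<omega>))"

text \<open>Measurability is part of the definition because \<^const>\<open>measure\<close> is \<open>0\<close> on non-measurable sets.\<close>

definition tendsto_in_prob ::
  "'a measure \<Rightarrow> (nat \<Rightarrow> 'a \<Rightarrow> 'b::{metric_space,second_countable_topology}) \<Rightarrow> ('a \<Rightarrow> 'b) \<Rightarrow> bool" where
  "tendsto_in_prob M X Y \<longleftrightarrow>
     (\<forall>n. X n \<in> borel_measurable M) \<and> Y \<in> borel_measurable M \<and>
     (\<forall>\<epsilon>>0. (\<lambda>n. measure M {\<omega> \<in> space M. dist (X n \<omega>) (Y \<omega>) > \<epsilon>}) \<longlonglongrightarrow> 0)"

section \<open>Brownian motion\<close>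

definition brownian_motion ::
  "'a measure \<Rightarrow> (real \<Rightarrow> 'a measure) \<Rightarrow> real \<Rightarrow> (real \<Rightarrow> 'a \<Rightarrow> real) \<Rightarrow> bool" where
  "brownian_motion M F T W \<longleftrightarrow>
     adapted_process F T W \<and> continuous_process M T W \<and> (AE \<omega> in M. W 0 \<omega> = 0) \<and>
     (\<forall>s t. 0 \<le> s \<and> s < t \<and> t \<le> T \<longrightarrow>
        distributed M lborel (\<lambda>\<omega>. W t \<omega> - W s \<omega>) (normal_density 0 (sqrt (t - s))) \<and>
        prob_space.indep_set M (sets (F s))
          (sets (vimage_algebra (space M) (\<lambda>\<omega>. W t \<omega> - W s \<omega>) borel)))"

text \<open>The independence is that of the processes, as random elements of the path space.\<close>

definition independent_brownian_motions ::
  "'a measure \<Rightarrow> (real \<Rightarrow> 'a measure) \<Rightarrow> real \<Rightarrow> 'l set \<Rightarrow> ('l \<Rightarrow> real \<Rightarrow> 'a \<Rightarrow> real) \<Rightarrow> bool" where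
  "independent_brownian_motions M F T L W \<longleftrightarrow>
     (\<forall>l\<in>L. brownian_motion M F T (W l)) \<and>
     prob_space.indep_vars M (\<lambda>_. PiM {0..T} (\<lambda>_. borel)) (\<lambda>l \<omega>. \<lambda>t\<in>{0..T}. W l t \<omega>) L"

section \<open>Continuous semimartingales\<close>

definition martingale ::
  "'a measure \<Rightarrow> (real \<Rightarrow> 'a measure) \<Rightarrow> real \<Rightarrow> (real \<Rightarrow> 'a \<Rightarrow> real) \<Rightarrow> bool" where
  "martingale M F T X \<longleftrightarrow>
     adapted_process F T X \<and> (\<forall>t\<in>{0..T}. integrable M (X t)) \<and>
     (\<forall>s t. 0 \<le> s \<and> s \<le> t \<and> t \<le> T \<longrightarrow> (AE \<omega> in M. real_cond_exp M (F s) (X t) \<omega> = X s \<omega>))"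

text \<open>Almost surely the localizing times eventually exceed the horizon \<open>T\<close>; the value \<open>\<infinity>\<close> of a
  stopping time may be represented by any real number beyond \<open>T\<close>.\<close>

definition continuous_local_martingale ::
  "'a measure \<Rightarrow> (real \<Rightarrow> 'a measure) \<Rightarrow> real \<Rightarrow> (real \<Rightarrow> 'a \<Rightarrow> real) \<Rightarrow> bool" where
  "continuous_local_martingale M F T X \<longleftrightarrow>
     adapted_process F T X \<and> continuous_process M T X \<and>
     (\<exists>\<tau> :: nat \<Rightarrow> 'a \<Rightarrow> real.
        (\<forall>n. stopping_time F (\<tau> n)) \<and> (\<forall>n. \<forall>\<omega>\<in>space M. 0 \<le> \<tau> n \<omega>) \<and>
        (AE \<omega> in M. incseq (\<lambda>n. \<tau> n \<omega>) \<and> (\<exists>n. T < \<tau> n \<omega>)) \<and>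
        (\<forall>n. martingale M F T (\<lambda>t \<omega>. X (min t (\<tau> n \<omega>)) \<omega> - X 0 \<omega>)))"

definition finite_variation_on :: "real \<Rightarrow> (real \<Rightarrow> real) \<Rightarrow> bool" where
  "finite_variation_on T f \<longleftrightarrow>
     (\<exists>B. \<forall>n (\<tau> :: nat \<Rightarrow> real). mono_on {..n} \<tau> \<and> \<tau> ` {..n} \<subseteq> {0..T} \<longrightarrow>
        (\<Sum>i<n. \<bar>f (\<tau> (Suc i)) - f (\<tau> i)\<bar>) \<le> B)"

definition continuous_semimartingale ::
  "'a measure \<Rightarrow> (real \<Rightarrow> 'a measure) \<Rightarrow> real \<Rightarrow> (real \<Rightarrow> 'a \<Rightarrow> real) \<Rightarrow> bool" where
  "continuous_semimartingale M F T X \<longleftrightarrow>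
     adapted_process F T X \<and> continuous_process M T X \<and>
     (\<exists>N A. continuous_local_martingale M F T N \<and>
        adapted_process F T A \<and> continuous_process M T A \<and>
        (AE \<omega> in M. finite_variation_on T (\<lambda>t. A t \<omega>)) \<and>
        (AE \<omega> in M. \<forall>t\<in>{0..T}. X t \<omega> = N t \<omega> + A t \<omega>))"

section \<open>Stochastic integrals\<close>

text \<open>\<open>Step n \<tau> \<xi>\<close> represents the simple predictable process \<open>\<Sum>i<n. 1\<^bsub>]\<tau> i, \<tau> (i+1)]\<^esub> \<xi> i\<close>.\<close>

datatype ('a, 'b) step_process =
  Step (step_num: nat) (step_time: "nat \<Rightarrow> real") (step_coeff: "nat \<Rightarrow> 'a \<Rightarrow> 'b")

definition simple_predictable ::
  "'a measure \<Rightarrow> (real \<Rightarrow> 'a measure) \<Rightarrow> real \<Rightarrow> ('a, 'b::euclidean_space) step_process \<Rightarrow> bool" where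
  "simple_predictable M F T S \<longleftrightarrow>
     mono_on {..step_num S} (step_time S) \<and> step_time S ` {..step_num S} \<subseteq> {0..T} \<and>
     (\<forall>i<step_num S. step_coeff S i \<in> borel_measurable (F (step_time S i))) \<and>
     (\<exists>C. \<forall>i<step_num S. \<forall>\<omega>\<in>space M. norm (step_coeff S i \<omega>) \<le> C)"

definition step_value :: "('a, 'b::euclidean_space) step_process \<Rightarrow> real \<Rightarrow> 'a \<Rightarrow> 'b" where
  "step_value S t \<omega> = (\<Sum>i<step_num S.
     indicator {step_time S i<..step_time S (Suc i)} t *\<^sub>R step_coeff S i \<omega>)"

definition step_integral ::
  "('a, 'b::euclidean_space) step_process \<Rightarrow> (real \<Rightarrow> 'a \<Rightarrow> real) \<Rightarrow> real \<Rightarrow> 'a \<Rightarrow> 'b" where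
  "step_integral S X t \<omega> = (\<Sum>i<step_num S.
     (X (min (step_time S (Suc i)) t) \<omega> - X (min (step_time S i) t) \<omega>) *\<^sub>R step_coeff S i \<omega>)"

text \<open>The Ito integral process \<open>I t = \<integral>\<^sub>0\<^sup>t H dW\<close> of a process \<open>H\<close> with \<open>E \<integral>\<^sub>0\<^sup>T H\<^sup>2 dt < \<infinity>\<close>: the continuous
  adapted version of the \<open>L\<^sup>2\<close>-limit of the integrals of simple predictable processes approximating
  \<open>H\<close> in \<open>L\<^sup>2(dt \<otimes> P)\<close>.\<close>

definition has_ito_integral ::
  "'a measure \<Rightarrow> (real \<Rightarrow> 'a measure) \<Rightarrow> real \<Rightarrow> (real \<Rightarrow> 'a \<Rightarrow> real) \<Rightarrow> (real \<Rightarrow> 'a \<Rightarrow> real) \<Rightarrow>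
   (real \<Rightarrow> 'a \<Rightarrow> real) \<Rightarrow> bool" where
  "has_ito_integral M F T W H I \<longleftrightarrow>
     adapted_process F T I \<and> continuous_process M T I \<and>
     (\<exists>S :: nat \<Rightarrow> ('a, real) step_process.
        (\<forall>n. simple_predictable M F T (S n)) \<and>
        (\<lambda>n. \<integral>\<^sup>+\<omega>. (\<integral>\<^sup>+t\<in>{0..T}. ennreal ((step_value (S n) t \<omega> - H t \<omega>)\<^sup>2) \<partial>lborel) \<partial>M) \<longlonglongrightarrow> 0 \<and>
        (\<forall>t\<in>{0..T}.
          (\<lambda>n. \<integral>\<^sup>+\<omega>. ennreal ((step_integral (S n) W t \<omega> - I t \<omega>)\<^sup>2) \<partial>M) \<longlonglongrightarrow> 0))"

text \<open>\<open>dX = (\<Sum>l\<in>L. \<sigma> l dW l) + b dt\<close> on \<open>[0, T]\<close>.\<close>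

definition has_ito_differential ::
  "'a measure \<Rightarrow> (real \<Rightarrow> 'a measure) \<Rightarrow> real \<Rightarrow> 'l set \<Rightarrow> ('l \<Rightarrow> real \<Rightarrow> 'a \<Rightarrow> real) \<Rightarrow>
   (real \<Rightarrow> 'a \<Rightarrow> real) \<Rightarrow> ('l \<Rightarrow> real \<Rightarrow> 'a \<Rightarrow> real) \<Rightarrow> (real \<Rightarrow> 'a \<Rightarrow> real) \<Rightarrow> bool" where
  "has_ito_differential M F T L W X \<sigma> b \<longleftrightarrow>
     (\<exists>I. (\<forall>l\<in>L. has_ito_integral M F T (W l) (\<sigma> l) (I l)) \<and>
       (AE \<omega> in M. \<forall>t\<in>{0..T}.
          X t \<omega> = X 0 \<omega> + (\<Sum>l\<in>L. I l t \<omega>) + (LINT s:{0..t}|lborel. b s \<omega>)))"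

text \<open>The stochastic integral over \<open>]0, T]\<close> with respect to a semimartingale \<open>X\<close>, for integrands in the
  uniform closure of the simple predictable processes (such as continuous deterministic functions),
  is the continuous extension, from uniform convergence to convergence in probability, of the
  elementary integral. It is determined up to a null set. When \<open>X\<close> is continuous, the integrals over
  \<open>]0, T[\<close> and \<open>]0, T]\<close> coincide.\<close>

definition unif_approx ::
  "'a measure \<Rightarrow> (real \<Rightarrow> 'a measure) \<Rightarrow> real \<Rightarrow> (real \<Rightarrow> 'a \<Rightarrow> 'b::euclidean_space) \<Rightarrow>
   (nat \<Rightarrow> ('a, 'b) step_process) \<Rightarrow> bool" where
  "unif_approx M F T H S \<longleftrightarrow>
     (\<forall>n. simple_predictable M F T (S n)) \<and>
     uniform_limit ({0<..T} \<times> space M)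
       (\<lambda>n (t, \<omega>). step_value (S n) t \<omega>) (\<lambda>(t, \<omega>). H t \<omega>) sequentially"

definition has_stochastic_integral ::
  "'a measure \<Rightarrow> (real \<Rightarrow> 'a measure) \<Rightarrow> real \<Rightarrow> (real \<Rightarrow> 'a \<Rightarrow> real) \<Rightarrow>
   (real \<Rightarrow> 'a \<Rightarrow> 'b::euclidean_space) \<Rightarrow> ('a \<Rightarrow> 'b) \<Rightarrow> bool" where
  "has_stochastic_integral M F T X H Y \<longleftrightarrow>
     (\<exists>S. unif_approx M F T H S) \<and>
     (\<forall>S. unif_approx M F T H S \<longrightarrow> tendsto_in_prob M (\<lambda>n. step_integral (S n) X T) Y)"

definition stochastic_integral ::
  "'a measure \<Rightarrow> (real \<Rightarrow> 'a measure) \<Rightarrow> real \<Rightarrow> (real \<Rightarrow> 'a \<Rightarrow> real) \<Rightarrow>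
   (real \<Rightarrow> 'a \<Rightarrow> 'b::euclidean_space) \<Rightarrow> 'a \<Rightarrow> 'b" where
  "stochastic_integral M F T X H = (SOME Y. has_stochastic_integral M F T X H Y)"

section \<open>Fourier coefficients and the Bohr convolution product\<close>

definition fourier_coeff :: "(real \<Rightarrow> complex) \<Rightarrow> int \<Rightarrow> complex" where
  "fourier_coeff \<phi> k =
     1 / (2 * pi) * (LINT \<theta>:{0..2*pi}|lborel. \<phi> \<theta> * exp (- \<i> * of_int k * of_real \<theta>))"

definition fourier_coeff_d ::
  "'a measure \<Rightarrow> (real \<Rightarrow> 'a measure) \<Rightarrow> (real \<Rightarrow> 'a \<Rightarrow> real) \<Rightarrow> 'a \<Rightarrow> int \<Rightarrow> complex" where
  "fourier_coeff_d M F X \<omega> k =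
     1 / (2 * pi) *
       stochastic_integral M F (2 * pi) X (\<lambda>\<theta> _. exp (- \<i> * of_int k * of_real \<theta>)) \<omega>"

definition bohr_mean :: "nat \<Rightarrow> (int \<Rightarrow> complex) \<Rightarrow> (int \<Rightarrow> complex) \<Rightarrow> int \<Rightarrow> complex" where
  "bohr_mean N \<Phi> \<Psi> k = 1 / (2 * of_nat N + 1) * (\<Sum>s\<in>{- int N..int N}. \<Phi> s * \<Psi> (k - s))"

text \<open>\<open>\<Xi> = \<Phi> *\<^sub>B \<Psi>\<close> for random functions on the integers, the limits being limits in probability.\<close>

definition has_bohr_convolution_in_prob ::
  "'a measure \<Rightarrow> ('a \<Rightarrow> int \<Rightarrow> complex) \<Rightarrow> ('a \<Rightarrow> int \<Rightarrow> complex) \<Rightarrow> ('a \<Rightarrow> int \<Rightarrow> complex) \<Rightarrow> bool" where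
  "has_bohr_convolution_in_prob M \<Phi> \<Psi> \<Xi> \<longleftrightarrow>
     (\<forall>k. tendsto_in_prob M (\<lambda>N \<omega>. bohr_mean N (\<Phi> \<omega>) (\<Psi> \<omega>) k) (\<lambda>\<omega>. \<Xi> \<omega> k))"

end

theory Submission
  imports Defs
begin

text \<open>
  Write \<open>X\<^sub>s = \<integral> e\<^sup>-\<^sup>i\<^sup>s\<^sup>t dX\<close>. The isometry bounds \<open>E |X\<^sub>s|\<^sup>2\<close> by a constant independent of \<open>s\<close>, so the
  bilinear forms \<open>(2N+1)\<^sup>-\<^sup>1 \<Sum>\<^sub>|\<^sub>s\<^sub>|\<^sub>\<le>\<^sub>N X\<^sub>s Y\<^sub>k\<^sub>-\<^sub>s\<close> are bounded in \<open>L\<^sup>1\<close> uniformly in \<open>N\<close>, and the integrands may be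
  replaced by simple predictable ones. Drift terms disappear in the limit by Bessel's inequality. For
  simple integrands the form is, up to a Riemann sum over a uniform mesh of \<open>n \<ge> 2N+1\<close> cells, a
  quadratic form in Brownian increments whose kernel \<open>K\<close> is \<open>1/(2N+1)\<close> times a Dirichlet kernel. The
  off-diagonal part is a martingale transform with second moment of order \<open>\<integral>\<integral> |K|\<^sup>2 = O(1/N)\<close>, and
  the diagonal part converges to \<open>\<integral> e\<^sup>-\<^sup>i\<^sup>k\<^sup>t d\<langle>X,Y\<rangle>\<close>. All convergences hold in
  \<open>L\<^sup>1\<close>.
\<close>

section \<open>Square-integrable functions\<close>

text \<open>Two limits are taken in a fixed order. At fixed \<open>N\<close> the Fourier
  coefficients of \<open>dp\<close> are replaced by sums over a mesh of \<open>n\<close> cells; all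
  estimates are uniform in \<open>n \<ge> 2N+1\<close>, and \<open>n\<close> goes to infinity first,
  so every stochastic double integral is a finite double sum over cells. The condition
  \<open>n \<ge> 2N+1\<close> makes the characters of index -N, ..., N exactly orthogonal on the
  mesh: their indices differ by at most \<open>2N\<close>, hence never by a nonzero multiple of
  \<open>n\<close>. This gives both Bessel's inequality for drift increments and the exact value
  \<open>(2 * pi)\<^sup>2 / (2N+1)\<close> for the double sum of |K|^2. The probabilistic obstacle
  is the bracket of two different Brownian motions. Each increment is independent of
  \<open>F s\<close> by itself, whereas the diagonal requires the product of two of them to be
  orthogonal to \<open>F s\<close>; this is extracted from the independence of the paths by
  subdivision. The accuracy \<open>\<epsilon>\<close> of the simple integrands must be fixed before
  \<open>N\<close>: their error bound contains their supremum, over which an \<open>L2\<close>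
  approximation gives no control.\<close>

definition sq_integrable :: "'a measure \<Rightarrow> ('a \<Rightarrow> 'b::euclidean_space) \<Rightarrow> bool" where
  "sq_integrable M f \<longleftrightarrow> f \<in> borel_measurable M \<and> integrable M (\<lambda>x. (norm (f x))\<^sup>2)"

text \<open>A Bochner integral is 0 for a non-integrable function, so a bound on
  \<open>l2norm\<close> carries information only together with \<open>sq_integrable\<close>. The two
  are therefore proved side by side.\<close>

definition l2norm :: "'a measure \<Rightarrow> ('a \<Rightarrow> 'b::euclidean_space) \<Rightarrow> real" where
  "l2norm M f = sqrt (\<integral>x. (norm (f x))\<^sup>2 \<partial>M)"

lemma sq_integrable_measurable [measurable_dest]:
  "sq_integrable M f \<Longrightarrow> f \<in> borel_measurable M"
  by (simp add: sq_integrable_def)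

lemma l2norm_nonneg [simp]: "0 \<le> l2norm M f"
  by (simp add: l2norm_def)

lemma l2norm_power2: "(l2norm M f)\<^sup>2 = (\<integral>x. (norm (f x))\<^sup>2 \<partial>M)"
  by (simp add: l2norm_def)

lemma l2norm_le_iff: "0 \<le> c \<Longrightarrow> l2norm M f \<le> c \<longleftrightarrow> (\<integral>x. (norm (f x))\<^sup>2 \<partial>M) \<le> c\<^sup>2"
  by (metis l2norm_nonneg l2norm_power2 power2_le_imp_le power_mono)

lemma nn_integral_eq_l2norm:
  assumes "sq_integrable M f"
  shows "(\<integral>\<^sup>+x. ennreal ((norm (f x))\<^sup>2) \<partial>M) = ennreal ((l2norm M f)\<^sup>2)"
  using assms by (simp add: l2norm_power2 sq_integrable_def nn_integral_eq_integral)

text \<open>The entry point for the limits in \<open>has_ito_integral\<close>, which are stated with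
  \<open>nn_integral\<close>: finiteness there yields integrability, and only then does the
  real-valued norm bound have its meaning.\<close>

lemma sq_integrableI_nn_integral:
  assumes [measurable]: "f \<in> borel_measurable M"
    and le: "(\<integral>\<^sup>+x. ennreal ((norm (f x))\<^sup>2) \<partial>M) \<le> ennreal (c\<^sup>2)" and c: "0 \<le> c"
  shows "sq_integrable M f" "l2norm M f \<le> c"
proof -
  show sq: "sq_integrable M f"
    unfolding sq_integrable_def using le
    by (auto intro!: integrableI_bounded order.strict_trans1[OF le])
  have "(l2norm M f)\<^sup>2 \<le> c\<^sup>2"
    using le unfolding nn_integral_eq_l2norm[OF sq] by (simp add: ennreal_le_iff)
  then show "l2norm M f \<le> c"
    using c power2_le_imp_le by blast
qed

lemma sq_integrable_dominated:
  assumes f: "sq_integrable M f" and g: "g \<in> borel_measurable M"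
    and le: "AE x in M. norm (g x) \<le> C * norm (f x)"
  shows "sq_integrable M g"
proof -
  have "integrable M (\<lambda>x. C\<^sup>2 * (norm (f x))\<^sup>2)"
    using f by (auto simp: sq_integrable_def)
  moreover have "AE x in M. (norm (g x))\<^sup>2 \<le> C\<^sup>2 * (norm (f x))\<^sup>2"
    using le by eventually_elim (metis norm_ge_zero power_mono power_mult_distrib)
  ultimately show ?thesis
    unfolding sq_integrable_def using g
    by (intro conjI, simp) (erule Bochner_Integration.integrable_bound, auto)
qed

lemma l2norm_dominated:
  assumes f: "sq_integrable M f" and g: "g \<in> borel_measurable M" and C: "0 \<le> C"
    and le: "AE x in M. norm (g x) \<le> C * norm (f x)"
  shows "l2norm M g \<le> C * l2norm M f"
proof -
  have sg: "sq_integrable M g" by (rule sq_integrable_dominated[OF f g le])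
  have "AE x in M. (norm (g x))\<^sup>2 \<le> C\<^sup>2 * (norm (f x))\<^sup>2"
    using le by eventually_elim (metis norm_ge_zero power_mono power_mult_distrib)
  then have "(\<integral>x. (norm (g x))\<^sup>2 \<partial>M) \<le> (\<integral>x. C\<^sup>2 * (norm (f x))\<^sup>2 \<partial>M)"
    using sg f by (intro integral_mono_AE) (auto simp: sq_integrable_def)
  also have "\<dots> = (C * l2norm M f)\<^sup>2"
    by (simp add: l2norm_power2 power_mult_distrib)
  finally show ?thesis
    using C by (subst l2norm_le_iff) auto
qed

lemma sq_integrable_cong_AE:
  assumes "AE x in M. f x = g x" "sq_integrable M f" "g \<in> borel_measurable M"
  shows "sq_integrable M g"
  using assms(1) by (intro sq_integrable_dominated[OF assms(2,3), of 1]) auto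

lemma l2norm_cong_AE:
  assumes "AE x in M. f x = g x" "f \<in> borel_measurable M" "g \<in> borel_measurable M"
  shows "l2norm M f = l2norm M g"
  unfolding l2norm_def using assms
  by (intro arg_cong[of _ _ sqrt] integral_cong_AE) (auto elim: eventually_mono)

lemma l2norm_minus_commute: "l2norm M (\<lambda>x. f x - g x) = l2norm M (\<lambda>x. g x - f x)"
  by (simp add: l2norm_def norm_minus_commute)

lemma sq_integrable_uminus: "sq_integrable M f \<Longrightarrow> sq_integrable M (\<lambda>x. - f x)"
  by (rule sq_integrable_dominated[of M f _ 1]) auto

lemma sq_integrable_zero [simp]: "sq_integrable M (\<lambda>x. 0)"
  by (simp add: sq_integrable_def)

lemma sq_integrable_const [simp]: "finite_measure M \<Longrightarrow> sq_integrable M (\<lambda>x. c)"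
  by (simp add: sq_integrable_def finite_measure.integrable_const)

lemma sq_integrable_add:
  assumes f: "sq_integrable M f" and g: "sq_integrable M g"
  shows "sq_integrable M (\<lambda>x. f x + g x)"
proof -
  have [measurable]: "f \<in> borel_measurable M" "g \<in> borel_measurable M"
    using f g by (auto simp: sq_integrable_def)
  have "integrable M (\<lambda>x. 2 * (norm (f x))\<^sup>2 + 2 * (norm (g x))\<^sup>2)"
    using f g by (auto simp: sq_integrable_def)
  moreover have "(norm (f x + g x))\<^sup>2 \<le> 2 * (norm (f x))\<^sup>2 + 2 * (norm (g x))\<^sup>2" for x
  proof -
    have "(norm (f x + g x))\<^sup>2 \<le> (norm (f x) + norm (g x))\<^sup>2"
      by (intro power_mono norm_triangle_ineq) auto
    also have "\<dots> \<le> 2 * (norm (f x))\<^sup>2 + 2 * (norm (g x))\<^sup>2"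
      using sum_squares_bound[of "norm (f x)" "norm (g x)"] by (simp add: power2_sum)
    finally show ?thesis .
  qed
  ultimately show ?thesis
    unfolding sq_integrable_def by (auto intro: Bochner_Integration.integrable_bound)
qed

lemma sq_integrable_diff:
  "sq_integrable M f \<Longrightarrow> sq_integrable M g \<Longrightarrow> sq_integrable M (\<lambda>x. f x - g x)"
  using sq_integrable_add[of M f "\<lambda>x. - g x"] sq_integrable_uminus[of M g] by simp

lemma sq_integrable_sum:
  "(\<And>i. i \<in> I \<Longrightarrow> sq_integrable M (f i)) \<Longrightarrow> sq_integrable M (\<lambda>x. \<Sum>i\<in>I. f i x)"
  by (induction I rule: infinite_finite_induct) (auto intro: sq_integrable_add)

text \<open>The bound \<open>x * y \<le> x\<^sup>2 + y\<^sup>2\<close> gives integrability; the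
  inequality is then transferred from its \<open>nn_integral\<close> version.\<close>

lemma
  assumes f: "sq_integrable M f" and g: "sq_integrable M g"
  shows sq_integrable_norm_mult: "integrable M (\<lambda>x. norm (f x) * norm (g x))"
    and l2norm_Cauchy_Schwarz: "(\<integral>x. norm (f x) * norm (g x) \<partial>M) \<le> l2norm M f * l2norm M g"
proof -
  have [measurable]: "f \<in> borel_measurable M" "g \<in> borel_measurable M"
    using f g by (auto simp: sq_integrable_def)
  have "integrable M (\<lambda>x. (norm (f x))\<^sup>2 + (norm (g x))\<^sup>2)"
    using f g by (auto simp: sq_integrable_def)
  moreover have "norm (f x) * norm (g x) \<le> (norm (f x))\<^sup>2 + (norm (g x))\<^sup>2" for x
  proof -
    have "2 * (norm (f x) * norm (g x)) \<le> (norm (f x))\<^sup>2 + (norm (g x))\<^sup>2"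
      using sum_squares_bound[of "norm (f x)" "norm (g x)"] by (simp add: mult.assoc)
    moreover have "0 \<le> norm (f x) * norm (g x)" by simp
    ultimately show ?thesis by linarith
  qed
  ultimately show int: "integrable M (\<lambda>x. norm (f x) * norm (g x))"
    by (auto intro: Bochner_Integration.integrable_bound)
  have "(\<integral>\<^sup>+x. ennreal (norm (f x)) * ennreal (norm (g x)) \<partial>M)\<^sup>2
      \<le> (\<integral>\<^sup>+x. (ennreal (norm (f x)))\<^sup>2 \<partial>M) * (\<integral>\<^sup>+x. (ennreal (norm (g x)))\<^sup>2 \<partial>M)"
    by (intro Cauchy_Schwarz_nn_integral) auto
  also have "\<dots> = ennreal ((l2norm M f)\<^sup>2) * ennreal ((l2norm M g)\<^sup>2)"
    by (simp add: ennreal_power nn_integral_eq_l2norm[OF f] nn_integral_eq_l2norm[OF g])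
  also have "(\<integral>\<^sup>+x. ennreal (norm (f x)) * ennreal (norm (g x)) \<partial>M)
      = ennreal (\<integral>x. norm (f x) * norm (g x) \<partial>M)"
    using int by (simp add: ennreal_mult[symmetric] nn_integral_eq_integral)
  finally have "(\<integral>x. norm (f x) * norm (g x) \<partial>M)\<^sup>2 \<le> (l2norm M f * l2norm M g)\<^sup>2"
    by (simp add: ennreal_power ennreal_mult[symmetric] power_mult_distrib)
  then show "(\<integral>x. norm (f x) * norm (g x) \<partial>M) \<le> l2norm M f * l2norm M g"
    by (rule power2_le_imp_le) auto
qed

lemma sq_integrable_mult_integrable:
  fixes f g :: "'a \<Rightarrow> 'b::{euclidean_space,real_normed_field}"
  assumes "sq_integrable M f" "sq_integrable M g"
  shows "integrable M (\<lambda>x. f x * g x)"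
  by (rule Bochner_Integration.integrable_bound[OF sq_integrable_norm_mult[OF assms]])
    (use assms in \<open>auto simp: sq_integrable_def norm_mult\<close>)

lemma sq_integrable_inner_integrable:
  assumes "sq_integrable M f" "sq_integrable M g"
  shows "integrable M (\<lambda>x. f x \<bullet> g x)"
  by (rule Bochner_Integration.integrable_bound[OF sq_integrable_norm_mult[OF assms]])
    (use assms in \<open>auto simp: sq_integrable_def Cauchy_Schwarz_ineq2\<close>)

lemma l2norm_add_le:
  assumes f: "sq_integrable M f" and g: "sq_integrable M g"
  shows "l2norm M (\<lambda>x. f x + g x) \<le> l2norm M f + l2norm M g"
proof -
  have i: "integrable M (\<lambda>x. (norm (f x))\<^sup>2)" "integrable M (\<lambda>x. (norm (g x))\<^sup>2)"
    "integrable M (\<lambda>x. norm (f x) * norm (g x))"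
    "integrable M (\<lambda>x. (norm (f x + g x))\<^sup>2)"
    using f g sq_integrable_norm_mult[OF f g] sq_integrable_add[OF f g]
    by (auto simp: sq_integrable_def)
  have "(\<integral>x. (norm (f x + g x))\<^sup>2 \<partial>M)
      \<le> (\<integral>x. (norm (f x))\<^sup>2 + (norm (g x))\<^sup>2 + 2 * (norm (f x) * norm (g x)) \<partial>M)"
  proof (intro integral_mono)
    show "(norm (f x + g x))\<^sup>2 \<le> (norm (f x))\<^sup>2 + (norm (g x))\<^sup>2 + 2 * (norm (f x) * norm (g x))" for x
      using power_mono[OF norm_triangle_ineq[of "f x" "g x"], of 2] by (simp add: power2_sum)
  qed (use i in auto)
  also have "\<dots> \<le> (l2norm M f)\<^sup>2 + (l2norm M g)\<^sup>2 + 2 * (l2norm M f * l2norm M g)"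
    using i l2norm_Cauchy_Schwarz[OF f g] by (simp add: l2norm_power2)
  also have "\<dots> = (l2norm M f + l2norm M g)\<^sup>2"
    by (simp add: power2_sum)
  finally show ?thesis
    by (subst l2norm_le_iff) auto
qed

lemma l2norm_diff_le:
  assumes "sq_integrable M f" "sq_integrable M g"
  shows "l2norm M (\<lambda>x. f x - g x) \<le> l2norm M f + l2norm M g"
  using l2norm_add_le[OF assms(1) sq_integrable_uminus[OF assms(2)]] by (simp add: l2norm_def)

lemma l2norm_triangle:
  assumes "sq_integrable M f" "sq_integrable M g" "sq_integrable M h"
  shows "l2norm M (\<lambda>x. f x - h x) \<le> l2norm M (\<lambda>x. f x - g x) + l2norm M (\<lambda>x. g x - h x)"
  using l2norm_add_le[OF sq_integrable_diff[OF assms(1,2)] sq_integrable_diff[OF assms(2,3)]]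
  by simp

lemma (in prob_space)
  assumes f: "sq_integrable M f"
  shows sq_integrable_integrable: "integrable M f"
    and expectation_norm_le_l2norm: "expectation (\<lambda>x. norm (f x)) \<le> l2norm M f"
proof -
  have 1: "sq_integrable M (\<lambda>_. 1::real)"
    using finite_measure_axioms by simp
  have "integrable M (\<lambda>x. norm (f x))"
    using sq_integrable_norm_mult[OF f 1] by simp
  then show "integrable M f"
    using f by (simp add: sq_integrable_def integrable_norm_iff)
  show "expectation (\<lambda>x. norm (f x)) \<le> l2norm M f"
    using l2norm_Cauchy_Schwarz[OF f 1] by (simp add: l2norm_def prob_space)
qed

text \<open>Riesz-Fischer with a prescribed rate. The increments have geometric, hence summable,
  \<open>L1\<close> norms, so the sequence converges almost surely; Fatou's lemma then carries the
  Cauchy bound over to the distance from the limit.\<close>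

lemma (in prob_space) l2_complete:
  fixes Y :: "nat \<Rightarrow> 'a \<Rightarrow> 'b::euclidean_space"
  assumes Y: "\<And>i. sq_integrable M (Y i)" and c: "0 \<le> c"
    and le: "\<And>i j. i \<le> j \<Longrightarrow> l2norm M (\<lambda>\<omega>. Y i \<omega> - Y j \<omega>) \<le> c * (1/2)^i"
  obtains Z where "sq_integrable M Z" "\<And>i. l2norm M (\<lambda>\<omega>. Y i \<omega> - Z \<omega>) \<le> c * (1/2)^i"
proof -
  have [measurable]: "Y i \<in> borel_measurable M" for i
    using Y[of i] by (simp add: sq_integrable_def)
  have bnd: "(\<integral>\<^sup>+\<omega>. ennreal (norm (Y (Suc i) \<omega> - Y i \<omega>)) \<partial>M) \<le> ennreal (c * (1/2)^i)" for i
  proof -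
    have sq: "sq_integrable M (\<lambda>\<omega>. Y (Suc i) \<omega> - Y i \<omega>)"
      by (intro sq_integrable_diff Y)
    have "expectation (\<lambda>\<omega>. norm (Y (Suc i) \<omega> - Y i \<omega>)) \<le> c * (1/2)^i"
      using expectation_norm_le_l2norm[OF sq] le[of i "Suc i"]
      by (simp add: l2norm_minus_commute[of _ "Y (Suc i)"])
    then show ?thesis
      using sq_integrable_integrable[OF sq]
      by (subst nn_integral_eq_integral) (auto intro: ennreal_leI)
  qed
  have "(\<integral>\<^sup>+\<omega>. (\<Sum>i. ennreal (norm (Y (Suc i) \<omega> - Y i \<omega>))) \<partial>M)
      = (\<Sum>i. \<integral>\<^sup>+\<omega>. ennreal (norm (Y (Suc i) \<omega> - Y i \<omega>)) \<partial>M)"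
    by (intro nn_integral_suminf) auto
  also have "\<dots> \<le> (\<Sum>i. ennreal (c * (1/2)^i))"
    by (intro suminf_le bnd) auto
  also have "\<dots> = ennreal (\<Sum>i. c * (1/2)^i)"
    using c by (intro suminf_ennreal2) (auto intro!: summable_mult summable_geometric)
  also have "\<dots> < \<infinity>" by simp
  finally have "(\<integral>\<^sup>+\<omega>. (\<Sum>i. ennreal (norm (Y (Suc i) \<omega> - Y i \<omega>))) \<partial>M) \<noteq> \<infinity>"
    by simp
  then have "AE \<omega> in M. (\<Sum>i. ennreal (norm (Y (Suc i) \<omega> - Y i \<omega>))) \<noteq> \<infinity>"
    by (intro nn_integral_noteq_infinite) auto
  then have conv: "AE \<omega> in M. (\<lambda>i. Y i \<omega>) \<longlonglongrightarrow> lim (\<lambda>i. Y i \<omega>)"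
  proof eventually_elim
    case (elim \<omega>)
    then have "summable (\<lambda>i. norm (Y (Suc i) \<omega> - Y i \<omega>))"
      by (intro summable_suminf_not_top) auto
    then have "summable (\<lambda>i. Y (Suc i) \<omega> - Y i \<omega>)"
      by (rule summable_norm_cancel)
    then have "convergent (\<lambda>n. Y n \<omega> - Y 0 \<omega>)"
      unfolding summable_iff_convergent sum_lessThan_telescope[of "\<lambda>n. Y n \<omega>"] .
    then have "convergent (\<lambda>n. Y n \<omega>)"
      using convergent_add_const_right_iff[of "\<lambda>n. Y n \<omega>" "- Y 0 \<omega>"] by simp
    then show ?case by (simp add: convergent_LIMSEQ_iff)
  qed
  \<comment> \<open>\<open>lim\<close> is an unspecified value where the sequence diverges, which by
    \<open>conv\<close> is a null set.\<close>
  define Z where "Z \<omega> = lim (\<lambda>i. Y i \<omega>)" for \<omega>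
  have [measurable]: "Z \<in> borel_measurable M"
    unfolding Z_def by measurable
  have *: "(\<integral>\<^sup>+\<omega>. ennreal ((norm (Y i \<omega> - Z \<omega>))\<^sup>2) \<partial>M) \<le> ennreal ((c * (1/2)^i)\<^sup>2)" for i
  proof -
    have "(\<integral>\<^sup>+\<omega>. ennreal ((norm (Y i \<omega> - Z \<omega>))\<^sup>2) \<partial>M)
        = (\<integral>\<^sup>+\<omega>. liminf (\<lambda>j. ennreal ((norm (Y i \<omega> - Y j \<omega>))\<^sup>2)) \<partial>M)"
    proof (intro nn_integral_cong_AE)
      show "AE \<omega> in M. ennreal ((norm (Y i \<omega> - Z \<omega>))\<^sup>2) = liminf (\<lambda>j. ennreal ((norm (Y i \<omega> - Y j \<omega>))\<^sup>2))"
        using conv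
      proof eventually_elim
        case (elim \<omega>)
        then have "(\<lambda>j. ennreal ((norm (Y i \<omega> - Y j \<omega>))\<^sup>2)) \<longlonglongrightarrow> ennreal ((norm (Y i \<omega> - Z \<omega>))\<^sup>2)"
          unfolding Z_def by (intro tendsto_intros) auto
        then show ?case
          by (intro lim_imp_Liminf[symmetric]) auto
      qed
    qed
    also have "\<dots> \<le> liminf (\<lambda>j. \<integral>\<^sup>+\<omega>. ennreal ((norm (Y i \<omega> - Y j \<omega>))\<^sup>2) \<partial>M)"
      by (intro nn_integral_liminf) auto
    also have "\<dots> \<le> ennreal ((c * (1/2)^i)\<^sup>2)"
    proof (rule Liminf_le)
      have "(\<integral>\<^sup>+\<omega>. ennreal ((norm (Y i \<omega> - Y j \<omega>))\<^sup>2) \<partial>M) \<le> ennreal ((c * (1/2)^i)\<^sup>2)" if "i \<le> j" for j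
        using le[OF that] by (subst nn_integral_eq_l2norm) (auto intro!: sq_integrable_diff Y ennreal_leI power_mono)
      then show "\<forall>\<^sub>F j in sequentially. (\<integral>\<^sup>+\<omega>. ennreal ((norm (Y i \<omega> - Y j \<omega>))\<^sup>2) \<partial>M) \<le> ennreal ((c * (1/2)^i)\<^sup>2)"
        by (auto simp: eventually_sequentially)
    qed auto
    finally show ?thesis .
  qed
  have sq: "sq_integrable M (\<lambda>\<omega>. Y i \<omega> - Z \<omega>)" "l2norm M (\<lambda>\<omega>. Y i \<omega> - Z \<omega>) \<le> c * (1/2)^i" for i
    using sq_integrableI_nn_integral[OF _ *[of i]] c by auto
  have "sq_integrable M Z"
    using sq_integrable_diff[OF Y sq(1), of 0 0] by simp
  then show ?thesis using sq(2) that by blast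
qed

lemma (in prob_space) L1_imp_tendsto_in_prob:
  fixes X :: "nat \<Rightarrow> 'a \<Rightarrow> 'b::euclidean_space"
  assumes [measurable]: "\<And>n. X n \<in> borel_measurable M" "Y \<in> borel_measurable M"
    and int: "\<And>n. integrable M (\<lambda>\<omega>. X n \<omega> - Y \<omega>)"
    and lim: "(\<lambda>n. expectation (\<lambda>\<omega>. norm (X n \<omega> - Y \<omega>))) \<longlonglongrightarrow> 0"
  shows "tendsto_in_prob M X Y"
  unfolding tendsto_in_prob_def
proof (intro conjI allI impI)
  fix \<epsilon> :: real assume \<epsilon>: "0 < \<epsilon>"
  have le: "measure M {\<omega> \<in> space M. dist (X n \<omega>) (Y \<omega>) > \<epsilon>} \<le> expectation (\<lambda>\<omega>. norm (X n \<omega> - Y \<omega>)) / \<epsilon>" for n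
  proof -
    have "measure M {\<omega> \<in> space M. dist (X n \<omega>) (Y \<omega>) > \<epsilon>} \<le> measure M {\<omega> \<in> space M. \<epsilon> \<le> norm (X n \<omega> - Y \<omega>)}"
      by (intro finite_measure_mono) (auto simp: dist_norm)
    also have "\<dots> \<le> expectation (\<lambda>\<omega>. norm (X n \<omega> - Y \<omega>)) / \<epsilon>"
      using \<epsilon> int[of n] by (intro integral_Markov_inequality_measure[where A="{}"]) auto
    finally show ?thesis .
  qed
  show "(\<lambda>n. measure M {\<omega> \<in> space M. dist (X n \<omega>) (Y \<omega>) > \<epsilon>}) \<longlonglongrightarrow> 0"
    by (rule tendsto_sandwich[OF _ _ tendsto_const tendsto_divide_zero[OF lim, of \<epsilon>]])
      (use le in \<open>auto intro!: always_eventually\<close>)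
qed auto

section \<open>Step processes and partitions\<close>

text \<open>Every time of \<open>S\<close> has to be a point of \<open>x\<close>, but
  \<open>x\<close> may have more points. Several step processes can thus share one partition, and
  their integrals become sums over the same cells.\<close>

definition step_refinement :: "(nat \<Rightarrow> real) \<Rightarrow> nat \<Rightarrow> ('a, 'b) step_process \<Rightarrow> bool" where
  "step_refinement x m S \<longleftrightarrow> mono_on {..m} x \<and> mono_on {..step_num S} (step_time S) \<and>
     step_time S ` {..step_num S} \<subseteq> x ` {..m}"

text \<open>A telescoping sum in which the cells inside \<open>]x a, x b]\<close> are recognised by
  their right end points. Partitions may repeat points: a cell of length 0 may be selected or not,
  but its increment vanishes. If \<open>b < a\<close>, then \<open>x a = x b\<close> and both sides
  are 0.\<close>

lemma sum_over_subinterval: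
  fixes f :: "real \<Rightarrow> 'b::real_vector"
  assumes x: "mono_on {..m} x" and ab: "a \<le> m" "b \<le> m" "x a \<le> x b"
  shows "f (x b) - f (x a) = (\<Sum>c<m. indicator {x a<..x b} (x (Suc c)) *\<^sub>R (f (x (Suc c)) - f (x c)))"
proof (cases "a \<le> b")
  case True
  have mono: "x i \<le> x j" if "i \<le> j" "j \<le> m" for i j
    using x that by (auto simp: mono_on_def)
  have "indicator {x a<..x b} (x (Suc c)) *\<^sub>R (f (x (Suc c)) - f (x c))
      = (if c \<in> {a..<b} then f (x (Suc c)) - f (x c) else 0)" if "c < m" for c
  proof -
    consider "c < a" | "a \<le> c" "c < b" | "b \<le> c" by linarith
    then show ?thesis
    proof cases
      case 1
      then have "x (Suc c) \<le> x a" using ab by (intro mono) auto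
      with 1 show ?thesis by auto
    next
      case 2
      have le: "x (Suc c) \<le> x b" "x a \<le> x c" "x c \<le> x (Suc c)" using 2 ab that by (auto intro!: mono)
      show ?thesis
      proof (cases "x a < x (Suc c)")
        case True then show ?thesis using le 2 by auto
      next
        case False
        then have "x (Suc c) = x c" using le by linarith
        then show ?thesis by simp
      qed
    next
      case 3
      then have "x b \<le> x c" "x c \<le> x (Suc c)" using that by (auto intro!: mono)
      then have "x (Suc c) \<le> x b \<Longrightarrow> x (Suc c) = x c" by linarith
      then show ?thesis using 3 by (auto simp: indicator_def)
    qed
  qed
  then have "(\<Sum>c<m. indicator {x a<..x b} (x (Suc c)) *\<^sub>R (f (x (Suc c)) - f (x c)))
      = (\<Sum>c<m. if c \<in> {a..<b} then f (x (Suc c)) - f (x c) else 0)"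
    by (intro sum.cong) auto
  also have "\<dots> = (\<Sum>c\<in>{a..<b}. f (x (Suc c)) - f (x c))"
    using ab by (subst sum.inter_restrict[symmetric]) (auto intro!: sum.cong)
  also have "\<dots> = f (x b) - f (x a)"
    using sum_Suc_diff'[OF True, of "\<lambda>i. f (x i)"] by simp
  finally show ?thesis by simp
next
  case False
  then have "x b \<le> x a" using mono_onD[OF x, of b a] ab by simp
  then have "x b = x a" using ab by simp
  then show ?thesis by simp
qed

text \<open>A step process is constant on the half-open cells of a refinement, so one value per
  cell, read at the right end point, represents it. The proof telescopes each increment of
  \<open>X\<close> over the refinement and exchanges the sums.\<close>

lemma step_integral_refines:
  assumes r: "step_refinement x m S"
  shows "step_integral S X t \<omega> =
    (\<Sum>c<m. (X (min (x (Suc c)) t) \<omega> - X (min (x c) t) \<omega>) *\<^sub>R step_value S (x (Suc c)) \<omega>)"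
proof -
  let ?f = "\<lambda>u. X (min u t) \<omega>"
  have "?f (step_time S (Suc i)) - ?f (step_time S i) =
      (\<Sum>c<m. indicator {step_time S i<..step_time S (Suc i)} (x (Suc c)) *\<^sub>R (?f (x (Suc c)) - ?f (x c)))"
    if "i < step_num S" for i
  proof -
    have "step_time S i \<in> x ` {..m}" "step_time S (Suc i) \<in> x ` {..m}"
      using r that unfolding step_refinement_def by (auto simp: image_subset_iff)
    then obtain a b where ab: "a \<le> m" "b \<le> m" "step_time S i = x a" "step_time S (Suc i) = x b"
      by auto
    have "step_time S i \<le> step_time S (Suc i)"
      using r that by (auto simp: step_refinement_def mono_on_def)
    then have "x a \<le> x b"
      using ab by simp
    then show ?thesis
      using sum_over_subinterval[of m x a b ?f] r ab by (simp add: step_refinement_def)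
  qed
  then have "step_integral S X t \<omega> = (\<Sum>i<step_num S. (\<Sum>c<m. indicator {step_time S i<..step_time S (Suc i)} (x (Suc c)) *\<^sub>R (?f (x (Suc c)) - ?f (x c))) *\<^sub>R step_coeff S i \<omega>)"
    unfolding step_integral_def by (intro sum.cong) auto
  also have "\<dots> = (\<Sum>i<step_num S. \<Sum>c<m. (?f (x (Suc c)) - ?f (x c)) *\<^sub>R (indicator {step_time S i<..step_time S (Suc i)} (x (Suc c)) *\<^sub>R step_coeff S i \<omega>))"
    unfolding scaleR_sum_left by (intro sum.cong refl) (simp only: real_scaleR_def scaleR_scaleR, rule arg_cong2[where f=scaleR, OF mult.commute refl])
  also have "\<dots> = (\<Sum>c<m. (?f (x (Suc c)) - ?f (x c)) *\<^sub>R step_value S (x (Suc c)) \<omega>)"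
    unfolding step_value_def by (subst sum.swap) (simp only: scaleR_sum_right)
  finally show ?thesis .
qed

text \<open>No time of \<open>S\<close> lies strictly inside a cell, so each of them precedes
  \<open>t\<close> exactly when it precedes the right end of the cell of \<open>t\<close>.\<close>

lemma step_value_constant:
  assumes r: "step_refinement x m S" and c: "c < m" "x c < t" "t \<le> x (Suc c)"
  shows "step_value S t \<omega> = step_value S (x (Suc c)) \<omega>"
proof -
  have mono: "x i \<le> x j" if "i \<le> j" "j \<le> m" for i j
    using r that by (auto simp: step_refinement_def mono_on_def)
  have eq: "u < t \<longleftrightarrow> u < x (Suc c)" if "u \<in> x ` {..m}" for u
  proof -
    obtain a where a: "a \<le> m" "u = x a" using \<open>u \<in> x ` {..m}\<close> by auto
    show ?thesis
    proof (cases "a \<le> c")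
      case True then show ?thesis using mono[of a c] a c by auto
    next
      case False then show ?thesis using mono[of "Suc c" a] a c by auto
    qed
  qed
  have "indicator {step_time S i<..step_time S (Suc i)} t = (indicator {step_time S i<..step_time S (Suc i)} (x (Suc c)) :: real)"
    if "i < step_num S" for i
  proof -
    have "step_time S i \<in> x ` {..m}" "step_time S (Suc i) \<in> x ` {..m}"
      using r that unfolding step_refinement_def by (auto simp: image_subset_iff)
    from this[THEN eq] show ?thesis by (auto simp: indicator_def)
  qed
  then show ?thesis unfolding step_value_def by (auto intro!: sum.cong)
qed

lemma step_value_bounded:
  assumes "simple_predictable M F T S"
  obtains C where "0 \<le> C" "\<And>t \<omega>. \<omega> \<in> space M \<Longrightarrow> norm (step_value S t \<omega>) \<le> C"
proof -
  obtain C where C: "\<And>i \<omega>. i < step_num S \<Longrightarrow> \<omega> \<in> space M \<Longrightarrow> norm (step_coeff S i \<omega>) \<le> C"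
    using assms unfolding simple_predictable_def by blast
  have "norm (step_value S t \<omega>) \<le> real (step_num S) * \<bar>C\<bar>" if "\<omega> \<in> space M" for t \<omega>
  proof -
    have "norm (step_value S t \<omega>) \<le> (\<Sum>i<step_num S. \<bar>C\<bar>)"
      unfolding step_value_def
      using C that by (intro sum_norm_le) (force simp: indicator_def)
    then show ?thesis by simp
  qed
  then show ?thesis by (intro that[of "real (step_num S) * \<bar>C\<bar>"]) auto
qed

lemma common_refinement:
  fixes P :: "real set"
  assumes "finite P" "P \<noteq> {}"
  obtains x and m :: nat where "strict_mono_on {..m} x" "x ` {..m} = P"
proof -
  let ?l = "sorted_list_of_set P"
  have len: "length ?l = card P" "card P > 0"
    using assms by (auto simp: card_gt_0_iff)
  have "strict_mono_on {..card P - 1} (\<lambda>i. ?l ! i)"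
    using len sorted_wrt_nth_less[OF strict_sorted_list_of_set[of P]]
    by (auto simp: strict_mono_on_def)
  moreover have "(\<lambda>i. ?l ! i) ` {..card P - 1} = P"
  proof -
    have "{..card P - 1} = {..<length ?l}" using len by auto
    moreover have "(\<lambda>i. ?l ! i) ` {..<length ?l} = set ?l"
      by (auto simp: set_conv_nth)
    ultimately show ?thesis
      using assms by simp
  qed
  ultimately show ?thesis using that by blast
qed

lemma partition_endpoints:
  fixes x :: "nat \<Rightarrow> real"
  assumes "mono_on {..m} x" "x ` {..m} \<subseteq> {0..T}" "0 \<in> x ` {..m}" "T \<in> x ` {..m}"
  shows "x 0 = 0" "x m = T"
proof -
  obtain i j where ij: "i \<le> m" "x i = 0" "j \<le> m" "x j = T" using assms(3,4) by auto
  have "x 0 \<le> x i" "x j \<le> x m"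
    using mono_onD[OF assms(1), of 0 i] mono_onD[OF assms(1), of j m] ij by auto
  moreover have "0 \<le> x 0" "x m \<le> T" using assms(2) by (auto simp: image_subset_iff)
  ultimately show "x 0 = 0" "x m = T" using ij by auto
qed

section \<open>Uniform meshes and left-point interpolation\<close>

definition mesh :: "real \<Rightarrow> nat \<Rightarrow> nat \<Rightarrow> real" where
  "mesh T n q = T * real q / real n"

definition mesh_step :: "real \<Rightarrow> nat \<Rightarrow> (real \<Rightarrow> 'b) \<Rightarrow> ('a, 'b) step_process" where
  "mesh_step T n h = Step n (mesh T n) (\<lambda>q \<omega>. h (mesh T n q))"

lemma mesh_mono: "0 \<le> T \<Longrightarrow> q \<le> r \<Longrightarrow> mesh T n q \<le> mesh T n r"
  by (simp add: mesh_def divide_right_mono mult_left_mono)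

text \<open>The case \<open>n = 0\<close> is included: division by zero puts every mesh point at
  0.\<close>

lemma mesh_in: "0 \<le> T \<Longrightarrow> q \<le> n \<Longrightarrow> mesh T n q \<in> {0..T}"
  by (cases "n = 0") (auto simp: mesh_def divide_le_eq mult_left_mono)

lemma mesh_0 [simp]: "mesh T n 0 = 0" and mesh_n [simp]: "0 < n \<Longrightarrow> mesh T n n = T"
  and mesh_Suc_diff: "mesh T n (Suc q) - mesh T n q = T / n"
  by (auto simp: mesh_def add_divide_distrib distrib_left)

lemma simple_predictable_mesh_step:
  assumes "0 \<le> T"
  shows "simple_predictable M F T (mesh_step T n h)"
proof -
  have "\<exists>C. \<forall>i<n. norm (h (mesh T n i)) \<le> C"
    by (intro exI[of _ "\<Sum>i<n. norm (h (mesh T n i))"]) (auto intro: member_le_sum)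
  then show ?thesis
    using assms unfolding simple_predictable_def mesh_step_def
    by (auto simp: mono_on_def mesh_mono image_subset_iff dest: mesh_in)
qed

lemma step_integral_mesh_step:
  assumes "0 \<le> T"
  shows "step_integral (mesh_step T n h) X T \<omega> =
    (\<Sum>q<n. (X (mesh T n (Suc q)) \<omega> - X (mesh T n q) \<omega>) *\<^sub>R h (mesh T n q))"
  using mesh_in[OF assms, of _ n]
  unfolding step_integral_def mesh_step_def by (auto intro!: sum.cong simp: min_absorb1)

lemma mesh_cell:
  assumes T: "0 < T" and n: "0 < n" and t: "0 < t" "t \<le> T"
  obtains q where "q < n" "mesh T n q < t" "t \<le> mesh T n (Suc q)"
    "\<And>h \<omega>. step_value (mesh_step T n h) t \<omega> = (h (mesh T n q) :: 'b::euclidean_space)"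
proof -
  \<comment> \<open>Cells are open on the left and closed on the right, so a mesh point belongs to
    the cell that it closes; hence the ceiling minus 1.\<close>
  define q where "q = nat (\<lceil>t * n / T\<rceil> - 1)"
  have pos: "0 < t * n / T" using assms by auto
  then have *: "real q = of_int \<lceil>t * n / T\<rceil> - 1" unfolding q_def
    by (simp add: of_nat_nat)
  have 1: "real q < t * n / T" "t * n / T \<le> real q + 1" unfolding * by linarith+
  then have m: "mesh T n q < t" "t \<le> mesh T n (Suc q)"
    using assms by (auto simp: mesh_def field_simps)
  have "t * n / T \<le> n" using assms by (simp add: field_simps)
  then have q: "q < n" using 1(1) by linarith
  have "step_value (mesh_step T n h) t \<omega> = h (mesh T n q)" for h :: "real \<Rightarrow> 'b" and \<omega> :: 'c
  proof -
    have uniq: "i = q" if "mesh T n i < t" "t \<le> mesh T n (Suc i)" for i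
    proof (rule ccontr)
      assume "i \<noteq> q"
      then have "Suc i \<le> q \<or> Suc q \<le> i" by auto
      then show False
        using that m mesh_mono[of T "Suc i" q n] mesh_mono[of T "Suc q" i n] T by auto
    qed
    have "indicator {mesh T n i<..mesh T n (Suc i)} t *\<^sub>R h (mesh T n i)
        = (if i = q then h (mesh T n q) else 0)" for i
    proof (cases "i = q")
      case True then show ?thesis using m by simp
    next
      case False
      then have "t \<notin> {mesh T n i<..mesh T n (Suc i)}" using uniq[of i] by auto
      then show ?thesis using False by simp
    qed
    then have "step_value (mesh_step T n h) t \<omega> = (\<Sum>i<n. if i = q then h (mesh T n q) else 0)"
      unfolding step_value_def mesh_step_def by simp
    then show ?thesis using q by simp
  qed
  then show ?thesis by (rule that[OF q m])
qed

section \<open>Square-integrable martingales\<close>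

text \<open>Vanishing of the conditional expectation of \<open>D\<close> given \<open>G\<close>,
  expressed by test functions. In this form it passes to sums, to \<open>L2\<close> limits and to
  products with \<open>G\<close>-measurable factors by plain integral computations.\<close>

definition orth :: "'a measure \<Rightarrow> 'a measure \<Rightarrow> ('a \<Rightarrow> real) \<Rightarrow> bool" where
  "orth M G D \<longleftrightarrow> integrable M D \<and>
     (\<forall>\<xi>\<in>borel_measurable G. (\<exists>C. \<forall>\<omega>\<in>space M. \<bar>\<xi> \<omega>\<bar> \<le> C) \<longrightarrow> (\<integral>\<omega>. \<xi> \<omega> * D \<omega> \<partial>M) = 0)"

lemma orthD: "orth M G D \<Longrightarrow> \<xi> \<in> borel_measurable G \<Longrightarrow> (\<And>\<omega>. \<omega> \<in> space M \<Longrightarrow> \<bar>\<xi> \<omega>\<bar> \<le> C) \<Longrightarrow>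
    (\<integral>\<omega>. \<xi> \<omega> * D \<omega> \<partial>M) = 0"
  unfolding orth_def by blast

lemma integrable_bounded_mult:
  fixes D :: "'a \<Rightarrow> real"
  assumes D: "integrable M D" and \<xi>: "\<xi> \<in> borel_measurable M" "\<And>\<omega>. \<omega> \<in> space M \<Longrightarrow> \<bar>\<xi> \<omega>\<bar> \<le> C"
  shows "integrable M (\<lambda>\<omega>. \<xi> \<omega> * D \<omega>)"
proof (rule Bochner_Integration.integrable_bound)
  show "integrable M (\<lambda>\<omega>. C * D \<omega>)" using D by simp
  show "AE \<omega> in M. norm (\<xi> \<omega> * D \<omega>) \<le> norm (C * D \<omega>)"
  proof (intro AE_I2)
    fix \<omega> assume "\<omega> \<in> space M"
    then have "\<bar>\<xi> \<omega>\<bar> \<le> \<bar>C\<bar>" using \<xi>(2)[of \<omega>] by linarith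
    then show "norm (\<xi> \<omega> * D \<omega>) \<le> norm (C * D \<omega>)" by (simp add: abs_mult mult_right_mono)
  qed
qed (use D \<xi> in auto)

text \<open>Truncation of \<open>\<xi>\<close> at level \<open>n\<close> preserves
  \<open>G\<close>-measurability, and the modulus of \<open>\<xi> * D\<close> dominates the
  truncated products.\<close>

lemma orth_unbounded:
  assumes D: "orth M G D" and G: "subalgebra M G" and \<xi>[measurable]: "\<xi> \<in> borel_measurable G"
    and int: "integrable M (\<lambda>\<omega>. \<xi> \<omega> * D \<omega>)"
  shows "(\<integral>\<omega>. \<xi> \<omega> * D \<omega> \<partial>M) = 0"
proof -
  define \<zeta> where "\<zeta> n \<omega> = (if \<bar>\<xi> \<omega>\<bar> \<le> real n then \<xi> \<omega> else 0)" for n \<omega>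
  have \<zeta>G: "\<zeta> n \<in> borel_measurable G" for n unfolding \<zeta>_def by measurable
  have [measurable]: "\<zeta> n \<in> borel_measurable M" "\<xi> \<in> borel_measurable M" for n
    using \<zeta>G \<xi> measurable_from_subalg[OF G] by blast+
  have [measurable]: "D \<in> borel_measurable M" using D by (auto simp: orth_def)
  have "(\<lambda>n. \<integral>\<omega>. \<zeta> n \<omega> * D \<omega> \<partial>M) \<longlonglongrightarrow> (\<integral>\<omega>. \<xi> \<omega> * D \<omega> \<partial>M)"
  proof (rule integral_dominated_convergence[where w="\<lambda>\<omega>. norm (\<xi> \<omega> * D \<omega>)"])
    show "AE \<omega> in M. (\<lambda>n. \<zeta> n \<omega> * D \<omega>) \<longlonglongrightarrow> \<xi> \<omega> * D \<omega>"
    proof (intro AE_I2 tendsto_eventually)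
      fix \<omega>
      obtain N :: nat where "\<bar>\<xi> \<omega>\<bar> \<le> N" using real_arch_simple by blast
      then show "\<forall>\<^sub>F n in sequentially. \<zeta> n \<omega> * D \<omega> = \<xi> \<omega> * D \<omega>"
        unfolding eventually_sequentially \<zeta>_def by (intro exI[of _ N]) auto
    qed
    show "integrable M (\<lambda>\<omega>. norm (\<xi> \<omega> * D \<omega>))" using int by simp
  qed (auto simp: \<zeta>_def abs_mult)
  moreover have "(\<integral>\<omega>. \<zeta> n \<omega> * D \<omega> \<partial>M) = 0" for n
    using \<zeta>G by (intro orthD[OF D, of _ "real n"]) (auto simp: \<zeta>_def)
  ultimately show ?thesis by (simp add: LIMSEQ_const_iff)
qed

lemma orth_zero [simp]: "orth M G (\<lambda>_. 0)" by (simp add: orth_def)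

lemma orth_add:
  assumes "orth M G D" "orth M G E" "subalgebra M G"
  shows "orth M G (\<lambda>\<omega>. D \<omega> + E \<omega>)"
  unfolding orth_def
proof (intro conjI ballI impI)
  show "integrable M (\<lambda>\<omega>. D \<omega> + E \<omega>)" using assms by (auto simp: orth_def)
  fix \<xi> :: "'a \<Rightarrow> real" assume \<xi>: "\<xi> \<in> borel_measurable G" "\<exists>C. \<forall>\<omega>\<in>space M. \<bar>\<xi> \<omega>\<bar> \<le> C"
  then obtain C where C: "\<And>\<omega>. \<omega> \<in> space M \<Longrightarrow> \<bar>\<xi> \<omega>\<bar> \<le> C" by auto
  have "\<xi> \<in> borel_measurable M" using measurable_from_subalg[OF assms(3) \<xi>(1)] .
  then have "integrable M (\<lambda>\<omega>. \<xi> \<omega> * D \<omega>)" "integrable M (\<lambda>\<omega>. \<xi> \<omega> * E \<omega>)"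
    using assms C by (auto intro!: integrable_bounded_mult simp: orth_def)
  then show "(\<integral>\<omega>. \<xi> \<omega> * (D \<omega> + E \<omega>) \<partial>M) = 0"
    using orthD[OF assms(1) \<xi>(1) C] orthD[OF assms(2) \<xi>(1) C] by (simp add: distrib_left)
qed

lemma orth_cmult: "orth M G D \<Longrightarrow> orth M G (\<lambda>\<omega>. c * D \<omega>)"
  unfolding orth_def by (auto simp: mult.left_commute[of _ c])

lemma orth_sum:
  "subalgebra M G \<Longrightarrow> (\<And>i. i \<in> I \<Longrightarrow> orth M G (D i)) \<Longrightarrow> orth M G (\<lambda>\<omega>. \<Sum>i\<in>I. D i \<omega>)"
  by (induction I rule: infinite_finite_induct) (auto intro: orth_add)

text \<open>Serves for factors that are themselves sums of Brownian increments, which are square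
  integrable but unbounded.\<close>

lemma orth_mult_unbounded:
  assumes D: "orth M G D" and G: "subalgebra M G"
    and \<zeta>: "\<zeta> \<in> borel_measurable G" "integrable M (\<lambda>\<omega>. \<zeta> \<omega> * D \<omega>)"
  shows "orth M G (\<lambda>\<omega>. \<zeta> \<omega> * D \<omega>)"
  unfolding orth_def
proof (intro conjI ballI impI \<zeta>(2))
  fix \<xi> :: "'a \<Rightarrow> real" assume \<xi>: "\<xi> \<in> borel_measurable G" "\<exists>C. \<forall>\<omega>\<in>space M. \<bar>\<xi> \<omega>\<bar> \<le> C"
  then obtain B where B: "\<And>\<omega>. \<omega> \<in> space M \<Longrightarrow> \<bar>\<xi> \<omega>\<bar> \<le> B" by auto
  have "(\<integral>\<omega>. (\<xi> \<omega> * \<zeta> \<omega>) * D \<omega> \<partial>M) = 0"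
  proof (rule orth_unbounded[OF D G])
    show "(\<lambda>\<omega>. \<xi> \<omega> * \<zeta> \<omega>) \<in> borel_measurable G" using \<xi>(1) \<zeta>(1) by simp
    show "integrable M (\<lambda>\<omega>. \<xi> \<omega> * \<zeta> \<omega> * D \<omega>)"
      using integrable_bounded_mult[OF \<zeta>(2) measurable_from_subalg[OF G \<xi>(1)] B] by (simp add: mult.assoc)
  qed
  then show "(\<integral>\<omega>. \<xi> \<omega> * (\<zeta> \<omega> * D \<omega>) \<partial>M) = 0" by (simp add: mult.assoc)
qed

lemma orth_mult:
  assumes D: "orth M G D" and G: "subalgebra M G"
    and \<zeta>: "\<zeta> \<in> borel_measurable G" "\<And>\<omega>. \<omega> \<in> space M \<Longrightarrow> \<bar>\<zeta> \<omega>\<bar> \<le> C"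
  shows "orth M G (\<lambda>\<omega>. \<zeta> \<omega> * D \<omega>)"
  by (rule orth_mult_unbounded[OF D G \<zeta>(1)], rule integrable_bounded_mult[OF _ _ \<zeta>(2)])
    (use D measurable_from_subalg[OF G \<zeta>(1)] in \<open>auto simp: orth_def\<close>)

lemma orth_mono:
  assumes "orth M G D" "subalgebra G H"
  shows "orth M H D"
  using assms measurable_from_subalg[OF assms(2)] unfolding orth_def by blast

text \<open>For a bounded \<open>\<xi>\<close> the expectation of \<open>\<xi> * D\<close> depends
  continuously on \<open>D\<close> in \<open>L2\<close>, with modulus at most
  \<open>\<bar>C\<bar>\<close> times the norm.\<close>

lemma (in prob_space) orth_l2_limit:
  assumes D: "\<And>n. orth M G (D n)" "\<And>n. sq_integrable M (D n)" and E: "sq_integrable M E"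
    and G: "subalgebra M G" and lim: "(\<lambda>n. l2norm M (\<lambda>\<omega>. D n \<omega> - E \<omega>)) \<longlonglongrightarrow> 0"
  shows "orth M G E"
  unfolding orth_def
proof (intro conjI ballI impI)
  show "integrable M E" using E by (rule sq_integrable_integrable)
  fix \<xi> :: "'a \<Rightarrow> real" assume \<xi>: "\<xi> \<in> borel_measurable G" "\<exists>C. \<forall>\<omega>\<in>space M. \<bar>\<xi> \<omega>\<bar> \<le> C"
  then obtain C where C: "\<And>\<omega>. \<omega> \<in> space M \<Longrightarrow> \<bar>\<xi> \<omega>\<bar> \<le> C" by auto
  have \<xi>M: "\<xi> \<in> borel_measurable M" using measurable_from_subalg[OF G \<xi>(1)] .
  have "\<bar>expectation (\<lambda>\<omega>. \<xi> \<omega> * E \<omega>)\<bar> \<le> \<bar>C\<bar> * l2norm M (\<lambda>\<omega>. D n \<omega> - E \<omega>)" for n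
  proof -
    have DE: "sq_integrable M (\<lambda>\<omega>. D n \<omega> - E \<omega>)" using D E by (intro sq_integrable_diff)
    have "integrable M (\<lambda>\<omega>. \<xi> \<omega> * D n \<omega>)" "integrable M (\<lambda>\<omega>. \<xi> \<omega> * E \<omega>)"
      using integrable_bounded_mult[OF sq_integrable_integrable[OF D(2)] \<xi>M C]
        integrable_bounded_mult[OF sq_integrable_integrable[OF E] \<xi>M C] by auto
    then have "expectation (\<lambda>\<omega>. \<xi> \<omega> * (D n \<omega> - E \<omega>)) = - expectation (\<lambda>\<omega>. \<xi> \<omega> * E \<omega>)"
      using orthD[OF D(1) \<xi>(1) C] by (simp add: right_diff_distrib)
    then have "\<bar>expectation (\<lambda>\<omega>. \<xi> \<omega> * E \<omega>)\<bar> = \<bar>expectation (\<lambda>\<omega>. \<xi> \<omega> * (D n \<omega> - E \<omega>))\<bar>" by simp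
    also have "\<dots> \<le> expectation (\<lambda>\<omega>. \<bar>\<xi> \<omega> * (D n \<omega> - E \<omega>)\<bar>)" by simp
    also have "\<dots> \<le> expectation (\<lambda>\<omega>. \<bar>C\<bar> * norm (D n \<omega> - E \<omega>))"
    proof (intro integral_mono)
      show "integrable M (\<lambda>\<omega>. \<bar>\<xi> \<omega> * (D n \<omega> - E \<omega>)\<bar>)"
        using integrable_bounded_mult[OF sq_integrable_integrable[OF DE] \<xi>M C] by simp
      show "integrable M (\<lambda>\<omega>. \<bar>C\<bar> * norm (D n \<omega> - E \<omega>))"
        using sq_integrable_integrable[OF DE] by simp
      show "\<bar>\<xi> \<omega> * (D n \<omega> - E \<omega>)\<bar> \<le> \<bar>C\<bar> * norm (D n \<omega> - E \<omega>)" if "\<omega> \<in> space M" for \<omega>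
        using C[OF that] by (auto simp: abs_mult intro!: mult_right_mono)
    qed
    also have "\<dots> \<le> \<bar>C\<bar> * l2norm M (\<lambda>\<omega>. D n \<omega> - E \<omega>)"
      using expectation_norm_le_l2norm[OF DE] by (simp add: mult_left_mono)
    finally show ?thesis .
  qed
  moreover have "(\<lambda>n. \<bar>C\<bar> * l2norm M (\<lambda>\<omega>. D n \<omega> - E \<omega>)) \<longlonglongrightarrow> 0"
    using tendsto_mult_left[OF lim, of "\<bar>C\<bar>"] by simp
  ultimately have "\<bar>expectation (\<lambda>\<omega>. \<xi> \<omega> * E \<omega>)\<bar> \<le> 0"
    by (intro LIMSEQ_le_const) auto
  then show "expectation (\<lambda>\<omega>. \<xi> \<omega> * E \<omega>) = 0" by simp
qed

text \<open>The cross terms vanish because \<open>(\<Sum>c<m. D c *\<^sub>R v c) \<bullet> v m\<close> is \<open>G m\<close>-measurable.\<close>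

lemma martingale_difference_isometry:
  fixes v :: "nat \<Rightarrow> 'a \<Rightarrow> 'b::euclidean_space"
  assumes sub: "\<And>c. c \<le> m \<Longrightarrow> subalgebra M (G c)"
    and mono: "\<And>c d. c \<le> d \<Longrightarrow> d \<le> m \<Longrightarrow> subalgebra (G d) (G c)"
    and D: "\<And>c. c < m \<Longrightarrow> D c \<in> borel_measurable (G (Suc c))" "\<And>c. c < m \<Longrightarrow> orth M (G c) (D c)"
    and v: "\<And>c. c < m \<Longrightarrow> v c \<in> borel_measurable (G c)"
    and sq: "\<And>c. c < m \<Longrightarrow> sq_integrable M (\<lambda>\<omega>. D c \<omega> *\<^sub>R v c \<omega>)"
  shows "(l2norm M (\<lambda>\<omega>. \<Sum>c<m. D c \<omega> *\<^sub>R v c \<omega>))\<^sup>2 = (\<Sum>c<m. (l2norm M (\<lambda>\<omega>. D c \<omega> *\<^sub>R v c \<omega>))\<^sup>2)"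
  using assms
proof (induction m)
  case 0 then show ?case by (simp add: l2norm_def)
next
  case (Suc m)
  let ?A = "\<lambda>\<omega>. \<Sum>c<m. D c \<omega> *\<^sub>R v c \<omega>" and ?B = "\<lambda>\<omega>. D m \<omega> *\<^sub>R v m \<omega>"
  have sA: "sq_integrable M ?A" using Suc.prems by (intro sq_integrable_sum) auto
  have sB: "sq_integrable M ?B" using Suc.prems by auto
  have "D c \<in> borel_measurable (G m)" "v c \<in> borel_measurable (G m)" if "c < m" for c
    using that Suc.prems(3)[of c] Suc.prems(5)[of c]
      measurable_from_subalg[OF Suc.prems(2)[of "Suc c" m]] measurable_from_subalg[OF Suc.prems(2)[of c m]]
    by auto
  then have A: "?A \<in> borel_measurable (G m)" by (intro borel_measurable_sum borel_measurable_scaleR) auto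
  have int: "integrable M (\<lambda>\<omega>. (?A \<omega> \<bullet> v m \<omega>) * D m \<omega>)"
    using sq_integrable_inner_integrable[OF sA sB] by (simp add: mult.commute)
  have "(\<integral>\<omega>. (?A \<omega> \<bullet> v m \<omega>) * D m \<omega> \<partial>M) = 0"
    using Suc.prems(1)[of m] Suc.prems(4)[of m] Suc.prems(5)[of m] A int
    by (intro orth_unbounded) auto
  then have cross: "(\<integral>\<omega>. ?A \<omega> \<bullet> ?B \<omega> \<partial>M) = 0" by (simp add: mult.commute)
  have sq_norm_add: "(norm (a + b))\<^sup>2 = (norm a)\<^sup>2 + 2 * (a \<bullet> b) + (norm b)\<^sup>2" for a b :: 'b
    by (simp add: power2_norm_eq_inner inner_add_left inner_add_right inner_commute)
  have "(\<integral>\<omega>. (norm (?A \<omega> + ?B \<omega>))\<^sup>2 \<partial>M) = (\<integral>\<omega>. (norm (?A \<omega>))\<^sup>2 + 2 * (?A \<omega> \<bullet> ?B \<omega>) + (norm (?B \<omega>))\<^sup>2 \<partial>M)"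
    unfolding sq_norm_add by simp
  also have "\<dots> = (l2norm M ?A)\<^sup>2 + (l2norm M ?B)\<^sup>2"
    using sA sB sq_integrable_inner_integrable[OF sA sB] cross
    by (simp add: l2norm_power2 sq_integrable_def)
  finally have "(l2norm M (\<lambda>\<omega>. ?A \<omega> + ?B \<omega>))\<^sup>2 = (l2norm M ?A)\<^sup>2 + (l2norm M ?B)\<^sup>2"
    by (simp add: l2norm_power2)
  moreover have "(l2norm M ?A)\<^sup>2 = (\<Sum>c<m. (l2norm M (\<lambda>\<omega>. D c \<omega> *\<^sub>R v c \<omega>))\<^sup>2)"
    using Suc.prems by (intro Suc.IH) auto
  ultimately show ?case by simp
qed

text \<open>The martingale property in terms of \<open>orth\<close>, for square-integrable
  processes. It applies alike to Brownian motion, to elementary integrals and to Ito integrals, and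
  it is the form in which the isometry on partitions takes its input.\<close>

definition l2_martingale :: "'a measure \<Rightarrow> (real \<Rightarrow> 'a measure) \<Rightarrow> real \<Rightarrow> (real \<Rightarrow> 'a \<Rightarrow> real) \<Rightarrow> bool" where
  "l2_martingale M F T X \<longleftrightarrow> adapted_process F T X \<and> (\<forall>t\<in>{0..T}. sq_integrable M (X t)) \<and>
     (\<forall>s t. 0 \<le> s \<and> s \<le> t \<and> t \<le> T \<longrightarrow> orth M (F s) (\<lambda>\<omega>. X t \<omega> - X s \<omega>))"

context usual_filtered_prob_space
begin

lemma F_mono: "s \<le> t \<Longrightarrow> subalgebra (F t) (F s)"
  using space_F sets_F_mono by (auto simp: subalgebra_def)

lemma measurable_F_mono: "f \<in> borel_measurable (F s) \<Longrightarrow> s \<le> t \<Longrightarrow> f \<in> borel_measurable (F t)"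
  using measurable_from_subalg[OF F_mono] .

lemma measurable_F: "f \<in> borel_measurable (F s) \<Longrightarrow> s \<in> {0..T} \<Longrightarrow> f \<in> borel_measurable M"
  using measurable_from_subalg[OF F_subalgebra] .

lemma l2_martingale_sum:
  assumes "\<And>i. i \<in> I \<Longrightarrow> l2_martingale M F T (X i)"
  shows "l2_martingale M F T (\<lambda>t \<omega>. \<Sum>i\<in>I. X i t \<omega>)"
  unfolding l2_martingale_def
proof (intro conjI allI impI ballI)
  show "adapted_process F T (\<lambda>t \<omega>. \<Sum>i\<in>I. X i t \<omega>)"
    using assms unfolding l2_martingale_def adapted_process_def by (auto intro!: borel_measurable_sum)
  show "sq_integrable M (\<lambda>\<omega>. \<Sum>i\<in>I. X i t \<omega>)" if "t \<in> {0..T}" for t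
    using assms that unfolding l2_martingale_def by (auto intro!: sq_integrable_sum)
  show "orth M (F s) (\<lambda>\<omega>. (\<Sum>i\<in>I. X i t \<omega>) - (\<Sum>i\<in>I. X i s \<omega>))" if "0 \<le> s \<and> s \<le> t \<and> t \<le> T" for s t
    unfolding sum_subtractf[symmetric]
    using assms that F_subalgebra[of s] unfolding l2_martingale_def by (intro orth_sum) auto
qed

lemma l2_martingale_diff:
  assumes X: "l2_martingale M F T X" and Y: "l2_martingale M F T Y"
  shows "l2_martingale M F T (\<lambda>t \<omega>. X t \<omega> - Y t \<omega>)"
  unfolding l2_martingale_def
proof (intro conjI allI impI ballI)
  show "adapted_process F T (\<lambda>t \<omega>. X t \<omega> - Y t \<omega>)"
    using assms unfolding l2_martingale_def adapted_process_def by (auto intro!: borel_measurable_diff)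
  show "sq_integrable M (\<lambda>\<omega>. X t \<omega> - Y t \<omega>)" if "t \<in> {0..T}" for t
    using assms that unfolding l2_martingale_def by (auto intro!: sq_integrable_diff)
  show "orth M (F s) (\<lambda>\<omega>. (X t \<omega> - Y t \<omega>) - (X s \<omega> - Y s \<omega>))" if "0 \<le> s \<and> s \<le> t \<and> t \<le> T" for s t
  proof -
    have "orth M (F s) (\<lambda>\<omega>. (X t \<omega> - X s \<omega>) + (-1) * (Y t \<omega> - Y s \<omega>))"
      using X Y that F_subalgebra[of s] unfolding l2_martingale_def
      by (intro orth_add orth_cmult) auto
    then show ?thesis by (simp add: algebra_simps)
  qed
qed

lemma partition_subalgebras:
  fixes x :: "nat \<Rightarrow> real"
  assumes "mono_on {..m} x" "x ` {..m} \<subseteq> {0..T}"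
  shows "c \<le> m \<Longrightarrow> subalgebra M (F (x c))" "c \<le> d \<Longrightarrow> d \<le> m \<Longrightarrow> subalgebra (F (x d)) (F (x c))"
  using assms(2) F_subalgebra F_mono mono_onD[OF assms(1), of c d] by (auto simp: image_subset_iff)

text \<open>The isometry is used twice: with the coefficients \<open>v\<close>, bounded term by term
  by \<open>C\<close>, and backwards with all coefficients equal to 1, where the increments
  telescope to \<open>X (x m) - X (x 0)\<close>.\<close>

lemma l2_martingale_sum_increments:
  fixes v :: "nat \<Rightarrow> 'a \<Rightarrow> 'b::euclidean_space"
  assumes X: "l2_martingale M F T X" and x: "mono_on {..m} x" "x ` {..m} \<subseteq> {0..T}"
    and v: "\<And>c. c < m \<Longrightarrow> v c \<in> borel_measurable (F (x c))"
    and C: "0 \<le> C" "\<And>c \<omega>. c < m \<Longrightarrow> \<omega> \<in> space M \<Longrightarrow> norm (v c \<omega>) \<le> C"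
  shows "l2norm M (\<lambda>\<omega>. \<Sum>c<m. (X (x (Suc c)) \<omega> - X (x c) \<omega>) *\<^sub>R v c \<omega>)
    \<le> C * l2norm M (\<lambda>\<omega>. X (x m) \<omega> - X (x 0) \<omega>)"
    and "sq_integrable M (\<lambda>\<omega>. \<Sum>c<m. (X (x (Suc c)) \<omega> - X (x c) \<omega>) *\<^sub>R v c \<omega>)"
proof -
  let ?D = "\<lambda>c \<omega>. X (x (Suc c)) \<omega> - X (x c) \<omega>"
  have in01: "c \<le> m \<Longrightarrow> x c \<in> {0..T}" for c using x(2) by auto
  have le: "c < m \<Longrightarrow> x c \<le> x (Suc c)" for c using x(1) by (auto simp: mono_on_def)
  have D: "?D c \<in> borel_measurable (F (x (Suc c)))" "orth M (F (x c)) (?D c)" "sq_integrable M (?D c)" if "c < m" for c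
  proof -
    show "?D c \<in> borel_measurable (F (x (Suc c)))"
      using X in01[of c] in01[of "Suc c"] that le[OF that] measurable_F_mono
      unfolding l2_martingale_def adapted_process_def by (intro borel_measurable_diff) force+
    show "orth M (F (x c)) (?D c)" "sq_integrable M (?D c)"
      using X in01[of c] in01[of "Suc c"] le that unfolding l2_martingale_def
      by (auto intro!: sq_integrable_diff)
  qed
  have vM[measurable]: "v c \<in> borel_measurable M" if "c < m" for c
    using measurable_F[OF v[OF that]] in01[of c] that by auto
  have sq: "sq_integrable M (\<lambda>\<omega>. ?D c \<omega> *\<^sub>R v c \<omega>)" and
    le2: "l2norm M (\<lambda>\<omega>. ?D c \<omega> *\<^sub>R v c \<omega>) \<le> C * l2norm M (?D c)" if "c < m" for c
  proof -
    have [measurable]: "v c \<in> borel_measurable M" "?D c \<in> borel_measurable M"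
      using vM D(3) that by (auto simp: sq_integrable_def)
    have *: "AE \<omega> in M. norm (?D c \<omega> *\<^sub>R v c \<omega>) \<le> C * norm (?D c \<omega>)"
      using C(2)[OF that] by (intro AE_I2) (auto simp: mult.commute[of C] intro!: mult_left_mono)
    show "sq_integrable M (\<lambda>\<omega>. ?D c \<omega> *\<^sub>R v c \<omega>)"
      by (rule sq_integrable_dominated[OF D(3)[OF that] _ *]) measurable
    show "l2norm M (\<lambda>\<omega>. ?D c \<omega> *\<^sub>R v c \<omega>) \<le> C * l2norm M (?D c)"
      by (rule l2norm_dominated[OF D(3)[OF that] _ C(1) *]) measurable
  qed
  then show "sq_integrable M (\<lambda>\<omega>. \<Sum>c<m. ?D c \<omega> *\<^sub>R v c \<omega>)" by (intro sq_integrable_sum) auto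
  have "(l2norm M (\<lambda>\<omega>. \<Sum>c<m. ?D c \<omega> *\<^sub>R v c \<omega>))\<^sup>2 = (\<Sum>c<m. (l2norm M (\<lambda>\<omega>. ?D c \<omega> *\<^sub>R v c \<omega>))\<^sup>2)"
    by (rule martingale_difference_isometry[where G="\<lambda>c. F (x c)"]) (use partition_subalgebras[OF x] D v sq in auto)
  also have "\<dots> \<le> (\<Sum>c<m. (C * l2norm M (?D c))\<^sup>2)"
    by (intro sum_mono power_mono le2) auto
  also have "\<dots> = C\<^sup>2 * (\<Sum>c<m. (l2norm M (\<lambda>\<omega>. ?D c \<omega> *\<^sub>R (1::real)))\<^sup>2)"
    by (simp add: power_mult_distrib sum_distrib_left)
  also have "(\<Sum>c<m. (l2norm M (\<lambda>\<omega>. ?D c \<omega> *\<^sub>R (1::real)))\<^sup>2) = (l2norm M (\<lambda>\<omega>. \<Sum>c<m. ?D c \<omega> *\<^sub>R (1::real)))\<^sup>2"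
    by (rule martingale_difference_isometry[where G="\<lambda>c. F (x c)", symmetric])
      (use partition_subalgebras[OF x] D in auto)
  also have "(\<lambda>\<omega>. \<Sum>c<m. ?D c \<omega> *\<^sub>R (1::real)) = (\<lambda>\<omega>. X (x m) \<omega> - X (x 0) \<omega>)"
  proof
    fix \<omega>
    show "(\<Sum>c<m. ?D c \<omega> *\<^sub>R (1::real)) = X (x m) \<omega> - X (x 0) \<omega>"
      using sum_lessThan_telescope[of "\<lambda>i. X (x i) \<omega>" m] by (simp only: real_scaleR_def mult_1_right)
  qed
  finally have "(l2norm M (\<lambda>\<omega>. \<Sum>c<m. ?D c \<omega> *\<^sub>R v c \<omega>))\<^sup>2 \<le> (C * l2norm M (\<lambda>\<omega>. X (x m) \<omega> - X (x 0) \<omega>))\<^sup>2"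
    by (simp only: power_mult_distrib)
  then show "l2norm M (\<lambda>\<omega>. \<Sum>c<m. ?D c \<omega> *\<^sub>R v c \<omega>) \<le> C * l2norm M (\<lambda>\<omega>. X (x m) \<omega> - X (x 0) \<omega>)"
    by (rule power2_le_imp_le) (intro mult_nonneg_nonneg C(1) l2norm_nonneg)
qed

end

section \<open>Brownian motion and the Ito integral\<close>

lemma (in prob_space) normal_moments:
  assumes D: "distributed M lborel X (normal_density 0 \<sigma>)" and \<sigma>: "0 < \<sigma>"
  shows "integrable M (\<lambda>\<omega>. X \<omega> ^ k)" "expectation X = 0" "expectation (\<lambda>\<omega>. (X \<omega>)\<^sup>2) = \<sigma>\<^sup>2"
    "expectation (\<lambda>\<omega>. X \<omega> ^ 4) = 3 * \<sigma> ^ 4"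
proof -
  show "integrable M (\<lambda>\<omega>. X \<omega> ^ k)"
    using integrable_normal_moment[OF \<sigma>, of 0 k] distributed_integrable[OF D, of "\<lambda>x. x ^ k"] by simp
  show "expectation X = 0" by (rule normal_distributed_expectation[OF \<sigma> D])
  show "expectation (\<lambda>\<omega>. (X \<omega>)\<^sup>2) = \<sigma>\<^sup>2"
    using normal_distributed_variance[OF \<sigma> D] normal_distributed_expectation[OF \<sigma> D] by simp
  have "expectation (\<lambda>\<omega>. X \<omega> ^ 4) = fact 4 / ((2 / \<sigma>\<^sup>2)\<^sup>2 * fact 2)"
    using integral_normal_moment_even[OF \<sigma>, of 0 2] distributed_integral[OF D, of "\<lambda>x. x ^ 4"]
    by simp
  also have "\<dots> = 3 * \<sigma> ^ 4"
    by (simp add: fact_numeral power_divide power_mult[symmetric])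
  finally show "expectation (\<lambda>\<omega>. X \<omega> ^ 4) = 3 * \<sigma> ^ 4" .
qed

context usual_filtered_prob_space
begin

text \<open>The two random variables generate sub-sigma-algebras of the independent ones in
  \<open>brownian_motion\<close>. The factor \<open>\<xi>\<close> is allowed to be merely
  integrable, because it will be the squared norm of a square-integrable coefficient.\<close>

lemma brownian_motion_independent:
  assumes W: "brownian_motion M F T W" and st: "0 \<le> s" "s < t" "t \<le> T"
    and \<xi>: "\<xi> \<in> borel_measurable (F s)" "integrable M \<xi>"
    and g: "g \<in> borel_measurable borel" "integrable M (\<lambda>\<omega>. g (W t \<omega> - W s \<omega>) :: real)"
  shows "integrable M (\<lambda>\<omega>. \<xi> \<omega> * g (W t \<omega> - W s \<omega>))"
    and "expectation (\<lambda>\<omega>. \<xi> \<omega> * g (W t \<omega> - W s \<omega>)) = expectation \<xi> * expectation (\<lambda>\<omega>. g (W t \<omega> - W s \<omega>))"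
proof -
  let ?D = "\<lambda>\<omega>. W t \<omega> - W s \<omega>"
  let ?V = "vimage_algebra (space M) ?D borel"
  have ind: "indep_set (sets (F s)) (sets ?V)"
    using W st unfolding brownian_motion_def by blast
  have "?D \<in> measurable ?V borel" by (rule measurable_vimage_algebra1) auto
  then have gV: "(\<lambda>\<omega>. g (?D \<omega>)) \<in> borel_measurable ?V"
    using measurable_compose g(1) by blast
  have 1: "sigma_sets (space M) {\<xi> -` A \<inter> space M | A. A \<in> sets borel} \<subseteq> sets (F s)"
  proof -
    have "{\<xi> -` A \<inter> space M | A. A \<in> sets borel} \<subseteq> sets (F s)"
      using measurable_sets[OF \<xi>(1)] by (auto simp: space_F)
    from sets.sigma_sets_subset[OF this] show ?thesis by (simp add: space_F)
  qed
  have 2: "sigma_sets (space M) {(\<lambda>\<omega>. g (?D \<omega>)) -` A \<inter> space M | A. A \<in> sets borel} \<subseteq> sets ?V"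
  proof -
    have "{(\<lambda>\<omega>. g (?D \<omega>)) -` A \<inter> space M | A. A \<in> sets borel} \<subseteq> sets ?V"
      using measurable_sets[OF gV] by auto
    from sets.sigma_sets_subset[OF this] show ?thesis by simp
  qed
  have "indep_set (sigma_sets (space M) {\<xi> -` A \<inter> space M | A. A \<in> sets borel})
      (sigma_sets (space M) {(\<lambda>\<omega>. g (?D \<omega>)) -` A \<inter> space M | A. A \<in> sets borel})"
    using ind 1 2 unfolding indep_sets2_eq by blast
  then have "indep_var borel \<xi> borel (\<lambda>\<omega>. g (?D \<omega>))"
    using \<xi>(2) g(2) unfolding indep_var_eq by auto
  from indep_var_lebesgue_integral[OF this \<xi>(2) g(2)] indep_var_integrable[OF this \<xi>(2) g(2)]
  show "integrable M (\<lambda>\<omega>. \<xi> \<omega> * g (?D \<omega>))"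
    "expectation (\<lambda>\<omega>. \<xi> \<omega> * g (?D \<omega>)) = expectation \<xi> * expectation (\<lambda>\<omega>. g (?D \<omega>))" by auto
qed

text \<open>These are the moments of a centred normal variable of variance \<open>t - s\<close>; the
  definition of \<open>brownian_motion\<close> is silent for \<open>s = t\<close>, which is treated
  apart. The fourth moment later gives the variance \<open>2 * (t - s)\<^sup>2\<close> of the
  squared increment.\<close>

lemma brownian_motion_moments:
  assumes W: "brownian_motion M F T W" and st: "0 \<le> s" "s \<le> t" "t \<le> T"
  shows "integrable M (\<lambda>\<omega>. (W t \<omega> - W s \<omega>) ^ k)" "expectation (\<lambda>\<omega>. W t \<omega> - W s \<omega>) = 0"
    "expectation (\<lambda>\<omega>. (W t \<omega> - W s \<omega>)\<^sup>2) = t - s" "expectation (\<lambda>\<omega>. (W t \<omega> - W s \<omega>) ^ 4) = 3 * (t - s)\<^sup>2"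
proof -
  consider "s = t" | "s < t" using st by linarith
  then have "integrable M (\<lambda>\<omega>. (W t \<omega> - W s \<omega>) ^ k) \<and> expectation (\<lambda>\<omega>. W t \<omega> - W s \<omega>) = 0 \<and>
    expectation (\<lambda>\<omega>. (W t \<omega> - W s \<omega>)\<^sup>2) = t - s \<and> expectation (\<lambda>\<omega>. (W t \<omega> - W s \<omega>) ^ 4) = 3 * (t - s)\<^sup>2"
  proof cases
    case 1 then show ?thesis by simp
  next
    case 2
    then have D: "distributed M lborel (\<lambda>\<omega>. W t \<omega> - W s \<omega>) (normal_density 0 (sqrt (t - s)))"
      using W st unfolding brownian_motion_def by blast
    have "sqrt (t - s) ^ 4 = (t - s)\<^sup>2"
      using 2 power_mult[of "sqrt (t - s)" 2 2] by simp
    then show ?thesis using normal_moments[OF D] 2 by auto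
  qed
  then show "integrable M (\<lambda>\<omega>. (W t \<omega> - W s \<omega>) ^ k)" "expectation (\<lambda>\<omega>. W t \<omega> - W s \<omega>) = 0"
    "expectation (\<lambda>\<omega>. (W t \<omega> - W s \<omega>)\<^sup>2) = t - s" "expectation (\<lambda>\<omega>. (W t \<omega> - W s \<omega>) ^ 4) = 3 * (t - s)\<^sup>2"
    by auto
qed

lemma brownian_motion_increment:
  assumes W: "brownian_motion M F T W" and st: "0 \<le> s" "s \<le> t" "t \<le> T"
  shows "orth M (F s) (\<lambda>\<omega>. W t \<omega> - W s \<omega>)"
    and "orth M (F s) (\<lambda>\<omega>. (W t \<omega> - W s \<omega>)\<^sup>2 - (t - s))"
    and "sq_integrable M (\<lambda>\<omega>. W t \<omega> - W s \<omega>)"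
    and "sq_integrable M (\<lambda>\<omega>. (W t \<omega> - W s \<omega>)\<^sup>2)"
proof -
  let ?D = "\<lambda>\<omega>. W t \<omega> - W s \<omega>"
  note mom = brownian_motion_moments[OF W st]
  have [measurable]: "?D \<in> borel_measurable M" using mom(1)[of 1] by auto
  show "sq_integrable M ?D" "sq_integrable M (\<lambda>\<omega>. (?D \<omega>)\<^sup>2)"
    using mom(1)[of 2] mom(1)[of 4] unfolding sq_integrable_def by (auto simp: power_mult[symmetric])
  have Es: "integrable M \<xi>" if "\<xi> \<in> borel_measurable (F s)" "\<exists>C. \<forall>\<omega>\<in>space M. \<bar>\<xi> \<omega>\<bar> \<le> C" for \<xi> :: "'a \<Rightarrow> real"
  proof -
    obtain C where "\<forall>\<omega>\<in>space M. \<bar>\<xi> \<omega>\<bar> \<le> C" using \<open>\<exists>C. \<forall>\<omega>\<in>space M. \<bar>\<xi> \<omega>\<bar> \<le> C\<close> by auto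
    then show ?thesis
      using that(1) st measurable_F[OF that(1)] by (intro integrable_const_bound[where B=C]) auto
  qed
  have *: "expectation (\<lambda>\<omega>. \<xi> \<omega> * g (?D \<omega>)) = expectation \<xi> * expectation (\<lambda>\<omega>. g (?D \<omega>))"
    if "\<xi> \<in> borel_measurable (F s)" "\<exists>C. \<forall>\<omega>\<in>space M. \<bar>\<xi> \<omega>\<bar> \<le> C" "s < t" "g \<in> borel_measurable borel" "integrable M (\<lambda>\<omega>. g (?D \<omega>))"
    for \<xi> :: "'a \<Rightarrow> real" and g :: "real \<Rightarrow> real"
    using brownian_motion_independent(2)[OF W st(1) that(3) st(3) that(1) Es[OF that(1,2)] that(4,5)] .
  \<comment> \<open>\<open>s = t\<close> falls outside the definition of
    \<open>brownian_motion\<close>; the increment is then 0 and orthogonality rests on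
    \<open>g 0 = 0\<close>.\<close>
  have **: "orth M (F s) (\<lambda>\<omega>. g (?D \<omega>))"
    if g: "g \<in> borel_measurable borel" "integrable M (\<lambda>\<omega>. g (?D \<omega>))" "expectation (\<lambda>\<omega>. g (?D \<omega>)) = 0"
      "s = t \<Longrightarrow> g 0 = 0" for g :: "real \<Rightarrow> real"
    unfolding orth_def
  proof (intro conjI ballI impI)
    show "integrable M (\<lambda>\<omega>. g (?D \<omega>))" by (rule g)
    fix \<xi> :: "'a \<Rightarrow> real" assume \<xi>: "\<xi> \<in> borel_measurable (F s)" "\<exists>C. \<forall>\<omega>\<in>space M. \<bar>\<xi> \<omega>\<bar> \<le> C"
    show "expectation (\<lambda>\<omega>. \<xi> \<omega> * g (?D \<omega>)) = 0"
    proof (cases "s = t")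
      case True
      then show ?thesis using g(4) by simp
    next
      case False
      then have "s < t" using st by simp
      show ?thesis unfolding *[OF \<xi> \<open>s < t\<close> g(1,2)] g(3) by simp
    qed
  qed
  show "orth M (F s) ?D"
    using mom(1)[of 1] mom(2) by (intro **[of "\<lambda>x. x"]) simp_all
  have "expectation (\<lambda>\<omega>. (?D \<omega>)\<^sup>2 - (t - s)) = 0"
    using mom(1)[of 2] mom(3) by (simp add: prob_space)
  then show "orth M (F s) (\<lambda>\<omega>. (?D \<omega>)\<^sup>2 - (t - s))"
    using mom(1)[of 2] by (intro **[of "\<lambda>x. x\<^sup>2 - (t - s)"]) simp_all
qed

text \<open>Independence of the increment from \<open>F s\<close> separates the two squared factors,
  so \<open>v\<close> may be unbounded. This generality is used when \<open>v\<close> contains a sum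
  of earlier increments.\<close>

lemma brownian_motion_increment_scaleR:
  fixes v :: "'a \<Rightarrow> 'b::euclidean_space"
  assumes W: "brownian_motion M F T W" and st: "0 \<le> s" "s \<le> t" "t \<le> T"
    and v: "v \<in> borel_measurable (F s)" "sq_integrable M v"
  shows "sq_integrable M (\<lambda>\<omega>. (W t \<omega> - W s \<omega>) *\<^sub>R v \<omega>)"
    and "(l2norm M (\<lambda>\<omega>. (W t \<omega> - W s \<omega>) *\<^sub>R v \<omega>))\<^sup>2 = (t - s) * (l2norm M v)\<^sup>2"
proof -
  let ?D = "\<lambda>\<omega>. W t \<omega> - W s \<omega>"
  note mom = brownian_motion_moments[OF W st]
  have [measurable]: "?D \<in> borel_measurable M" using mom(1)[of 1] by auto
  have "integrable M (\<lambda>\<omega>. (norm (v \<omega>))\<^sup>2 * (?D \<omega>)\<^sup>2) \<and>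
      expectation (\<lambda>\<omega>. (norm (v \<omega>))\<^sup>2 * (?D \<omega>)\<^sup>2) = expectation (\<lambda>\<omega>. (norm (v \<omega>))\<^sup>2) * (t - s)"
  proof (cases "s = t")
    case False
    then have "s < t" using st by auto
    have "(\<lambda>\<omega>. (norm (v \<omega>))\<^sup>2) \<in> borel_measurable (F s)" using v(1) by measurable
    then show ?thesis
      using brownian_motion_independent[OF W st(1) \<open>s < t\<close> st(3), of "\<lambda>\<omega>. (norm (v \<omega>))\<^sup>2" "\<lambda>x. x\<^sup>2"] v(2) mom
      by (auto simp: sq_integrable_def)
  qed simp
  then have *: "integrable M (\<lambda>\<omega>. (norm (?D \<omega> *\<^sub>R v \<omega>))\<^sup>2)"
      "expectation (\<lambda>\<omega>. (norm (?D \<omega> *\<^sub>R v \<omega>))\<^sup>2) = (t - s) * (l2norm M v)\<^sup>2"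
    by (auto simp: power_mult_distrib l2norm_power2 mult.commute)
  show "sq_integrable M (\<lambda>\<omega>. ?D \<omega> *\<^sub>R v \<omega>)"
    using *(1) v(2) unfolding sq_integrable_def by auto
  show "(l2norm M (\<lambda>\<omega>. ?D \<omega> *\<^sub>R v \<omega>))\<^sup>2 = (t - s) * (l2norm M v)\<^sup>2"
    using *(2) by (simp add: l2norm_power2)
qed

lemma brownian_motion_l2_martingale:
  assumes W: "brownian_motion M F T W"
  shows "l2_martingale M F T W"
  unfolding l2_martingale_def
proof (intro conjI allI impI ballI)
  show A: "adapted_process F T W" using W by (simp add: brownian_motion_def)
  show "sq_integrable M (W t)" if t: "t \<in> {0..T}" for t
  proof (rule sq_integrable_cong_AE)
    show "sq_integrable M (\<lambda>\<omega>. W t \<omega> - W 0 \<omega>)"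
      using t by (intro brownian_motion_increment[OF W]) auto
    show "AE \<omega> in M. W t \<omega> - W 0 \<omega> = W t \<omega>"
      using W by (auto simp: brownian_motion_def elim: eventually_mono)
    show "W t \<in> borel_measurable M"
      using A t measurable_F unfolding adapted_process_def by blast
  qed
  show "orth M (F s) (\<lambda>\<omega>. W t \<omega> - W s \<omega>)" if "0 \<le> s \<and> s \<le> t \<and> t \<le> T" for s t
    using that by (intro brownian_motion_increment[OF W]) auto
qed

text \<open>It suffices to treat one summand, a bounded \<open>\<xi>\<close> times an increment of
  \<open>X\<close> cut off at \<open>t\<close>. Its change between \<open>s\<close> and
  \<open>t\<close> is \<open>\<xi>\<close> times an increment of \<open>X\<close> that either
  vanishes or starts no earlier than the time at which \<open>\<xi>\<close> is known.\<close>

lemma step_integral_l2_martingale: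
  assumes X: "l2_martingale M F T X" and S: "simple_predictable M F T S"
  shows "l2_martingale M F T (step_integral S X :: real \<Rightarrow> 'a \<Rightarrow> real)"
proof -
  let ?I = "\<lambda>i t \<omega>. (X (min (step_time S (Suc i)) t) \<omega> - X (min (step_time S i) t) \<omega>) * step_coeff S i \<omega>"
  have eq: "step_integral S X = (\<lambda>t \<omega>. \<Sum>i<step_num S. ?I i t \<omega>)"
    by (simp add: fun_eq_iff step_integral_def)
  obtain C where C: "\<And>i \<omega>. i < step_num S \<Longrightarrow> \<omega> \<in> space M \<Longrightarrow> \<bar>step_coeff S i \<omega>\<bar> \<le> C"
    using S unfolding simple_predictable_def real_norm_def by blast
  have XF: "X t \<in> borel_measurable (F t)" "sq_integrable M (X t)" if "0 \<le> t" "t \<le> T" for t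
    using X that unfolding l2_martingale_def adapted_process_def by auto
  have "l2_martingale M F T (?I i)" if i: "i < step_num S" for i
  proof -
    let ?a = "step_time S i" and ?b = "step_time S (Suc i)" and ?\<xi> = "step_coeff S i"
    have ab: "0 \<le> ?a" "?a \<le> ?b" "?b \<le> T" and \<xi>F: "?\<xi> \<in> borel_measurable (F ?a)"
      using S i unfolding simple_predictable_def by (auto simp: image_subset_iff mono_on_def)
    have [measurable]: "?\<xi> \<in> borel_measurable M" using measurable_F[OF \<xi>F] ab by auto
    show ?thesis
      unfolding l2_martingale_def
    proof (intro conjI allI impI ballI)
      show "adapted_process F T (?I i)" unfolding adapted_process_def
      proof
        fix t assume t: "t \<in> {0..T}"
        show "?I i t \<in> borel_measurable (F t)"
        proof (cases "?a \<le> t")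
          case True
          have "X (min ?b t) \<in> borel_measurable (F t)" "X (min ?a t) \<in> borel_measurable (F t)"
            using XF(1)[of "min ?b t"] XF(1)[of "min ?a t"] measurable_F_mono[of _ "min ?b t" t]
              measurable_F_mono[of _ "min ?a t" t] t ab by (auto simp: min_le_iff_disj)
          then show ?thesis using measurable_F_mono[OF \<xi>F True] by simp
        next
          case False
          \<comment> \<open>Before time \<open>?a\<close> the coefficient is not yet measurable, but
            both arguments of \<open>X\<close> equal \<open>t\<close> and the summand is 0.\<close>
          then have "?I i t = (\<lambda>_. 0)" using ab by (simp add: fun_eq_iff)
          then show ?thesis by simp
        qed
      qed
      show "sq_integrable M (?I i t)" if "t \<in> {0..T}" for t
      proof (rule sq_integrable_dominated)
        show sq: "sq_integrable M (\<lambda>\<omega>. X (min ?b t) \<omega> - X (min ?a t) \<omega>)"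
          using ab that by (intro sq_integrable_diff XF) auto
        then show "?I i t \<in> borel_measurable M" by (auto simp: sq_integrable_def)
        show "AE \<omega> in M. norm (?I i t \<omega>) \<le> C * norm (X (min ?b t) \<omega> - X (min ?a t) \<omega>)"
          using C[OF i] by (intro AE_I2) (auto simp: abs_mult mult.commute[of C] intro!: mult_left_mono)
      qed
      fix s t assume st: "0 \<le> s \<and> s \<le> t \<and> t \<le> T"
      \<comment> \<open>End points of the part of the interval from \<open>?a\<close> to
        \<open>?b\<close> that lies between \<open>s\<close> and \<open>t\<close>; they coincide
        when that part is empty, in particular when \<open>t < ?a\<close>.\<close>
      let ?a' = "max s (min ?a t)" and ?b' = "max s (min ?b t)"
      have diff: "(\<lambda>\<omega>. ?I i t \<omega> - ?I i s \<omega>) = (\<lambda>\<omega>. ?\<xi> \<omega> * (X ?b' \<omega> - X ?a' \<omega>))"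
      proof -
        have "X (min u t) \<omega> - X (min u s) \<omega> = X (max s (min u t)) \<omega> - X s \<omega>" for u \<omega>
          using st by (auto simp: min_def max_def)
        from this[of ?a] this[of ?b] show ?thesis
          by (simp add: fun_eq_iff algebra_simps) (smt (verit) distrib_left)
      qed
      show "orth M (F s) (\<lambda>\<omega>. ?I i t \<omega> - ?I i s \<omega>)"
      proof (cases "?a \<le> t")
        case True
        then have a': "?a \<le> ?a'" "s \<le> ?a'" "?a' \<le> ?b'" "0 \<le> ?a'" "?b' \<le> T" using ab st by auto
        have "orth M (F ?a') (\<lambda>\<omega>. X ?b' \<omega> - X ?a' \<omega>)"
          using X a' unfolding l2_martingale_def by blast
        then have "orth M (F ?a') (\<lambda>\<omega>. ?\<xi> \<omega> * (X ?b' \<omega> - X ?a' \<omega>))"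
          using a' C[OF i] by (intro orth_mult F_subalgebra measurable_F_mono[OF \<xi>F]) auto
        then show ?thesis unfolding diff using F_mono a' by (blast intro: orth_mono)
      next
        case False
        then have "?a' = ?b'" using ab st by auto
        then show ?thesis unfolding diff by simp
      qed
    qed
  qed
  then show ?thesis unfolding eq by (intro l2_martingale_sum) auto
qed

text \<open>Square integrability and orthogonality of the increments both pass from the elementary
  integrals to their \<open>L2\<close> limit at each fixed time.\<close>

lemma has_ito_integral_l2_martingale:
  assumes W: "brownian_motion M F T W" and I: "has_ito_integral M F T W H I"
  shows "l2_martingale M F T I"
proof -
  obtain S :: "nat \<Rightarrow> ('a, real) step_process" where S: "\<And>n. simple_predictable M F T (S n)"
    and lim: "\<And>t. t \<in> {0..T} \<Longrightarrow> (\<lambda>n. \<integral>\<^sup>+\<omega>. ennreal ((step_integral (S n) W t \<omega> - I t \<omega>)\<^sup>2) \<partial>M) \<longlonglongrightarrow> 0"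
    using I unfolding has_ito_integral_def by blast
  have adI: "adapted_process F T I" using I by (simp add: has_ito_integral_def)
  have mart: "l2_martingale M F T (step_integral (S n) W)" for n
    by (intro step_integral_l2_martingale S brownian_motion_l2_martingale W)
  have IM [measurable]: "I t \<in> borel_measurable M" if "t \<in> {0..T}" for t
    using adI that measurable_F unfolding adapted_process_def by blast
  have conv: "sq_integrable M (I t) \<and> (\<lambda>n. l2norm M (\<lambda>\<omega>. step_integral (S n) W t \<omega> - I t \<omega>)) \<longlonglongrightarrow> 0" if t: "t \<in> {0..T}" for t
  proof -
    let ?E = "\<lambda>n. \<integral>\<^sup>+\<omega>. ennreal ((norm (step_integral (S n) W t \<omega> - I t \<omega>))\<^sup>2) \<partial>M"
    have lim': "?E \<longlonglongrightarrow> 0" using lim[OF t] by simp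
    have J: "sq_integrable M (step_integral (S n) W t)" for n
      using mart[of n] t by (simp add: l2_martingale_def)
    have sqd: "sq_integrable M (\<lambda>\<omega>. step_integral (S n) W t \<omega> - I t \<omega>)" if "?E n < 1" for n
    proof (rule sq_integrableI_nn_integral(1)[where c=1])
      show "(\<lambda>\<omega>. step_integral (S n) W t \<omega> - I t \<omega>) \<in> borel_measurable M"
        using IM[OF t] J[of n] by (auto simp: sq_integrable_def)
    qed (use that in auto)
    \<comment> \<open>The limit makes the extended integral finite for some \<open>n\<close>. One
      such \<open>n\<close> already shows that \<open>I t\<close>, a difference of two
      square-integrable functions, is square integrable.\<close>
    have ev: "\<forall>\<^sub>F n in sequentially. ?E n < 1"
      using order_tendstoD(2)[OF lim', of 1] by simp
    then obtain n where "?E n < 1" by (auto simp: eventually_sequentially)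
    then have sqI: "sq_integrable M (I t)"
      using sq_integrable_diff[OF J sqd, of n n] by simp
    have "?E n = ennreal ((l2norm M (\<lambda>\<omega>. step_integral (S n) W t \<omega> - I t \<omega>))\<^sup>2)" for n
      by (intro nn_integral_eq_l2norm sq_integrable_diff J sqI)
    then have "(\<lambda>n. ennreal ((l2norm M (\<lambda>\<omega>. step_integral (S n) W t \<omega> - I t \<omega>))\<^sup>2)) \<longlonglongrightarrow> ennreal 0"
      using lim' by simp
    then have "(\<lambda>n. (l2norm M (\<lambda>\<omega>. step_integral (S n) W t \<omega> - I t \<omega>))\<^sup>2) \<longlonglongrightarrow> 0"
      by (subst (asm) tendsto_ennreal_iff) auto
    then have "(\<lambda>n. sqrt ((l2norm M (\<lambda>\<omega>. step_integral (S n) W t \<omega> - I t \<omega>))\<^sup>2)) \<longlonglongrightarrow> sqrt 0"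
      by (rule tendsto_real_sqrt)
    then show ?thesis using sqI by simp
  qed
  show ?thesis unfolding l2_martingale_def
  proof (intro conjI allI impI ballI adI)
    show "sq_integrable M (I t)" if "t \<in> {0..T}" for t using conv[OF that] by simp
    fix s t assume st: "0 \<le> s \<and> s \<le> t \<and> t \<le> T"
    have s: "s \<in> {0..T}" and t: "t \<in> {0..T}" using st by auto
    let ?J = "\<lambda>n. step_integral (S n) W"
    have J: "sq_integrable M (?J n u)" if "u \<in> {0..T}" for n u
      using mart[of n] that by (simp add: l2_martingale_def)
    show "orth M (F s) (\<lambda>\<omega>. I t \<omega> - I s \<omega>)"
    proof (rule orth_l2_limit[where D="\<lambda>n \<omega>. ?J n t \<omega> - ?J n s \<omega>"])
      show "orth M (F s) (\<lambda>\<omega>. ?J n t \<omega> - ?J n s \<omega>)" for n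
        using mart[of n] st unfolding l2_martingale_def by blast
      show "sq_integrable M (\<lambda>\<omega>. ?J n t \<omega> - ?J n s \<omega>)" for n using J s t by (intro sq_integrable_diff)
      show "sq_integrable M (\<lambda>\<omega>. I t \<omega> - I s \<omega>)" using conv s t by (intro sq_integrable_diff) auto
      show "subalgebra M (F s)" using s by (rule F_subalgebra)
      have lim2: "(\<lambda>n. l2norm M (\<lambda>\<omega>. ?J n t \<omega> - I t \<omega>) + l2norm M (\<lambda>\<omega>. ?J n s \<omega> - I s \<omega>)) \<longlonglongrightarrow> 0"
        using tendsto_add[OF conjunct2[OF conv[OF t]] conjunct2[OF conv[OF s]]] by simp
      have le2: "l2norm M (\<lambda>\<omega>. (?J n t \<omega> - ?J n s \<omega>) - (I t \<omega> - I s \<omega>))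
          \<le> l2norm M (\<lambda>\<omega>. ?J n t \<omega> - I t \<omega>) + l2norm M (\<lambda>\<omega>. ?J n s \<omega> - I s \<omega>)" for n
      proof -
        have "l2norm M (\<lambda>\<omega>. (?J n t \<omega> - I t \<omega>) + (I s \<omega> - ?J n s \<omega>))
          \<le> l2norm M (\<lambda>\<omega>. ?J n t \<omega> - I t \<omega>) + l2norm M (\<lambda>\<omega>. I s \<omega> - ?J n s \<omega>)"
          using J s t conv by (intro l2norm_add_le sq_integrable_diff) auto
        then show ?thesis by (simp add: l2norm_minus_commute[of M "I s"] algebra_simps)
      qed
      show "(\<lambda>n. l2norm M (\<lambda>\<omega>. (?J n t \<omega> - ?J n s \<omega>) - (I t \<omega> - I s \<omega>))) \<longlonglongrightarrow> 0"
        by (rule tendsto_sandwich[OF _ _ tendsto_const lim2]) (use le2 in auto)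
    qed
  qed
qed

end

section \<open>Products of increments of independent Brownian motions\<close>

lemma sum_double_split:
  fixes f :: "nat \<Rightarrow> nat \<Rightarrow> 'b::comm_monoid_add"
  shows "(\<Sum>q<n. \<Sum>r<n. f q r) = (\<Sum>q<n. f q q) + ((\<Sum>r<n. \<Sum>q<r. f q r) + (\<Sum>q<n. \<Sum>r<q. f q r))"
proof (induction n)
  case (Suc n)
  have "(\<Sum>q<Suc n. \<Sum>r<Suc n. f q r) = (\<Sum>q<n. \<Sum>r<n. f q r) + (\<Sum>q<n. f q n) + ((\<Sum>r<n. f n r) + f n n)"
    by (simp add: sum.distrib ac_simps)
  then show ?case unfolding Suc.IH by (simp add: ac_simps)
qed simp

context usual_filtered_prob_space
begin

text \<open>Each \<open>Z i\<close> is a measurable functional of the whole path of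
  \<open>W i\<close>, so independence of the paths applies. Two intervals are allowed because the
  mean square of a sum of products involves increments over different cells.\<close>

lemma independent_brownian_motions_increments:
  assumes W: "independent_brownian_motions M F T L W" and lm: "l \<in> L" "m \<in> L" "l \<noteq> m"
    and pts: "a \<in> {0..T}" "b \<in> {0..T}" "a' \<in> {0..T}" "b' \<in> {0..T}"
  defines "Z \<equiv> \<lambda>i \<omega>. (W i b \<omega> - W i a \<omega>) * (W i b' \<omega> - W i a' \<omega>)"
  shows "integrable M (\<lambda>\<omega>. Z l \<omega> * Z m \<omega>)"
    and "expectation (\<lambda>\<omega>. Z l \<omega> * Z m \<omega>) = expectation (Z l) * expectation (Z m)"
proof -
  let ?Y = "\<lambda>path :: real \<Rightarrow> real. (path b - path a) * (path b' - path a')"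
  have "indep_vars (\<lambda>_. PiM {0..T} (\<lambda>_. borel)) (\<lambda>i \<omega>. \<lambda>t\<in>{0..T}. W i t \<omega>) {l, m}"
    using W lm unfolding independent_brownian_motions_def by (blast intro: indep_vars_subset)
  then have "indep_vars (\<lambda>_. borel) (\<lambda>i \<omega>. ?Y (\<lambda>t\<in>{0..T}. W i t \<omega>)) {l, m}"
    by (rule indep_vars_compose2) (use pts in measurable)
  moreover have "(\<lambda>i \<omega>. ?Y (\<lambda>t\<in>{0..T}. W i t \<omega>)) = Z"
    using pts by (simp add: Z_def fun_eq_iff)
  ultimately have ind: "indep_vars (\<lambda>_. borel) Z {l, m}" by simp
  have int: "integrable M (Z i)" if "i \<in> {l, m}" for i
  proof -
    have "brownian_motion M F T (W i)" using W lm that by (auto simp: independent_brownian_motions_def)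
    then have "l2_martingale M F T (W i)" by (rule brownian_motion_l2_martingale)
    then show ?thesis unfolding Z_def l2_martingale_def
      using pts by (intro sq_integrable_mult_integrable sq_integrable_diff) auto
  qed
  show "integrable M (\<lambda>\<omega>. Z l \<omega> * Z m \<omega>)"
    using indep_vars_integrable[OF _ ind int] lm by simp
  show "expectation (\<lambda>\<omega>. Z l \<omega> * Z m \<omega>) = expectation (Z l) * expectation (Z m)"
    using indep_vars_lebesgue_integral[OF _ ind int] lm by simp
qed

text \<open>Both motions are adapted to \<open>F\<close> and mutually independent, but joint independence of their
  increments from \<open>F s\<close> is not assumed. Along a subdivision of \<open>[s, t]\<close> the off-diagonal part of the
  product of the increments is orthogonal to \<open>F s\<close>, and the diagonal part tends to 0 in mean square.\<close>

lemma independent_brownian_motions_orth: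
  assumes W: "independent_brownian_motions M F T L W" and lm: "l \<in> L" "m \<in> L" "l \<noteq> m"
    and st: "0 \<le> s" "s \<le> t" "t \<le> T"
  shows "sq_integrable M (\<lambda>\<omega>. (W l t \<omega> - W l s \<omega>) * (W m t \<omega> - W m s \<omega>))"
    and "orth M (F s) (\<lambda>\<omega>. (W l t \<omega> - W l s \<omega>) * (W m t \<omega> - W m s \<omega>))"
proof -
  have bm: "brownian_motion M F T (W l)" "brownian_motion M F T (W m)"
    using W lm by (auto simp: independent_brownian_motions_def)
  have mart: "l2_martingale M F T (W l)" "l2_martingale M F T (W m)"
    using bm by (auto intro: brownian_motion_l2_martingale)
  have sq2: "sq_integrable M (\<lambda>\<omega>. (W l v \<omega> - W l u \<omega>) * (W m v \<omega> - W m u \<omega>))" if "u \<in> {0..T}" "v \<in> {0..T}" for u v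
  proof -
    have [measurable]: "W l u \<in> borel_measurable M" "W l v \<in> borel_measurable M"
      "W m u \<in> borel_measurable M" "W m v \<in> borel_measurable M"
      using mart that unfolding l2_martingale_def sq_integrable_def by auto
    show ?thesis
      using independent_brownian_motions_increments(1)[OF W lm that(1,2) that(1,2)]
      by (simp add: sq_integrable_def power2_eq_square ac_simps)
  qed
  then show "sq_integrable M (\<lambda>\<omega>. (W l t \<omega> - W l s \<omega>) * (W m t \<omega> - W m s \<omega>))" using st by auto
  define x where "x n q = s + (t - s) * (real q / real (Suc n))" for n q :: nat
  have x0: "x n 0 = s" and xn: "x n (Suc n) = t" for n
    by (simp_all add: x_def del: of_nat_Suc)
  have xd: "x n (Suc q) - x n q = (t - s) / real (Suc n)" for n q
  proof -
    have "x n (Suc q) - x n q = (t - s) * (real (Suc q) / real (Suc n) - real q / real (Suc n))"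
      unfolding x_def by (simp only: right_diff_distrib)
    then show ?thesis by (simp add: diff_divide_distrib[symmetric])
  qed
  have xmono: "x n q \<le> x n r" if "q \<le> r" for n q r
    using that st unfolding x_def by (auto intro!: mult_left_mono divide_right_mono)
  have xin: "x n q \<in> {0..T}" "s \<le> x n q" if "q \<le> Suc n" for n q
    using xmono[of 0 q n] xmono[of q "Suc n" n] that st x0 xn by auto
  define Z where "Z n i q = (\<lambda>\<omega>. W i (x n (Suc q)) \<omega> - W i (x n q) \<omega>)" for n i q
  have sum: "(\<Sum>q<Suc n. Z n i q \<omega>) = W i t \<omega> - W i s \<omega>" for n i \<omega>
    using sum_lessThan_telescope[of "\<lambda>q. W i (x n q) \<omega>" "Suc n"] unfolding Z_def x0 xn .
  have Zsq: "sq_integrable M (Z n i q)" and Zorth: "orth M (F (x n q)) (Z n i q)"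
    and Zmeas: "Z n i q \<in> borel_measurable (F (x n (Suc q)))" if "q < Suc n" "i \<in> {l, m}" for n i q
  proof -
    have m: "l2_martingale M F T (W i)" using mart that by auto
    have x: "x n q \<in> {0..T}" "x n (Suc q) \<in> {0..T}" "x n q \<le> x n (Suc q)"
      using xin(1)[of q n] xin(1)[of "Suc q" n] xmono[of q "Suc q" n] that by simp_all
    show "sq_integrable M (Z n i q)" "orth M (F (x n q)) (Z n i q)"
      using m x unfolding Z_def l2_martingale_def by (auto intro!: sq_integrable_diff)
    have W: "W i (x n q) \<in> borel_measurable (F (x n q))" "W i (x n (Suc q)) \<in> borel_measurable (F (x n (Suc q)))"
      using m x by (auto simp: l2_martingale_def adapted_process_def)
    show "Z n i q \<in> borel_measurable (F (x n (Suc q)))"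
      unfolding Z_def by (intro borel_measurable_diff W(2) measurable_F_mono[OF W(1) x(3)])
  qed
  let ?E = "\<lambda>\<omega>. (W l t \<omega> - W l s \<omega>) * (W m t \<omega> - W m s \<omega>)"
  let ?R = "\<lambda>n \<omega>. \<Sum>q<Suc n. Z n l q \<omega> * Z n m q \<omega>"
  let ?D = "\<lambda>n \<omega>. (\<Sum>r<Suc n. (\<Sum>q<r. Z n l q \<omega>) * Z n m r \<omega>) + (\<Sum>r<Suc n. (\<Sum>q<r. Z n m q \<omega>) * Z n l r \<omega>)"
  have split: "?E \<omega> = ?R n \<omega> + ?D n \<omega>" for n \<omega>
  proof -
    have "?E \<omega> = (\<Sum>q<Suc n. \<Sum>r<Suc n. Z n l q \<omega> * Z n m r \<omega>)"
      unfolding sum[of n, symmetric] sum_product ..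
    then show ?thesis
      unfolding sum_double_split by (simp only: sum_distrib_left sum_distrib_right mult.commute)
  qed
  have Rsq: "sq_integrable M (?R n)" for n
    unfolding Z_def by (intro sq_integrable_sum sq2 xin) auto
  have off: "orth M (F s) (\<lambda>\<omega>. (\<Sum>q<r. Z n i q \<omega>) * Z n j r \<omega>)" if "r < Suc n" "i \<in> {l, m}" "j \<in> {l, m}" for n r i j
  proof (rule orth_mono)
    have xr: "x n r \<in> {0..T}" using that by (intro xin) auto
    have "(\<lambda>\<omega>. \<Sum>q<r. Z n i q \<omega>) \<in> borel_measurable (F (x n r))"
    proof (intro borel_measurable_sum)
      fix q assume "q \<in> {..<r}"
      then show "Z n i q \<in> borel_measurable (F (x n r))"
        using Zmeas[of q n i] that xmono[of "Suc q" r n] by (auto intro: measurable_F_mono)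
    qed
    moreover have "integrable M (\<lambda>\<omega>. (\<Sum>q<r. Z n i q \<omega>) * Z n j r \<omega>)"
      using that by (intro sq_integrable_mult_integrable sq_integrable_sum Zsq) auto
    ultimately show "orth M (F (x n r)) (\<lambda>\<omega>. (\<Sum>q<r. Z n i q \<omega>) * Z n j r \<omega>)"
      using that xr by (intro orth_mult_unbounded Zorth F_subalgebra)
    show "subalgebra (F (x n r)) (F s)" using that by (intro F_mono xin) auto
  qed
  \<comment> \<open>The mean square is a double sum of mixed fourth moments. Independence of the
    paths factors each into two covariances, which vanish unless the cells agree. The
    \<open>Suc n\<close> remaining terms equal \<open>((t - s) / Suc n)\<^sup>2\<close>.\<close>
  have Rnorm: "(l2norm M (?R n))\<^sup>2 = (t - s)\<^sup>2 / real (Suc n)" for n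
  proof -
    have ZZ: "expectation (\<lambda>\<omega>. Z n i q \<omega> * Z n i r \<omega>) = (if q = r then (t - s) / real (Suc n) else 0)"
      if "q < Suc n" "r < Suc n" "i \<in> {l, m}" for q r i
    proof -
      have 0: "expectation (\<lambda>\<omega>. Z n i q \<omega> * Z n i r \<omega>) = 0" if "q < r" "r < Suc n" for q r
      proof (rule orth_unbounded)
        show "orth M (F (x n r)) (Z n i r)" using that \<open>i \<in> {l, m}\<close> by (intro Zorth)
        show "subalgebra M (F (x n r))" using that by (intro F_subalgebra xin) auto
        show "Z n i q \<in> borel_measurable (F (x n r))"
          using Zmeas[of q n i] that \<open>i \<in> {l, m}\<close> xmono[of "Suc q" r n] by (auto intro: measurable_F_mono)
        show "integrable M (\<lambda>\<omega>. Z n i q \<omega> * Z n i r \<omega>)"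
          using that \<open>i \<in> {l, m}\<close> by (intro sq_integrable_mult_integrable Zsq) auto
      qed
      consider "q = r" | "q < r" | "r < q" by linarith
      then show ?thesis
      proof cases
        case 1
        have "brownian_motion M F T (W i)" using bm that by auto
        from brownian_motion_moments(3)[OF this, of "x n q" "x n (Suc q)"] show ?thesis
          using 1 that xin[of q n] xin[of "Suc q" n] xmono[of q "Suc q" n] xd[of n q]
          unfolding Z_def by (simp add: power2_eq_square)
      next
        case 2 then show ?thesis using 0 that by auto
      next
        case 3 then show ?thesis using 0[of r q] that by (auto simp: mult.commute)
      qed
    qed
    have pint: "integrable M (\<lambda>\<omega>. (Z n l q \<omega> * Z n l r \<omega>) * (Z n m q \<omega> * Z n m r \<omega>))"
      and pexp: "expectation (\<lambda>\<omega>. (Z n l q \<omega> * Z n l r \<omega>) * (Z n m q \<omega> * Z n m r \<omega>)) =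
        (if q = r then ((t - s) / real (Suc n))\<^sup>2 else 0)" if "q < Suc n" "r < Suc n" for q r
    proof -
      note * = independent_brownian_motions_increments[OF W lm, of "x n q" "x n (Suc q)" "x n r" "x n (Suc r)"]
      show "integrable M (\<lambda>\<omega>. (Z n l q \<omega> * Z n l r \<omega>) * (Z n m q \<omega> * Z n m r \<omega>))"
        using that unfolding Z_def by (intro *(1) xin) auto
      have "expectation (\<lambda>\<omega>. (Z n l q \<omega> * Z n l r \<omega>) * (Z n m q \<omega> * Z n m r \<omega>)) =
          expectation (\<lambda>\<omega>. Z n l q \<omega> * Z n l r \<omega>) * expectation (\<lambda>\<omega>. Z n m q \<omega> * Z n m r \<omega>)"
        using that unfolding Z_def by (intro *(2) xin) auto
      then show "expectation (\<lambda>\<omega>. (Z n l q \<omega> * Z n l r \<omega>) * (Z n m q \<omega> * Z n m r \<omega>)) =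
        (if q = r then ((t - s) / real (Suc n))\<^sup>2 else 0)"
        using that by (simp add: ZZ power2_eq_square)
    qed
    have "(l2norm M (?R n))\<^sup>2 = expectation (\<lambda>\<omega>. \<Sum>q<Suc n. \<Sum>r<Suc n. (Z n l q \<omega> * Z n l r \<omega>) * (Z n m q \<omega> * Z n m r \<omega>))"
      unfolding l2norm_power2
      by (intro Bochner_Integration.integral_cong refl)
        (simp only: real_norm_def power2_abs, simp only: power2_eq_square sum_product ac_simps)
    also have "\<dots> = (\<Sum>q<Suc n. \<Sum>r<Suc n. expectation (\<lambda>\<omega>. (Z n l q \<omega> * Z n l r \<omega>) * (Z n m q \<omega> * Z n m r \<omega>)))"
      by (subst Bochner_Integration.integral_sum, (intro Bochner_Integration.integrable_sum pint; simp),
          intro sum.cong refl Bochner_Integration.integral_sum pint; simp)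
    also have "\<dots> = (\<Sum>q<Suc n. \<Sum>r<Suc n. if q = r then ((t - s) / real (Suc n))\<^sup>2 else 0)"
      by (intro sum.cong refl pexp) auto
    also have "\<dots> = (\<Sum>q<Suc n. ((t - s) / real (Suc n))\<^sup>2)"
      by (intro sum.cong refl) simp
    also have "\<dots> = (t - s)\<^sup>2 / real (Suc n)"
      by (simp add: power_divide power2_eq_square[of "1 + real n"])
    finally show ?thesis .
  qed
  show "orth M (F s) ?E"
  proof (rule orth_l2_limit[where D="?D"])
    show "orth M (F s) (?D n)" for n
      using st by (intro orth_add orth_sum off F_subalgebra) auto
    show E: "sq_integrable M ?E" by (intro sq2) (use st in auto)
    have D_eq: "?D n = (\<lambda>\<omega>. ?E \<omega> - ?R n \<omega>)" for n
      using split[of _ n] by (simp add: fun_eq_iff)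
    show "sq_integrable M (?D n)" for n
      unfolding D_eq by (intro sq_integrable_diff E Rsq)
    show "subalgebra M (F s)" using st by (intro F_subalgebra) auto
    have "l2norm M (\<lambda>\<omega>. ?D n \<omega> - ?E \<omega>) = sqrt ((t - s)\<^sup>2 / real (Suc n))" for n
    proof -
      have "l2norm M (\<lambda>\<omega>. ?D n \<omega> - ?E \<omega>) = l2norm M (?R n)"
      proof -
        have "e = r + d \<Longrightarrow> d - e = - r" for d e r :: real by simp
        then have "?D n \<omega> - ?E \<omega> = - ?R n \<omega>" for \<omega> using split[of \<omega> n] by blast
        then show ?thesis unfolding l2norm_def by (simp only: norm_minus_cancel)
      qed
      also have "\<dots> = sqrt ((l2norm M (?R n))\<^sup>2)" by simp
      finally show ?thesis unfolding Rnorm .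
    qed
    moreover have "(\<lambda>n. sqrt ((t - s)\<^sup>2 / real (Suc n))) \<longlonglongrightarrow> sqrt 0"
      by (intro tendsto_real_sqrt LIMSEQ_Suc[OF lim_const_over_n])
    ultimately show "(\<lambda>n. l2norm M (\<lambda>\<omega>. ?D n \<omega> - ?E \<omega>)) \<longlonglongrightarrow> 0" by simp
  qed
qed

end

section \<open>Drift terms\<close>

text \<open>Lebesgue measure on the horizon alone is finite, and so is its product with
  \<open>M\<close>. The processes \<open>b\<close> and \<open>\<sigma>\<close> are treated as
  square-integrable functions on this product.\<close>

abbreviation time_measure :: "real \<Rightarrow> real measure" where
  "time_measure T \<equiv> restrict_space lborel {0..T}"

lemma sets_time_measure: "sets (time_measure T \<Otimes>\<^sub>M M) = sets (restrict_space borel {0..T} \<Otimes>\<^sub>M M)"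
  by (intro sets_pair_measure_cong) (auto simp: sets_restrict_space)

lemma measurable_process_iff:
  "measurable_process M T X \<longleftrightarrow> (\<lambda>(t, \<omega>). X t \<omega>) \<in> borel_measurable (time_measure T \<Otimes>\<^sub>M M)"
  unfolding measurable_process_def by (simp add: measurable_cong_sets[OF sets_time_measure refl])

lemma finite_measure_time_measure: "finite_measure (time_measure T)"
proof
  have "emeasure lborel {0..T} \<noteq> \<infinity>" by (cases "0 \<le> T") auto
  then show "emeasure (time_measure T) (space (time_measure T)) \<noteq> \<infinity>"
    by (simp add: space_restrict_space emeasure_restrict_space)
qed

lemma integral_time_measure:
  fixes f :: "real \<Rightarrow> 'b::euclidean_space"
  assumes "t \<in> {0..T}"
  shows "(LINT s:{0..t}|lborel. f s) = (\<integral>s. indicator {0..t} s *\<^sub>R f s \<partial>time_measure T)"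
proof -
  have *: "(indicator {0..T} s :: real) *\<^sub>R (indicator {0..t} s :: real) *\<^sub>R f s = indicator {0..t} s *\<^sub>R f s" for s
    using assms by (auto simp: indicator_def)
  have "(\<integral>s. indicator {0..t} s *\<^sub>R f s \<partial>time_measure T)
      = (\<integral>s. (indicator {0..T} s :: real) *\<^sub>R (indicator {0..t} s :: real) *\<^sub>R f s \<partial>lborel)"
    by (rule integral_restrict_space) auto
  then show ?thesis unfolding set_lebesgue_integral_def * by (rule sym)
qed

lemma integral_time_measure_T:
  fixes f :: "real \<Rightarrow> 'b::euclidean_space"
  shows "(LINT s:{0..T}|lborel. f s) = (\<integral>s. f s \<partial>time_measure T)"
  by (simp add: set_lebesgue_integral_def integral_restrict_space)

text \<open>Both bounds have on the right an increment of a function of the upper limit, so that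
  they telescope over a partition. The second is the Cauchy-Schwarz inequality for \<open>f\<close>
  against the indicator of \<open>]u, v]\<close>, whose squared norm is
  \<open>v - u\<close>.\<close>

lemma drift_increments:
  fixes f :: "real \<Rightarrow> real"
  assumes f: "set_integrable lborel {0..T} f" and f2: "set_integrable lborel {0..T} (\<lambda>s. (f s)\<^sup>2)"
    and uv: "0 \<le> u" "u \<le> v" "v \<le> T"
  shows "\<bar>(LINT s:{0..v}|lborel. f s) - (LINT s:{0..u}|lborel. f s)\<bar>
      \<le> (LINT s:{0..v}|lborel. \<bar>f s\<bar>) - (LINT s:{0..u}|lborel. \<bar>f s\<bar>)"
    and "((LINT s:{0..v}|lborel. f s) - (LINT s:{0..u}|lborel. f s))\<^sup>2
      \<le> (v - u) * ((LINT s:{0..v}|lborel. (f s)\<^sup>2) - (LINT s:{0..u}|lborel. (f s)\<^sup>2))"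
proof -
  have diff: "(LINT s:{0..v}|lborel. g s) - (LINT s:{0..u}|lborel. g s) = (LINT s:{u<..v}|lborel. g s)"
    if g: "set_integrable lborel {0..T} g" for g :: "real \<Rightarrow> real"
  proof -
    have "{0..v} = {0..u} \<union> {u<..v}" using uv by auto
    moreover have "(LINT s:{0..u} \<union> {u<..v}|lborel. g s) = (LINT s:{0..u}|lborel. g s) + (LINT s:{u<..v}|lborel. g s)"
      by (rule set_integral_Un) (use uv in \<open>auto intro!: set_integrable_subset[OF g]\<close>)
    ultimately show ?thesis by simp
  qed
  have fa: "set_integrable lborel {0..T} (\<lambda>s. \<bar>f s\<bar>)" using f by (rule set_integrable_abs)
  have sub: "set_integrable lborel {u<..v} g" if "set_integrable lborel {0..T} g" for g :: "real \<Rightarrow> real"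
    by (rule set_integrable_subset[OF that]) (use uv in auto)
  show "\<bar>(LINT s:{0..v}|lborel. f s) - (LINT s:{0..u}|lborel. f s)\<bar>
      \<le> (LINT s:{0..v}|lborel. \<bar>f s\<bar>) - (LINT s:{0..u}|lborel. \<bar>f s\<bar>)"
    unfolding diff[OF f] diff[OF fa] using set_integral_norm_bound[OF sub[OF f]] by simp
  let ?g = "\<lambda>s. indicator {u<..v} s * f s" and ?h = "\<lambda>s. indicator {u<..v} s :: real"
  have g: "sq_integrable lborel ?g"
  proof -
    have "(norm (?g s))\<^sup>2 = indicator {u<..v} s * (f s)\<^sup>2" for s by (auto simp: indicator_def)
    then show ?thesis
      using sub[OF f] sub[OF f2] unfolding set_integrable_def sq_integrable_def by auto
  qed
  have h: "sq_integrable lborel ?h"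
  proof -
    have "(norm (?h s))\<^sup>2 = indicator {u<..v} s" for s by (auto simp: indicator_def)
    moreover have "integrable lborel (indicator {u<..v} :: real \<Rightarrow> real)"
      using uv by (intro integrable_real_indicator) auto
    ultimately show ?thesis unfolding sq_integrable_def by auto
  qed
  have "\<bar>LINT s:{u<..v}|lborel. f s\<bar> \<le> (\<integral>s. norm (?g s) * norm (?h s) \<partial>lborel)"
    unfolding set_lebesgue_integral_def
    by (rule order_trans[OF integral_abs_bound], rule integral_mono_AE', rule sq_integrable_norm_mult[OF g h])
      (auto simp: indicator_def)
  also have "\<dots> \<le> l2norm lborel ?g * l2norm lborel ?h" by (rule l2norm_Cauchy_Schwarz[OF g h])
  finally have "\<bar>LINT s:{u<..v}|lborel. f s\<bar>\<^sup>2 \<le> (l2norm lborel ?g * l2norm lborel ?h)\<^sup>2"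
    by (intro power_mono) auto
  also have "\<dots> = (LINT s:{u<..v}|lborel. (f s)\<^sup>2) * (v - u)"
  proof -
    have "(norm (?g s))\<^sup>2 = indicator {u<..v} s *\<^sub>R (f s)\<^sup>2" "(norm (?h s))\<^sup>2 = indicator {u<..v} s" for s
      by (auto simp: indicator_def)
    then show ?thesis
      using uv by (simp add: power_mult_distrib l2norm_power2 set_lebesgue_integral_def)
  qed
  finally show "((LINT s:{0..v}|lborel. f s) - (LINT s:{0..u}|lborel. f s))\<^sup>2
      \<le> (v - u) * ((LINT s:{0..v}|lborel. (f s)\<^sup>2) - (LINT s:{0..u}|lborel. (f s)\<^sup>2))"
    unfolding diff[OF f] diff[OF f2] by (simp add: mult.commute)
qed

section \<open>Integrals over time and probability\<close>

context prob_space
begin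

lemma pair_sigma_finite_time: "pair_sigma_finite (time_measure T) M"
proof -
  interpret N: finite_measure "time_measure T" by (rule finite_measure_time_measure)
  show ?thesis ..
qed

lemma nn_integral_time_product:
  assumes h: "(\<lambda>(t, \<omega>). h t \<omega>) \<in> borel_measurable (time_measure T \<Otimes>\<^sub>M M)"
  shows "(\<integral>\<^sup>+\<omega>. (\<integral>\<^sup>+t\<in>{0..T}. h t \<omega> \<partial>lborel) \<partial>M) = (\<integral>\<^sup>+z. (\<lambda>(t, \<omega>). h t \<omega>) z \<partial>(time_measure T \<Otimes>\<^sub>M M))"
proof -
  interpret pair_sigma_finite "time_measure T" M by (rule pair_sigma_finite_time)
  have "(\<integral>\<^sup>+\<omega>. (\<integral>\<^sup>+t\<in>{0..T}. h t \<omega> \<partial>lborel) \<partial>M) = (\<integral>\<^sup>+\<omega>. (\<integral>\<^sup>+t. h t \<omega> \<partial>time_measure T) \<partial>M)"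
    by (simp add: nn_integral_restrict_space)
  then show ?thesis using nn_integral_snd[OF h] by simp
qed

lemma sq_integrable_time_product:
  assumes X: "measurable_process M T X"
    and fin: "(\<integral>\<^sup>+\<omega>. (\<integral>\<^sup>+t\<in>{0..T}. ennreal ((X t \<omega>)\<^sup>2) \<partial>lborel) \<partial>M) < \<infinity>"
  shows "sq_integrable (time_measure T \<Otimes>\<^sub>M M) (\<lambda>(t, \<omega>). X t \<omega>)"
proof -
  have [measurable]: "(\<lambda>(t, \<omega>). X t \<omega>) \<in> borel_measurable (time_measure T \<Otimes>\<^sub>M M)"
    using X by (simp add: measurable_process_iff)
  have "(\<lambda>(t, \<omega>). ennreal ((X t \<omega>)\<^sup>2)) \<in> borel_measurable (time_measure T \<Otimes>\<^sub>M M)"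
    by measurable
  from nn_integral_time_product[OF this] fin
  have "(\<integral>\<^sup>+z. ennreal (((\<lambda>(t, \<omega>). X t \<omega>) z)\<^sup>2) \<partial>(time_measure T \<Otimes>\<^sub>M M)) < \<infinity>"
    by (simp add: case_prod_unfold)
  then show ?thesis unfolding sq_integrable_def
    by (auto intro!: integrableI_bounded)
qed

lemma time_integral_measurable:
  fixes G :: "real \<Rightarrow> 'a \<Rightarrow> 'b::euclidean_space"
  assumes [measurable]: "(\<lambda>(t, \<omega>). G t \<omega>) \<in> borel_measurable (time_measure T \<Otimes>\<^sub>M M)" and t: "t \<in> {0..T}"
  shows "(\<lambda>\<omega>. LINT s:{0..t}|lborel. G s \<omega>) \<in> borel_measurable M"
proof -
  interpret N: finite_measure "time_measure T" by (rule finite_measure_time_measure)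
  have ind [measurable]: "indicator {0..t} \<in> borel_measurable (time_measure T)"
    by (intro measurable_restrict_space1) auto
  have "(\<lambda>(\<omega>, s). (indicator {0..t} s :: real) *\<^sub>R G s \<omega>) \<in> borel_measurable (M \<Otimes>\<^sub>M time_measure T)"
    by (subst measurable_pair_swap_iff) (simp add: case_prod_unfold split_beta', measurable)
  then have "(\<lambda>\<omega>. \<integral>s. (indicator {0..t} s :: real) *\<^sub>R G s \<omega> \<partial>time_measure T) \<in> borel_measurable M"
    by (rule N.borel_measurable_lebesgue_integral)
  then show ?thesis unfolding integral_time_measure[OF t] .
qed

lemma
  fixes G :: "real \<Rightarrow> 'a \<Rightarrow> 'b::euclidean_space"
  assumes G: "integrable (time_measure T \<Otimes>\<^sub>M M) (\<lambda>(t, \<omega>). G t \<omega>)"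
  shows time_integral_integrable: "integrable M (\<lambda>\<omega>. LINT s:{0..T}|lborel. G s \<omega>)"
    and time_integral_norm: "expectation (\<lambda>\<omega>. norm (LINT s:{0..T}|lborel. G s \<omega>)) \<le> (\<integral>z. norm ((\<lambda>(t, \<omega>). G t \<omega>) z) \<partial>(time_measure T \<Otimes>\<^sub>M M))"
    and time_integral_expectation: "expectation (\<lambda>\<omega>. LINT s:{0..T}|lborel. G s \<omega>) = (\<integral>z. (\<lambda>(t, \<omega>). G t \<omega>) z \<partial>(time_measure T \<Otimes>\<^sub>M M))"
proof -
  interpret pair_sigma_finite "time_measure T" M by (rule pair_sigma_finite_time)
  have N: "integrable (time_measure T \<Otimes>\<^sub>M M) (\<lambda>(t, \<omega>). norm (G t \<omega>))"
    using integrable_norm[OF G] by (simp add: case_prod_unfold)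
  show 1: "integrable M (\<lambda>\<omega>. LINT s:{0..T}|lborel. G s \<omega>)"
    unfolding integral_time_measure_T using integrable_snd[OF G] .
  show "expectation (\<lambda>\<omega>. LINT s:{0..T}|lborel. G s \<omega>) = (\<integral>z. (\<lambda>(t, \<omega>). G t \<omega>) z \<partial>(time_measure T \<Otimes>\<^sub>M M))"
    unfolding integral_time_measure_T using integral_snd[OF G] by simp
  have "expectation (\<lambda>\<omega>. norm (LINT s:{0..T}|lborel. G s \<omega>)) \<le> expectation (\<lambda>\<omega>. \<integral>s. norm (G s \<omega>) \<partial>time_measure T)"
    using 1 integrable_snd[OF N] unfolding integral_time_measure_T
    by (intro integral_mono) auto
  also have "\<dots> = (\<integral>z. norm ((\<lambda>(t, \<omega>). G t \<omega>) z) \<partial>(time_measure T \<Otimes>\<^sub>M M))"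
    using integral_snd[OF N] by (simp add: case_prod_unfold)
  finally show "expectation (\<lambda>\<omega>. norm (LINT s:{0..T}|lborel. G s \<omega>)) \<le> (\<integral>z. norm ((\<lambda>(t, \<omega>). G t \<omega>) z) \<partial>(time_measure T \<Otimes>\<^sub>M M))" .
qed

lemma square_time_integral:
  assumes b: "sq_integrable (time_measure T \<Otimes>\<^sub>M M) (\<lambda>(t, \<omega>). b t \<omega> :: real)"
  shows "integrable M (\<lambda>\<omega>. LINT s:{0..T}|lborel. (b s \<omega>)\<^sup>2)"
    and "expectation (\<lambda>\<omega>. LINT s:{0..T}|lborel. (b s \<omega>)\<^sup>2) = (l2norm (time_measure T \<Otimes>\<^sub>M M) (\<lambda>(t, \<omega>). b t \<omega>))\<^sup>2"
    and "AE \<omega> in M. set_integrable lborel {0..T} (\<lambda>s. b s \<omega>) \<and> set_integrable lborel {0..T} (\<lambda>s. (b s \<omega>)\<^sup>2)"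
proof -
  interpret pair_sigma_finite "time_measure T" M by (rule pair_sigma_finite_time)
  interpret N: finite_measure "time_measure T" by (rule finite_measure_time_measure)
  have bm: "(\<lambda>(t, \<omega>). b t \<omega>) \<in> borel_measurable (time_measure T \<Otimes>\<^sub>M M)"
    using b by (simp add: sq_integrable_def)
  have int: "integrable (time_measure T \<Otimes>\<^sub>M M) (\<lambda>(t, \<omega>). (b t \<omega>)\<^sup>2)"
    using b by (simp add: sq_integrable_def case_prod_unfold)
  show "integrable M (\<lambda>\<omega>. LINT s:{0..T}|lborel. (b s \<omega>)\<^sup>2)" by (rule time_integral_integrable[OF int])
  show "expectation (\<lambda>\<omega>. LINT s:{0..T}|lborel. (b s \<omega>)\<^sup>2) = (l2norm (time_measure T \<Otimes>\<^sub>M M) (\<lambda>(t, \<omega>). b t \<omega>))\<^sup>2"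
    unfolding time_integral_expectation[OF int] l2norm_power2 by (simp add: case_prod_unfold)
  have "AE \<omega> in M. integrable (time_measure T) (\<lambda>s. (b s \<omega>)\<^sup>2)"
    using AE_integrable_snd[OF int] by simp
  then show "AE \<omega> in M. set_integrable lborel {0..T} (\<lambda>s. b s \<omega>) \<and> set_integrable lborel {0..T} (\<lambda>s. (b s \<omega>)\<^sup>2)"
    using AE_space
  proof eventually_elim
    case (elim \<omega>)
    have [measurable]: "(\<lambda>s. b s \<omega>) \<in> borel_measurable (time_measure T)"
      using measurable_compose[OF measurable_Pair2'[OF elim(2)] bm] by simp
    have "integrable (time_measure T) (\<lambda>s. 1 + (b s \<omega>)\<^sup>2)" using elim by auto
    moreover have "\<bar>x\<bar> \<le> 1 + x\<^sup>2" for x :: real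
      using sum_squares_bound[of "\<bar>x\<bar>" 1] by auto
    ultimately have "integrable (time_measure T) (\<lambda>s. b s \<omega>)"
      by (auto intro: Bochner_Integration.integrable_bound)
    then show ?case using elim(1)
      by (simp add: set_integrable_def integrable_restrict_space)
  qed
qed

text \<open>The pathwise counterpart of the martingale estimate: the sum is at most \<open>C\<close>
  times the integral of \<open>\<bar>b\<bar>\<close>, and Cauchy-Schwarz in time bounds the square
  of that integral by \<open>T\<close> times the integral of \<open>b\<^sup>2\<close>.\<close>

lemma drift_sum_increments:
  fixes v :: "nat \<Rightarrow> 'a \<Rightarrow> 'b::euclidean_space"
  assumes b: "sq_integrable (time_measure T \<Otimes>\<^sub>M M) (\<lambda>(t, \<omega>). b t \<omega> :: real)"
    and T: "0 \<le> T" and x: "mono_on {..m} x" "x ` {..m} \<subseteq> {0..T}"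
    and v: "\<And>c. c < m \<Longrightarrow> v c \<in> borel_measurable M"
    and C: "0 \<le> C" "\<And>c \<omega>. c < m \<Longrightarrow> \<omega> \<in> space M \<Longrightarrow> norm (v c \<omega>) \<le> C"
  defines "A \<equiv> \<lambda>t \<omega>. LINT s:{0..t}|lborel. b s \<omega>"
  shows "l2norm M (\<lambda>\<omega>. \<Sum>c<m. (A (x (Suc c)) \<omega> - A (x c) \<omega>) *\<^sub>R v c \<omega>)
      \<le> C * (sqrt T * l2norm (time_measure T \<Otimes>\<^sub>M M) (\<lambda>(t, \<omega>). b t \<omega>))" (is "l2norm M ?S \<le> _")
    and "sq_integrable M (\<lambda>\<omega>. \<Sum>c<m. (A (x (Suc c)) \<omega> - A (x c) \<omega>) *\<^sub>R v c \<omega>)"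
proof -
  let ?B = "\<lambda>\<omega>. LINT s:{0..T}|lborel. (b s \<omega>)\<^sup>2"
  have xin: "x c \<in> {0..T}" if "c \<le> m" for c using x(2) that by auto
  have xle: "x c \<le> x (Suc c)" if "c < m" for c using mono_onD[OF x(1), of c "Suc c"] that by auto
  have [measurable]: "A t \<in> borel_measurable M" if "t \<in> {0..T}" for t
    unfolding A_def by (rule time_integral_measurable[OF _ that]) (use b in \<open>simp add: sq_integrable_def\<close>)
  have Smeas: "?S \<in> borel_measurable M"
    by (intro borel_measurable_sum borel_measurable_scaleR borel_measurable_diff) (use xin v in auto)
  have bound: "AE \<omega> in M. (norm (?S \<omega>))\<^sup>2 \<le> C\<^sup>2 * (T * ?B \<omega>)"
    using square_time_integral(3)[OF b] AE_space
  proof eventually_elim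
    case (elim \<omega>)
    then have i: "set_integrable lborel {0..T} (\<lambda>s. b s \<omega>)" "set_integrable lborel {0..T} (\<lambda>s. (b s \<omega>)\<^sup>2)" by auto
    then have ia: "set_integrable lborel {0..T} (\<lambda>s. \<bar>b s \<omega>\<bar>)" by (auto intro: set_integrable_abs)
    let ?G = "\<lambda>t. LINT s:{0..t}|lborel. \<bar>b s \<omega>\<bar>"
    have zero: "(LINT s:{0..0}|lborel. h s) = 0" for h :: "real \<Rightarrow> real"
    proof -
      have "AE s in lborel. s \<noteq> (0::real)" by (rule AE_lborel_singleton)
      then have "AE s in lborel. indicator {0..0} s *\<^sub>R h s = 0" by eventually_elim auto
      then show ?thesis unfolding set_lebesgue_integral_def by (rule integral_eq_zero_AE)
    qed
    have Gmono: "?G u \<le> ?G v" if "0 \<le> u" "u \<le> v" "v \<le> T" for u v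
      using drift_increments(1)[OF i that] by simp
    have "norm (?S \<omega>) \<le> (\<Sum>c<m. (?G (x (Suc c)) - ?G (x c)) * C)"
    proof (intro sum_norm_le)
      fix c assume "c \<in> {..<m}"
      then have c: "c < m" by simp
      have "\<bar>A (x (Suc c)) \<omega> - A (x c) \<omega>\<bar> \<le> ?G (x (Suc c)) - ?G (x c)"
        unfolding A_def using xin[of c] xin[of "Suc c"] xle[OF c] c by (intro drift_increments(1)[OF i]) auto
      then show "norm ((A (x (Suc c)) \<omega> - A (x c) \<omega>) *\<^sub>R v c \<omega>) \<le> (?G (x (Suc c)) - ?G (x c)) * C"
        using C(2)[OF c elim(2)] by (simp add: mult_mono)
    qed
    also have "\<dots> = (?G (x m) - ?G (x 0)) * C"
      using sum_lessThan_telescope[of "\<lambda>c. ?G (x c)" m] by (simp only: sum_distrib_right[symmetric])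
    also have "\<dots> \<le> ?G T * C"
      using Gmono[of "x m" T] Gmono[of 0 "x 0"] zero xin[of 0] xin[of m] C(1)
      by (intro mult_right_mono) auto
    finally have "(norm (?S \<omega>))\<^sup>2 \<le> (?G T * C)\<^sup>2" by (intro power_mono) auto
    also have "\<dots> = C\<^sup>2 * (?G T)\<^sup>2" by (simp add: power_mult_distrib)
    also have "(?G T)\<^sup>2 \<le> T * ?B \<omega>"
      using drift_increments(2)[OF ia _ order_refl T order_refl] i(2) zero by simp
    finally show ?case by (simp add: mult_left_mono)
  qed
  have int: "integrable M (\<lambda>\<omega>. C\<^sup>2 * (T * ?B \<omega>))"
    using square_time_integral(1)[OF b] by auto
  have "integrable M (\<lambda>\<omega>. (norm (?S \<omega>))\<^sup>2)"
  proof (rule Bochner_Integration.integrable_bound[OF int])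
    show "(\<lambda>\<omega>. (norm (?S \<omega>))\<^sup>2) \<in> borel_measurable M" using Smeas by measurable
    show "AE \<omega> in M. norm ((norm (?S \<omega>))\<^sup>2) \<le> norm (C\<^sup>2 * (T * ?B \<omega>))"
      using bound by eventually_elim (simp del: scaleR_scaleR)
  qed
  then show sq: "sq_integrable M ?S" using Smeas by (simp add: sq_integrable_def)
  have "(\<integral>\<omega>. (norm (?S \<omega>))\<^sup>2 \<partial>M) \<le> (\<integral>\<omega>. C\<^sup>2 * (T * ?B \<omega>) \<partial>M)"
    by (rule integral_mono_AE[OF _ int bound]) (use sq in \<open>simp add: sq_integrable_def\<close>)
  also have "\<dots> = (C * (sqrt T * l2norm (time_measure T \<Otimes>\<^sub>M M) (\<lambda>(t, \<omega>). b t \<omega>)))\<^sup>2"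
    using T by (simp add: square_time_integral(2)[OF b] power_mult_distrib)
  finally show "l2norm M ?S \<le> C * (sqrt T * l2norm (time_measure T \<Otimes>\<^sub>M M) (\<lambda>(t, \<omega>). b t \<omega>))"
    using C(1) T by (subst l2norm_le_iff) auto
qed

text \<open>Cauchy-Schwarz on each cell produces its length \<open>T / n\<close>. This
  \<open>1 / n\<close> later cancels the factor \<open>n\<close> in Bessel's inequality on the
  mesh.\<close>

lemma drift_mesh_squares:
  assumes b: "sq_integrable (time_measure T \<Otimes>\<^sub>M M) (\<lambda>(t, \<omega>). b t \<omega> :: real)"
    and T: "0 \<le> T" and n: "0 < n"
  defines "A \<equiv> \<lambda>t \<omega>. LINT s:{0..t}|lborel. b s \<omega>"
  shows "AE \<omega> in M. (\<Sum>q<n. (A (mesh T n (Suc q)) \<omega> - A (mesh T n q) \<omega>)\<^sup>2) \<le> T / n * (LINT s:{0..T}|lborel. (b s \<omega>)\<^sup>2)"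
  using square_time_integral(3)[OF b]
proof eventually_elim
  case (elim \<omega>)
  then have i: "set_integrable lborel {0..T} (\<lambda>s. b s \<omega>)" "set_integrable lborel {0..T} (\<lambda>s. (b s \<omega>)\<^sup>2)" by auto
  let ?Q = "\<lambda>t. LINT s:{0..t}|lborel. (b s \<omega>)\<^sup>2"
  have "(\<Sum>q<n. (A (mesh T n (Suc q)) \<omega> - A (mesh T n q) \<omega>)\<^sup>2) \<le> (\<Sum>q<n. T / n * (?Q (mesh T n (Suc q)) - ?Q (mesh T n q)))"
  proof (intro sum_mono)
    fix q assume q: "q \<in> {..<n}"
    have "0 \<le> mesh T n q" "mesh T n q \<le> mesh T n (Suc q)" "mesh T n (Suc q) \<le> T"
      using mesh_in[OF T, of q n] mesh_in[OF T, of "Suc q" n] mesh_mono[OF T, of q "Suc q" n] q by auto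
    from drift_increments(2)[OF i this]
    show "(A (mesh T n (Suc q)) \<omega> - A (mesh T n q) \<omega>)\<^sup>2 \<le> T / n * (?Q (mesh T n (Suc q)) - ?Q (mesh T n q))"
      unfolding A_def mesh_Suc_diff .
  qed
  also have "\<dots> = T / n * (?Q (mesh T n n) - ?Q (mesh T n 0))"
    using sum_lessThan_telescope[of "\<lambda>q. ?Q (mesh T n q)" n] by (simp only: sum_distrib_left[symmetric])
  also have "\<dots> \<le> T / n * ?Q T"
  proof (intro mult_left_mono)
    have "0 \<le> ?Q 0" unfolding set_lebesgue_integral_def by (intro integral_nonneg_AE) auto
    then show "?Q (mesh T n n) - ?Q (mesh T n 0) \<le> ?Q T" using n by simp
  qed (use T in auto)
  finally show ?case .
qed

end

section \<open>Existence of the stochastic integral\<close>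

text \<open>Continuity of the elementary integral from the uniform norm to \<open>L2\<close>, with
  constant \<open>\<kappa>\<close>. Square-integrable martingales and drifts both have it, sums
  inherit it, and it suffices to construct the integrals of Lipschitz functions. The coefficients
  are complex for the sake of the characters.\<close>

definition l2_integrator :: "'a measure \<Rightarrow> (real \<Rightarrow> 'a measure) \<Rightarrow> real \<Rightarrow> (real \<Rightarrow> 'a \<Rightarrow> real) \<Rightarrow> real \<Rightarrow> bool" where
  "l2_integrator M F T X \<kappa> \<longleftrightarrow> 0 \<le> \<kappa> \<and> (\<forall>t\<in>{0..T}. X t \<in> borel_measurable M) \<and>
     (\<forall>m x (v :: nat \<Rightarrow> 'a \<Rightarrow> complex) C.
        mono_on {..m} x \<and> x ` {..m} \<subseteq> {0..T} \<and> (\<forall>c<m. v c \<in> borel_measurable (F (x c))) \<and>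
        0 \<le> C \<and> (\<forall>c<m. \<forall>\<omega>\<in>space M. norm (v c \<omega>) \<le> C) \<longrightarrow>
        sq_integrable M (\<lambda>\<omega>. \<Sum>c<m. (X (x (Suc c)) \<omega> - X (x c) \<omega>) *\<^sub>R v c \<omega>) \<and>
        l2norm M (\<lambda>\<omega>. \<Sum>c<m. (X (x (Suc c)) \<omega> - X (x c) \<omega>) *\<^sub>R v c \<omega>) \<le> C * \<kappa>)"

lemma l2_integratorI:
  assumes "0 \<le> \<kappa>" "\<And>t. t \<in> {0..T} \<Longrightarrow> X t \<in> borel_measurable M"
    and "\<And>m x (v :: nat \<Rightarrow> 'a \<Rightarrow> complex) C. mono_on {..m} x \<Longrightarrow> x ` {..m} \<subseteq> {0..T} \<Longrightarrow>
      (\<And>c. c < m \<Longrightarrow> v c \<in> borel_measurable (F (x c))) \<Longrightarrow> 0 \<le> C \<Longrightarrow>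
      (\<And>c \<omega>. c < m \<Longrightarrow> \<omega> \<in> space M \<Longrightarrow> norm (v c \<omega>) \<le> C) \<Longrightarrow>
      sq_integrable M (\<lambda>\<omega>. \<Sum>c<m. (X (x (Suc c)) \<omega> - X (x c) \<omega>) *\<^sub>R v c \<omega>) \<and>
      l2norm M (\<lambda>\<omega>. \<Sum>c<m. (X (x (Suc c)) \<omega> - X (x c) \<omega>) *\<^sub>R v c \<omega>) \<le> C * \<kappa>"
  shows "l2_integrator M F T X \<kappa>"
  using assms unfolding l2_integrator_def by auto

lemma l2_integratorD:
  fixes v :: "nat \<Rightarrow> 'a \<Rightarrow> complex"
  assumes "l2_integrator M F T X \<kappa>" "mono_on {..m} x" "x ` {..m} \<subseteq> {0..T}"
    "\<And>c. c < m \<Longrightarrow> v c \<in> borel_measurable (F (x c))" "0 \<le> C"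
    "\<And>c \<omega>. c < m \<Longrightarrow> \<omega> \<in> space M \<Longrightarrow> norm (v c \<omega>) \<le> C"
  shows "sq_integrable M (\<lambda>\<omega>. \<Sum>c<m. (X (x (Suc c)) \<omega> - X (x c) \<omega>) *\<^sub>R v c \<omega>)"
    "l2norm M (\<lambda>\<omega>. \<Sum>c<m. (X (x (Suc c)) \<omega> - X (x c) \<omega>) *\<^sub>R v c \<omega>) \<le> C * \<kappa>"
  using assms unfolding l2_integrator_def by blast+

lemma l2_integrator_measurable: "l2_integrator M F T X \<kappa> \<Longrightarrow> t \<in> {0..T} \<Longrightarrow> X t \<in> borel_measurable M"
  and l2_integrator_nonneg: "l2_integrator M F T X \<kappa> \<Longrightarrow> 0 \<le> \<kappa>"
  by (auto simp: l2_integrator_def)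

text \<open>The set where the two limits are more than \<open>e\<close> apart is covered by two sets
  of vanishing measure. Uniqueness is what identifies the value picked by \<open>SOME\<close> in
  \<open>stochastic_integral\<close>, up to a null set.\<close>

lemma tendsto_in_prob_unique:
  assumes "prob_space M" and Y: "tendsto_in_prob M X Y" and Z: "tendsto_in_prob M X Z"
  shows "AE \<omega> in M. Y \<omega> = Z \<omega>"
proof -
  interpret prob_space M by fact
  have [measurable]: "X n \<in> borel_measurable M" "Y \<in> borel_measurable M" "Z \<in> borel_measurable M" for n
    using Y Z by (auto simp: tendsto_in_prob_def)
  have "AE \<omega> in M. dist (Y \<omega>) (Z \<omega>) \<le> 1 / real (Suc k)" for k
  proof -
    define e where "e = 1 / real (Suc k)"
    have e: "0 < e" by (simp add: e_def)
    let ?A = "\<lambda>V n. {\<omega> \<in> space M. dist (X n \<omega>) (V \<omega>) > e / 2}"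
    have le: "measure M {\<omega> \<in> space M. dist (Y \<omega>) (Z \<omega>) > e} \<le> measure M (?A Y n) + measure M (?A Z n)" for n
    proof -
      have "{\<omega> \<in> space M. dist (Y \<omega>) (Z \<omega>) > e} \<subseteq> ?A Y n \<union> ?A Z n"
      proof
        fix \<omega> assume \<omega>: "\<omega> \<in> {\<omega> \<in> space M. dist (Y \<omega>) (Z \<omega>) > e}"
        have "dist (Y \<omega>) (Z \<omega>) \<le> dist (X n \<omega>) (Y \<omega>) + dist (X n \<omega>) (Z \<omega>)" by (rule dist_triangle3)
        then show "\<omega> \<in> ?A Y n \<union> ?A Z n" using \<omega> by auto
      qed
      then have "measure M {\<omega> \<in> space M. dist (Y \<omega>) (Z \<omega>) > e} \<le> measure M (?A Y n \<union> ?A Z n)"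
        by (intro finite_measure_mono) auto
      also have "\<dots> \<le> measure M (?A Y n) + measure M (?A Z n)"
        by (intro measure_Un_le) auto
      finally show ?thesis .
    qed
    have "0 < e / 2" using e by simp
    then have "(\<lambda>n. measure M (?A Y n)) \<longlonglongrightarrow> 0" "(\<lambda>n. measure M (?A Z n)) \<longlonglongrightarrow> 0"
      using Y Z unfolding tendsto_in_prob_def by blast+
    from tendsto_add[OF this] have "(\<lambda>n. measure M (?A Y n) + measure M (?A Z n)) \<longlonglongrightarrow> 0" by simp
    then have "measure M {\<omega> \<in> space M. dist (Y \<omega>) (Z \<omega>) > e} \<le> 0"
      using le by (intro LIMSEQ_le_const) auto
    then have "measure M {\<omega> \<in> space M. dist (Y \<omega>) (Z \<omega>) > e} = 0"
      using measure_nonneg[of M "{\<omega> \<in> space M. dist (Y \<omega>) (Z \<omega>) > e}"] by linarith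
    then have "AE \<omega> in M. \<omega> \<notin> {\<omega> \<in> space M. dist (Y \<omega>) (Z \<omega>) > e}"
      by (subst (asm) prob_eq_0) auto
    then show ?thesis using AE_space by eventually_elim (simp add: e_def)
  qed
  then have "AE \<omega> in M. \<forall>k. dist (Y \<omega>) (Z \<omega>) \<le> 1 / real (Suc k)" by (simp add: AE_all_countable)
  then show ?thesis
  proof eventually_elim
    case (elim \<omega>)
    have "dist (Y \<omega>) (Z \<omega>) \<le> 0"
      by (rule LIMSEQ_le_const[OF lim_const_over_n[THEN LIMSEQ_Suc, of 1]]) (use elim in auto)
    then show ?case by simp
  qed
qed

lemma (in prob_space) l2_imp_tendsto_in_prob:
  fixes X :: "nat \<Rightarrow> 'a \<Rightarrow> 'b::euclidean_space"
  assumes sq: "\<And>n. sq_integrable M (X n)" "sq_integrable M Y"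
    and lim: "(\<lambda>n. l2norm M (\<lambda>\<omega>. X n \<omega> - Y \<omega>)) \<longlonglongrightarrow> 0"
  shows "tendsto_in_prob M X Y"
proof (rule L1_imp_tendsto_in_prob)
  have d: "sq_integrable M (\<lambda>\<omega>. X n \<omega> - Y \<omega>)" for n by (intro sq_integrable_diff sq)
  show "X n \<in> borel_measurable M" "Y \<in> borel_measurable M" for n using sq by (auto simp: sq_integrable_def)
  show "integrable M (\<lambda>\<omega>. X n \<omega> - Y \<omega>)" for n by (rule sq_integrable_integrable[OF d])
  show "(\<lambda>n. expectation (\<lambda>\<omega>. norm (X n \<omega> - Y \<omega>))) \<longlonglongrightarrow> 0"
    by (rule tendsto_sandwich[OF _ _ tendsto_const lim]) (use expectation_norm_le_l2norm[OF d] in auto)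
qed

context usual_filtered_prob_space
begin

lemma l2_integrator_l2_martingale:
  assumes X: "l2_martingale M F T X"
  shows "l2_integrator M F T X (l2norm M (\<lambda>\<omega>. X T \<omega> - X 0 \<omega>))"
proof (intro l2_integratorI conjI)
  show "X t \<in> borel_measurable M" if "t \<in> {0..T}" for t
    using X that by (auto simp: l2_martingale_def sq_integrable_def)
  fix m :: nat and x and v :: "nat \<Rightarrow> 'a \<Rightarrow> complex" and C
  assume x: "mono_on {..m} x" "x ` {..m} \<subseteq> {0..T}" and v: "\<And>c. c < m \<Longrightarrow> v c \<in> borel_measurable (F (x c))"
    and C: "0 \<le> C" "\<And>c \<omega>. c < m \<Longrightarrow> \<omega> \<in> space M \<Longrightarrow> norm (v c \<omega>) \<le> C"
  note * = l2_martingale_sum_increments[OF X x v C]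
  show "sq_integrable M (\<lambda>\<omega>. \<Sum>c<m. (X (x (Suc c)) \<omega> - X (x c) \<omega>) *\<^sub>R v c \<omega>)" using *(2) .
  have x0: "0 \<le> x 0" "x 0 \<le> x m" "x m \<le> T" "0 \<le> x m"
    using x mono_onD[OF x(1), of 0 m] by (auto simp: image_subset_iff)
  \<comment> \<open>A four-point partition 0, \<open>x 0\<close>, \<open>x m\<close>,
    \<open>T\<close> with coefficient 1 on the middle cell only: the increment over a subinterval
    has no larger norm than the one over the whole horizon.\<close>
  define y where "y = (\<lambda>c::nat. [0, x 0, x m, T] ! c)"
  have y: "mono_on {..3} y" "y ` {..3} \<subseteq> {0..T}"
    using x0 by (auto simp: y_def mono_on_def image_subset_iff numeral_eq_Suc le_Suc_eq)
  have "l2norm M (\<lambda>\<omega>. \<Sum>c<3. (X (y (Suc c)) \<omega> - X (y c) \<omega>) *\<^sub>R (if c = 1 then 1 else (0::real)))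
      \<le> 1 * l2norm M (\<lambda>\<omega>. X (y 3) \<omega> - X (y 0) \<omega>)"
    by (rule l2_martingale_sum_increments(1)[OF X y]) auto
  then have "l2norm M (\<lambda>\<omega>. X (x m) \<omega> - X (x 0) \<omega>) \<le> l2norm M (\<lambda>\<omega>. X T \<omega> - X 0 \<omega>)"
    by (simp add: y_def numeral_eq_Suc)
  then show "l2norm M (\<lambda>\<omega>. \<Sum>c<m. (X (x (Suc c)) \<omega> - X (x c) \<omega>) *\<^sub>R v c \<omega>) \<le> C * l2norm M (\<lambda>\<omega>. X T \<omega> - X 0 \<omega>)"
    using *(1) C(1) by (meson mult_left_mono order_trans)
qed simp

lemma l2_integrator_drift:
  assumes b: "sq_integrable (time_measure T \<Otimes>\<^sub>M M) (\<lambda>(t, \<omega>). b t \<omega> :: real)" and T: "0 \<le> T"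
  shows "l2_integrator M F T (\<lambda>t \<omega>. LINT s:{0..t}|lborel. b s \<omega>)
    (sqrt T * l2norm (time_measure T \<Otimes>\<^sub>M M) (\<lambda>(t, \<omega>). b t \<omega>))"
proof (intro l2_integratorI conjI)
  show "(\<lambda>\<omega>. LINT s:{0..t}|lborel. b s \<omega>) \<in> borel_measurable M" if "t \<in> {0..T}" for t
    using b that by (intro time_integral_measurable) (auto simp: sq_integrable_def)
  fix m :: nat and x and v :: "nat \<Rightarrow> 'a \<Rightarrow> complex" and C
  assume x: "mono_on {..m} x" "x ` {..m} \<subseteq> {0..T}" and v: "\<And>c. c < m \<Longrightarrow> v c \<in> borel_measurable (F (x c))"
    and C: "0 \<le> C" "\<And>c \<omega>. c < m \<Longrightarrow> \<omega> \<in> space M \<Longrightarrow> norm (v c \<omega>) \<le> C"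
  have vM: "v c \<in> borel_measurable M" if "c < m" for c
    using measurable_F[OF v[OF that]] x(2) that by (auto simp: image_subset_iff)
  note * = drift_sum_increments[OF b T x vM C]
  show "sq_integrable M (\<lambda>\<omega>. \<Sum>c<m. ((LINT s:{0..x (Suc c)}|lborel. b s \<omega>) - (LINT s:{0..x c}|lborel. b s \<omega>)) *\<^sub>R v c \<omega>)"
    using *(2) .
  show "l2norm M (\<lambda>\<omega>. \<Sum>c<m. ((LINT s:{0..x (Suc c)}|lborel. b s \<omega>) - (LINT s:{0..x c}|lborel. b s \<omega>)) *\<^sub>R v c \<omega>)
    \<le> C * (sqrt T * l2norm (time_measure T \<Otimes>\<^sub>M M) (\<lambda>(t, \<omega>). b t \<omega>))"
    using *(1) .
qed (use T in simp)

lemma l2_integrator_add: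
  assumes X: "l2_integrator M F T X \<kappa>" and Y: "l2_integrator M F T Y \<kappa>'"
  shows "l2_integrator M F T (\<lambda>t \<omega>. X t \<omega> + Y t \<omega>) (\<kappa> + \<kappa>')"
proof (intro l2_integratorI conjI)
  show "(\<lambda>\<omega>. X t \<omega> + Y t \<omega>) \<in> borel_measurable M" if "t \<in> {0..T}" for t
    using X Y that by (intro borel_measurable_add) (auto dest: l2_integrator_measurable)
  show "0 \<le> \<kappa> + \<kappa>'" using l2_integrator_nonneg[OF X] l2_integrator_nonneg[OF Y] by simp
  fix m :: nat and x and v :: "nat \<Rightarrow> 'a \<Rightarrow> complex" and C
  assume x: "mono_on {..m} x" "x ` {..m} \<subseteq> {0..T}" and v: "\<And>c. c < m \<Longrightarrow> v c \<in> borel_measurable (F (x c))"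
    and C: "0 \<le> C" "\<And>c \<omega>. c < m \<Longrightarrow> \<omega> \<in> space M \<Longrightarrow> norm (v c \<omega>) \<le> C"
  note 1 = l2_integratorD[OF X x v C] and 2 = l2_integratorD[OF Y x v C]
  have eq: "(\<lambda>\<omega>. \<Sum>c<m. (X (x (Suc c)) \<omega> + Y (x (Suc c)) \<omega> - (X (x c) \<omega> + Y (x c) \<omega>)) *\<^sub>R v c \<omega>)
    = (\<lambda>\<omega>. (\<Sum>c<m. (X (x (Suc c)) \<omega> - X (x c) \<omega>) *\<^sub>R v c \<omega>) + (\<Sum>c<m. (Y (x (Suc c)) \<omega> - Y (x c) \<omega>) *\<^sub>R v c \<omega>))"
    by (simp only: sum.distrib[symmetric] scaleR_add_left[symmetric] add_diff_add)
  show "sq_integrable M (\<lambda>\<omega>. \<Sum>c<m. (X (x (Suc c)) \<omega> + Y (x (Suc c)) \<omega> - (X (x c) \<omega> + Y (x c) \<omega>)) *\<^sub>R v c \<omega>)"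
    unfolding eq by (intro sq_integrable_add 1(1) 2(1))
  show "l2norm M (\<lambda>\<omega>. \<Sum>c<m. (X (x (Suc c)) \<omega> + Y (x (Suc c)) \<omega> - (X (x c) \<omega> + Y (x c) \<omega>)) *\<^sub>R v c \<omega>) \<le> C * (\<kappa> + \<kappa>')"
    unfolding eq using l2norm_add_le[OF 1(1) 2(1)] 1(2) 2(2) by (simp add: distrib_left)
qed

text \<open>Only increments enter the estimate, so the initial value \<open>Y 0\<close> can be any
  random variable.\<close>

lemma l2_integrator_cong:
  assumes X: "l2_integrator M F T X \<kappa>" and Y: "\<And>t. t \<in> {0..T} \<Longrightarrow> Y t \<in> borel_measurable M"
    and eq: "AE \<omega> in M. \<forall>t\<in>{0..T}. Y t \<omega> = Y 0 \<omega> + X t \<omega>"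
  shows "l2_integrator M F T Y \<kappa>"
proof (intro l2_integratorI conjI Y)
  show "0 \<le> \<kappa>" using l2_integrator_nonneg[OF X] .
  fix m :: nat and x and v :: "nat \<Rightarrow> 'a \<Rightarrow> complex" and C
  assume x: "mono_on {..m} x" "x ` {..m} \<subseteq> {0..T}" and v: "\<And>c. c < m \<Longrightarrow> v c \<in> borel_measurable (F (x c))"
    and C: "0 \<le> C" "\<And>c \<omega>. c < m \<Longrightarrow> \<omega> \<in> space M \<Longrightarrow> norm (v c \<omega>) \<le> C"
  note 1 = l2_integratorD[OF X x v C]
  have xin: "x c \<in> {0..T}" if "c \<le> m" for c using x(2) that by auto
  have vM: "v c \<in> borel_measurable M" if "c < m" for c
    using measurable_F[OF v[OF that]] xin that by auto
  have AE: "AE \<omega> in M. (\<Sum>c<m. (X (x (Suc c)) \<omega> - X (x c) \<omega>) *\<^sub>R v c \<omega>) = (\<Sum>c<m. (Y (x (Suc c)) \<omega> - Y (x c) \<omega>) *\<^sub>R v c \<omega>)"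
    using eq
  proof eventually_elim
    case (elim \<omega>)
    show ?case
    proof (intro sum.cong refl)
      fix c assume "c \<in> {..<m}"
      then have c: "x (Suc c) \<in> {0..T}" "x c \<in> {0..T}" using xin[of c] xin[of "Suc c"] by simp_all
      show "(X (x (Suc c)) \<omega> - X (x c) \<omega>) *\<^sub>R v c \<omega> = (Y (x (Suc c)) \<omega> - Y (x c) \<omega>) *\<^sub>R v c \<omega>"
        unfolding bspec[OF elim c(1)] bspec[OF elim c(2)] by simp
    qed
  qed
  have meas: "(\<lambda>\<omega>. \<Sum>c<m. (Y (x (Suc c)) \<omega> - Y (x c) \<omega>) *\<^sub>R v c \<omega>) \<in> borel_measurable M"
    by (intro borel_measurable_sum borel_measurable_scaleR borel_measurable_diff) (use xin Y vM in auto)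
  show "sq_integrable M (\<lambda>\<omega>. \<Sum>c<m. (Y (x (Suc c)) \<omega> - Y (x c) \<omega>) *\<^sub>R v c \<omega>)"
    by (rule sq_integrable_cong_AE[OF AE 1(1) meas])
  show "l2norm M (\<lambda>\<omega>. \<Sum>c<m. (Y (x (Suc c)) \<omega> - Y (x c) \<omega>) *\<^sub>R v c \<omega>) \<le> C * \<kappa>"
    using l2norm_cong_AE[OF AE _ meas] 1 by (simp add: sq_integrable_def)
qed

text \<open>A summand that is active at the right end of the cell starts before it, hence at a
  partition point no later than \<open>x c\<close>. The value on the cell is therefore known at its
  left end, which is what the isometry asks of a coefficient.\<close>

lemma step_value_measurable:
  assumes S: "simple_predictable M F T (S :: ('a, 'b::euclidean_space) step_process)" and r: "step_refinement x m S" and c: "c < m"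
  shows "step_value S (x (Suc c)) \<in> borel_measurable (F (x c))"
proof -
  have "(\<lambda>\<omega>. indicator {step_time S i<..step_time S (Suc i)} (x (Suc c)) *\<^sub>R step_coeff S i \<omega>) \<in> borel_measurable (F (x c))"
    if i: "i < step_num S" for i
  proof (cases "step_time S i < x (Suc c)")
    case True
    have "step_time S i \<in> x ` {..m}" using r i by (auto simp: step_refinement_def image_subset_iff)
    then obtain a where a: "a \<le> m" "step_time S i = x a" by auto
    have "mono_on {..m} x" using r by (simp add: step_refinement_def)
    note mono = mono_onD[OF this]
    have "a \<le> c"
    proof (rule ccontr)
      assume "\<not> a \<le> c"
      then have "x (Suc c) \<le> x a" using a by (intro mono) auto
      then show False using True a by simp
    qed
    then have "step_time S i \<le> x c" using mono[of a c] a c by simp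
    moreover have "step_coeff S i \<in> borel_measurable (F (step_time S i))"
      using S i by (auto simp: simple_predictable_def)
    ultimately have "step_coeff S i \<in> borel_measurable (F (x c))"
      using measurable_from_subalg[OF F_mono] by blast
    then show ?thesis by simp
  next
    case False
    then show ?thesis by simp
  qed
  then show ?thesis unfolding step_value_def by (intro borel_measurable_sum) auto
qed

text \<open>Adding 0 and \<open>T\<close> makes the partition span the horizon, and enumerating a
  finite set of points makes it strictly increasing even if the step processes repeat times.\<close>

lemma simple_predictable_refinement:
  assumes S: "simple_predictable M F T S" and S': "simple_predictable M F T S'" and T: "0 \<le> T"
  obtains x and m :: nat where "strict_mono_on {..m} x" "step_refinement x m S" "step_refinement x m S'"
    "x ` {..m} \<subseteq> {0..T}" "x 0 = 0" "x m = T"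
proof -
  let ?P = "{0, T} \<union> step_time S ` {..step_num S} \<union> step_time S' ` {..step_num S'}"
  have fin: "finite ?P" "?P \<noteq> {}" by auto
  obtain x and m :: nat where x: "strict_mono_on {..m} x" "x ` {..m} = ?P"
    using common_refinement[OF fin] .
  have mono: "mono_on {..m} x" using x(1) by (rule strict_mono_on_imp_mono_on)
  have sub: "x ` {..m} \<subseteq> {0..T}"
    unfolding x(2) using S S' T by (auto simp: simple_predictable_def)
  have "step_refinement x m S" "step_refinement x m S'"
    using S S' x mono by (auto simp: step_refinement_def simple_predictable_def)
  moreover have "x 0 = 0" "x m = T"
    by (intro partition_endpoints[OF mono sub]; simp add: x(2))+
  ultimately show ?thesis using that x(1) sub by blast
qed

text \<open>On a common refinement the difference of the two integrals is a single elementary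
  integral whose coefficients are bounded by \<open>e\<close>.\<close>

lemma l2_integrator_step:
  fixes S S' :: "('a, complex) step_process"
  assumes X: "l2_integrator M F T X \<kappa>" and S: "simple_predictable M F T S" "simple_predictable M F T S'"
    and T: "0 \<le> T" and e: "0 \<le> e"
    and le: "\<And>t \<omega>. 0 < t \<Longrightarrow> t \<le> T \<Longrightarrow> \<omega> \<in> space M \<Longrightarrow> norm (step_value S t \<omega> - step_value S' t \<omega>) \<le> e"
  shows "l2norm M (\<lambda>\<omega>. step_integral S X T \<omega> - step_integral S' X T \<omega>) \<le> e * \<kappa>"
    and "sq_integrable M (step_integral S X T)"
proof -
  obtain x and m :: nat where x: "strict_mono_on {..m} x" "step_refinement x m S" "step_refinement x m S'"
    "x ` {..m} \<subseteq> {0..T}" "x 0 = 0" "x m = T"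
    using simple_predictable_refinement[OF S T] .
  have mono: "mono_on {..m} x" using x(1) by (rule strict_mono_on_imp_mono_on)
  have int: "step_integral S'' X T \<omega> = (\<Sum>c<m. (X (x (Suc c)) \<omega> - X (x c) \<omega>) *\<^sub>R step_value S'' (x (Suc c)) \<omega>)"
    if "step_refinement x m S''" for S'' :: "('a, complex) step_process" and \<omega>
    unfolding step_integral_refines[OF that]
    using x(4) by (intro sum.cong refl) (auto simp: image_subset_iff min_absorb1)
  \<comment> \<open>Strict monotonicity of the partition keeps every right end point positive; the
    hypothesis \<open>le\<close> says nothing at time 0.\<close>
  have "0 < x (Suc c) \<and> x (Suc c) \<le> T" if "c < m" for c
  proof -
    have "x c < x (Suc c)" using x(1) that by (auto simp: strict_mono_on_def)
    moreover have "0 \<le> x c" "x (Suc c) \<le> T" using x(4) that by (auto simp: image_subset_iff)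
    ultimately show ?thesis by simp
  qed
  then have "l2norm M (\<lambda>\<omega>. \<Sum>c<m. (X (x (Suc c)) \<omega> - X (x c) \<omega>) *\<^sub>R (step_value S (x (Suc c)) \<omega> - step_value S' (x (Suc c)) \<omega>)) \<le> e * \<kappa>"
    by (intro l2_integratorD(2)[OF X mono x(4)] borel_measurable_diff step_value_measurable S e le) (use x in auto)
  then show "l2norm M (\<lambda>\<omega>. step_integral S X T \<omega> - step_integral S' X T \<omega>) \<le> e * \<kappa>"
    unfolding int[OF x(2)] int[OF x(3)] by (simp add: sum_subtractf scaleR_diff_right)
  obtain C where C: "0 \<le> C" "\<And>t \<omega>. \<omega> \<in> space M \<Longrightarrow> norm (step_value S t \<omega>) \<le> C"
    using step_value_bounded[OF S(1)] by metis
  have "sq_integrable M (\<lambda>\<omega>. \<Sum>c<m. (X (x (Suc c)) \<omega> - X (x c) \<omega>) *\<^sub>R step_value S (x (Suc c)) \<omega>)"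
    by (intro l2_integratorD(1)[OF X mono x(4), where C=C] step_value_measurable S C) (use x in auto)
  moreover have "step_integral S X T = (\<lambda>\<omega>. \<Sum>c<m. (X (x (Suc c)) \<omega> - X (x c) \<omega>) *\<^sub>R step_value S (x (Suc c)) \<omega>)"
    by (rule ext) (rule int[OF x(2)])
  ultimately show "sq_integrable M (step_integral S X T)" by (simp only:)
qed

lemma mesh_step_error:
  fixes h :: "real \<Rightarrow> 'b::euclidean_space" and \<omega> :: 'c
  assumes T: "0 < T" and n: "0 < n" and L: "\<And>t u. norm (h t - h u) \<le> L * \<bar>t - u\<bar>" and t: "0 < t" "t \<le> T"
  shows "norm (step_value (mesh_step T n h) t \<omega> - h t) \<le> L * T / n"
proof -
  obtain q where q: "q < n" "mesh T n q < t" "t \<le> mesh T n (Suc q)" and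
    v: "\<And>h (\<omega> :: 'c). step_value (mesh_step T n h) t \<omega> = (h (mesh T n q) :: 'b)"
    using mesh_cell[OF T n t] by metis
  have "0 \<le> L" using order_trans[OF norm_ge_zero L[of 0 1]] by simp
  have "norm (h (mesh T n q) - h t) \<le> L * \<bar>mesh T n q - t\<bar>" by (rule L)
  also have "\<dots> \<le> L * (T / n)"
    using q mesh_Suc_diff[of T n q] \<open>0 \<le> L\<close> by (intro mult_left_mono) auto
  finally show ?thesis by (simp add: v)
qed

lemma unif_approx_mesh_step:
  fixes h :: "real \<Rightarrow> 'b::euclidean_space"
  assumes T: "0 < T" and L: "\<And>t u. norm (h t - h u) \<le> L * \<bar>t - u\<bar>"
  shows "unif_approx M F T (\<lambda>t _. h t) (\<lambda>n. mesh_step T n h)"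
  unfolding unif_approx_def
proof (intro conjI allI)
  show "simple_predictable M F T (mesh_step T n h)" for n
    using T by (intro simple_predictable_mesh_step) auto
  show "uniform_limit ({0<..T} \<times> space M) (\<lambda>n (t, \<omega>). step_value (mesh_step T n h) t \<omega>) (\<lambda>(t, \<omega>). h t) sequentially"
  proof (rule uniform_limitI)
    fix e :: real assume e: "0 < e"
    have "\<forall>\<^sub>F n in sequentially. L * T / real n < e"
      using order_tendstoD(2)[OF lim_const_over_n e] .
    then have "\<forall>\<^sub>F n in sequentially. L * T / real n < e \<and> 0 < n"
      using eventually_gt_at_top[of 0] by (rule eventually_conj)
    then show "\<forall>\<^sub>F n in sequentially. \<forall>z\<in>{0<..T} \<times> space M.
        dist (case z of (t, \<omega>) \<Rightarrow> step_value (mesh_step T n h) t \<omega>) (case z of (t, \<omega>) \<Rightarrow> h t) < e"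
    proof eventually_elim
      case (elim n)
      show ?case
      proof
        fix z assume z: "z \<in> {0<..T} \<times> space M"
        then obtain t \<omega> where t: "z = (t, \<omega>)" "0 < t" "t \<le> T" by auto
        have "norm (step_value (mesh_step T n h) t \<omega> - h t) \<le> L * T / n"
          using elim by (intro mesh_step_error[OF T _ L t(2,3)]) auto
        then show "dist (case z of (t, \<omega>) \<Rightarrow> step_value (mesh_step T n h) t \<omega>) (case z of (t, \<omega>) \<Rightarrow> h t) < e"
          using elim unfolding t by (simp add: dist_norm)
      qed
    qed
  qed
qed

text \<open>Dyadic meshes approximate a Lipschitz \<open>h\<close> at the geometric rate that
  \<open>l2_complete\<close> asks for. Comparison with them shows that every uniformly approximating
  sequence has the same limit, as \<open>has_stochastic_integral\<close> demands.\<close>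

lemma stochastic_integral_exists:
  fixes h :: "real \<Rightarrow> complex"
  assumes X: "l2_integrator M F T X \<kappa>" and T: "0 < T" and L: "\<And>t u. norm (h t - h u) \<le> L * \<bar>t - u\<bar>"
  obtains Z where "sq_integrable M Z" "has_stochastic_integral M F T X (\<lambda>t _. h t) Z"
    "(\<lambda>n. l2norm M (\<lambda>\<omega>. step_integral (mesh_step T n h) X T \<omega> - Z \<omega>)) \<longlonglongrightarrow> 0"
proof -
  let ?S = "\<lambda>n. mesh_step T n h :: ('a, complex) step_process"
  let ?Y = "\<lambda>j. step_integral (?S (2^j)) X T"
  have L0: "0 \<le> L" using order_trans[OF norm_ge_zero L[of 0 1]] by simp
  have \<kappa>: "0 \<le> \<kappa>" using X by (rule l2_integrator_nonneg)
  have sp: "simple_predictable M F T (?S n)" for n using T by (intro simple_predictable_mesh_step) auto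
  have err: "norm (step_value (?S (2^j)) t \<omega> - h t) \<le> L * T * (1/2)^j" if "0 < t" "t \<le> T" for j t \<omega>
    using mesh_step_error[OF T _ L that, of "2^j" \<omega>] by (simp add: power_divide)
  have sq: "sq_integrable M (step_integral S X T)" if "simple_predictable M F T S" for S :: "('a, complex) step_process"
    using T by (intro l2_integrator_step(2)[OF X that that, of 0]) auto
  have "l2norm M (\<lambda>\<omega>. ?Y i \<omega> - ?Y j \<omega>) \<le> (2 * (L * T) * \<kappa>) * (1/2)^i" if "i \<le> j" for i j
  proof -
    have "(1/2)^j \<le> (1/2 :: real)^i" using that by (intro power_decreasing) auto
    then have ij: "L * T * (1/2)^j \<le> L * T * (1/2)^i" using L0 T by (intro mult_left_mono) auto
    have "l2norm M (\<lambda>\<omega>. ?Y i \<omega> - ?Y j \<omega>) \<le> (2 * (L * T) * (1/2)^i) * \<kappa>"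
    proof (rule l2_integrator_step(1)[OF X sp sp])
      fix t \<omega> assume t: "0 < t" "t \<le> T"
      have "norm (step_value (?S (2^i)) t \<omega> - step_value (?S (2^j)) t \<omega>)
          \<le> norm (step_value (?S (2^i)) t \<omega> - h t) + norm (step_value (?S (2^j)) t \<omega> - h t)"
        using norm_triangle_ineq4[of "step_value (?S (2^i)) t \<omega> - h t" "step_value (?S (2^j)) t \<omega> - h t"] by simp
      then show "norm (step_value (?S (2^i)) t \<omega> - step_value (?S (2^j)) t \<omega>) \<le> 2 * (L * T) * (1/2)^i"
        using err[OF t, of i \<omega>] err[OF t, of j \<omega>] ij by linarith
    qed (use T L0 in auto)
    then show ?thesis by (simp add: ac_simps)
  qed
  then obtain Z where Z: "sq_integrable M Z" "\<And>i. l2norm M (\<lambda>\<omega>. ?Y i \<omega> - Z \<omega>) \<le> (2 * (L * T) * \<kappa>) * (1/2)^i"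
    using l2_complete[of ?Y "2 * (L * T) * \<kappa>", OF sq[OF sp]] \<kappa> L0 T by auto
  have conv: "(\<lambda>n. l2norm M (\<lambda>\<omega>. step_integral (S n) X T \<omega> - Z \<omega>)) \<longlonglongrightarrow> 0"
    if S: "unif_approx M F T (\<lambda>t _. h t) S" for S
  proof (rule tendstoI)
    fix e :: real assume e: "0 < e"
    have spS: "simple_predictable M F T (S n)" for n using S by (simp add: unif_approx_def)
    \<comment> \<open>\<open>\<kappa> + 1\<close> avoids division by zero and leaves
      \<open>d * \<kappa> \<le> e / 2\<close>.\<close>
    define d where "d = e / (2 * (\<kappa> + 1))"
    have d: "0 < d" "d * \<kappa> \<le> e / 2" using e \<kappa> by (auto simp: d_def field_simps)
    have "\<forall>\<^sub>F n in sequentially. \<forall>z\<in>{0<..T} \<times> space M.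
        dist (case z of (t, \<omega>) \<Rightarrow> step_value (S n) t \<omega>) (case z of (t, \<omega>) \<Rightarrow> h t) < d"
      using S d(1) unfolding unif_approx_def by (intro uniform_limitD) auto
    then show "\<forall>\<^sub>F n in sequentially. dist (l2norm M (\<lambda>\<omega>. step_integral (S n) X T \<omega> - Z \<omega>)) 0 < e"
    proof eventually_elim
      case (elim n)
      have b: "l2norm M (\<lambda>\<omega>. step_integral (S n) X T \<omega> - Z \<omega>) \<le> d * \<kappa> + 3 * (L * T) * \<kappa> * (1/2)^i" for i
      proof -
        have "l2norm M (\<lambda>\<omega>. step_integral (S n) X T \<omega> - ?Y i \<omega>) \<le> (d + L * T * (1/2)^i) * \<kappa>"
        proof (rule l2_integrator_step(1)[OF X spS sp])
          fix t \<omega> assume t: "0 < t" "t \<le> T" "\<omega> \<in> space M"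
          have "norm (step_value (S n) t \<omega> - h t) < d" using elim t by (force simp: dist_norm)
          moreover have "norm (step_value (S n) t \<omega> - step_value (?S (2^i)) t \<omega>)
              \<le> norm (step_value (S n) t \<omega> - h t) + norm (step_value (?S (2^i)) t \<omega> - h t)"
            using norm_triangle_ineq4[of "step_value (S n) t \<omega> - h t" "step_value (?S (2^i)) t \<omega> - h t"] by simp
          ultimately show "norm (step_value (S n) t \<omega> - step_value (?S (2^i)) t \<omega>) \<le> d + L * T * (1/2)^i"
            using err[OF t(1,2), of i \<omega>] by linarith
        qed (use T L0 d in auto)
        moreover have "l2norm M (\<lambda>\<omega>. step_integral (S n) X T \<omega> - Z \<omega>)
            \<le> l2norm M (\<lambda>\<omega>. step_integral (S n) X T \<omega> - ?Y i \<omega>) + l2norm M (\<lambda>\<omega>. ?Y i \<omega> - Z \<omega>)"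
          by (intro l2norm_triangle sq spS sp Z(1))
        ultimately show ?thesis using Z(2)[of i] by (simp add: algebra_simps)
      qed
      \<comment> \<open>With \<open>n\<close> fixed, the dyadic mesh used for comparison is refined
        until its own error disappears.\<close>
      have "(\<lambda>i. d * \<kappa> + 3 * (L * T) * \<kappa> * (1/2)^i) \<longlonglongrightarrow> d * \<kappa> + 3 * (L * T) * \<kappa> * 0"
        by (intro tendsto_intros LIMSEQ_realpow_zero) auto
      then have "l2norm M (\<lambda>\<omega>. step_integral (S n) X T \<omega> - Z \<omega>) \<le> d * \<kappa> + 3 * (L * T) * \<kappa> * 0"
        using b by (intro LIMSEQ_le_const) auto
      then show ?case using d e by simp
    qed
  qed
  have mesh: "unif_approx M F T (\<lambda>t _. h t) ?S" by (rule unif_approx_mesh_step[OF T L])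
  have "has_stochastic_integral M F T X (\<lambda>t _. h t) Z"
    unfolding has_stochastic_integral_def
  proof (intro conjI allI impI exI)
    show "unif_approx M F T (\<lambda>t _. h t) ?S" by (rule mesh)
    fix S assume S: "unif_approx M F T (\<lambda>t _. h t) S"
    then show "tendsto_in_prob M (\<lambda>n. step_integral (S n) X T) Z"
      by (intro l2_imp_tendsto_in_prob sq Z(1) conv) (auto simp: unif_approx_def)
  qed
  then show ?thesis using that Z(1) conv[OF mesh] by blast
qed

text \<open>The chosen value of \<open>stochastic_integral\<close> agrees almost surely with the
  \<open>L2\<close> limit constructed before, so the mesh sums converge to it in \<open>L2\<close>
  and not just in probability.\<close>

lemma stochastic_integral_mesh:
  fixes h :: "real \<Rightarrow> complex"
  assumes X: "l2_integrator M F T X \<kappa>" and T: "0 < T" and L: "\<And>t u. norm (h t - h u) \<le> L * \<bar>t - u\<bar>"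
  shows "sq_integrable M (stochastic_integral M F T X (\<lambda>t _. h t))"
    and "(\<lambda>n. l2norm M (\<lambda>\<omega>. step_integral (mesh_step T n h) X T \<omega> - stochastic_integral M F T X (\<lambda>t _. h t) \<omega>)) \<longlonglongrightarrow> 0"
proof -
  obtain Z where Z: "sq_integrable M Z" "has_stochastic_integral M F T X (\<lambda>t _. h t) Z"
    "(\<lambda>n. l2norm M (\<lambda>\<omega>. step_integral (mesh_step T n h) X T \<omega> - Z \<omega>)) \<longlonglongrightarrow> 0"
    using stochastic_integral_exists[OF X T L] .
  let ?Y = "stochastic_integral M F T X (\<lambda>t _. h t)"
  have Y: "has_stochastic_integral M F T X (\<lambda>t _. h t) ?Y"
    unfolding stochastic_integral_def
    by (rule someI[of "has_stochastic_integral M F T X (\<lambda>t _. h t)", OF Z(2)])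
  have mesh: "unif_approx M F T (\<lambda>t _. h t) (\<lambda>n. mesh_step T n h)" by (rule unif_approx_mesh_step[OF T L])
  have lim: "tendsto_in_prob M (\<lambda>n. step_integral (mesh_step T n h) X T) ?Y"
    "tendsto_in_prob M (\<lambda>n. step_integral (mesh_step T n h) X T) Z"
    using Y Z(2) mesh unfolding has_stochastic_integral_def by blast+
  have eq: "AE \<omega> in M. Z \<omega> = ?Y \<omega>"
    using tendsto_in_prob_unique[OF prob_space_axioms lim(2,1)] .
  have [measurable]: "?Y \<in> borel_measurable M" "Z \<in> borel_measurable M"
    "step_integral (mesh_step T n h) X T \<in> borel_measurable M" for n
    using lim by (auto simp: tendsto_in_prob_def)
  show "sq_integrable M ?Y" by (rule sq_integrable_cong_AE[OF eq Z(1)]) measurable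
  have "l2norm M (\<lambda>\<omega>. step_integral (mesh_step T n h) X T \<omega> - Z \<omega>) = l2norm M (\<lambda>\<omega>. step_integral (mesh_step T n h) X T \<omega> - ?Y \<omega>)" for n
    by (intro l2norm_cong_AE) (use eq in \<open>auto elim: eventually_mono\<close>)
  then show "(\<lambda>n. l2norm M (\<lambda>\<omega>. step_integral (mesh_step T n h) X T \<omega> - ?Y \<omega>)) \<longlonglongrightarrow> 0" using Z(3) by simp
qed

end

section \<open>Quadratic forms in Brownian increments\<close>

context usual_filtered_prob_space
begin

lemma brownian_motion_isometry:
  fixes v :: "nat \<Rightarrow> 'a \<Rightarrow> 'b::euclidean_space"
  assumes W: "brownian_motion M F T W" and x: "mono_on {..m} x" "x ` {..m} \<subseteq> {0..T}"
    and v: "\<And>c. c < m \<Longrightarrow> v c \<in> borel_measurable (F (x c))" "\<And>c. c < m \<Longrightarrow> sq_integrable M (v c)"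
  shows "sq_integrable M (\<lambda>\<omega>. \<Sum>c<m. (W (x (Suc c)) \<omega> - W (x c) \<omega>) *\<^sub>R v c \<omega>)"
    and "(l2norm M (\<lambda>\<omega>. \<Sum>c<m. (W (x (Suc c)) \<omega> - W (x c) \<omega>) *\<^sub>R v c \<omega>))\<^sup>2
      = (\<Sum>c<m. (x (Suc c) - x c) * (l2norm M (v c))\<^sup>2)"
proof -
  have mart: "l2_martingale M F T W" by (rule brownian_motion_l2_martingale[OF W])
  have xc: "0 \<le> x c" "x c \<le> x (Suc c)" "x (Suc c) \<le> T" if "c < m" for c
    using x(2) mono_onD[OF x(1), of c "Suc c"] that by (auto simp: image_subset_iff)
  have inc: "sq_integrable M (\<lambda>\<omega>. (W (x (Suc c)) \<omega> - W (x c) \<omega>) *\<^sub>R v c \<omega>)"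
    "(l2norm M (\<lambda>\<omega>. (W (x (Suc c)) \<omega> - W (x c) \<omega>) *\<^sub>R v c \<omega>))\<^sup>2 = (x (Suc c) - x c) * (l2norm M (v c))\<^sup>2"
    if "c < m" for c
    using brownian_motion_increment_scaleR[OF W xc[OF that] v(1)[OF that] v(2)[OF that]] by auto
  show "sq_integrable M (\<lambda>\<omega>. \<Sum>c<m. (W (x (Suc c)) \<omega> - W (x c) \<omega>) *\<^sub>R v c \<omega>)"
    by (intro sq_integrable_sum inc) auto
  have Wm: "W (x c) \<in> borel_measurable (F (x c))" if "c \<le> m" for c
    using mart x(2) that unfolding l2_martingale_def adapted_process_def by (auto simp: image_subset_iff)
  have "(l2norm M (\<lambda>\<omega>. \<Sum>c<m. (W (x (Suc c)) \<omega> - W (x c) \<omega>) *\<^sub>R v c \<omega>))\<^sup>2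
      = (\<Sum>c<m. (l2norm M (\<lambda>\<omega>. (W (x (Suc c)) \<omega> - W (x c) \<omega>) *\<^sub>R v c \<omega>))\<^sup>2)"
  proof (rule martingale_difference_isometry[where G="\<lambda>c. F (x c)"])
    show "(\<lambda>\<omega>. W (x (Suc c)) \<omega> - W (x c) \<omega>) \<in> borel_measurable (F (x (Suc c)))" if "c < m" for c
      using Wm[of "Suc c"] Wm[of c] measurable_F_mono[OF _ xc(2)[OF that]] that by (intro borel_measurable_diff) auto
    show "orth M (F (x c)) (\<lambda>\<omega>. W (x (Suc c)) \<omega> - W (x c) \<omega>)" if "c < m" for c
      using brownian_motion_increment(1)[OF W xc[OF that]] .
  qed (use partition_subalgebras[OF x] v inc in auto)
  also have "\<dots> = (\<Sum>c<m. (x (Suc c) - x c) * (l2norm M (v c))\<^sup>2)"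
    by (intro sum.cong refl inc(2)) auto
  finally show "(l2norm M (\<lambda>\<omega>. \<Sum>c<m. (W (x (Suc c)) \<omega> - W (x c) \<omega>) *\<^sub>R v c \<omega>))\<^sup>2
      = (\<Sum>c<m. (x (Suc c) - x c) * (l2norm M (v c))\<^sup>2)" .
qed

lemma bounded_coefficient:
  fixes u :: "'a \<Rightarrow> complex"
  assumes u: "sq_integrable M u" and \<eta>: "\<eta> \<in> borel_measurable M" "\<And>\<omega>. \<omega> \<in> space M \<Longrightarrow> \<bar>\<eta> \<omega>\<bar> \<le> C" and C: "0 \<le> C"
  shows "sq_integrable M (\<lambda>\<omega>. of_real (\<eta> \<omega>) * u \<omega>)" "l2norm M (\<lambda>\<omega>. of_real (\<eta> \<omega>) * u \<omega>) \<le> C * l2norm M u"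
proof -
  have m: "(\<lambda>\<omega>. of_real (\<eta> \<omega>) * u \<omega>) \<in> borel_measurable M"
    using \<eta>(1) u by (auto simp: sq_integrable_def)
  have le: "AE \<omega> in M. norm (of_real (\<eta> \<omega>) * u \<omega>) \<le> C * norm (u \<omega>)"
    using \<eta>(2) by (intro AE_I2) (auto simp: norm_mult intro!: mult_right_mono)
  show "sq_integrable M (\<lambda>\<omega>. of_real (\<eta> \<omega>) * u \<omega>)" by (rule sq_integrable_dominated[OF u m le])
  show "l2norm M (\<lambda>\<omega>. of_real (\<eta> \<omega>) * u \<omega>) \<le> C * l2norm M u" by (rule l2norm_dominated[OF u m C le])
qed

text \<open>For fixed \<open>c'\<close> the sum over \<open>c < c'\<close> is known at time
  \<open>x c'\<close>, so the double sum is an elementary integral against \<open>V\<close> whose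
  coefficients contain elementary integrals against \<open>W\<close>. Two isometries give the
  weighted square sum of \<open>K\<close>, with a factor \<open>C\<close> from each of
  \<open>\<xi>\<close> and \<open>\<eta>\<close>. The argument covers \<open>V = W\<close> and
  different motions alike.\<close>

lemma brownian_offdiagonal:
  fixes K :: "nat \<Rightarrow> nat \<Rightarrow> complex" and \<xi> \<eta> :: "nat \<Rightarrow> 'a \<Rightarrow> real"
  assumes W: "brownian_motion M F T W" "brownian_motion M F T V"
    and x: "mono_on {..m} x" "x ` {..m} \<subseteq> {0..T}"
    and \<xi>: "\<And>c. c < m \<Longrightarrow> \<xi> c \<in> borel_measurable (F (x c))" "\<And>c \<omega>. c < m \<Longrightarrow> \<omega> \<in> space M \<Longrightarrow> \<bar>\<xi> c \<omega>\<bar> \<le> C"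
    and \<eta>: "\<And>c. c < m \<Longrightarrow> \<eta> c \<in> borel_measurable (F (x c))" "\<And>c \<omega>. c < m \<Longrightarrow> \<omega> \<in> space M \<Longrightarrow> \<bar>\<eta> c \<omega>\<bar> \<le> C"
    and C: "0 \<le> C"
    and K: "(\<Sum>c<m. \<Sum>c'<m. (x (Suc c) - x c) * (x (Suc c') - x c') * (norm (K c c'))\<^sup>2) \<le> B"
  defines "S \<equiv> \<lambda>\<omega>. \<Sum>c'<m. \<Sum>c<c'. K c c' * of_real (\<xi> c \<omega> * (W (x (Suc c)) \<omega> - W (x c) \<omega>)) *
    of_real (\<eta> c' \<omega> * (V (x (Suc c')) \<omega> - V (x c') \<omega>))"
  shows "sq_integrable M S" "l2norm M S \<le> C\<^sup>2 * sqrt B"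
proof -
  define \<delta> where "\<delta> c = x (Suc c) - x c" for c
  have \<delta>: "0 \<le> \<delta> c" if "c < m" for c using mono_onD[OF x(1), of c "Suc c"] that by (auto simp: \<delta>_def)
  define A where "A c' \<omega> = (\<Sum>c<c'. (W (x (Suc c)) \<omega> - W (x c) \<omega>) *\<^sub>R (K c c' * of_real (\<xi> c \<omega>)))" for c' \<omega>
  define v where "v c' \<omega> = of_real (\<eta> c' \<omega>) * A c' \<omega>" for c' \<omega>
  have S_eq: "S = (\<lambda>\<omega>. \<Sum>c'<m. (V (x (Suc c')) \<omega> - V (x c') \<omega>) *\<^sub>R v c' \<omega>)"
    unfolding S_def v_def A_def
    by (simp only: sum_distrib_left sum_distrib_right scaleR_sum_right scaleR_conv_of_real of_real_mult ac_simps)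
  have \<xi>M: "\<xi> c \<in> borel_measurable M" "\<eta> c \<in> borel_measurable M" if "c < m" for c
    using measurable_F[OF \<xi>(1)[OF that]] measurable_F[OF \<eta>(1)[OF that]] x(2) that by (auto simp: image_subset_iff)
  have Kc: "sq_integrable M (\<lambda>\<omega>. K c c' * of_real (\<xi> c \<omega>))" "l2norm M (\<lambda>\<omega>. K c c' * of_real (\<xi> c \<omega>)) \<le> C * norm (K c c')"
    if "c < m" for c c'
  proof -
    have 1: "sq_integrable M (\<lambda>\<omega>. K c c')" using finite_measure_axioms by simp
    note * = bounded_coefficient[OF 1 \<xi>M(1)[OF that] \<xi>(2)[OF that] C]
    show "sq_integrable M (\<lambda>\<omega>. K c c' * of_real (\<xi> c \<omega>))" using *(1) by (simp add: mult.commute)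
    have "l2norm M (\<lambda>\<omega>. K c c') = norm (K c c')" by (simp add: l2norm_def prob_space)
    then show "l2norm M (\<lambda>\<omega>. K c c' * of_real (\<xi> c \<omega>)) \<le> C * norm (K c c')" using *(2) by (simp add: mult.commute)
  qed
  have A: "sq_integrable M (A c')" "(l2norm M (A c'))\<^sup>2 \<le> C\<^sup>2 * (\<Sum>c<m. \<delta> c * (norm (K c c'))\<^sup>2)"
    "A c' \<in> borel_measurable (F (x c'))" if c': "c' < m" for c'
  proof -
    have x': "mono_on {..c'} x" "x ` {..c'} \<subseteq> {0..T}"
      using x that by (auto intro: mono_on_subset)
    note * = brownian_motion_isometry[OF W(1) x', of "\<lambda>c \<omega>. K c c' * of_real (\<xi> c \<omega>)"]
    have prem: "c < c' \<Longrightarrow> (\<lambda>\<omega>. K c c' * of_real (\<xi> c \<omega>)) \<in> borel_measurable (F (x c))"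
      "c < c' \<Longrightarrow> sq_integrable M (\<lambda>\<omega>. K c c' * of_real (\<xi> c \<omega>))" for c
      using \<xi>(1)[of c] Kc(1)[of c c'] that by auto
    show "sq_integrable M (A c')" using *(1)[OF prem] unfolding A_def .
    have "(l2norm M (A c'))\<^sup>2 = (\<Sum>c<c'. \<delta> c * (l2norm M (\<lambda>\<omega>. K c c' * of_real (\<xi> c \<omega>)))\<^sup>2)"
      using *(2)[OF prem] unfolding A_def \<delta>_def .
    also have "\<dots> \<le> (\<Sum>c<c'. \<delta> c * (C * norm (K c c'))\<^sup>2)"
      using that \<delta> by (intro sum_mono mult_left_mono power_mono Kc(2)) auto
    also have "\<dots> \<le> (\<Sum>c<m. \<delta> c * (C * norm (K c c'))\<^sup>2)"
      using that \<delta> by (intro sum_mono2) auto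
    also have "\<dots> = C\<^sup>2 * (\<Sum>c<m. \<delta> c * (norm (K c c'))\<^sup>2)"
      by (simp add: sum_distrib_left power_mult_distrib ac_simps)
    finally show "(l2norm M (A c'))\<^sup>2 \<le> C\<^sup>2 * (\<Sum>c<m. \<delta> c * (norm (K c c'))\<^sup>2)" .
    show "A c' \<in> borel_measurable (F (x c'))"
      unfolding A_def
    proof (intro borel_measurable_sum borel_measurable_scaleR)
      fix c assume "c \<in> {..<c'}"
      then have c: "c < c'" by simp
      have xc: "x c \<le> x c'" "x (Suc c) \<le> x c'" "x c \<in> {0..T}" "x (Suc c) \<in> {0..T}"
        using mono_onD[OF x(1), of c c'] mono_onD[OF x(1), of "Suc c" c'] c c' x(2) by (auto simp: image_subset_iff)
      have ad: "W t \<in> borel_measurable (F t)" if "t \<in> {0..T}" for t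
        using W(1) that by (auto simp: brownian_motion_def adapted_process_def)
      show "(\<lambda>\<omega>. W (x (Suc c)) \<omega> - W (x c) \<omega>) \<in> borel_measurable (F (x c'))"
        by (intro borel_measurable_diff measurable_F_mono[OF ad] xc)
      show "(\<lambda>\<omega>. K c c' * of_real (\<xi> c \<omega>)) \<in> borel_measurable (F (x c'))"
        using measurable_F_mono[OF \<xi>(1) xc(1)] c c' by simp
    qed
  qed
  have v: "v c' \<in> borel_measurable (F (x c'))" "sq_integrable M (v c')" "l2norm M (v c') \<le> C * l2norm M (A c')" if "c' < m" for c'
  proof -
    show "v c' \<in> borel_measurable (F (x c'))"
      unfolding v_def using A(3)[OF that] \<eta>(1)[OF that] by simp
    note * = bounded_coefficient[OF A(1)[OF that] \<xi>M(2)[OF that] \<eta>(2)[OF that] C]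
    show "sq_integrable M (v c')" "l2norm M (v c') \<le> C * l2norm M (A c')"
      using * unfolding v_def by auto
  qed
  note iso = brownian_motion_isometry[OF W(2) x v(1,2)]
  show "sq_integrable M S" unfolding S_eq by (rule iso(1))
  have "(l2norm M S)\<^sup>2 = (\<Sum>c'<m. \<delta> c' * (l2norm M (v c'))\<^sup>2)" unfolding S_eq \<delta>_def by (rule iso(2))
  also have "\<dots> \<le> (\<Sum>c'<m. \<delta> c' * (C\<^sup>2 * (C\<^sup>2 * (\<Sum>c<m. \<delta> c * (norm (K c c'))\<^sup>2))))"
  proof (intro sum_mono mult_left_mono)
    fix c' assume "c' \<in> {..<m}"
    then have c': "c' < m" by simp
    have "(l2norm M (v c'))\<^sup>2 \<le> (C * l2norm M (A c'))\<^sup>2" using v(3)[OF c'] by (intro power_mono) auto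
    also have "\<dots> \<le> C\<^sup>2 * (C\<^sup>2 * (\<Sum>c<m. \<delta> c * (norm (K c c'))\<^sup>2))"
      unfolding power_mult_distrib by (intro mult_left_mono A(2) c') auto
    finally show "(l2norm M (v c'))\<^sup>2 \<le> C\<^sup>2 * (C\<^sup>2 * (\<Sum>c<m. \<delta> c * (norm (K c c'))\<^sup>2))" .
  qed (use \<delta> in auto)
  also have "\<dots> = (C\<^sup>2 * C\<^sup>2) * (\<Sum>c'<m. \<Sum>c<m. \<delta> c * \<delta> c' * (norm (K c c'))\<^sup>2)"
    by (simp only: sum_distrib_left ac_simps)
  also have "\<dots> = (C\<^sup>2 * C\<^sup>2) * (\<Sum>c<m. \<Sum>c'<m. \<delta> c * \<delta> c' * (norm (K c c'))\<^sup>2)"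
    by (subst sum.swap) rule
  also have "\<dots> \<le> (C\<^sup>2 * C\<^sup>2) * B" using K unfolding \<delta>_def by (intro mult_left_mono) auto
  finally have "(l2norm M S)\<^sup>2 \<le> (C\<^sup>2 * C\<^sup>2) * B" .
  then have "sqrt ((l2norm M S)\<^sup>2) \<le> sqrt ((C\<^sup>2 * C\<^sup>2) * B)" by (rule real_sqrt_le_mono)
  also have "\<dots> = C\<^sup>2 * sqrt B"
    by (simp only: real_sqrt_mult real_sqrt_mult_self abs_power2)
  finally show "l2norm M S \<le> C\<^sup>2 * sqrt B" by simp
qed

text \<open>For \<open>l = l'\<close> the normal moments give \<open>3 - 2 + 1 = 2\<close> times
  \<open>(t - s)\<^sup>2\<close> as the second moment; for different motions it factors into
  \<open>(t - s)\<^sup>2\<close>. The constant 2 serves both cases.\<close>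

lemma brownian_covariation_increment:
  assumes W: "independent_brownian_motions M F T L W" and l: "l \<in> L" "l' \<in> L"
    and st: "0 \<le> s" "s \<le> t" "t \<le> T"
  defines "U \<equiv> \<lambda>\<omega>. (W l t \<omega> - W l s \<omega>) * (W l' t \<omega> - W l' s \<omega>) - (if l = l' then t - s else 0)"
  shows "orth M (F s) U" "sq_integrable M U" "(l2norm M U)\<^sup>2 \<le> 2 * (t - s)\<^sup>2"
proof -
  have "orth M (F s) U \<and> sq_integrable M U \<and> (l2norm M U)\<^sup>2 \<le> 2 * (t - s)\<^sup>2"
  proof (cases "l = l'")
    case True
    have bm: "brownian_motion M F T (W l)" using W l by (simp add: independent_brownian_motions_def)
    let ?D = "\<lambda>\<omega>. W l t \<omega> - W l s \<omega>"
    have U: "U = (\<lambda>\<omega>. (?D \<omega>)\<^sup>2 - (t - s))" using True by (simp add: U_def power2_eq_square)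
    have sq: "sq_integrable M U"
      unfolding U using brownian_motion_increment(4)[OF bm st] finite_measure_axioms
      by (intro sq_integrable_diff sq_integrable_const)
    note mom = brownian_motion_moments[OF bm st]
    have sqid: "(y\<^sup>2 - e)\<^sup>2 = y ^ 4 - 2 * e * y\<^sup>2 + e\<^sup>2" for y e :: real
      by (simp add: power2_eq_square power4_eq_xxxx algebra_simps)
    have "(l2norm M U)\<^sup>2 = expectation (\<lambda>\<omega>. ?D \<omega> ^ 4 - 2 * (t - s) * (?D \<omega>)\<^sup>2 + (t - s)\<^sup>2)"
      unfolding l2norm_power2 U real_norm_def power2_abs sqid ..
    also have "\<dots> = 3 * (t - s)\<^sup>2 - 2 * (t - s) * (t - s) + (t - s)\<^sup>2"
      using mom(1)[of 4] mom(1)[of 2] mom(3,4) by (simp add: prob_space)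
    also have "\<dots> = 2 * (t - s)\<^sup>2" by (simp add: power2_eq_square)
    finally show ?thesis using sq brownian_motion_increment(2)[OF bm st] unfolding U by simp
  next
    case False
    have U: "U = (\<lambda>\<omega>. (W l t \<omega> - W l s \<omega>) * (W l' t \<omega> - W l' s \<omega>))" using False by (simp add: U_def)
    have bm: "brownian_motion M F T (W l)" "brownian_motion M F T (W l')"
      using W l by (auto simp: independent_brownian_motions_def)
    have "(l2norm M U)\<^sup>2 = expectation (\<lambda>\<omega>. ((W l t \<omega> - W l s \<omega>) * (W l t \<omega> - W l s \<omega>)) * ((W l' t \<omega> - W l' s \<omega>) * (W l' t \<omega> - W l' s \<omega>)))"
      unfolding l2norm_power2 U
      by (intro Bochner_Integration.integral_cong refl) (simp add: power2_eq_square ac_simps)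
    also have "\<dots> = expectation (\<lambda>\<omega>. (W l t \<omega> - W l s \<omega>) * (W l t \<omega> - W l s \<omega>)) * expectation (\<lambda>\<omega>. (W l' t \<omega> - W l' s \<omega>) * (W l' t \<omega> - W l' s \<omega>))"
      using st by (intro independent_brownian_motions_increments(2)[OF W l False]) auto
    also have "\<dots> = (t - s)\<^sup>2"
      using brownian_motion_moments(3)[OF bm(1) st] brownian_motion_moments(3)[OF bm(2) st]
      by (simp add: power2_eq_square)
    finally have "(l2norm M U)\<^sup>2 \<le> 2 * (t - s)\<^sup>2" by simp
    then show ?thesis
      using independent_brownian_motions_orth[OF W l False st] unfolding U by simp
  qed
  then show "orth M (F s) U" "sq_integrable M U" "(l2norm M U)\<^sup>2 \<le> 2 * (t - s)\<^sup>2" by auto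
qed

text \<open>The compensated products are martingale differences, so their second moments add up, and
  the total is governed by the sum of the squared cell lengths, which is small with the mesh
  size.\<close>

lemma brownian_diagonal:
  fixes k :: "nat \<Rightarrow> complex" and \<xi> \<eta> :: "nat \<Rightarrow> 'a \<Rightarrow> real"
  assumes W: "independent_brownian_motions M F T L W" and l: "l \<in> L" "l' \<in> L"
    and x: "mono_on {..m} x" "x ` {..m} \<subseteq> {0..T}"
    and \<xi>: "\<And>c. c < m \<Longrightarrow> \<xi> c \<in> borel_measurable (F (x c))" "\<And>c \<omega>. c < m \<Longrightarrow> \<omega> \<in> space M \<Longrightarrow> \<bar>\<xi> c \<omega>\<bar> \<le> C"
    and \<eta>: "\<And>c. c < m \<Longrightarrow> \<eta> c \<in> borel_measurable (F (x c))" "\<And>c \<omega>. c < m \<Longrightarrow> \<omega> \<in> space M \<Longrightarrow> \<bar>\<eta> c \<omega>\<bar> \<le> C"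
    and C: "0 \<le> C" and k: "\<And>c. c < m \<Longrightarrow> norm (k c) \<le> 1"
  defines "U \<equiv> \<lambda>c \<omega>. (W l (x (Suc c)) \<omega> - W l (x c) \<omega>) * (W l' (x (Suc c)) \<omega> - W l' (x c) \<omega>) - (if l = l' then x (Suc c) - x c else 0)"
  defines "S \<equiv> \<lambda>\<omega>. \<Sum>c<m. U c \<omega> *\<^sub>R (k c * of_real (\<xi> c \<omega> * \<eta> c \<omega>))"
  shows "sq_integrable M S" "l2norm M S \<le> C\<^sup>2 * sqrt (2 * (\<Sum>c<m. (x (Suc c) - x c)\<^sup>2))"
proof -
  have xc: "0 \<le> x c" "x c \<le> x (Suc c)" "x (Suc c) \<le> T" if "c < m" for c
    using x(2) mono_onD[OF x(1), of c "Suc c"] that by (auto simp: image_subset_iff)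
  have U: "orth M (F (x c)) (U c)" "sq_integrable M (U c)" "(l2norm M (U c))\<^sup>2 \<le> 2 * (x (Suc c) - x c)\<^sup>2" if "c < m" for c
    using brownian_covariation_increment[OF W l xc[OF that]] unfolding U_def by auto
  have ad: "W i t \<in> borel_measurable (F t)" if "t \<in> {0..T}" "i \<in> L" for t i
    using W that by (auto simp: independent_brownian_motions_def brownian_motion_def adapted_process_def)
  have Um: "U c \<in> borel_measurable (F (x (Suc c)))" if "c < m" for c
  proof -
    have "W i (x (Suc c)) \<in> borel_measurable (F (x (Suc c)))" "W i (x c) \<in> borel_measurable (F (x (Suc c)))" if "i \<in> L" for i
      using ad[of "x (Suc c)" i] measurable_F_mono[OF ad[of "x c" i], of "x (Suc c)"] xc[OF \<open>c < m\<close>] that by auto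
    then show ?thesis unfolding U_def using l by (intro borel_measurable_diff borel_measurable_times) auto
  qed
  let ?v = "\<lambda>c \<omega>. k c * of_real (\<xi> c \<omega> * \<eta> c \<omega>)"
  have v: "?v c \<in> borel_measurable (F (x c))" if "c < m" for c using \<xi>(1)[OF that] \<eta>(1)[OF that] by simp
  have vM: "?v c \<in> borel_measurable M" if "c < m" for c
    using measurable_F[OF v[OF that]] xc[OF that] by auto
  have le: "AE \<omega> in M. norm (U c \<omega> *\<^sub>R ?v c \<omega>) \<le> C\<^sup>2 * norm (U c \<omega>)" if c: "c < m" for c
  proof (intro AE_I2)
    fix \<omega> assume \<omega>: "\<omega> \<in> space M"
    have "norm (?v c \<omega>) \<le> 1 * (C * C)"
      unfolding norm_mult norm_of_real abs_mult using k[OF c] \<xi>(2)[OF c \<omega>] \<eta>(2)[OF c \<omega>] C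
      by (intro mult_mono) auto
    then show "norm (U c \<omega> *\<^sub>R ?v c \<omega>) \<le> C\<^sup>2 * norm (U c \<omega>)"
      by (simp only: norm_scaleR real_norm_def power2_eq_square mult_1 mult.commute[of "C * C"]) (rule mult_left_mono, auto)
  qed
  have Uv: "sq_integrable M (\<lambda>\<omega>. U c \<omega> *\<^sub>R ?v c \<omega>)" "l2norm M (\<lambda>\<omega>. U c \<omega> *\<^sub>R ?v c \<omega>) \<le> C\<^sup>2 * l2norm M (U c)" if c: "c < m" for c
  proof -
    have m: "(\<lambda>\<omega>. U c \<omega> *\<^sub>R ?v c \<omega>) \<in> borel_measurable M"
      using U(2)[OF c] vM[OF c] by (intro borel_measurable_scaleR) (auto simp: sq_integrable_def)
    show "sq_integrable M (\<lambda>\<omega>. U c \<omega> *\<^sub>R ?v c \<omega>)" by (rule sq_integrable_dominated[OF U(2)[OF c] m le[OF c]])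
    show "l2norm M (\<lambda>\<omega>. U c \<omega> *\<^sub>R ?v c \<omega>) \<le> C\<^sup>2 * l2norm M (U c)" by (rule l2norm_dominated[OF U(2)[OF c] m _ le[OF c]]) simp
  qed
  show "sq_integrable M S" unfolding S_def by (intro sq_integrable_sum Uv) auto
  have "(l2norm M S)\<^sup>2 = (\<Sum>c<m. (l2norm M (\<lambda>\<omega>. U c \<omega> *\<^sub>R ?v c \<omega>))\<^sup>2)"
    unfolding S_def
    by (rule martingale_difference_isometry[where G="\<lambda>c. F (x c)"])
      (use partition_subalgebras[OF x] U(1) Um v Uv(1) in auto)
  also have "\<dots> \<le> (\<Sum>c<m. (C\<^sup>2)\<^sup>2 * (2 * (x (Suc c) - x c)\<^sup>2))"
  proof (intro sum_mono)
    fix c assume "c \<in> {..<m}"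
    then have c: "c < m" by simp
    have "(l2norm M (\<lambda>\<omega>. U c \<omega> *\<^sub>R ?v c \<omega>))\<^sup>2 \<le> (C\<^sup>2 * l2norm M (U c))\<^sup>2" using Uv(2)[OF c] by (intro power_mono) auto
    also have "\<dots> \<le> (C\<^sup>2)\<^sup>2 * (2 * (x (Suc c) - x c)\<^sup>2)"
      unfolding power_mult_distrib by (intro mult_left_mono U(3) c) auto
    finally show "(l2norm M (\<lambda>\<omega>. U c \<omega> *\<^sub>R ?v c \<omega>))\<^sup>2 \<le> (C\<^sup>2)\<^sup>2 * (2 * (x (Suc c) - x c)\<^sup>2)" .
  qed
  also have "\<dots> = (C\<^sup>2)\<^sup>2 * (2 * (\<Sum>c<m. (x (Suc c) - x c)\<^sup>2))"
    by (simp only: sum_distrib_left)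
  finally have "sqrt ((l2norm M S)\<^sup>2) \<le> sqrt ((C\<^sup>2)\<^sup>2 * (2 * (\<Sum>c<m. (x (Suc c) - x c)\<^sup>2)))" by (rule real_sqrt_le_mono)
  also have "\<dots> = C\<^sup>2 * sqrt (2 * (\<Sum>c<m. (x (Suc c) - x c)\<^sup>2))"
    unfolding real_sqrt_mult[of "(C\<^sup>2)\<^sup>2"] real_sqrt_abs by simp
  finally show "l2norm M S \<le> C\<^sup>2 * sqrt (2 * (\<Sum>c<m. (x (Suc c) - x c)\<^sup>2))" by simp
qed

text \<open>The subtracted sum is the compensator of the diagonal, present only when the two motions
  are the same. What remains is one diagonal fluctuation and two triangles; the second triangle is
  the first with the motions exchanged and the kernel transposed.\<close>

lemma brownian_bilinear_estimate:
  fixes K :: "nat \<Rightarrow> nat \<Rightarrow> complex" and \<xi> \<eta> :: "nat \<Rightarrow> 'a \<Rightarrow> real"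
  assumes W: "independent_brownian_motions M F T L W" and l: "l \<in> L" "l' \<in> L"
    and x: "mono_on {..m} x" "x ` {..m} \<subseteq> {0..T}"
    and \<xi>: "\<And>c. c < m \<Longrightarrow> \<xi> c \<in> borel_measurable (F (x c))" "\<And>c \<omega>. c < m \<Longrightarrow> \<omega> \<in> space M \<Longrightarrow> \<bar>\<xi> c \<omega>\<bar> \<le> C"
    and \<eta>: "\<And>c. c < m \<Longrightarrow> \<eta> c \<in> borel_measurable (F (x c))" "\<And>c \<omega>. c < m \<Longrightarrow> \<omega> \<in> space M \<Longrightarrow> \<bar>\<eta> c \<omega>\<bar> \<le> C"
    and C: "0 \<le> C"
    and K: "(\<Sum>c<m. \<Sum>c'<m. (x (Suc c) - x c) * (x (Suc c') - x c') * (norm (K c c'))\<^sup>2) \<le> B"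
    and K1: "\<And>c. c < m \<Longrightarrow> norm (K c c) \<le> 1"
  defines "R \<equiv> \<lambda>\<omega>. (\<Sum>c<m. \<Sum>c'<m. K c c' * of_real (\<xi> c \<omega> * (W l (x (Suc c)) \<omega> - W l (x c) \<omega>)) *
      of_real (\<eta> c' \<omega> * (W l' (x (Suc c')) \<omega> - W l' (x c') \<omega>))) -
    (if l = l' then \<Sum>c<m. K c c * of_real ((x (Suc c) - x c) * (\<xi> c \<omega> * \<eta> c \<omega>)) else 0)"
  shows "sq_integrable M R" "l2norm M R \<le> C\<^sup>2 * (sqrt (2 * (\<Sum>c<m. (x (Suc c) - x c)\<^sup>2)) + 2 * sqrt B)"
proof -
  have bm: "brownian_motion M F T (W l)" "brownian_motion M F T (W l')"
    using W l by (auto simp: independent_brownian_motions_def)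
  let ?Z = "\<lambda>c \<omega>. W l (x (Suc c)) \<omega> - W l (x c) \<omega>" and ?V = "\<lambda>c \<omega>. W l' (x (Suc c)) \<omega> - W l' (x c) \<omega>"
  let ?f = "\<lambda>\<omega> c c'. K c c' * of_real (\<xi> c \<omega> * ?Z c \<omega>) * of_real (\<eta> c' \<omega> * ?V c' \<omega>)"
  define D where "D \<omega> = (\<Sum>c<m. (?Z c \<omega> * ?V c \<omega> - (if l = l' then x (Suc c) - x c else 0)) *\<^sub>R (K c c * of_real (\<xi> c \<omega> * \<eta> c \<omega>)))" for \<omega>
  define O1 where "O1 \<omega> = (\<Sum>c'<m. \<Sum>c<c'. ?f \<omega> c c')" for \<omega>
  define O2 where "O2 \<omega> = (\<Sum>c'<m. \<Sum>c<c'. K c' c * of_real (\<eta> c \<omega> * ?V c \<omega>) * of_real (\<xi> c' \<omega> * ?Z c' \<omega>))" for \<omega>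
  have K': "(\<Sum>c<m. \<Sum>c'<m. (x (Suc c) - x c) * (x (Suc c') - x c') * (norm (K c' c))\<^sup>2) \<le> B"
    using K by (subst sum.swap) (simp add: mult.commute)
  note O1 = brownian_offdiagonal[OF bm(1) bm(2) x \<xi> \<eta> C K, folded O1_def]
  note O2 = brownian_offdiagonal[where K="\<lambda>c c'. K c' c", OF bm(2) bm(1) x \<eta> \<xi> C K', folded O2_def]
  note D = brownian_diagonal[where k="\<lambda>c. K c c", OF W l x \<xi> \<eta> C K1, folded D_def]
  have "R \<omega> = D \<omega> + (O1 \<omega> + O2 \<omega>)" for \<omega>
  proof -
    have O2': "O2 \<omega> = (\<Sum>q<m. \<Sum>r<q. ?f \<omega> q r)" unfolding O2_def by (simp only: ac_simps)
    have "(\<Sum>c<m. ?f \<omega> c c) - (if l = l' then \<Sum>c<m. K c c * of_real ((x (Suc c) - x c) * (\<xi> c \<omega> * \<eta> c \<omega>)) else 0) = D \<omega>"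
      by (cases "l = l'") (simp_all add: D_def sum_subtractf[symmetric] scaleR_conv_of_real algebra_simps)
    then show ?thesis unfolding R_def sum_double_split O1_def[symmetric] O2'[symmetric] by (simp add: algebra_simps)
  qed
  then have R: "R = (\<lambda>\<omega>. D \<omega> + (O1 \<omega> + O2 \<omega>))" by (simp add: fun_eq_iff)
  have sq: "sq_integrable M D" "sq_integrable M O1" "sq_integrable M O2" using D O1 O2 by auto
  show "sq_integrable M R" unfolding R by (intro sq_integrable_add sq)
  have "l2norm M R \<le> l2norm M D + (l2norm M O1 + l2norm M O2)"
    unfolding R by (rule order_trans[OF l2norm_add_le add_left_mono[OF l2norm_add_le]]) (intro sq sq_integrable_add)+
  then show "l2norm M R \<le> C\<^sup>2 * (sqrt (2 * (\<Sum>c<m. (x (Suc c) - x c)\<^sup>2)) + 2 * sqrt B)"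
    using D(2) O1(2) O2(2) by (simp add: algebra_simps)
qed

end

section \<open>Fourier characters on a uniform mesh\<close>

definition fourier_char :: "int \<Rightarrow> real \<Rightarrow> complex" where
  "fourier_char k t = exp (- \<i> * of_int k * of_real t)"

lemma norm_fourier_char [simp]: "norm (fourier_char k t) = 1"
proof -
  have "fourier_char k t = exp (\<i> * of_real (- (real_of_int k * t)))"
    by (simp add: fourier_char_def mult_ac)
  then show ?thesis by (simp only: norm_exp_i_times)
qed

lemma fourier_char_add: "fourier_char (j + k) t = fourier_char j t * fourier_char k t"
  by (simp add: fourier_char_def algebra_simps exp_add[symmetric] exp_diff exp_minus field_simps)

lemma cnj_fourier_char: "cnj (fourier_char k t) = fourier_char (- k) t"
  by (simp add: fourier_char_def exp_cnj)

lemma fourier_char_zero [simp]: "fourier_char 0 t = 1"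
  by (simp add: fourier_char_def)

text \<open>Factoring out a character, which has modulus 1, leaves the elementary bound of
  \<open>exp (\<i> * y) - 1\<close> by \<open>\<bar>y\<bar>\<close>.\<close>

lemma fourier_char_Lipschitz: "norm (fourier_char k t - fourier_char k u) \<le> \<bar>of_int k\<bar> * \<bar>t - u\<bar>"
proof -
  have eq: "fourier_char k t = exp (\<i> * of_real (- (real_of_int k * t)))" for t
    by (simp add: fourier_char_def mult_ac)
  have 1: "norm (exp (\<i> * of_real y) - 1) \<le> \<bar>y\<bar>" for y :: real
    using iexp_approx1[of y 0] by simp
  have "fourier_char k t - fourier_char k u = fourier_char k u * (exp (\<i> * of_real (real_of_int k * (u - t))) - 1)"
    unfolding eq right_diff_distrib exp_add[symmetric] by (simp add: algebra_simps)
  then have "norm (fourier_char k t - fourier_char k u) = norm (exp (\<i> * of_real (real_of_int k * (u - t))) - 1)"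
    by (simp only: norm_mult norm_fourier_char mult_1)
  also have "\<dots> \<le> \<bar>real_of_int k * (u - t)\<bar>" by (rule 1)
  finally show ?thesis by (simp add: abs_mult abs_minus_commute)
qed

lemma fourier_char_measurable [measurable]: "fourier_char k \<in> borel_measurable borel"
  unfolding fourier_char_def by measurable

text \<open>A geometric series in an \<open>n\<close>-th root of unity, which differs from 1 because
  a nonzero \<open>j\<close> with \<open>\<bar>j\<bar> < n\<close> is not a multiple of
  \<open>n\<close>.\<close>

lemma sum_fourier_char_mesh:
  assumes "\<bar>j\<bar> < int n"
  shows "(\<Sum>q<n. fourier_char j (mesh (2 * pi) n q)) = (if j = 0 then of_nat n else 0)"
proof (cases "j = 0")
  case False
  have n: "0 < n" using assms False by auto
  define w where "w = exp (- \<i> * of_int j * of_real (2 * pi / n))"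
  have pw: "fourier_char j (mesh (2 * pi) n q) = w ^ q" for q
    unfolding w_def fourier_char_def mesh_def exp_of_nat_mult[symmetric]
    by (simp add: mult_ac)
  have wn: "w ^ n = 1"
  proof -
    have "w ^ n = exp (of_nat n * (- \<i> * of_int j * of_real (2 * pi / n)))"
      unfolding w_def by (rule exp_of_nat_mult[symmetric])
    also have "of_nat n * (- \<i> * of_int j * of_real (2 * pi / n)) = of_int (2 * (- j)) * of_real pi * \<i>"
      using n by simp
    also have "exp \<dots> = 1" unfolding exp_eq_1 by (auto intro: exI[of _ "- j"])
    finally show ?thesis .
  qed
  have "w \<noteq> 1"
  proof
    assume "w = 1"
    then obtain i :: int where "Im (- \<i> * of_int j * of_real (2 * pi / n)) = of_int (2 * i) * pi"
      unfolding w_def exp_eq_1 by auto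
    then have "- (real_of_int j * (2 * pi / n)) = of_int (2 * i) * pi" by simp
    then have "pi * (- real_of_int j) = pi * (real_of_int i * n)" using n by (simp add: field_simps)
    then have "- real_of_int j = real_of_int i * n" by (simp only: mult_cancel_left pi_neq_zero simp_thms)
    then have "real_of_int (- j) = real_of_int (i * int n)" by simp
    then have ji: "- j = i * int n" by (simp only: of_int_eq_iff)
    then have "i \<noteq> 0" using False by auto
    then have "1 \<le> \<bar>i\<bar>" by linarith
    then have "1 * int n \<le> \<bar>i\<bar> * int n" by (intro mult_right_mono) auto
    then have "int n \<le> \<bar>i\<bar> * int n" by simp
    then show False using ji assms by (metis abs_minus_cancel abs_mult abs_of_nat not_le)
  qed
  then show ?thesis using False wn by (simp add: pw geometric_sum)
qed simp

lemma fourier_char_mesh_orthogonal: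
  assumes "\<bar>s - s'\<bar> < int n"
  shows "(\<Sum>q<n. fourier_char s (mesh (2 * pi) n q) * cnj (fourier_char s' (mesh (2 * pi) n q))) = (if s = s' then of_nat n else 0)"
  using sum_fourier_char_mesh[OF assms] by (simp add: cnj_fourier_char fourier_char_add[symmetric])

text \<open>The squared norm of \<open>a\<close> minus its projection is nonnegative, and by
  orthogonality on the mesh it equals the difference of the two sides divided by
  \<open>n\<close>.\<close>

lemma Bessel_mesh:
  fixes a :: "nat \<Rightarrow> complex"
  assumes A: "finite A" "\<And>s s'. s \<in> A \<Longrightarrow> s' \<in> A \<Longrightarrow> \<bar>s - s'\<bar> < int n" and n: "0 < n"
  shows "(\<Sum>s\<in>A. (norm (\<Sum>q<n. a q * fourier_char s (mesh (2 * pi) n q)))\<^sup>2) \<le> n * (\<Sum>q<n. (norm (a q))\<^sup>2)"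
proof -
  let ?e = "\<lambda>s q. fourier_char s (mesh (2 * pi) n q)"
  define h where "h s = (\<Sum>q<n. a q * ?e s q)" for s
  \<comment> \<open>Orthogonal projection of \<open>a\<close> on the span of the conjugate
    characters; each of them has squared norm \<open>n\<close> on the mesh.\<close>
  define b where "b q = (\<Sum>s\<in>A. h s * cnj (?e s q)) / n" for q
  have cn: "of_nat n \<noteq> (0::complex)" using n by simp
  have ab: "(\<Sum>q<n. a q * cnj (b q)) = (\<Sum>s\<in>A. h s * cnj (h s)) / n"
  proof -
    have "(\<Sum>q<n. a q * cnj (b q)) = (\<Sum>q<n. \<Sum>s\<in>A. (a q * ?e s q) * cnj (h s) / n)"
      unfolding b_def by (simp add: sum_distrib_left sum_divide_distrib ac_simps)
    also have "\<dots> = (\<Sum>s\<in>A. \<Sum>q<n. (a q * ?e s q) * cnj (h s) / n)" by (rule sum.swap)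
    also have "\<dots> = (\<Sum>s\<in>A. h s * cnj (h s) / n)"
      by (intro sum.cong refl) (simp only: h_def sum_divide_distrib[symmetric] sum_distrib_right[symmetric])
    finally show ?thesis by (simp add: sum_divide_distrib)
  qed
  have bb: "(\<Sum>q<n. b q * cnj (b q)) = (\<Sum>s\<in>A. h s * cnj (h s)) / n"
  proof -
    have "(\<Sum>q<n. b q * cnj (b q)) = (\<Sum>q<n. \<Sum>s\<in>A. \<Sum>s'\<in>A. h s * cnj (h s') / (of_nat n * of_nat n) * (?e s' q * cnj (?e s q)))"
      unfolding b_def by (simp add: sum_product sum_divide_distrib ac_simps)
    also have "\<dots> = (\<Sum>s\<in>A. \<Sum>s'\<in>A. \<Sum>q<n. h s * cnj (h s') / (of_nat n * of_nat n) * (?e s' q * cnj (?e s q)))"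
      by (subst sum.swap) (intro sum.cong refl sum.swap)
    also have "\<dots> = (\<Sum>s\<in>A. \<Sum>s'\<in>A. h s * cnj (h s') / (of_nat n * of_nat n) * (if s' = s then of_nat n else 0))"
      by (intro sum.cong refl) (simp only: sum_distrib_left[symmetric] fourier_char_mesh_orthogonal A)
    also have "\<dots> = (\<Sum>s\<in>A. h s * cnj (h s) / n)"
      using cn A(1) by (intro sum.cong refl) (simp add: if_distrib cong: if_cong)
    finally show ?thesis by (simp add: sum_divide_distrib)
  qed
  have nn: "z * cnj z = of_real ((norm z)\<^sup>2)" for z by (rule complex_norm_square[symmetric])
  have "of_real (\<Sum>q<n. (norm (a q - b q))\<^sup>2) = (\<Sum>q<n. (a q - b q) * cnj (a q - b q))"
    by (simp only: of_real_sum nn)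
  also have "\<dots> = (\<Sum>q<n. a q * cnj (a q)) - (\<Sum>q<n. a q * cnj (b q)) - cnj (\<Sum>q<n. a q * cnj (b q)) + (\<Sum>q<n. b q * cnj (b q))"
    by (simp add: algebra_simps sum.distrib sum_subtractf)
  also have "cnj (\<Sum>q<n. a q * cnj (b q)) = (\<Sum>s\<in>A. h s * cnj (h s)) / n"
    unfolding ab by (simp add: mult.commute)
  also have "(\<Sum>q<n. a q * cnj (a q)) - (\<Sum>q<n. a q * cnj (b q)) - (\<Sum>s\<in>A. h s * cnj (h s)) / n + (\<Sum>q<n. b q * cnj (b q))
      = (\<Sum>q<n. a q * cnj (a q)) - (\<Sum>s\<in>A. h s * cnj (h s)) / n"
    unfolding ab bb by simp
  also have "\<dots> = of_real ((\<Sum>q<n. (norm (a q))\<^sup>2) - (\<Sum>s\<in>A. (norm (h s))\<^sup>2) / n)"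
    by (simp only: nn of_real_sum of_real_diff of_real_divide of_real_of_nat_eq)
  finally have "(\<Sum>q<n. (norm (a q - b q))\<^sup>2) = (\<Sum>q<n. (norm (a q))\<^sup>2) - (\<Sum>s\<in>A. (norm (h s))\<^sup>2) / n"
    by (simp only: of_real_eq_iff)
  moreover have "0 \<le> (\<Sum>q<n. (norm (a q - b q))\<^sup>2)" by (intro sum_nonneg) auto
  ultimately have "(\<Sum>s\<in>A. (norm (h s))\<^sup>2) / n \<le> (\<Sum>q<n. (norm (a q))\<^sup>2)" by linarith
  then show ?thesis using n unfolding h_def by (simp add: field_simps)
qed

section \<open>Mesh sums on refining partitions\<close>

text \<open>The left endpoint of the mesh cell containing \<open>t\<close>, as the value at \<open>t\<close> of the step function
  that interpolates the identity.\<close>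

definition mesh_left :: "real \<Rightarrow> nat \<Rightarrow> real \<Rightarrow> real" where
  "mesh_left T n t = step_value (mesh_step T n (\<lambda>u. u) :: (unit, real) step_process) t ()"

lemma
  assumes "0 < T" "0 < n" "0 < t" "t \<le> T"
  shows step_value_mesh_left: "step_value (mesh_step T n h) t \<omega> = (h (mesh_left T n t) :: 'b::euclidean_space)"
    and mesh_left_cell: "\<exists>q<n. mesh_left T n t = mesh T n q \<and> mesh T n q < t \<and> t \<le> mesh T n (Suc q)"
proof -
  obtain q where q: "q < n" "mesh T n q < t" "t \<le> mesh T n (Suc q)" by (rule mesh_cell[OF assms]) blast
  have uniq: "i = q" if "mesh T n i < t" "t \<le> mesh T n (Suc i)" for i
  proof (rule ccontr)
    assume "i \<noteq> q"
    then have "Suc i \<le> q \<or> Suc q \<le> i" by auto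
    then show False
      using that q mesh_mono[of T "Suc i" q n] mesh_mono[of T "Suc q" i n] assms(1) by auto
  qed
  have v: "step_value (mesh_step T n h) t \<omega> = h (mesh T n q)" for h :: "real \<Rightarrow> 'd::euclidean_space" and \<omega> :: 'e
  proof -
    obtain i where "mesh T n i < t" "t \<le> mesh T n (Suc i)"
      "\<And>h (\<omega> :: 'e). step_value (mesh_step T n h) t \<omega> = (h (mesh T n i) :: 'd)"
      by (rule mesh_cell[OF assms]) blast
    then show ?thesis using uniq by metis
  qed
  have left: "mesh_left T n t = mesh T n q" by (simp add: mesh_left_def v)
  show "step_value (mesh_step T n h) t \<omega> = h (mesh_left T n t)" unfolding left by (rule v)
  show "\<exists>q<n. mesh_left T n t = mesh T n q \<and> mesh T n q < t \<and> t \<le> mesh T n (Suc q)" using q left by auto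
qed

text \<open>Approximates \<open>2 * pi\<close> times a Fourier coefficient of \<open>dX\<close>. As
  a finite sum it is linear in \<open>X\<close> for every path, whereas linearity of the stochastic
  integral holds up to null sets.\<close>

definition mesh_fourier :: "nat \<Rightarrow> (real \<Rightarrow> 'a \<Rightarrow> real) \<Rightarrow> int \<Rightarrow> 'a \<Rightarrow> complex" where
  "mesh_fourier n X s \<omega> = step_integral (mesh_step (2 * pi) n (fourier_char s)) X (2 * pi) \<omega>"

lemma mesh_fourier_eq:
  "mesh_fourier n X s \<omega> = (\<Sum>q<n. (X (mesh (2 * pi) n (Suc q)) \<omega> - X (mesh (2 * pi) n q) \<omega>) *\<^sub>R fourier_char s (mesh (2 * pi) n q))"
  unfolding mesh_fourier_def by (rule step_integral_mesh_step) simp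

text \<open>Associativity of integration on one cell: integrating against
  \<open>step_integral S X\<close> amounts to multiplying the increments of \<open>X\<close> by the
  values of \<open>S\<close>.\<close>

lemma step_integral_increment:
  assumes r: "step_refinement x m S" and c: "c < m"
  shows "step_integral S X (x (Suc c)) \<omega> - step_integral S X (x c) \<omega> = (X (x (Suc c)) \<omega> - X (x c) \<omega>) *\<^sub>R step_value S (x (Suc c)) \<omega>"
proof -
  have mono: "x i \<le> x j" if "i \<le> j" "j \<le> m" for i j
    using r that by (auto simp: step_refinement_def mono_on_def)
  let ?t = "\<lambda>t d. (X (min (x (Suc d)) t) \<omega> - X (min (x d) t) \<omega>) *\<^sub>R step_value S (x (Suc d)) \<omega>"
  have "?t (x (Suc c)) d - ?t (x c) d = (if d = c then (X (x (Suc c)) \<omega> - X (x c) \<omega>) *\<^sub>R step_value S (x (Suc c)) \<omega> else 0)"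
    if d: "d < m" for d
  proof -
    consider "d < c" | "d = c" | "c < d" by linarith
    then show ?thesis
    proof cases
      case 1
      then have "x (Suc d) \<le> x c" "x d \<le> x c" "x c \<le> x (Suc c)" using c by (auto intro!: mono)
      then show ?thesis using 1 by (simp add: min_absorb1)
    next
      case 2
      have "x c \<le> x (Suc c)" using c by (auto intro!: mono)
      then show ?thesis using 2 by (simp add: min_absorb1 min_absorb2)
    next
      case 3
      then have "x (Suc c) \<le> x d" "x (Suc c) \<le> x (Suc d)" "x c \<le> x d" "x c \<le> x (Suc d)" using d by (auto intro!: mono)
      then show ?thesis using 3 by (simp add: min_absorb2)
    qed
  qed
  then have "(\<Sum>d<m. ?t (x (Suc c)) d - ?t (x c) d) = (\<Sum>d<m. if d = c then (X (x (Suc c)) \<omega> - X (x c) \<omega>) *\<^sub>R step_value S (x (Suc c)) \<omega> else 0)"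
    by (intro sum.cong refl) auto
  also have "\<dots> = (X (x (Suc c)) \<omega> - X (x c) \<omega>) *\<^sub>R step_value S (x (Suc c)) \<omega>" using c by simp
  finally show ?thesis unfolding step_integral_refines[OF r] sum_subtractf[symmetric] .
qed

text \<open>The least index \<open>d\<close> with \<open>t \<le> x d\<close> closes the cell of
  \<open>t\<close>. Repeated partition points do no harm, since half-open cells of length 0 are
  empty.\<close>

lemma partition_cell:
  fixes x :: "nat \<Rightarrow> real"
  assumes x: "mono_on {..m} x" and t: "x 0 < t" "t \<le> x m"
  obtains c where "c < m" "x c < t" "t \<le> x (Suc c)"
    "\<And>a :: nat \<Rightarrow> 'b::real_vector. (\<Sum>d<m. indicator {x d<..x (Suc d)} t *\<^sub>R a d) = a c"
proof -
  define d where "d = (LEAST d. t \<le> x d)"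
  have d: "t \<le> x d" "d \<le> m" unfolding d_def using t(2) by (auto intro: LeastI Least_le)
  have "d \<noteq> 0" using d(1) t(1) by (metis not_le)
  then obtain c where c: "d = Suc c" using not0_implies_Suc by blast
  have "\<not> t \<le> x c" using not_less_Least[of c "\<lambda>d. t \<le> x d"] c unfolding d_def by auto
  then have cc: "c < m" "x c < t" "t \<le> x (Suc c)" using c d by auto
  have "indicator {x i<..x (Suc i)} t *\<^sub>R a i = (if i = c then a c else 0)" if "i < m" for i and a :: "nat \<Rightarrow> 'b"
  proof (cases "i = c")
    case True then show ?thesis using cc by simp
  next
    case False
    then have "Suc i \<le> c \<or> Suc c \<le> i" by auto
    then have "x (Suc i) \<le> x c \<or> x (Suc c) \<le> x i"
      using mono_onD[OF x, of "Suc i" c] mono_onD[OF x, of "Suc c" i] that cc by auto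
    then have "t \<notin> {x i<..x (Suc i)}" using cc by auto
    then show ?thesis using False by simp
  qed
  then have "(\<Sum>i<m. indicator {x i<..x (Suc i)} t *\<^sub>R a i) = (\<Sum>i<m. if i = c then a c else 0)" for a :: "nat \<Rightarrow> 'b"
    by (intro sum.cong refl) auto
  then have "(\<Sum>d<m. indicator {x d<..x (Suc d)} t *\<^sub>R a d) = a c" for a :: "nat \<Rightarrow> 'b" using cc by simp
  then show ?thesis by (rule that[OF cc])
qed

text \<open>The sum is the integral of the step function with values \<open>a c\<close>, which is
  within \<open>e\<close> of \<open>h\<close> at every point of the horizon except 0, the one point
  that the half-open cells miss.\<close>

lemma step_integral_vs_Riemann:
  fixes a :: "nat \<Rightarrow> complex" and h :: "real \<Rightarrow> complex"
  assumes x: "mono_on {..m} x" "x 0 = 0" "x m = T"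
    and h: "set_integrable lborel {0..T} h"
    and close: "\<And>c t. c < m \<Longrightarrow> x c < t \<Longrightarrow> t \<le> x (Suc c) \<Longrightarrow> norm (a c - h t) \<le> e" and e: "0 \<le> e"
  shows "norm ((\<Sum>c<m. (x (Suc c) - x c) *\<^sub>R a c) - (LINT t:{0..T}|lborel. h t)) \<le> T * e"
proof -
  have mono: "x i \<le> x j" if "i \<le> j" "j \<le> m" for i j using mono_onD[OF x(1)] that by auto
  have T: "0 \<le> T" using mono[of 0 m] x by simp
  let ?G = "\<lambda>t. \<Sum>c<m. indicator {x c<..x (Suc c)} t *\<^sub>R a c"
  have cell: "has_bochner_integral lborel (\<lambda>t. indicator {x c<..x (Suc c)} t *\<^sub>R a c) ((x (Suc c) - x c) *\<^sub>R a c)" if "c < m" for c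
  proof -
    have "has_bochner_integral lborel (indicator {x c<..x (Suc c)} :: real \<Rightarrow> real) (measure lborel {x c<..x (Suc c)})"
      by (rule has_bochner_integral_real_indicator) (use mono[of c "Suc c"] that in auto)
    then have "has_bochner_integral lborel (\<lambda>t. indicator {x c<..x (Suc c)} t *\<^sub>R a c) (measure lborel {x c<..x (Suc c)} *\<^sub>R a c)"
      by (rule has_bochner_integral_scaleR_left)
    then show ?thesis using mono[of c "Suc c"] that by simp
  qed
  have G: "has_bochner_integral lborel ?G (\<Sum>c<m. (x (Suc c) - x c) *\<^sub>R a c)"
    by (rule has_bochner_integral_sum) (use cell in auto)
  have H: "integrable lborel (\<lambda>t. indicator {0..T} t *\<^sub>R h t)" using h by (simp add: set_integrable_def)
  have diff: "(\<Sum>c<m. (x (Suc c) - x c) *\<^sub>R a c) - (LINT t:{0..T}|lborel. h t) = (\<integral>t. ?G t - indicator {0..T} t *\<^sub>R h t \<partial>lborel)"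
    using G H unfolding set_lebesgue_integral_def has_bochner_integral_iff by auto
  have "norm (\<integral>t. ?G t - indicator {0..T} t *\<^sub>R h t \<partial>lborel) \<le> (\<integral>t. norm (?G t - indicator {0..T} t *\<^sub>R h t) \<partial>lborel)"
    by (rule integral_norm_bound)
  also have "\<dots> \<le> (\<integral>t. indicator {0..T} t * e \<partial>lborel)"
  proof (rule integral_mono_AE)
    show "integrable lborel (\<lambda>t. norm (?G t - indicator {0..T} t *\<^sub>R h t))"
      using G H unfolding has_bochner_integral_iff by auto
    show "integrable lborel (\<lambda>t. indicator {0..T} t * e)" using T by auto
    have "AE t in lborel. t \<noteq> (0::real)" by (rule AE_lborel_singleton)
    then show "AE t in lborel. norm (?G t - indicator {0..T} t *\<^sub>R h t) \<le> indicator {0..T} t * e"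
    proof eventually_elim
      case (elim t)
      show ?case
      proof (cases "0 < t \<and> t \<le> T")
        case True
        then obtain c where c: "c < m" "x c < t" "t \<le> x (Suc c)" "?G t = a c"
          using partition_cell[OF x(1), of t] x(2,3) by metis
        show ?thesis unfolding c(4) using close[OF c(1-3)] True by simp
      next
        case False
        then have t: "t \<notin> {0..T}" using elim by auto
        have "indicator {x c<..x (Suc c)} t *\<^sub>R a c = 0" if "c < m" for c
          using t mono[of 0 c] mono[of "Suc c" m] that x(2,3) by auto
        then have "?G t = 0" by (intro sum.neutral) auto
        then show ?thesis using t by simp
      qed
    qed
  qed
  also have "\<dots> = T * e" using T by simp
  finally show ?thesis unfolding diff .
qed

text \<open>\<open>K\<close> is a modulated Dirichlet kernel on the mesh, divided by
  \<open>2N+1\<close>. Expanding |K|^2 over pairs of frequencies separates the variables, and each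
  factor is a mesh sum of the character of index \<open>s - s'\<close> or \<open>s' - s\<close>. As
  these indices are below \<open>n\<close> in modulus, only the \<open>2N+1\<close> pairs with
  \<open>s = s'\<close> survive, each contributing \<open>(2 * pi / (2N+1))\<^sup>2\<close>.\<close>

lemma mesh_kernel_bound:
  fixes x :: "nat \<Rightarrow> real" and k :: int
  assumes x: "mono_on {..m} x" and r: "step_refinement x m (mesh_step (2 * pi) n (\<lambda>u. u) :: (unit, real) step_process)"
    and x0: "x 0 = 0" "x m = 2 * pi" "\<And>c. c < m \<Longrightarrow> x c < x (Suc c)" and N: "2 * N + 1 \<le> n"
  defines "\<delta> \<equiv> \<lambda>c. x (Suc c) - x c" and "g \<equiv> \<lambda>c. mesh_left (2 * pi) n (x (Suc c))"
  defines "K \<equiv> \<lambda>c c'. (\<Sum>s\<in>{- int N..int N}. fourier_char s (g c) * fourier_char (k - s) (g c')) / (2 * of_nat N + 1)"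
  shows "(\<Sum>c<m. \<Sum>c'<m. \<delta> c * \<delta> c' * (norm (K c c'))\<^sup>2) = (2 * pi)\<^sup>2 / (2 * real N + 1)"
    and "\<And>c. K c c = fourier_char k (g c)"
    and "\<And>c. c < m \<Longrightarrow> g c \<le> x c \<and> x (Suc c) \<le> g c + 2 * pi / n"
    and "(\<Sum>c<m. (\<delta> c)\<^sup>2) \<le> (2 * pi)\<^sup>2 / n"
proof -
  let ?T = "2 * pi"
  have n: "0 < n" using N by auto
  have T: "0 < ?T" by simp
  have mono: "x i \<le> x j" if "i \<le> j" "j \<le> m" for i j using mono_onD[OF x] that by auto
  have xS: "0 < x (Suc c)" "x (Suc c) \<le> ?T" if "c < m" for c
    using x0(3)[OF that] mono[of 0 c] mono[of "Suc c" m] x0(1,2) that by auto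
  have val: "step_value (mesh_step ?T n h) (x (Suc c)) \<omega> = h (g c)" if "c < m" for c and h :: "real \<Rightarrow> 'd::euclidean_space" and \<omega> :: 'e
    unfolding g_def by (rule step_value_mesh_left[OF T n xS[OF that]])
  have rf: "step_refinement x m (mesh_step ?T n f :: ('e, 'd) step_process)" for f :: "real \<Rightarrow> 'd"
    using r by (simp add: step_refinement_def mesh_step_def)
  \<comment> \<open>A sum over the refining partition of a function of the mesh cell collapses to a
    sum over the mesh: both are the integral of one step process against the deterministic
    integrator \<open>t\<close>.\<close>
  have transfer: "(\<Sum>c<m. \<delta> c *\<^sub>R f (g c)) = (?T / n) *\<^sub>R (\<Sum>q<n. f (mesh ?T n q))" for f :: "real \<Rightarrow> complex"
  proof -
    have "(\<Sum>c<m. \<delta> c *\<^sub>R f (g c)) = (\<Sum>c<m. (min (x (Suc c)) ?T - min (x c) ?T) *\<^sub>R step_value (mesh_step ?T n f :: (unit, complex) step_process) (x (Suc c)) ())"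
    proof (intro sum.cong refl)
      fix c assume "c \<in> {..<m}"
      then have c: "c < m" by simp
      have "min (x (Suc c)) ?T = x (Suc c)" "min (x c) ?T = x c" using xS(2)[OF c] x0(3)[OF c] by auto
      then show "\<delta> c *\<^sub>R f (g c) = (min (x (Suc c)) ?T - min (x c) ?T) *\<^sub>R step_value (mesh_step ?T n f :: (unit, complex) step_process) (x (Suc c)) ()"
        by (simp only: val[OF c] \<delta>_def)
    qed
    also have "\<dots> = step_integral (mesh_step ?T n f) (\<lambda>t _. t) ?T ()"
      by (rule step_integral_refines[OF rf, symmetric])
    also have "\<dots> = (\<Sum>q<n. (mesh ?T n (Suc q) - mesh ?T n q) *\<^sub>R f (mesh ?T n q))"
      by (rule step_integral_mesh_step) simp
    finally show ?thesis by (simp only: mesh_Suc_diff scaleR_sum_right)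
  qed
  show loc: "g c \<le> x c \<and> x (Suc c) \<le> g c + ?T / n" if c: "c < m" for c
  proof -
    obtain q where q: "q < n" "g c = mesh ?T n q" "mesh ?T n q < x (Suc c)" "x (Suc c) \<le> mesh ?T n (Suc q)"
      using mesh_left_cell[OF T n xS[OF c]] unfolding g_def by blast
    have "mesh ?T n q \<in> x ` {..m}" using r q by (auto simp: step_refinement_def mesh_step_def image_subset_iff)
    then obtain a where a: "a \<le> m" "mesh ?T n q = x a" by auto
    have "a \<le> c"
    proof (rule ccontr)
      assume "\<not> a \<le> c"
      then have "x (Suc c) \<le> x a" using a by (intro mono) auto
      then show False using q a by simp
    qed
    then have "g c \<le> x c" using mono[of a c] a c q by simp
    moreover have "x (Suc c) \<le> g c + ?T / n" using q(2,4) mesh_Suc_diff[of ?T n q] by simp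
    ultimately show ?thesis by simp
  qed
  have \<delta>: "0 \<le> \<delta> c" "\<delta> c \<le> ?T / n" if "c < m" for c
    using x0(3)[OF that] loc[OF that] by (auto simp: \<delta>_def)
  have sum\<delta>: "(\<Sum>c<m. \<delta> c) = ?T"
    using sum_lessThan_telescope[of x m] x0 by (simp add: \<delta>_def)
  have "(\<Sum>c<m. (\<delta> c)\<^sup>2) \<le> (\<Sum>c<m. \<delta> c * (?T / n))"
    unfolding power2_eq_square by (intro sum_mono mult_left_mono \<delta>) auto
  also have "\<dots> = ?T * (?T / n)" by (simp only: sum_distrib_right[symmetric] sum\<delta>)
  finally show "(\<Sum>c<m. (\<delta> c)\<^sup>2) \<le> ?T\<^sup>2 / n" by (simp add: power2_eq_square)
  let ?A = "{- int N..int N}"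
  let ?M = "2 * of_nat N + 1 :: complex"
  have cardA: "card ?A = 2 * N + 1" by simp
  have M: "?M = of_nat (2 * N + 1)" "?M \<noteq> 0"
  proof -
    show 1: "?M = of_nat (2 * N + 1)" by simp
    show "?M \<noteq> 0" unfolding 1 of_nat_eq_0_iff by simp
  qed
  show "K c c = fourier_char k (g c)" for c
  proof -
    have "(\<Sum>s\<in>?A. fourier_char s (g c) * fourier_char (k - s) (g c)) = (\<Sum>s\<in>?A. fourier_char k (g c))"
      by (simp add: fourier_char_add[symmetric])
    also have "\<dots> = of_nat (card ?A) * fourier_char k (g c)" by (rule sum_constant)
    finally show ?thesis unfolding K_def cardA M(1)[symmetric] using M(2) by simp
  qed
  have "complex_of_real (\<Sum>c<m. \<Sum>c'<m. \<delta> c * \<delta> c' * (norm (K c c'))\<^sup>2)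
      = (\<Sum>c<m. \<Sum>c'<m. of_real (\<delta> c) * of_real (\<delta> c') * (K c c' * cnj (K c c')))"
    by (simp only: of_real_sum of_real_mult complex_norm_square)
  also have "\<dots> = (\<Sum>c<m. \<Sum>c'<m. \<Sum>s\<in>?A. \<Sum>s'\<in>?A.
      (\<delta> c *\<^sub>R fourier_char (s - s') (g c)) * (\<delta> c' *\<^sub>R fourier_char (s' - s) (g c')) / (?M * ?M))"
  proof (intro sum.cong refl)
    fix c c'
    have KK: "K c c' * cnj (K c c') = (\<Sum>s\<in>?A. \<Sum>s'\<in>?A. fourier_char (s - s') (g c) * fourier_char (s' - s) (g c') / (?M * ?M))"
    proof -
      have "fourier_char s (g c) * fourier_char (k - s) (g c') * cnj (fourier_char s' (g c) * fourier_char (k - s') (g c'))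
        = fourier_char (s - s') (g c) * fourier_char (s' - s) (g c')" for s s'
      proof -
        \<comment> \<open>The shift \<open>k\<close> cancels between the kernel and its
          conjugate.\<close>
        have "fourier_char (s - s') (g c) = fourier_char s (g c) * fourier_char (- s') (g c)"
          "fourier_char (s' - s) (g c') = fourier_char (k - s) (g c') * fourier_char (- (k - s')) (g c')"
          by (simp_all add: fourier_char_add[symmetric])
        then show ?thesis by (simp add: cnj_fourier_char)
      qed
      moreover have "cnj ?M = ?M" by simp
      ultimately show ?thesis
        unfolding K_def complex_cnj_divide times_divide_times_eq cnj_sum sum_product by (simp only: sum_divide_distrib)
    qed
    show "of_real (\<delta> c) * of_real (\<delta> c') * (K c c' * cnj (K c c')) = (\<Sum>s\<in>?A. \<Sum>s'\<in>?A.
      (\<delta> c *\<^sub>R fourier_char (s - s') (g c)) * (\<delta> c' *\<^sub>R fourier_char (s' - s) (g c')) / (?M * ?M))"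
      unfolding KK by (simp only: sum_distrib_left scaleR_conv_of_real times_divide_eq_right ac_simps)
  qed
  also have "\<dots> = (\<Sum>s\<in>?A. \<Sum>s'\<in>?A. \<Sum>c<m. \<Sum>c'<m.
      (\<delta> c *\<^sub>R fourier_char (s - s') (g c)) * (\<delta> c' *\<^sub>R fourier_char (s' - s) (g c')) / (?M * ?M))"
  proof -
    have "(\<Sum>c<m. \<Sum>c'<m. \<Sum>s\<in>?A. \<Sum>s'\<in>?A. f c c' s s') = (\<Sum>s\<in>?A. \<Sum>s'\<in>?A. \<Sum>c<m. \<Sum>c'<m. f c c' s s')"
      for f :: "nat \<Rightarrow> nat \<Rightarrow> int \<Rightarrow> int \<Rightarrow> complex"
    proof -
      have "(\<Sum>c<m. \<Sum>c'<m. \<Sum>s\<in>?A. \<Sum>s'\<in>?A. f c c' s s') = (\<Sum>c<m. \<Sum>s\<in>?A. \<Sum>c'<m. \<Sum>s'\<in>?A. f c c' s s')"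
        by (intro sum.cong refl sum.swap)
      also have "\<dots> = (\<Sum>s\<in>?A. \<Sum>c<m. \<Sum>c'<m. \<Sum>s'\<in>?A. f c c' s s')" by (rule sum.swap)
      also have "\<dots> = (\<Sum>s\<in>?A. \<Sum>c<m. \<Sum>s'\<in>?A. \<Sum>c'<m. f c c' s s')" by (intro sum.cong refl sum.swap)
      also have "\<dots> = (\<Sum>s\<in>?A. \<Sum>s'\<in>?A. \<Sum>c<m. \<Sum>c'<m. f c c' s s')" by (intro sum.cong refl sum.swap)
      finally show ?thesis .
    qed
    then show ?thesis .
  qed
  also have "\<dots> = (\<Sum>s\<in>?A. \<Sum>s'\<in>?A. if s = s' then (of_real ?T)\<^sup>2 / (?M * ?M) else 0)"
  proof (intro sum.cong refl)
    fix s s' assume s: "s \<in> ?A" "s' \<in> ?A"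
    have "(\<Sum>c<m. \<Sum>c'<m. (\<delta> c *\<^sub>R fourier_char (s - s') (g c)) * (\<delta> c' *\<^sub>R fourier_char (s' - s) (g c')) / (?M * ?M))
      = (\<Sum>c<m. \<delta> c *\<^sub>R fourier_char (s - s') (g c)) * (\<Sum>c'<m. \<delta> c' *\<^sub>R fourier_char (s' - s) (g c')) / (?M * ?M)"
      by (simp only: sum_product sum_divide_distrib)
    also have "(\<Sum>c<m. \<delta> c *\<^sub>R fourier_char (s - s') (g c)) = (if s = s' then of_real ?T else 0)"
    proof -
      have "\<bar>s - s'\<bar> < int n" using s N by auto
      from sum_fourier_char_mesh[OF this] show ?thesis unfolding transfer using n by (simp add: scaleR_conv_of_real)
    qed
    also have "(\<Sum>c'<m. \<delta> c' *\<^sub>R fourier_char (s' - s) (g c')) = (if s = s' then of_real ?T else 0)"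
    proof -
      have "\<bar>s' - s\<bar> < int n" using s N by auto
      from sum_fourier_char_mesh[OF this] show ?thesis unfolding transfer using n by (simp add: scaleR_conv_of_real)
    qed
    finally show "(\<Sum>c<m. \<Sum>c'<m. (\<delta> c *\<^sub>R fourier_char (s - s') (g c)) * (\<delta> c' *\<^sub>R fourier_char (s' - s) (g c')) / (?M * ?M))
      = (if s = s' then (of_real ?T)\<^sup>2 / (?M * ?M) else 0)" by (simp add: power2_eq_square)
  qed
  also have "\<dots> = (\<Sum>s\<in>?A. (of_real ?T)\<^sup>2 / (?M * ?M))" by (intro sum.cong refl) simp
  also have "\<dots> = of_nat (card ?A) * ((of_real ?T)\<^sup>2 / (?M * ?M))" by (rule sum_constant)
  also have "\<dots> = (of_real ?T)\<^sup>2 / ?M" unfolding cardA M(1)[symmetric] using M(2) by simp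
  also have "\<dots> = complex_of_real (?T\<^sup>2 / (2 * real N + 1))" by simp
  finally show "(\<Sum>c<m. \<Sum>c'<m. \<delta> c * \<delta> c' * (norm (K c c'))\<^sup>2) = (2 * pi)\<^sup>2 / (2 * real N + 1)"
    by (simp only: of_real_eq_iff)
qed

text \<open>Exchanging the sums over frequencies and cells moves all frequencies into the kernel, so
  that the Bohr mean becomes a bilinear form in the increments.\<close>

lemma bohr_mean_kernel:
  fixes a b :: "nat \<Rightarrow> complex"
  shows "bohr_mean N (\<lambda>s. \<Sum>c<m. a c * fourier_char s (g c)) (\<lambda>s. \<Sum>c<m. b c * fourier_char s (g c)) k
    = (\<Sum>c<m. \<Sum>c'<m. (\<Sum>s\<in>{- int N..int N}. fourier_char s (g c) * fourier_char (k - s) (g c')) / (2 * of_nat N + 1) * a c * b c')"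
proof -
  let ?M = "2 * of_nat N + 1 :: complex" and ?A = "{- int N..int N}"
  have "bohr_mean N (\<lambda>s. \<Sum>c<m. a c * fourier_char s (g c)) (\<lambda>s. \<Sum>c<m. b c * fourier_char s (g c)) k
    = (\<Sum>s\<in>?A. \<Sum>c<m. \<Sum>c'<m. fourier_char s (g c) * fourier_char (k - s) (g c') / ?M * a c * b c')"
    unfolding bohr_mean_def unfolding sum_product unfolding sum_distrib_left
    by (intro sum.cong refl) (simp add: field_simps)
  also have "\<dots> = (\<Sum>c<m. \<Sum>s\<in>?A. \<Sum>c'<m. fourier_char s (g c) * fourier_char (k - s) (g c') / ?M * a c * b c')"
    by (rule sum.swap)
  also have "\<dots> = (\<Sum>c<m. \<Sum>c'<m. \<Sum>s\<in>?A. fourier_char s (g c) * fourier_char (k - s) (g c') / ?M * a c * b c')"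
    by (intro sum.cong refl sum.swap)
  finally show ?thesis by (simp only: sum_distrib_right sum_divide_distrib)
qed

lemma bohr_mean_measurable:
  assumes "\<And>s. \<Phi> s \<in> borel_measurable M" "\<And>s. \<Psi> s \<in> borel_measurable M"
  shows "(\<lambda>\<omega>. bohr_mean N (\<lambda>s. \<Phi> s \<omega>) (\<lambda>s. \<Psi> s \<omega>) k) \<in> borel_measurable M"
  unfolding bohr_mean_def by (intro borel_measurable_times borel_measurable_sum assms) auto

lemma step_value_pair_measurable:
  assumes "\<And>i. i < step_num S \<Longrightarrow> step_coeff S i \<in> borel_measurable M"
  shows "(\<lambda>(t, \<omega>). step_value S t \<omega> :: 'b::euclidean_space) \<in> borel_measurable (borel \<Otimes>\<^sub>M M)"
proof -
  have "(\<lambda>z. indicator {step_time S i<..step_time S (Suc i)} (fst z) *\<^sub>R step_coeff S i (snd z)) \<in> borel_measurable (borel \<Otimes>\<^sub>M M)"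
    if "i < step_num S" for i
  proof -
    note [measurable] = assms[OF that]
    show ?thesis by measurable
  qed
  then show ?thesis unfolding step_value_def case_prod_unfold by (intro borel_measurable_sum) auto
qed

lemma measurable_time_measureI:
  "f \<in> borel_measurable (borel \<Otimes>\<^sub>M M) \<Longrightarrow> f \<in> borel_measurable (time_measure T \<Otimes>\<^sub>M M)"
proof -
  assume f: "f \<in> borel_measurable (borel \<Otimes>\<^sub>M M)"
  have "(\<lambda>z. (fst z, snd z)) \<in> measurable (time_measure T \<Otimes>\<^sub>M M) (borel \<Otimes>\<^sub>M M)"
  proof (intro measurable_Pair)
    have "(\<lambda>t. t) \<in> measurable (time_measure T) borel"
      by (rule measurable_restrict_space1) simp
    then show "fst \<in> measurable (time_measure T \<Otimes>\<^sub>M M) borel"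
      using measurable_compose[OF measurable_fst] by fastforce
  qed auto
  then show ?thesis using measurable_compose[OF _ f] by simp
qed

section \<open>Bohr means of simple integrands\<close>

context usual_filtered_prob_space
begin

lemma simple_predictable_coeff_measurable:
  assumes "simple_predictable M F T S" "i < step_num S"
  shows "step_coeff S i \<in> borel_measurable M"
proof -
  have "step_coeff S i \<in> borel_measurable (F (step_time S i))" "step_time S i \<in> {0..T}"
    using assms by (auto simp: simple_predictable_def image_subset_iff)
  then show ?thesis by (rule measurable_F)
qed

text \<open>Along a partition that refines the mesh and both integrands, the Bohr mean is the form
  with kernel \<open>K\<close>. Since \<open>K c c\<close> is the character of index
  \<open>k\<close>, its compensator is a Riemann sum for \<open>X\<close>; everything else is of
  order \<open>1 / sqrt (2N+1)\<close>, uniformly in \<open>n\<close>.\<close>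

lemma simple_bohr_mean:
  fixes S S' :: "('a, real) step_process" and k :: int
  assumes T: "T = 2 * pi" and W: "independent_brownian_motions M F T L W" and l: "l \<in> L" "l' \<in> L"
    and S: "simple_predictable M F T S" "simple_predictable M F T S'"
    and C: "0 \<le> C" "\<And>t \<omega>. \<omega> \<in> space M \<Longrightarrow> \<bar>step_value S t \<omega>\<bar> \<le> C" "\<And>t \<omega>. \<omega> \<in> space M \<Longrightarrow> \<bar>step_value S' t \<omega>\<bar> \<le> C"
    and N: "2 * N + 1 \<le> n"
  defines "B \<equiv> \<lambda>\<omega>. bohr_mean N (\<lambda>s. mesh_fourier n (step_integral S (W l)) s \<omega>) (\<lambda>s. mesh_fourier n (step_integral S' (W l')) s \<omega>) k"
    and "X \<equiv> \<lambda>\<omega>. if l = l' then LINT t:{0..T}|lborel. fourier_char k t * of_real (step_value S t \<omega> * step_value S' t \<omega>) else 0"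
  shows "integrable M (\<lambda>\<omega>. B \<omega> - X \<omega>)"
    and "expectation (\<lambda>\<omega>. norm (B \<omega> - X \<omega>)) \<le> C\<^sup>2 * (4 * T + \<bar>of_int k\<bar> * T\<^sup>2) / sqrt (2 * real N + 1)"
proof -
  have T0: "0 < T" and n: "0 < n" using T N by auto
  let ?P = "{0, T} \<union> step_time S ` {..step_num S} \<union> step_time S' ` {..step_num S'} \<union> mesh T n ` {..n}"
  have fin: "finite ?P" "?P \<noteq> {}" by auto
  obtain x and m :: nat where x: "strict_mono_on {..m} x" "x ` {..m} = ?P"
    using common_refinement[OF fin] .
  have mono: "mono_on {..m} x" using x(1) by (rule strict_mono_on_imp_mono_on)
  have sub: "x ` {..m} \<subseteq> {0..T}"
    unfolding x(2) using S T0 mesh_in[of T _ n] by (auto simp: simple_predictable_def)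
  have r: "step_refinement x m S" "step_refinement x m S'"
    using S x mono by (auto simp: step_refinement_def simple_predictable_def)
  have rm: "step_refinement x m (mesh_step T n h :: ('d, 'e) step_process)" for h :: "real \<Rightarrow> 'e"
    using x mono T0 by (auto simp: step_refinement_def mesh_step_def mono_on_def intro!: mesh_mono)
  have ends: "x 0 = 0" "x m = T"
    by (intro partition_endpoints[OF mono sub]; simp add: x(2))+
  have lt: "x c < x (Suc c)" if "c < m" for c using x(1) that by (auto simp: strict_mono_on_def)
  have xin: "x c \<in> {0..T}" if "c \<le> m" for c using sub that by auto
  define \<delta> where "\<delta> c = x (Suc c) - x c" for c
  define g where "g c = mesh_left T n (x (Suc c))" for c
  define K where "K c c' = (\<Sum>s\<in>{- int N..int N}. fourier_char s (g c) * fourier_char (k - s) (g c')) / (2 * of_nat N + 1)" for c c'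
  define \<xi> where "\<xi> c = step_value S (x (Suc c))" for c
  define \<eta> where "\<eta> c = step_value S' (x (Suc c))" for c
  note cells = mono rm[unfolded T] ends(1) ends(2)[unfolded T] lt N
  note kernel = mesh_kernel_bound(1)[where k=k, OF cells, folded T, folded \<delta>_def g_def, folded K_def]
    mesh_kernel_bound(3,4)[OF cells, folded T, folded \<delta>_def g_def]
  have Kcc: "K c c = fourier_char k (g c)" for c
    unfolding K_def g_def T by (rule mesh_kernel_bound(2)[OF cells])
  let ?Z = "\<lambda>c \<omega>. W l (x (Suc c)) \<omega> - W l (x c) \<omega>" and ?V = "\<lambda>c \<omega>. W l' (x (Suc c)) \<omega> - W l' (x c) \<omega>"
  define R where "R \<omega> = (\<Sum>c<m. \<Sum>c'<m. K c c' * of_real (\<xi> c \<omega> * ?Z c \<omega>) * of_real (\<eta> c' \<omega> * ?V c' \<omega>)) -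
    (if l = l' then \<Sum>c<m. K c c * of_real (\<delta> c * (\<xi> c \<omega> * \<eta> c \<omega>)) else 0)" for \<omega>
  have \<xi>: "\<xi> c \<in> borel_measurable (F (x c))" "\<eta> c \<in> borel_measurable (F (x c))" if "c < m" for c
    unfolding \<xi>_def \<eta>_def
    using step_value_measurable[OF S(1) r(1) that] step_value_measurable[OF S(2) r(2) that] by auto
  have \<xi>C: "\<bar>\<xi> c \<omega>\<bar> \<le> C" "\<bar>\<eta> c \<omega>\<bar> \<le> C" if "\<omega> \<in> space M" for c \<omega>
    unfolding \<xi>_def \<eta>_def by (rule C(2,3)[OF that])+
  have K1: "norm (K c c) \<le> 1" for c unfolding Kcc by simp
  have "sq_integrable M R \<and> l2norm M R \<le> C\<^sup>2 * (sqrt (2 * (\<Sum>c<m. (\<delta> c)\<^sup>2)) + 2 * sqrt (T\<^sup>2 / (2 * real N + 1)))"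
    using brownian_bilinear_estimate[OF W l mono sub \<xi>(1) \<xi>C(1) \<xi>(2) \<xi>C(2) C(1) eq_refl[OF kernel(1)[unfolded \<delta>_def]] K1]
    unfolding R_def \<delta>_def by auto
  then have Rsq: "sq_integrable M R" and Rle: "l2norm M R \<le> C\<^sup>2 * (sqrt (2 * (\<Sum>c<m. (\<delta> c)\<^sup>2)) + 2 * sqrt (T\<^sup>2 / (2 * real N + 1)))" by auto
  \<comment> \<open>On the finer cells the integral of \<open>S''\<close> grows by the value of
    \<open>S''\<close> times the Brownian increment, while the character keeps its value from the
    surrounding mesh cell.\<close>
  have mf: "mesh_fourier n (step_integral S'' (W i)) s \<omega> =
      (\<Sum>c<m. of_real (step_value S'' (x (Suc c)) \<omega> * (W i (x (Suc c)) \<omega> - W i (x c) \<omega>)) * fourier_char s (g c))"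
    if r: "step_refinement x m S''" for S'' :: "('a, real) step_process" and i s \<omega>
    unfolding mesh_fourier_def T[symmetric] step_integral_refines[OF rm]
  proof (intro sum.cong refl)
    fix c assume "c \<in> {..<m}"
    then have c: "c < m" by simp
    have 1: "min (x (Suc c)) T = x (Suc c)" "min (x c) T = x c" using xin[of c] xin[of "Suc c"] c by auto
    have 2: "step_value (mesh_step T n (fourier_char s)) (x (Suc c)) \<omega> = fourier_char s (g c)"
      unfolding g_def using xin[of c] xin[of "Suc c"] lt[OF c] c by (intro step_value_mesh_left T0 n) auto
    show "(step_integral S'' (W i) (min (x (Suc c)) T) \<omega> - step_integral S'' (W i) (min (x c) T) \<omega>) *\<^sub>R step_value (mesh_step T n (fourier_char s)) (x (Suc c)) \<omega>
      = of_real (step_value S'' (x (Suc c)) \<omega> * (W i (x (Suc c)) \<omega> - W i (x c) \<omega>)) * fourier_char s (g c)"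
      unfolding 1 2 step_integral_increment[OF r c] by (simp add: scaleR_conv_of_real mult.commute)
  qed
  have BR: "B \<omega> = R \<omega> + (if l = l' then \<Sum>c<m. \<delta> c *\<^sub>R (fourier_char k (g c) * of_real (\<xi> c \<omega> * \<eta> c \<omega>)) else 0)" for \<omega>
  proof -
    have "B \<omega> = (\<Sum>c<m. \<Sum>c'<m. K c c' * of_real (\<xi> c \<omega> * ?Z c \<omega>) * of_real (\<eta> c' \<omega> * ?V c' \<omega>))"
      unfolding B_def mf[OF r(1)] mf[OF r(2)] bohr_mean_kernel K_def \<xi>_def \<eta>_def ..
    moreover have "(\<Sum>c<m. K c c * of_real (\<delta> c * (\<xi> c \<omega> * \<eta> c \<omega>))) = (\<Sum>c<m. \<delta> c *\<^sub>R (fourier_char k (g c) * of_real (\<xi> c \<omega> * \<eta> c \<omega>)))"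
      unfolding Kcc by (simp add: scaleR_conv_of_real mult_ac)
    ultimately show ?thesis unfolding R_def by simp
  qed
  \<comment> \<open>\<open>\<bar>k\<bar>\<close> is the Lipschitz constant of the character,
    \<open>T / n\<close> bounds the distance from a point to the left end of its mesh cell, and
    \<open>C\<^sup>2\<close> bounds the product of the integrands.\<close>
  define e where "e = C\<^sup>2 * (\<bar>of_int k\<bar> * (T / n))"
  have e0: "0 \<le> e" unfolding e_def using T0 by auto
  have close: "norm (B \<omega> - X \<omega> - R \<omega>) \<le> T * e" if \<omega>: "\<omega> \<in> space M" for \<omega>
  proof (cases "l = l'")
    case True
    have hm: "(\<lambda>t. step_value S'' t \<omega>) \<in> borel_measurable borel" for S'' :: "('a, real) step_process"
      unfolding step_value_def by measurable
    have h: "set_integrable lborel {0..T} (\<lambda>t. fourier_char k t * of_real (step_value S t \<omega> * step_value S' t \<omega>))"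
    proof (rule set_integrable_bound)
      have "integrable lborel (indicator {0..T} :: real \<Rightarrow> real)"
        by (rule integrable_real_indicator) (use T0 in auto)
      then show "set_integrable lborel {0..T} (\<lambda>t. C\<^sup>2)" by (simp add: set_integrable_def)
      show "set_borel_measurable lborel {0..T} (\<lambda>t. fourier_char k t * of_real (step_value S t \<omega> * step_value S' t \<omega>))"
        unfolding set_borel_measurable_def using hm[of S] hm[of S'] by measurable
      show "AE t in lborel. t \<in> {0..T} \<longrightarrow> norm (fourier_char k t * of_real (step_value S t \<omega> * step_value S' t \<omega>)) \<le> norm (C\<^sup>2)"
        using C(2,3)[OF \<omega>] C(1) by (intro AE_I2 impI) (simp add: norm_mult abs_mult power2_eq_square mult_mono)
    qed
    have "norm ((\<Sum>c<m. (x (Suc c) - x c) *\<^sub>R (fourier_char k (g c) * of_real (\<xi> c \<omega> * \<eta> c \<omega>)))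
        - (LINT t:{0..T}|lborel. fourier_char k t * of_real (step_value S t \<omega> * step_value S' t \<omega>))) \<le> T * e"
    proof (rule step_integral_vs_Riemann[OF mono ends h _ e0])
      fix c t assume c: "c < m" and t: "x c < t" "t \<le> x (Suc c)"
      have v: "step_value S t \<omega> = \<xi> c \<omega>" "step_value S' t \<omega> = \<eta> c \<omega>"
        unfolding \<xi>_def \<eta>_def by (rule step_value_constant[OF _ c t]; rule r)+
      have "norm (fourier_char k (g c) - fourier_char k t) \<le> \<bar>of_int k\<bar> * \<bar>g c - t\<bar>" by (rule fourier_char_Lipschitz)
      also have "\<dots> \<le> \<bar>of_int k\<bar> * (T / n)"
        using kernel(2)[OF _ c] t by (intro mult_left_mono) auto
      finally have "norm (fourier_char k (g c) - fourier_char k t) * (\<bar>\<xi> c \<omega>\<bar> * \<bar>\<eta> c \<omega>\<bar>) \<le> (\<bar>of_int k\<bar> * (T / n)) * (C * C)"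
        using \<xi>C[OF \<omega>] C(1) T0 by (intro mult_mono) auto
      then show "norm (fourier_char k (g c) * of_real (\<xi> c \<omega> * \<eta> c \<omega>) - fourier_char k t * of_real (step_value S t \<omega> * step_value S' t \<omega>)) \<le> e"
        unfolding v left_diff_distrib[symmetric] norm_mult norm_of_real abs_mult e_def by (simp add: power2_eq_square mult_ac)
    qed
    then show ?thesis unfolding BR X_def \<delta>_def using True by (simp add: algebra_simps)
  next
    case False
    then show ?thesis unfolding BR X_def using e0 T0 by simp
  qed
  have mart: "l2_martingale M F T (step_integral S'' (W i))" if "simple_predictable M F T S''" "i \<in> L" for S'' i
    using W that by (intro step_integral_l2_martingale brownian_motion_l2_martingale) (auto simp: independent_brownian_motions_def)
  have mfm: "mesh_fourier n (step_integral S'' (W i)) s \<in> borel_measurable M" if "simple_predictable M F T S''" "i \<in> L" for S'' i s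
  proof -
    have "step_integral S'' (W i) t \<in> borel_measurable M" if "t \<in> {0..T}" for t
      using mart[OF \<open>simple_predictable M F T S''\<close> \<open>i \<in> L\<close>] that by (auto simp: l2_martingale_def sq_integrable_def)
    then show ?thesis unfolding mesh_fourier_eq T[symmetric]
      using mesh_in[of T _ n] T0 by (intro borel_measurable_sum borel_measurable_scaleR borel_measurable_diff) auto
  qed
  have Bm [measurable]: "B \<in> borel_measurable M"
    unfolding B_def by (intro bohr_mean_measurable mfm S l)
  have Xm [measurable]: "X \<in> borel_measurable M"
  proof (cases "l = l'")
    case True
    have sv: "(\<lambda>(t, \<omega>). step_value S'' t \<omega>) \<in> borel_measurable (borel \<Otimes>\<^sub>M M)" if "simple_predictable M F T S''" for S'' :: "('a, real) step_process"
      by (intro step_value_pair_measurable simple_predictable_coeff_measurable[OF that])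
    have [measurable]: "(\<lambda>z. step_value S (fst z) (snd z)) \<in> borel_measurable (borel \<Otimes>\<^sub>M M)" "(\<lambda>z. step_value S' (fst z) (snd z)) \<in> borel_measurable (borel \<Otimes>\<^sub>M M)"
      using sv[OF S(1)] sv[OF S(2)] by (simp_all add: case_prod_unfold)
    have "(\<lambda>(t, \<omega>). fourier_char k t * of_real (step_value S t \<omega> * step_value S' t \<omega>)) \<in> borel_measurable (borel \<Otimes>\<^sub>M M)"
      unfolding case_prod_unfold by measurable
    from time_integral_measurable[OF measurable_time_measureI[OF this], of T T] show ?thesis
      unfolding X_def using True T0 by simp
  qed (simp add: X_def)
  have DR: "integrable M (\<lambda>\<omega>. B \<omega> - X \<omega> - R \<omega>)"
    using close Rsq by (intro integrable_const_bound[where B="T * e"]) (auto simp: sq_integrable_def)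
  have "integrable M (\<lambda>\<omega>. (B \<omega> - X \<omega> - R \<omega>) + R \<omega>)"
    by (intro Bochner_Integration.integrable_add DR sq_integrable_integrable Rsq)
  then show int: "integrable M (\<lambda>\<omega>. B \<omega> - X \<omega>)" by simp
  have "expectation (\<lambda>\<omega>. norm (B \<omega> - X \<omega>)) \<le> expectation (\<lambda>\<omega>. T * e + norm (R \<omega>))"
  proof (rule integral_mono)
    show "integrable M (\<lambda>\<omega>. T * e + norm (R \<omega>))" using sq_integrable_integrable[OF Rsq] by auto
    show "norm (B \<omega> - X \<omega>) \<le> T * e + norm (R \<omega>)" if "\<omega> \<in> space M" for \<omega>
      using close[OF that] norm_triangle_ineq[of "B \<omega> - X \<omega> - R \<omega>" "R \<omega>"] by simp
  qed (use int in auto)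
  also have "\<dots> = T * e + expectation (\<lambda>\<omega>. norm (R \<omega>))"
    using sq_integrable_integrable[OF Rsq] by (simp add: prob_space)
  also have "\<dots> \<le> T * e + C\<^sup>2 * (sqrt (2 * (\<Sum>c<m. (\<delta> c)\<^sup>2)) + 2 * sqrt (T\<^sup>2 / (2 * real N + 1)))"
    using expectation_norm_le_l2norm[OF Rsq] Rle by simp
  \<comment> \<open>Half of \<open>4 * T\<close> comes from the diagonal fluctuation and half from
    the two triangles; \<open>\<bar>k\<bar> * T\<^sup>2\<close> is the error of the Riemann sum. The
    condition \<open>n \<ge> 2N+1\<close> converts \<open>1 / n\<close> into powers of
    \<open>1 / ?q\<close>.\<close>
  also have "\<dots> \<le> C\<^sup>2 * (4 * T + \<bar>of_int k\<bar> * T\<^sup>2) / sqrt (2 * real N + 1)"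
  proof -
    let ?q = "sqrt (2 * real N + 1)"
    have q: "1 \<le> ?q" "?q * ?q = 2 * real N + 1" by auto
    have nN: "2 * real N + 1 \<le> real n" using N by linarith
    have s1: "sqrt (2 * (\<Sum>c<m. (\<delta> c)\<^sup>2)) \<le> 2 * T / ?q"
    proof (rule real_le_lsqrt)
      have "2 * (\<Sum>c<m. (\<delta> c)\<^sup>2) \<le> 2 * (T\<^sup>2 / n)" using kernel(3) by simp
      also have "\<dots> \<le> 2 * (T\<^sup>2 / (2 * real N + 1))" using nN by (intro mult_left_mono divide_left_mono) auto
      also have "\<dots> \<le> 4 * (T\<^sup>2 / (2 * real N + 1))" by (intro mult_right_mono) auto
      also have "\<dots> = (2 * T / ?q)\<^sup>2" by (simp add: power_divide power_mult_distrib)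
      finally show "2 * (\<Sum>c<m. (\<delta> c)\<^sup>2) \<le> (2 * T / ?q)\<^sup>2" .
    qed (use T0 in auto)
    have s2: "sqrt (T\<^sup>2 / (2 * real N + 1)) = T / ?q" using T0 by (simp add: real_sqrt_divide)
    have "T / n \<le> T / ?q"
    proof (rule divide_left_mono)
      have "?q * 1 \<le> ?q * ?q" using q(1) by (intro mult_left_mono) auto
      then show "?q \<le> real n" using q(2) nN by simp
    qed (use T0 n in auto)
    then have "T * e \<le> T * (C\<^sup>2 * (\<bar>of_int k\<bar> * (T / ?q)))"
      unfolding e_def using T0 by (intro mult_left_mono) auto
    moreover have "C\<^sup>2 * (sqrt (2 * (\<Sum>c<m. (\<delta> c)\<^sup>2)) + 2 * sqrt (T\<^sup>2 / (2 * real N + 1))) \<le> C\<^sup>2 * (2 * T / ?q + 2 * (T / ?q))"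
      unfolding s2 by (intro mult_left_mono add_mono s1) auto
    moreover have "T * (C\<^sup>2 * (\<bar>of_int k\<bar> * (T / ?q))) + C\<^sup>2 * (2 * T / ?q + 2 * (T / ?q)) = C\<^sup>2 * (4 * T + \<bar>of_int k\<bar> * T\<^sup>2) / ?q"
      using q(1) by (simp add: field_simps power2_eq_square)
    ultimately show ?thesis by linarith
  qed
  finally show "expectation (\<lambda>\<omega>. norm (B \<omega> - X \<omega>)) \<le> C\<^sup>2 * (4 * T + \<bar>of_int k\<bar> * T\<^sup>2) / sqrt (2 * real N + 1)" .
qed

end

section \<open>Convergence of the Bohr means\<close>

lemma bohr_mean_diff_left: "bohr_mean N a b k - bohr_mean N a' b k = bohr_mean N (\<lambda>s. a s - a' s) b k"
  by (simp only: bohr_mean_def sum_subtractf left_diff_distrib right_diff_distrib)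

lemma bohr_mean_diff_right: "bohr_mean N a b k - bohr_mean N a b' k = bohr_mean N a (\<lambda>s. b s - b' s) k"
  by (simp only: bohr_mean_def sum_subtractf right_diff_distrib)

lemma bohr_mean_sum:
  "bohr_mean N (\<lambda>s. \<Sum>l\<in>L. a l s) (\<lambda>s. \<Sum>l\<in>L. b l s) k = (\<Sum>l\<in>L. \<Sum>l'\<in>L. bohr_mean N (a l) (b l') k)"
proof -
  have "bohr_mean N (\<lambda>s. \<Sum>l\<in>L. a l s) (\<lambda>s. \<Sum>l\<in>L. b l s) k
    = 1 / (2 * of_nat N + 1) * (\<Sum>l\<in>L. \<Sum>l'\<in>L. \<Sum>s\<in>{- int N..int N}. a l s * b l' (k - s))"
    unfolding bohr_mean_def sum_product
    by (subst sum.swap) (intro arg_cong2[where f="(*)"] refl sum.cong sum.swap)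
  then show ?thesis unfolding bohr_mean_def sum_distrib_left .
qed

text \<open>Cauchy-Schwarz is applied frequency by frequency and the average over \<open>s\<close>
  is kept, because drift coefficients are small only on average over the frequencies.\<close>

lemma (in prob_space)
  assumes \<Phi>: "\<And>s. sq_integrable M (\<Phi> s)" and \<Psi>: "\<And>s. sq_integrable M (\<Psi> s)"
  shows bohr_mean_integrable: "integrable M (\<lambda>\<omega>. bohr_mean N (\<lambda>s. \<Phi> s \<omega>) (\<lambda>s. \<Psi> s \<omega>) k)"
    and bohr_mean_L1: "expectation (\<lambda>\<omega>. norm (bohr_mean N (\<lambda>s. \<Phi> s \<omega>) (\<lambda>s. \<Psi> s \<omega>) k))
      \<le> (\<Sum>s\<in>{- int N..int N}. l2norm M (\<Phi> s) * l2norm M (\<Psi> (k - s))) / (2 * real N + 1)"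
proof -
  let ?A = "{- int N..int N}"
  show int: "integrable M (\<lambda>\<omega>. bohr_mean N (\<lambda>s. \<Phi> s \<omega>) (\<lambda>s. \<Psi> s \<omega>) k)"
    unfolding bohr_mean_def
    by (intro integrable_mult_right Bochner_Integration.integrable_sum sq_integrable_mult_integrable \<Phi> \<Psi>)
  have M: "norm (2 * of_nat N + 1 :: complex) = 2 * real N + 1"
  proof -
    have "(2 * of_nat N + 1 :: complex) = of_nat (2 * N + 1)" by simp
    then show ?thesis by (simp only: norm_of_nat)
  qed
  have "expectation (\<lambda>\<omega>. norm (bohr_mean N (\<lambda>s. \<Phi> s \<omega>) (\<lambda>s. \<Psi> s \<omega>) k))
      \<le> expectation (\<lambda>\<omega>. (\<Sum>s\<in>?A. norm (\<Phi> s \<omega>) * norm (\<Psi> (k - s) \<omega>)) / (2 * real N + 1))"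
  proof (rule integral_mono)
    show "integrable M (\<lambda>\<omega>. norm (bohr_mean N (\<lambda>s. \<Phi> s \<omega>) (\<lambda>s. \<Psi> s \<omega>) k))" using int by simp
    show "integrable M (\<lambda>\<omega>. (\<Sum>s\<in>?A. norm (\<Phi> s \<omega>) * norm (\<Psi> (k - s) \<omega>)) / (2 * real N + 1))"
      by (intro integrable_divide Bochner_Integration.integrable_sum sq_integrable_norm_mult \<Phi> \<Psi>)
    show "norm (bohr_mean N (\<lambda>s. \<Phi> s \<omega>) (\<lambda>s. \<Psi> s \<omega>) k) \<le> (\<Sum>s\<in>?A. norm (\<Phi> s \<omega>) * norm (\<Psi> (k - s) \<omega>)) / (2 * real N + 1)" for \<omega>
      unfolding bohr_mean_def norm_mult norm_divide M
      by (simp add: divide_right_mono sum_norm_le norm_mult)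
  qed
  also have "\<dots> = (\<Sum>s\<in>?A. expectation (\<lambda>\<omega>. norm (\<Phi> s \<omega>) * norm (\<Psi> (k - s) \<omega>))) / (2 * real N + 1)"
    by (simp add: Bochner_Integration.integral_sum sq_integrable_norm_mult \<Phi> \<Psi>)
  also have "\<dots> \<le> (\<Sum>s\<in>?A. l2norm M (\<Phi> s) * l2norm M (\<Psi> (k - s))) / (2 * real N + 1)"
    by (intro divide_right_mono sum_mono l2norm_Cauchy_Schwarz \<Phi> \<Psi>) auto
  finally show "expectation (\<lambda>\<omega>. norm (bohr_mean N (\<lambda>s. \<Phi> s \<omega>) (\<lambda>s. \<Psi> s \<omega>) k))
      \<le> (\<Sum>s\<in>?A. l2norm M (\<Phi> s) * l2norm M (\<Psi> (k - s))) / (2 * real N + 1)" .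
qed

text \<open>Collects the hypotheses in the form used for the convergence: the moment conditions
  become square integrability on the product of time and probability.\<close>

definition ito_process ::
  "'a measure \<Rightarrow> (real \<Rightarrow> 'a measure) \<Rightarrow> real \<Rightarrow> 'l set \<Rightarrow> ('l \<Rightarrow> real \<Rightarrow> 'a \<Rightarrow> real) \<Rightarrow>
   (real \<Rightarrow> 'a \<Rightarrow> real) \<Rightarrow> ('l \<Rightarrow> real \<Rightarrow> 'a \<Rightarrow> real) \<Rightarrow> (real \<Rightarrow> 'a \<Rightarrow> real) \<Rightarrow> bool" where
  "ito_process M F T L W X \<sigma> b \<longleftrightarrow> (\<forall>t\<in>{0..T}. X t \<in> borel_measurable M) \<and>
     (\<forall>l\<in>L. sq_integrable (time_measure T \<Otimes>\<^sub>M M) (\<lambda>(t, \<omega>). \<sigma> l t \<omega>)) \<and>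
     sq_integrable (time_measure T \<Otimes>\<^sub>M M) (\<lambda>(t, \<omega>). b t \<omega>) \<and> has_ito_differential M F T L W X \<sigma> b"

section \<open>Errors of integrands and drift\<close>

context prob_space
begin

lemma fourier_product_integrable:
  assumes f: "sq_integrable (time_measure T \<Otimes>\<^sub>M M) (\<lambda>(t, \<omega>). f t \<omega> :: real)"
    and g: "sq_integrable (time_measure T \<Otimes>\<^sub>M M) (\<lambda>(t, \<omega>). g t \<omega> :: real)"
  shows "integrable (time_measure T \<Otimes>\<^sub>M M) (\<lambda>(t, \<omega>). fourier_char k t * of_real (f t \<omega> * g t \<omega>))"
proof (rule Bochner_Integration.integrable_bound[OF sq_integrable_norm_mult[OF f g]])
  have [measurable]: "(\<lambda>z. f (fst z) (snd z)) \<in> borel_measurable (time_measure T \<Otimes>\<^sub>M M)"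
    "(\<lambda>z. g (fst z) (snd z)) \<in> borel_measurable (time_measure T \<Otimes>\<^sub>M M)"
    using f g by (auto simp: sq_integrable_def case_prod_unfold)
  have "(\<lambda>z. fourier_char k (fst z)) \<in> borel_measurable (borel \<Otimes>\<^sub>M M)" by measurable
  then have [measurable]: "(\<lambda>z. fourier_char k (fst z)) \<in> borel_measurable (time_measure T \<Otimes>\<^sub>M M)"
    by (rule measurable_time_measureI)
  show "(\<lambda>(t, \<omega>). fourier_char k t * of_real (f t \<omega> * g t \<omega>)) \<in> borel_measurable (time_measure T \<Otimes>\<^sub>M M)"
    unfolding case_prod_unfold by measurable
qed (auto simp: norm_mult abs_mult)

lemma time_integrable_sections:
  fixes G :: "real \<Rightarrow> 'a \<Rightarrow> 'b::euclidean_space"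
  assumes G: "integrable (time_measure T \<Otimes>\<^sub>M M) (\<lambda>(t, \<omega>). G t \<omega>)"
  shows "AE \<omega> in M. set_integrable lborel {0..T} (\<lambda>t. G t \<omega>)"
proof -
  interpret pair_sigma_finite "time_measure T" M by (rule pair_sigma_finite_time)
  show ?thesis
    using AE_integrable_snd[OF G] by (simp add: set_integrable_def integrable_restrict_space)
qed

text \<open>Write \<open>f * g - f' * g'\<close> as \<open>(f - f') * g + f' * (g - g')\<close> and
  apply Cauchy-Schwarz. The last \<open>\<epsilon>\<close> arises from bounding the norm of
  \<open>g\<close> by that of \<open>g'\<close>, so that only norms of the limit integrands
  \<open>f'\<close> and \<open>g'\<close> remain.\<close>

lemma fourier_product_L1:
  assumes f: "sq_integrable (time_measure T \<Otimes>\<^sub>M M) (\<lambda>(t, \<omega>). f t \<omega> :: real)"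
    and g: "sq_integrable (time_measure T \<Otimes>\<^sub>M M) (\<lambda>(t, \<omega>). g t \<omega> :: real)"
    and f': "sq_integrable (time_measure T \<Otimes>\<^sub>M M) (\<lambda>(t, \<omega>). f' t \<omega> :: real)"
    and g': "sq_integrable (time_measure T \<Otimes>\<^sub>M M) (\<lambda>(t, \<omega>). g' t \<omega> :: real)"
    and df: "l2norm (time_measure T \<Otimes>\<^sub>M M) (\<lambda>(t, \<omega>). f t \<omega> - f' t \<omega>) \<le> \<epsilon>"
    and dg: "l2norm (time_measure T \<Otimes>\<^sub>M M) (\<lambda>(t, \<omega>). g t \<omega> - g' t \<omega>) \<le> \<epsilon>"
  shows "expectation (\<lambda>\<omega>. norm ((LINT t:{0..T}|lborel. fourier_char k t * of_real (f t \<omega> * g t \<omega>)) -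
      (LINT t:{0..T}|lborel. fourier_char k t * of_real (f' t \<omega> * g' t \<omega>))))
    \<le> \<epsilon> * (l2norm (time_measure T \<Otimes>\<^sub>M M) (\<lambda>(t, \<omega>). f' t \<omega>) + l2norm (time_measure T \<Otimes>\<^sub>M M) (\<lambda>(t, \<omega>). g' t \<omega>) + \<epsilon>)"
proof -
  let ?\<mu> = "time_measure T \<Otimes>\<^sub>M M"
  let ?G = "\<lambda>t \<omega>. fourier_char k t * of_real (f t \<omega> * g t \<omega>)" and ?G' = "\<lambda>t \<omega>. fourier_char k t * of_real (f' t \<omega> * g' t \<omega>)"
  have i: "integrable ?\<mu> (\<lambda>(t, \<omega>). ?G t \<omega>)" "integrable ?\<mu> (\<lambda>(t, \<omega>). ?G' t \<omega>)"
    by (intro fourier_product_integrable f g f' g')+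
  have D: "integrable ?\<mu> (\<lambda>(t, \<omega>). ?G t \<omega> - ?G' t \<omega>)"
    using Bochner_Integration.integrable_diff[OF i] by (simp add: case_prod_unfold)
  have eq: "AE \<omega> in M. (LINT t:{0..T}|lborel. ?G t \<omega>) - (LINT t:{0..T}|lborel. ?G' t \<omega>) = (LINT t:{0..T}|lborel. ?G t \<omega> - ?G' t \<omega>)"
    using time_integrable_sections[OF i(1)] time_integrable_sections[OF i(2)]
    by eventually_elim (simp add: set_integral_diff)
  have m: "(\<lambda>\<omega>. LINT t:{0..T}|lborel. ?G t \<omega>) \<in> borel_measurable M" "(\<lambda>\<omega>. LINT t:{0..T}|lborel. ?G' t \<omega>) \<in> borel_measurable M"
    "(\<lambda>\<omega>. LINT t:{0..T}|lborel. ?G t \<omega> - ?G' t \<omega>) \<in> borel_measurable M"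
    using time_integral_integrable[OF i(1)] time_integral_integrable[OF i(2)] time_integral_integrable[OF D] by auto
  have "expectation (\<lambda>\<omega>. norm ((LINT t:{0..T}|lborel. ?G t \<omega>) - (LINT t:{0..T}|lborel. ?G' t \<omega>)))
      = expectation (\<lambda>\<omega>. norm (LINT t:{0..T}|lborel. ?G t \<omega> - ?G' t \<omega>))"
    by (rule integral_cong_AE) (use m eq in \<open>auto elim: eventually_mono\<close>)
  also have "\<dots> \<le> (\<integral>z. norm ((\<lambda>(t, \<omega>). ?G t \<omega> - ?G' t \<omega>) z) \<partial>?\<mu>)" by (rule time_integral_norm[OF D])
  also have "\<dots> \<le> (\<integral>z. norm ((\<lambda>(t, \<omega>). f t \<omega> - f' t \<omega>) z) * norm ((\<lambda>(t, \<omega>). g t \<omega>) z)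
      + norm ((\<lambda>(t, \<omega>). f' t \<omega>) z) * norm ((\<lambda>(t, \<omega>). g t \<omega> - g' t \<omega>) z) \<partial>?\<mu>)"
  proof (rule integral_mono)
    have d: "sq_integrable ?\<mu> (\<lambda>(t, \<omega>). f t \<omega> - f' t \<omega>)" "sq_integrable ?\<mu> (\<lambda>(t, \<omega>). g t \<omega> - g' t \<omega>)"
      using sq_integrable_diff[OF f f'] sq_integrable_diff[OF g g'] by (simp_all add: case_prod_unfold)
    show "integrable ?\<mu> (\<lambda>z. norm ((\<lambda>(t, \<omega>). f t \<omega> - f' t \<omega>) z) * norm ((\<lambda>(t, \<omega>). g t \<omega>) z)
      + norm ((\<lambda>(t, \<omega>). f' t \<omega>) z) * norm ((\<lambda>(t, \<omega>). g t \<omega> - g' t \<omega>) z))"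
      by (intro Bochner_Integration.integrable_add sq_integrable_norm_mult d f' g)
    show "integrable ?\<mu> (\<lambda>z. norm ((\<lambda>(t, \<omega>). ?G t \<omega> - ?G' t \<omega>) z))" using D by (rule integrable_norm)
    show "norm ((\<lambda>(t, \<omega>). ?G t \<omega> - ?G' t \<omega>) z) \<le> norm ((\<lambda>(t, \<omega>). f t \<omega> - f' t \<omega>) z) * norm ((\<lambda>(t, \<omega>). g t \<omega>) z)
      + norm ((\<lambda>(t, \<omega>). f' t \<omega>) z) * norm ((\<lambda>(t, \<omega>). g t \<omega> - g' t \<omega>) z)" for z
    proof -
      obtain t \<omega> where z: "z = (t, \<omega>)" by (cases z)
      have "norm (?G t \<omega> - ?G' t \<omega>) = \<bar>f t \<omega> * g t \<omega> - f' t \<omega> * g' t \<omega>\<bar>"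
        unfolding right_diff_distrib[symmetric] of_real_diff[symmetric] norm_mult norm_of_real by simp
      also have "f t \<omega> * g t \<omega> - f' t \<omega> * g' t \<omega> = (f t \<omega> - f' t \<omega>) * g t \<omega> + f' t \<omega> * (g t \<omega> - g' t \<omega>)"
        by (simp add: algebra_simps)
      also have "\<bar>\<dots>\<bar> \<le> \<bar>f t \<omega> - f' t \<omega>\<bar> * \<bar>g t \<omega>\<bar> + \<bar>f' t \<omega>\<bar> * \<bar>g t \<omega> - g' t \<omega>\<bar>"
        unfolding abs_mult[symmetric] by (rule abs_triangle_ineq)
      finally show ?thesis by (simp add: z)
    qed
  qed
  also have "\<dots> \<le> \<epsilon> * (l2norm ?\<mu> (\<lambda>(t, \<omega>). f' t \<omega>) + l2norm ?\<mu> (\<lambda>(t, \<omega>). g' t \<omega>) + \<epsilon>)"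
  proof -
    have d: "sq_integrable ?\<mu> (\<lambda>(t, \<omega>). f t \<omega> - f' t \<omega>)" "sq_integrable ?\<mu> (\<lambda>(t, \<omega>). g t \<omega> - g' t \<omega>)"
      using sq_integrable_diff[OF f f'] sq_integrable_diff[OF g g'] by (simp_all add: case_prod_unfold)
    let ?n = "l2norm ?\<mu>"
    have \<epsilon>: "0 \<le> \<epsilon>" using df l2norm_nonneg order_trans by blast
    have g_le: "?n (\<lambda>(t, \<omega>). g t \<omega>) \<le> \<epsilon> + ?n (\<lambda>(t, \<omega>). g' t \<omega>)"
      using l2norm_add_le[OF d(2) g'] dg by (simp add: case_prod_unfold)
    have "(\<integral>z. norm ((\<lambda>(t, \<omega>). f t \<omega> - f' t \<omega>) z) * norm ((\<lambda>(t, \<omega>). g t \<omega>) z)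
      + norm ((\<lambda>(t, \<omega>). f' t \<omega>) z) * norm ((\<lambda>(t, \<omega>). g t \<omega> - g' t \<omega>) z) \<partial>?\<mu>)
      = (\<integral>z. norm ((\<lambda>(t, \<omega>). f t \<omega> - f' t \<omega>) z) * norm ((\<lambda>(t, \<omega>). g t \<omega>) z) \<partial>?\<mu>)
      + (\<integral>z. norm ((\<lambda>(t, \<omega>). f' t \<omega>) z) * norm ((\<lambda>(t, \<omega>). g t \<omega> - g' t \<omega>) z) \<partial>?\<mu>)"
      by (intro Bochner_Integration.integral_add sq_integrable_norm_mult d f' g)
    also have "\<dots> \<le> ?n (\<lambda>(t, \<omega>). f t \<omega> - f' t \<omega>) * ?n (\<lambda>(t, \<omega>). g t \<omega>) + ?n (\<lambda>(t, \<omega>). f' t \<omega>) * ?n (\<lambda>(t, \<omega>). g t \<omega> - g' t \<omega>)"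
      by (intro add_mono l2norm_Cauchy_Schwarz d f' g)
    also have "\<dots> \<le> \<epsilon> * (\<epsilon> + ?n (\<lambda>(t, \<omega>). g' t \<omega>)) + ?n (\<lambda>(t, \<omega>). f' t \<omega>) * \<epsilon>"
      using df dg g_le \<epsilon> by (intro add_mono mult_mono) auto
    finally show ?thesis by (simp add: algebra_simps)
  qed
  finally show ?thesis .
qed

text \<open>On a finite measure space \<open>y\<^sup>2 \<le> 1 + y ^ 4\<close> turns a fourth moment
  into a second one.\<close>

lemma sq_integrable_fourth_power:
  assumes X: "measurable_process M T X"
    and fin: "(\<integral>\<^sup>+\<omega>. (\<integral>\<^sup>+t\<in>{0..T}. ennreal (X t \<omega> ^ 4) \<partial>lborel) \<partial>M) < \<infinity>"
  shows "sq_integrable (time_measure T \<Otimes>\<^sub>M M) (\<lambda>(t, \<omega>). X t \<omega>)"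
proof -
  interpret NM: finite_measure "time_measure T \<Otimes>\<^sub>M M"
    by (rule finite_measure_pair_measure[OF finite_measure_axioms finite_measure_time_measure])
  have [measurable]: "(\<lambda>z. X (fst z) (snd z)) \<in> borel_measurable (time_measure T \<Otimes>\<^sub>M M)"
    using X by (simp add: measurable_process_iff case_prod_unfold)
  have "(\<lambda>(t, \<omega>). ennreal (X t \<omega> ^ 4)) \<in> borel_measurable (time_measure T \<Otimes>\<^sub>M M)"
    unfolding case_prod_unfold by measurable
  from nn_integral_time_product[OF this] fin
  have "integrable (time_measure T \<Otimes>\<^sub>M M) (\<lambda>z. X (fst z) (snd z) ^ 4)"
    by (intro integrableI_bounded) (auto simp: case_prod_unfold)
  then have "integrable (time_measure T \<Otimes>\<^sub>M M) (\<lambda>z. 1 + X (fst z) (snd z) ^ 4)" by simp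
  then have "integrable (time_measure T \<Otimes>\<^sub>M M) (\<lambda>z. (X (fst z) (snd z))\<^sup>2)"
  proof (rule Bochner_Integration.integrable_bound)
    have "y\<^sup>2 \<le> 1 + y ^ 4" for y :: real
    proof -
      have "0 \<le> (y\<^sup>2 - 1)\<^sup>2" "0 \<le> y\<^sup>2" by simp_all
      moreover have "(y\<^sup>2 - 1)\<^sup>2 = y ^ 4 - 2 * y\<^sup>2 + 1" by (simp add: power2_eq_square power4_eq_xxxx algebra_simps)
      ultimately show ?thesis by linarith
    qed
    then show "AE z in time_measure T \<Otimes>\<^sub>M M. norm ((X (fst z) (snd z))\<^sup>2) \<le> norm (1 + X (fst z) (snd z) ^ 4)"
      by (intro AE_I2) (simp add: order_trans[OF _ abs_ge_self])
  qed measurable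
  then show ?thesis by (simp add: sq_integrable_def case_prod_unfold)
qed

text \<open>Bessel's inequality bounds the sum of the squared coefficients over \<open>A\<close>
  independently of \<open>N\<close> and \<open>n\<close>, since its factor \<open>n\<close> cancels
  against the cell length. Cauchy-Schwarz over the \<open>2N+1\<close> frequencies then makes their
  average norm of order \<open>1 / sqrt (2N+1)\<close>. The set \<open>A\<close> is general so as to
  include the reflected range of \<open>k - s\<close>.\<close>

lemma drift_mesh_fourier:
  assumes T: "T = 2 * pi" and b: "sq_integrable (time_measure T \<Otimes>\<^sub>M M) (\<lambda>(t, \<omega>). b t \<omega> :: real)"
    and A: "card A = 2 * N + 1" "\<And>s s'. s \<in> A \<Longrightarrow> s' \<in> A \<Longrightarrow> \<bar>s - s'\<bar> < int n"
    and sq: "\<And>s. sq_integrable M (mesh_fourier n (\<lambda>t \<omega>. LINT s:{0..t}|lborel. b s \<omega>) s)"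
  shows "(\<Sum>s\<in>A. l2norm M (mesh_fourier n (\<lambda>t \<omega>. LINT s:{0..t}|lborel. b s \<omega>) s)) / (2 * real N + 1)
    \<le> sqrt T * l2norm (time_measure T \<Otimes>\<^sub>M M) (\<lambda>(t, \<omega>). b t \<omega>) / sqrt (2 * real N + 1)"
proof -
  let ?X = "\<lambda>t \<omega>. LINT s:{0..t}|lborel. b s \<omega>" and ?\<beta> = "\<lambda>\<omega>. LINT s:{0..T}|lborel. (b s \<omega>)\<^sup>2"
  let ?b = "l2norm (time_measure T \<Otimes>\<^sub>M M) (\<lambda>(t, \<omega>). b t \<omega>)"
  have T0: "0 < T" using T by simp
  have fin: "finite A" using A(1) by (intro card_ge_0_finite) simp
  obtain s0 where "s0 \<in> A" using A(1) by (metis Suc_eq_plus1 card.empty ex_in_conv nat.simps(3))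
  then have n: "0 < n" using A(2)[of s0 s0] by simp
  have bound: "AE \<omega> in M. (\<Sum>s\<in>A. (norm (mesh_fourier n ?X s \<omega>))\<^sup>2) \<le> T * ?\<beta> \<omega>"
    using drift_mesh_squares[OF b less_imp_le[OF T0] n]
  proof eventually_elim
    case (elim \<omega>)
    have "(\<Sum>s\<in>A. (norm (mesh_fourier n ?X s \<omega>))\<^sup>2)
        = (\<Sum>s\<in>A. (norm (\<Sum>q<n. of_real (?X (mesh T n (Suc q)) \<omega> - ?X (mesh T n q) \<omega>) * fourier_char s (mesh (2 * pi) n q)))\<^sup>2)"
      unfolding mesh_fourier_eq scaleR_conv_of_real T ..
    also have "\<dots> \<le> n * (\<Sum>q<n. (norm (of_real (?X (mesh T n (Suc q)) \<omega> - ?X (mesh T n q) \<omega>) :: complex))\<^sup>2)"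
      by (rule Bessel_mesh[OF fin A(2) n])
    also have "\<dots> \<le> n * (T / n * ?\<beta> \<omega>)"
      unfolding norm_of_real power2_abs using elim by (intro mult_left_mono) auto
    also have "\<dots> = T * ?\<beta> \<omega>" using n by simp
    finally show ?case .
  qed
  have "(\<Sum>s\<in>A. (l2norm M (mesh_fourier n ?X s))\<^sup>2) = expectation (\<lambda>\<omega>. \<Sum>s\<in>A. (norm (mesh_fourier n ?X s \<omega>))\<^sup>2)"
    unfolding l2norm_power2 using sq by (intro Bochner_Integration.integral_sum[symmetric]) (simp add: sq_integrable_def)
  also have "\<dots> \<le> expectation (\<lambda>\<omega>. T * ?\<beta> \<omega>)"
    by (rule integral_mono_AE[OF _ _ bound])
      (use sq square_time_integral(1)[OF b] in \<open>auto simp: sq_integrable_def intro!: Bochner_Integration.integrable_sum\<close>)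
  also have "\<dots> = T * ?b\<^sup>2" by (simp add: square_time_integral(2)[OF b])
  finally have sum: "(\<Sum>s\<in>A. (l2norm M (mesh_fourier n ?X s))\<^sup>2) \<le> T * ?b\<^sup>2" .
  have "(\<Sum>s\<in>A. l2norm M (mesh_fourier n ?X s))\<^sup>2 \<le> (\<Sum>s\<in>A. (l2norm M (mesh_fourier n ?X s))\<^sup>2) * card A"
    by (rule sum_squared_le_sum_of_squares)
  also have "\<dots> \<le> (T * ?b\<^sup>2) * (2 * real N + 1)" unfolding A(1) using sum T0 by (intro mult_mono) auto
  also have "\<dots> = (sqrt T * ?b * sqrt (2 * real N + 1))\<^sup>2" using T0 by (simp add: power_mult_distrib)
  finally have "(\<Sum>s\<in>A. l2norm M (mesh_fourier n ?X s)) \<le> sqrt T * ?b * sqrt (2 * real N + 1)"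
    by (rule power2_le_imp_le) (use T0 in auto)
  then have "(\<Sum>s\<in>A. l2norm M (mesh_fourier n ?X s)) / (2 * real N + 1) \<le> sqrt T * ?b * sqrt (2 * real N + 1) / (2 * real N + 1)"
    by (intro divide_right_mono) auto
  also have "\<dots> = sqrt T * ?b / sqrt (2 * real N + 1)"
  proof -
    have "2 * real N + 1 = sqrt (2 * real N + 1) * sqrt (2 * real N + 1)" by simp
    moreover have "sqrt (2 * real N + 1) \<noteq> 0" by simp
    ultimately show ?thesis by (metis mult_divide_mult_cancel_right)
  qed
  finally show ?thesis .
qed

end

section \<open>Approximation of Ito processes\<close>

context usual_filtered_prob_space
begin

lemma l2_integrator_mono:
  assumes X: "l2_integrator M F T X \<kappa>" and le: "\<kappa> \<le> \<kappa>'"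
  shows "l2_integrator M F T X \<kappa>'"
proof (intro l2_integratorI conjI)
  show "0 \<le> \<kappa>'" using l2_integrator_nonneg[OF X] le by simp
  fix m :: nat and x and v :: "nat \<Rightarrow> 'a \<Rightarrow> complex" and C
  assume "mono_on {..m} x" "x ` {..m} \<subseteq> {0..T}" "\<And>c. c < m \<Longrightarrow> v c \<in> borel_measurable (F (x c))"
    and C: "0 \<le> C" and "\<And>c \<omega>. c < m \<Longrightarrow> \<omega> \<in> space M \<Longrightarrow> norm (v c \<omega>) \<le> C"
  note 1 = l2_integratorD[OF X this]
  show "sq_integrable M (\<lambda>\<omega>. \<Sum>c<m. (X (x (Suc c)) \<omega> - X (x c) \<omega>) *\<^sub>R v c \<omega>)" by (rule 1(1))
  show "l2norm M (\<lambda>\<omega>. \<Sum>c<m. (X (x (Suc c)) \<omega> - X (x c) \<omega>) *\<^sub>R v c \<omega>) \<le> C * \<kappa>'"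
    using 1(2) mult_left_mono[OF le C] by simp
qed (rule l2_integrator_measurable[OF X])

lemma l2_integrator_zero: "l2_integrator M F T (\<lambda>_ _. 0) 0"
  by (simp add: l2_integrator_def l2norm_def)

lemma l2_integrator_sum:
  "finite I \<Longrightarrow> (\<And>i. i \<in> I \<Longrightarrow> l2_integrator M F T (X i) (\<kappa> i)) \<Longrightarrow>
    l2_integrator M F T (\<lambda>t \<omega>. \<Sum>i\<in>I. X i t \<omega>) (\<Sum>i\<in>I. \<kappa> i)"
  by (induction I rule: finite_induct) (auto intro: l2_integrator_zero l2_integrator_add)

text \<open>Characters have modulus 1, so the constant of the integrator bounds the coefficients for
  all frequencies and meshes at once.\<close>

lemma l2_integrator_mesh_fourier:
  assumes X: "l2_integrator M F T X \<kappa>" and T: "T = 2 * pi"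
  shows "sq_integrable M (mesh_fourier n X s)" "l2norm M (mesh_fourier n X s) \<le> \<kappa>"
proof -
  have x: "mono_on {..n} (mesh T n)" "mesh T n ` {..n} \<subseteq> {0..T}"
    using mesh_mono[of T _ _ n] mesh_in[of T _ n] T by (auto simp: mono_on_def)
  have eq: "mesh_fourier n X s = (\<lambda>\<omega>. \<Sum>q<n. (X (mesh T n (Suc q)) \<omega> - X (mesh T n q) \<omega>) *\<^sub>R (\<lambda>q _. fourier_char s (mesh T n q)) q \<omega>)"
    by (simp add: fun_eq_iff mesh_fourier_eq T)
  show "sq_integrable M (mesh_fourier n X s)"
    unfolding eq by (rule l2_integratorD(1)[OF X x, where C=1]) auto
  have "l2norm M (mesh_fourier n X s) \<le> 1 * \<kappa>"
    unfolding eq by (rule l2_integratorD(2)[OF X x]) auto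
  then show "l2norm M (mesh_fourier n X s) \<le> \<kappa>" by simp
qed

lemma sq_integrable_step_value:
  assumes S: "simple_predictable M F T (S :: ('a, real) step_process)"
  shows "sq_integrable (time_measure T \<Otimes>\<^sub>M M) (\<lambda>(t, \<omega>). step_value S t \<omega>)"
proof -
  interpret N: finite_measure "time_measure T" by (rule finite_measure_time_measure)
  interpret NM: finite_measure "time_measure T \<Otimes>\<^sub>M M" by (rule finite_measure_pair_measure[OF finite_measure_axioms N.finite_measure_axioms])
  obtain C where C: "0 \<le> C" "\<And>t \<omega>. \<omega> \<in> space M \<Longrightarrow> norm (step_value S t \<omega>) \<le> C"
    using step_value_bounded[OF S] by metis
  have m: "(\<lambda>(t, \<omega>). step_value S t \<omega>) \<in> borel_measurable (time_measure T \<Otimes>\<^sub>M M)"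
    by (intro measurable_time_measureI step_value_pair_measurable simple_predictable_coeff_measurable[OF S])
  show ?thesis
  proof (rule sq_integrable_dominated[OF _ m])
    show "sq_integrable (time_measure T \<Otimes>\<^sub>M M) (\<lambda>_. C)" using NM.finite_measure_axioms by simp
    show "AE z in time_measure T \<Otimes>\<^sub>M M. norm ((\<lambda>(t, \<omega>). step_value S t \<omega>) z) \<le> 1 * norm C"
      using C by (intro AE_I2) (auto simp: space_pair_measure)
  qed
qed

text \<open>One index \<open>n\<close> serves the integrand and the integral at the times 0 and
  \<open>T\<close>. The remainder is a square-integrable martingale, so the norm of its increment
  over the horizon, at most \<open>\<epsilon> / 2 + \<epsilon> / 2\<close>, is its constant as an
  integrator.\<close>

lemma ito_integral_approx:
  assumes W: "brownian_motion M F T W" and I: "has_ito_integral M F T W H I" and T: "0 \<le> T"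
    and H: "sq_integrable (time_measure T \<Otimes>\<^sub>M M) (\<lambda>(t, \<omega>). H t \<omega>)" and \<epsilon>: "0 < \<epsilon>"
  shows "\<exists>S. simple_predictable M F T S \<and>
    l2norm (time_measure T \<Otimes>\<^sub>M M) (\<lambda>(t, \<omega>). step_value S t \<omega> - H t \<omega>) \<le> \<epsilon> \<and>
    l2_integrator M F T (\<lambda>t \<omega>. I t \<omega> - step_integral S W t \<omega>) \<epsilon>"
proof -
  obtain S :: "nat \<Rightarrow> ('a, real) step_process" where S: "\<And>n. simple_predictable M F T (S n)"
    and lim1: "(\<lambda>n. \<integral>\<^sup>+\<omega>. (\<integral>\<^sup>+t\<in>{0..T}. ennreal ((step_value (S n) t \<omega> - H t \<omega>)\<^sup>2) \<partial>lborel) \<partial>M) \<longlonglongrightarrow> 0"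
    and lim2: "\<And>t. t \<in> {0..T} \<Longrightarrow> (\<lambda>n. \<integral>\<^sup>+\<omega>. ennreal ((step_integral (S n) W t \<omega> - I t \<omega>)\<^sup>2) \<partial>M) \<longlonglongrightarrow> 0"
    using I unfolding has_ito_integral_def by blast
  have pos: "0 < ennreal ((\<epsilon> / 2)\<^sup>2)" using \<epsilon> by simp
  have "0 \<in> {0..T}" "T \<in> {0..T}" using T by auto
  then have "\<forall>\<^sub>F n in sequentially.
      (\<integral>\<^sup>+\<omega>. (\<integral>\<^sup>+t\<in>{0..T}. ennreal ((step_value (S n) t \<omega> - H t \<omega>)\<^sup>2) \<partial>lborel) \<partial>M) < ennreal ((\<epsilon> / 2)\<^sup>2) \<and>
      (\<integral>\<^sup>+\<omega>. ennreal ((step_integral (S n) W 0 \<omega> - I 0 \<omega>)\<^sup>2) \<partial>M) < ennreal ((\<epsilon> / 2)\<^sup>2) \<and>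
      (\<integral>\<^sup>+\<omega>. ennreal ((step_integral (S n) W T \<omega> - I T \<omega>)\<^sup>2) \<partial>M) < ennreal ((\<epsilon> / 2)\<^sup>2)"
    by (intro eventually_conj order_tendstoD(2)[OF lim1 pos] order_tendstoD(2)[OF lim2 pos])
  then obtain n where n: "(\<integral>\<^sup>+\<omega>. (\<integral>\<^sup>+t\<in>{0..T}. ennreal ((step_value (S n) t \<omega> - H t \<omega>)\<^sup>2) \<partial>lborel) \<partial>M) < ennreal ((\<epsilon> / 2)\<^sup>2)"
      "(\<integral>\<^sup>+\<omega>. ennreal ((step_integral (S n) W 0 \<omega> - I 0 \<omega>)\<^sup>2) \<partial>M) < ennreal ((\<epsilon> / 2)\<^sup>2)"
      "(\<integral>\<^sup>+\<omega>. ennreal ((step_integral (S n) W T \<omega> - I T \<omega>)\<^sup>2) \<partial>M) < ennreal ((\<epsilon> / 2)\<^sup>2)"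
    by (auto simp: eventually_sequentially)
  have J: "l2_martingale M F T (step_integral (S n) W)"
    by (intro step_integral_l2_martingale S brownian_motion_l2_martingale W)
  have IM: "l2_martingale M F T I" by (rule has_ito_integral_l2_martingale[OF W I])
  have R: "l2_martingale M F T (\<lambda>t \<omega>. I t \<omega> - step_integral (S n) W t \<omega>)"
    by (rule l2_martingale_diff[OF IM J])
  have e: "sq_integrable M (\<lambda>\<omega>. I t \<omega> - step_integral (S n) W t \<omega>)" if "t \<in> {0..T}" for t
    using R that by (auto simp: l2_martingale_def)
  have small: "l2norm M (\<lambda>\<omega>. I t \<omega> - step_integral (S n) W t \<omega>) \<le> \<epsilon> / 2"
    if "(\<integral>\<^sup>+\<omega>. ennreal ((step_integral (S n) W t \<omega> - I t \<omega>)\<^sup>2) \<partial>M) < ennreal ((\<epsilon> / 2)\<^sup>2)" "t \<in> {0..T}" for t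
    using that(1) \<epsilon> e[OF that(2)]
    by (intro sq_integrableI_nn_integral(2)) (auto simp: sq_integrable_def power2_commute[of "I t _"])
  have sq: "sq_integrable (time_measure T \<Otimes>\<^sub>M M) (\<lambda>(t, \<omega>). step_value (S n) t \<omega> - H t \<omega>)"
    using sq_integrable_diff[OF sq_integrable_step_value[OF S[of n]] H] by (simp add: case_prod_unfold)
  then have m: "(\<lambda>z. step_value (S n) (fst z) (snd z) - H (fst z) (snd z)) \<in> borel_measurable (time_measure T \<Otimes>\<^sub>M M)"
    by (simp add: sq_integrable_def case_prod_unfold)
  have "(\<integral>\<^sup>+z. ennreal ((norm ((\<lambda>(t, \<omega>). step_value (S n) t \<omega> - H t \<omega>) z))\<^sup>2) \<partial>(time_measure T \<Otimes>\<^sub>M M)) \<le> ennreal ((\<epsilon> / 2)\<^sup>2)"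
  proof -
    have "(\<lambda>(t, \<omega>). ennreal ((step_value (S n) t \<omega> - H t \<omega>)\<^sup>2)) \<in> borel_measurable (time_measure T \<Otimes>\<^sub>M M)"
      unfolding case_prod_unfold using m by measurable
    from nn_integral_time_product[OF this] n(1) show ?thesis by (simp add: case_prod_unfold)
  qed
  then have "l2norm (time_measure T \<Otimes>\<^sub>M M) (\<lambda>(t, \<omega>). step_value (S n) t \<omega> - H t \<omega>) \<le> \<epsilon> / 2"
    using \<epsilon> sq by (intro sq_integrableI_nn_integral(2)) (auto simp: sq_integrable_def)
  moreover have "l2_integrator M F T (\<lambda>t \<omega>. I t \<omega> - step_integral (S n) W t \<omega>) \<epsilon>"
  proof (rule l2_integrator_mono[OF l2_integrator_l2_martingale[OF R]])
    have 0: "0 \<in> {0..T}" "T \<in> {0..T}" using T by auto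
    show "l2norm M (\<lambda>\<omega>. (I T \<omega> - step_integral (S n) W T \<omega>) - (I 0 \<omega> - step_integral (S n) W 0 \<omega>)) \<le> \<epsilon>"
      using l2norm_diff_le[OF e[OF 0(2)] e[OF 0(1)]] small[OF n(2) 0(1)] small[OF n(3) 0(2)] by simp
  qed
  ultimately show ?thesis using S[of n] \<epsilon> by (intro exI[of _ "S n"]) auto
qed

lemma ito_process_integrator:
  assumes p: "ito_process M F T L W p \<sigma> b" and W: "\<And>l. l \<in> L \<Longrightarrow> brownian_motion M F T (W l)"
    and L: "finite L" and T: "0 \<le> T"
  obtains \<kappa> where "l2_integrator M F T p \<kappa>"
proof -
  obtain I where I: "\<And>l. l \<in> L \<Longrightarrow> has_ito_integral M F T (W l) (\<sigma> l) (I l)"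
    and eq: "AE \<omega> in M. \<forall>t\<in>{0..T}. p t \<omega> = p 0 \<omega> + (\<Sum>l\<in>L. I l t \<omega>) + (LINT s:{0..t}|lborel. b s \<omega>)"
    using p unfolding ito_process_def has_ito_differential_def by blast
  have "l2_integrator M F T (\<lambda>t \<omega>. (\<Sum>l\<in>L. I l t \<omega>) + (LINT s:{0..t}|lborel. b s \<omega>))
      ((\<Sum>l\<in>L. l2norm M (\<lambda>\<omega>. I l T \<omega> - I l 0 \<omega>)) + sqrt T * l2norm (time_measure T \<Otimes>\<^sub>M M) (\<lambda>(t, \<omega>). b t \<omega>))"
    using p T unfolding ito_process_def
    by (intro l2_integrator_add l2_integrator_sum l2_integrator_drift L l2_integrator_l2_martingale has_ito_integral_l2_martingale[OF W I]) auto
  then have "l2_integrator M F T p ((\<Sum>l\<in>L. l2norm M (\<lambda>\<omega>. I l T \<omega> - I l 0 \<omega>)) + sqrt T * l2norm (time_measure T \<Otimes>\<^sub>M M) (\<lambda>(t, \<omega>). b t \<omega>))"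
  proof (rule l2_integrator_cong)
    show "p t \<in> borel_measurable M" if "t \<in> {0..T}" for t using p that by (auto simp: ito_process_def)
    show "AE \<omega> in M. \<forall>t\<in>{0..T}. p t \<omega> = p 0 \<omega> + ((\<Sum>l\<in>L. I l t \<omega>) + (LINT s:{0..t}|lborel. b s \<omega>))"
      using eq by (simp only: add.assoc)
  qed
  then show ?thesis by (rule that)
qed

text \<open>\<open>Q\<close> gathers the remainders of the Ito integrals and is small as an
  integrator. The drift is kept apart: it need not be small, but its coefficients average
  out.\<close>

lemma ito_process_decomposition:
  fixes \<epsilon> :: real
  assumes p: "ito_process M F T L W p \<sigma> b" and W: "\<And>l. l \<in> L \<Longrightarrow> brownian_motion M F T (W l)"
    and L: "finite L" and T: "0 \<le> T" and \<epsilon>: "0 < \<epsilon>"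
  obtains S Q where "\<And>l. l \<in> L \<Longrightarrow> simple_predictable M F T (S l)"
    "\<And>l. l \<in> L \<Longrightarrow> l2norm (time_measure T \<Otimes>\<^sub>M M) (\<lambda>(t, \<omega>). step_value (S l) t \<omega> - \<sigma> l t \<omega>) \<le> \<epsilon>"
    "l2_integrator M F T Q (card L * \<epsilon>)"
    "AE \<omega> in M. \<forall>t\<in>{0..T}. p t \<omega> = p 0 \<omega> + ((\<Sum>l\<in>L. step_integral (S l) (W l) t \<omega>) + Q t \<omega> + (LINT s:{0..t}|lborel. b s \<omega>))"
proof -
  obtain I where I: "\<And>l. l \<in> L \<Longrightarrow> has_ito_integral M F T (W l) (\<sigma> l) (I l)"
    and eq: "AE \<omega> in M. \<forall>t\<in>{0..T}. p t \<omega> = p 0 \<omega> + (\<Sum>l\<in>L. I l t \<omega>) + (LINT s:{0..t}|lborel. b s \<omega>)"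
    using p unfolding ito_process_def has_ito_differential_def by blast
  have "\<forall>l\<in>L. \<exists>S. simple_predictable M F T S \<and>
    l2norm (time_measure T \<Otimes>\<^sub>M M) (\<lambda>(t, \<omega>). step_value S t \<omega> - \<sigma> l t \<omega>) \<le> \<epsilon> \<and>
    l2_integrator M F T (\<lambda>t \<omega>. I l t \<omega> - step_integral S (W l) t \<omega>) \<epsilon>"
  proof
    fix l assume l: "l \<in> L"
    show "\<exists>S. simple_predictable M F T S \<and>
      l2norm (time_measure T \<Otimes>\<^sub>M M) (\<lambda>(t, \<omega>). step_value S t \<omega> - \<sigma> l t \<omega>) \<le> \<epsilon> \<and>
      l2_integrator M F T (\<lambda>t \<omega>. I l t \<omega> - step_integral S (W l) t \<omega>) \<epsilon>"
      using p l unfolding ito_process_def by (intro ito_integral_approx[OF W[OF l] I[OF l] T _ \<epsilon>]) auto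
  qed
  from bchoice[OF this] obtain S where "\<forall>l\<in>L. simple_predictable M F T (S l) \<and>
    l2norm (time_measure T \<Otimes>\<^sub>M M) (\<lambda>(t, \<omega>). step_value (S l) t \<omega> - \<sigma> l t \<omega>) \<le> \<epsilon> \<and>
    l2_integrator M F T (\<lambda>t \<omega>. I l t \<omega> - step_integral (S l) (W l) t \<omega>) \<epsilon>"
    by (elim exE)
  then have S: "simple_predictable M F T (S l)"
    "l2norm (time_measure T \<Otimes>\<^sub>M M) (\<lambda>(t, \<omega>). step_value (S l) t \<omega> - \<sigma> l t \<omega>) \<le> \<epsilon>"
    "l2_integrator M F T (\<lambda>t \<omega>. I l t \<omega> - step_integral (S l) (W l) t \<omega>) \<epsilon>" if "l \<in> L" for l
    using that by auto
  let ?Q = "\<lambda>t \<omega>. \<Sum>l\<in>L. I l t \<omega> - step_integral (S l) (W l) t \<omega>"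
  have "l2_integrator M F T ?Q (\<Sum>l\<in>L. \<epsilon>)" by (intro l2_integrator_sum L S(3))
  then have Q: "l2_integrator M F T ?Q (card L * \<epsilon>)" by simp
  have dec: "AE \<omega> in M. \<forall>t\<in>{0..T}. p t \<omega> = p 0 \<omega> + ((\<Sum>l\<in>L. step_integral (S l) (W l) t \<omega>) + ?Q t \<omega> + (LINT s:{0..t}|lborel. b s \<omega>))"
    using eq
  proof eventually_elim
    case (elim \<omega>)
    show ?case
    proof
      fix t assume t: "t \<in> {0..T}"
      have "(\<Sum>l\<in>L. I l t \<omega>) = (\<Sum>l\<in>L. step_integral (S l) (W l) t \<omega>) + ?Q t \<omega>"
        by (simp add: sum_subtractf)
      then show "p t \<omega> = p 0 \<omega> + ((\<Sum>l\<in>L. step_integral (S l) (W l) t \<omega>) + ?Q t \<omega> + (LINT s:{0..t}|lborel. b s \<omega>))"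
        unfolding bspec[OF elim t] by (simp only: add.assoc)
    qed
  qed
  show ?thesis by (rule that[OF _ _ Q dec]) (erule S)+
qed

end

section \<open>Bohr means of Ito processes and the limit of fine meshes\<close>

context usual_filtered_prob_space
begin

text \<open>Mesh coefficients are linear in the process, so subtracting the simple part leaves
  almost surely those of \<open>Q\<close> and of the drift; the initial value drops out with the
  increments.\<close>

lemma residual_mesh_fourier:
  assumes T: "T = 2 * pi" and p: "ito_process M F T L W p \<sigma> b" and L: "finite L" and n: "0 < n"
    and p\<kappa>: "l2_integrator M F T p \<kappa>" and J: "\<And>l. l \<in> L \<Longrightarrow> l2_martingale M F T (J l)"
    and Q: "l2_integrator M F T Q q"
    and eq: "AE \<omega> in M. \<forall>t\<in>{0..T}. p t \<omega> = p 0 \<omega> + ((\<Sum>l\<in>L. J l t \<omega>) + Q t \<omega> + (LINT s:{0..t}|lborel. b s \<omega>))"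
  defines "D \<equiv> \<lambda>s \<omega>. mesh_fourier n p s \<omega> - (\<Sum>l\<in>L. mesh_fourier n (J l) s \<omega>)"
  shows "sq_integrable M (D s)"
    and "l2norm M (D s) \<le> q + l2norm M (mesh_fourier n (\<lambda>t \<omega>. LINT s:{0..t}|lborel. b s \<omega>) s)"
proof -
  let ?A = "\<lambda>t \<omega>. LINT s:{0..t}|lborel. b s \<omega>"
  have T0: "0 \<le> T" using T by simp
  have A: "l2_integrator M F T ?A (sqrt T * l2norm (time_measure T \<Otimes>\<^sub>M M) (\<lambda>(t, \<omega>). b t \<omega>))"
    using p T0 by (intro l2_integrator_drift) (auto simp: ito_process_def)
  note sqA = l2_integrator_mesh_fourier[OF A T] and sqQ = l2_integrator_mesh_fourier[OF Q T]
    and sqp = l2_integrator_mesh_fourier[OF p\<kappa> T]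
  have sqJ: "sq_integrable M (mesh_fourier n (J l) s)" if "l \<in> L" for l
    by (rule l2_integrator_mesh_fourier(1)[OF l2_integrator_l2_martingale[OF J[OF that]] T])
  show sqD: "sq_integrable M (D s)"
    unfolding D_def using sqJ by (intro sq_integrable_diff sqp(1) sq_integrable_sum) auto
  have "AE \<omega> in M. mesh_fourier n Q s \<omega> + mesh_fourier n ?A s \<omega> = D s \<omega>"
    using eq
  proof eventually_elim
    case (elim \<omega>)
    let ?X = "\<lambda>t. (\<Sum>l\<in>L. J l t \<omega>) + Q t \<omega> + ?A t \<omega>"
    have "mesh_fourier n p s \<omega> = (\<Sum>q<n. ((\<Sum>l\<in>L. J l (mesh T n (Suc q)) \<omega> - J l (mesh T n q) \<omega>)
        + (Q (mesh T n (Suc q)) \<omega> - Q (mesh T n q) \<omega>) + (?A (mesh T n (Suc q)) \<omega> - ?A (mesh T n q) \<omega>)) *\<^sub>R fourier_char s (mesh T n q))"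
      unfolding mesh_fourier_eq T[symmetric]
    proof (intro sum.cong refl)
      fix r assume "r \<in> {..<n}"
      then have "mesh T n (Suc r) \<in> {0..T}" "mesh T n r \<in> {0..T}" by (auto intro!: mesh_in[OF T0] simp del: atLeastAtMost_iff)
      note * = bspec[OF elim this(1)] bspec[OF elim this(2)]
      show "(p (mesh T n (Suc r)) \<omega> - p (mesh T n r) \<omega>) *\<^sub>R fourier_char s (mesh T n r) =
        ((\<Sum>l\<in>L. J l (mesh T n (Suc r)) \<omega> - J l (mesh T n r) \<omega>)
        + (Q (mesh T n (Suc r)) \<omega> - Q (mesh T n r) \<omega>) + (?A (mesh T n (Suc r)) \<omega> - ?A (mesh T n r) \<omega>)) *\<^sub>R fourier_char s (mesh T n r)"
        unfolding *(1) *(2) sum_subtractf by simp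
    qed
    also have "\<dots> = (\<Sum>l\<in>L. mesh_fourier n (J l) s \<omega>) + mesh_fourier n Q s \<omega> + mesh_fourier n ?A s \<omega>"
      unfolding mesh_fourier_eq T[symmetric] scaleR_add_left sum.distrib scaleR_sum_left
      by (subst sum.swap) simp
    finally show ?case unfolding D_def by simp
  qed
  then have "l2norm M (\<lambda>\<omega>. mesh_fourier n Q s \<omega> + mesh_fourier n ?A s \<omega>) = l2norm M (D s)"
    using sqQ(1)[of n s] sqA(1)[of n s] sqD by (intro l2norm_cong_AE) (auto simp: sq_integrable_def)
  moreover have "l2norm M (\<lambda>\<omega>. mesh_fourier n Q s \<omega> + mesh_fourier n ?A s \<omega>) \<le> l2norm M (mesh_fourier n Q s) + l2norm M (mesh_fourier n ?A s)"
    by (rule l2norm_add_le[OF sqQ(1) sqA(1)])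
  ultimately show "l2norm M (D s) \<le> q + l2norm M (mesh_fourier n ?A s)" using sqQ(2)[of n s] by simp
qed

text \<open>The error splits into four: the simple forms against their integrals \<open>X\<close>,
  these against \<open>Y\<close>, and the residuals \<open>D\<close> and \<open>D'\<close> in either
  factor. Contributions of the approximation total at most \<open>\<epsilon> * G\<close>, all others
  at most \<open>H / sqrt (2N+1)\<close>. First \<open>\<eta>\<close> determines
  \<open>\<epsilon>\<close>, and only then \<open>N0\<close>, as \<open>H\<close> depends on the
  simple processes through \<open>C\<close>.\<close>

lemma mesh_bohr_convergence:
  fixes k :: int and \<eta> :: real
  assumes T: "T = 2 * pi" and L: "finite L" and W: "independent_brownian_motions M F T L W"
    and p: "ito_process M F T L W p \<sigma> b" and p': "ito_process M F T L W p' \<sigma>' b'" and \<eta>: "0 < \<eta>"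
  defines "\<Xi> \<equiv> \<lambda>\<omega>. LINT t:{0..T}|lborel. fourier_char k t * of_real (\<Sum>l\<in>L. \<sigma> l t \<omega> * \<sigma>' l t \<omega>)"
  shows "integrable M \<Xi>"
    and "\<exists>N0. \<forall>N\<ge>N0. \<forall>n\<ge>2 * N + 1.
      expectation (\<lambda>\<omega>. norm (bohr_mean N (\<lambda>s. mesh_fourier n p s \<omega>) (\<lambda>s. mesh_fourier n p' s \<omega>) k - \<Xi> \<omega>)) \<le> \<eta>"
proof -
  let ?\<mu> = "time_measure T \<Otimes>\<^sub>M M"
  have T0: "0 \<le> T" "0 < T" using T by auto
  have bm: "brownian_motion M F T (W l)" if "l \<in> L" for l
    using W that by (simp add: independent_brownian_motions_def)
  have \<sigma>: "sq_integrable ?\<mu> (\<lambda>(t, \<omega>). \<sigma> l t \<omega>)" "sq_integrable ?\<mu> (\<lambda>(t, \<omega>). \<sigma>' l t \<omega>)" if "l \<in> L" for l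
    using p p' that by (auto simp: ito_process_def)
  define Y where "Y l \<omega> = (LINT t:{0..T}|lborel. fourier_char k t * of_real (\<sigma> l t \<omega> * \<sigma>' l t \<omega>))" for l \<omega>
  have Yi: "integrable ?\<mu> (\<lambda>(t, \<omega>). fourier_char k t * of_real (\<sigma> l t \<omega> * \<sigma>' l t \<omega>))" if "l \<in> L" for l
    using \<sigma>[OF that] by (intro fourier_product_integrable)
  have Yint: "integrable M (Y l)" if "l \<in> L" for l
    unfolding Y_def by (rule time_integral_integrable[OF Yi[OF that]])
  have Gsum: "(\<lambda>(t, \<omega>). fourier_char k t * of_real (\<Sum>l\<in>L. \<sigma> l t \<omega> * \<sigma>' l t \<omega>))
      = (\<lambda>z. \<Sum>l\<in>L. (\<lambda>(t, \<omega>). fourier_char k t * of_real (\<sigma> l t \<omega> * \<sigma>' l t \<omega>)) z)"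
    by (simp add: fun_eq_iff sum_distrib_left)
  have "integrable ?\<mu> (\<lambda>(t, \<omega>). fourier_char k t * of_real (\<Sum>l\<in>L. \<sigma> l t \<omega> * \<sigma>' l t \<omega>))"
    unfolding Gsum by (intro Bochner_Integration.integrable_sum Yi)
  then show \<Xi>int: "integrable M \<Xi>" unfolding \<Xi>_def by (rule time_integral_integrable)
  \<comment> \<open>The time integral of the sum over \<open>l\<close> splits where all the sections
    are integrable, hence almost surely.\<close>
  have \<Xi>Y: "AE \<omega> in M. \<Xi> \<omega> = (\<Sum>l\<in>L. Y l \<omega>)"
  proof -
    have "AE \<omega> in M. \<forall>l\<in>L. set_integrable lborel {0..T} (\<lambda>t. fourier_char k t * of_real (\<sigma> l t \<omega> * \<sigma>' l t \<omega>))"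
      using time_integrable_sections[OF Yi] L by (intro AE_finite_allI) auto
    then show ?thesis
    proof eventually_elim
      case (elim \<omega>)
      have "\<Xi> \<omega> = (LINT t:{0..T}|lborel. \<Sum>l\<in>L. fourier_char k t * of_real (\<sigma> l t \<omega> * \<sigma>' l t \<omega>))"
        unfolding \<Xi>_def of_real_sum sum_distrib_left ..
      also have "\<dots> = (\<Sum>l\<in>L. Y l \<omega>)"
        unfolding Y_def set_lebesgue_integral_def scaleR_sum_right
        using elim by (intro Bochner_Integration.integral_sum) (auto simp: set_integrable_def)
      finally show ?case .
    qed
  qed
  obtain \<kappa> where \<kappa>: "l2_integrator M F T p \<kappa>" using ito_process_integrator[OF p bm L T0(1)] by blast
  obtain \<kappa>' where \<kappa>': "l2_integrator M F T p' \<kappa>'" using ito_process_integrator[OF p' bm L T0(1)] by blast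
  note \<kappa>0 = l2_integrator_nonneg[OF \<kappa>] l2_integrator_nonneg[OF \<kappa>']
  define \<beta> where "\<beta> = sqrt T * l2norm ?\<mu> (\<lambda>(t, \<omega>). b t \<omega>)"
  define \<beta>' where "\<beta>' = sqrt T * l2norm ?\<mu> (\<lambda>(t, \<omega>). b' t \<omega>)"
  have \<beta>0: "0 \<le> \<beta>" "0 \<le> \<beta>'" using T0 by (auto simp: \<beta>_def \<beta>'_def)
  define c where "c = real (card L)"
  define V where "V l = l2norm ?\<mu> (\<lambda>(t, \<omega>). \<sigma> l t \<omega>) + l2norm ?\<mu> (\<lambda>(t, \<omega>). \<sigma>' l t \<omega>) + 1" for l
  have V0: "0 \<le> V l" for l unfolding V_def by (intro add_nonneg_nonneg l2norm_nonneg) auto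
  \<comment> \<open>Sum of the coefficients of \<open>\<epsilon>\<close> in the final estimate; it
    is fixed by the two processes and their coefficients before any approximation is chosen.\<close>
  define G where "G = \<kappa>' * c + (\<kappa> + c + \<beta>) * c + (\<Sum>l\<in>L. V l)"
  have G0: "0 \<le> G"
    unfolding G_def c_def using \<kappa>0 \<beta>0 V0 by (intro add_nonneg_nonneg mult_nonneg_nonneg sum_nonneg) auto
  \<comment> \<open>\<open>\<epsilon> \<le> 1\<close> is behind
    \<open>c * \<epsilon> \<le> c\<close> and the constant 1 in \<open>V\<close>;
    \<open>G + 1\<close> keeps the denominator positive.\<close>
  define \<epsilon> where "\<epsilon> = min 1 (\<eta> / (2 * (G + 1)))"
  have \<epsilon>: "0 < \<epsilon>" "\<epsilon> \<le> 1" using \<eta> G0 by (auto simp: \<epsilon>_def)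
  have \<epsilon>G: "\<epsilon> * G \<le> \<eta> / 2"
  proof -
    have "\<epsilon> * G \<le> \<eta> / (2 * (G + 1)) * (G + 1)" using G0 \<eta> by (intro mult_mono) (auto simp: \<epsilon>_def)
    also have "\<dots> = \<eta> / 2" using G0 by (simp add: field_simps)
    finally show ?thesis .
  qed
  obtain S Q where S: "\<And>l. l \<in> L \<Longrightarrow> simple_predictable M F T (S l)"
    "\<And>l. l \<in> L \<Longrightarrow> l2norm ?\<mu> (\<lambda>(t, \<omega>). step_value (S l) t \<omega> - \<sigma> l t \<omega>) \<le> \<epsilon>"
    and Q: "l2_integrator M F T Q (card L * \<epsilon>)"
    and eq: "AE \<omega> in M. \<forall>t\<in>{0..T}. p t \<omega> = p 0 \<omega> + ((\<Sum>l\<in>L. step_integral (S l) (W l) t \<omega>) + Q t \<omega> + (LINT s:{0..t}|lborel. b s \<omega>))"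
    using ito_process_decomposition[OF p bm L T0(1) \<epsilon>(1)] by blast
  obtain S' Q' where S': "\<And>l. l \<in> L \<Longrightarrow> simple_predictable M F T (S' l)"
    "\<And>l. l \<in> L \<Longrightarrow> l2norm ?\<mu> (\<lambda>(t, \<omega>). step_value (S' l) t \<omega> - \<sigma>' l t \<omega>) \<le> \<epsilon>"
    and Q': "l2_integrator M F T Q' (card L * \<epsilon>)"
    and eq': "AE \<omega> in M. \<forall>t\<in>{0..T}. p' t \<omega> = p' 0 \<omega> + ((\<Sum>l\<in>L. step_integral (S' l) (W l) t \<omega>) + Q' t \<omega> + (LINT s:{0..t}|lborel. b' s \<omega>))"
    using ito_process_decomposition[OF p' bm L T0(1) \<epsilon>(1)] by blast
  have bounded: "\<exists>C. 0 \<le> C \<and> (\<forall>l\<in>L. \<forall>t. \<forall>\<omega>\<in>space M. \<bar>step_value (S'' l) t \<omega>\<bar> \<le> C)"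
    if "\<forall>l\<in>L. simple_predictable M F T (S'' l)" for S'' :: "_ \<Rightarrow> ('a, real) step_process"
  proof -
    have "\<forall>l\<in>L. \<exists>C. 0 \<le> C \<and> (\<forall>t. \<forall>\<omega>\<in>space M. \<bar>step_value (S'' l) t \<omega>\<bar> \<le> C)"
    proof
      fix l assume "l \<in> L"
      from step_value_bounded[OF bspec[OF that this]] show "\<exists>C. 0 \<le> C \<and> (\<forall>t. \<forall>\<omega>\<in>space M. \<bar>step_value (S'' l) t \<omega>\<bar> \<le> C)"
        unfolding real_norm_def by metis
    qed
    then obtain C where C: "\<And>l. l \<in> L \<Longrightarrow> 0 \<le> C l" "\<And>l t \<omega>. l \<in> L \<Longrightarrow> \<omega> \<in> space M \<Longrightarrow> \<bar>step_value (S'' l) t \<omega>\<bar> \<le> C l"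
      by metis
    have "C l \<le> sum C L" if "l \<in> L" for l using that C(1) L by (intro member_le_sum) auto
    then show ?thesis
      by (intro exI[of _ "sum C L"]) (meson C order_trans sum_nonneg)
  qed
  obtain C1 where C1: "0 \<le> C1" "\<forall>l\<in>L. \<forall>t. \<forall>\<omega>\<in>space M. \<bar>step_value (S l) t \<omega>\<bar> \<le> C1"
    using bounded[of S] S(1) by blast
  obtain C2 where C2: "0 \<le> C2" "\<forall>l\<in>L. \<forall>t. \<forall>\<omega>\<in>space M. \<bar>step_value (S' l) t \<omega>\<bar> \<le> C2"
    using bounded[of S'] S'(1) by blast
  define C where "C = max C1 C2"
  have C: "0 \<le> C" "\<And>l t \<omega>. l \<in> L \<Longrightarrow> \<omega> \<in> space M \<Longrightarrow> \<bar>step_value (S l) t \<omega>\<bar> \<le> C"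
    "\<And>l t \<omega>. l \<in> L \<Longrightarrow> \<omega> \<in> space M \<Longrightarrow> \<bar>step_value (S' l) t \<omega>\<bar> \<le> C"
    using C1 C2 unfolding C_def by (auto intro: max.coboundedI1 max.coboundedI2)
  define E where "E = C\<^sup>2 * (4 * T + \<bar>of_int k\<bar> * T\<^sup>2)"
  have E0: "0 \<le> E" unfolding E_def using T0 by auto
  \<comment> \<open>Sum of the coefficients of \<open>1 / sqrt (2N+1)\<close>; the factor
    \<open>c\<close> in front of \<open>c * E\<close> and the one inside count the pairs of
    motions.\<close>
  define H where "H = \<kappa>' * \<beta> + (\<kappa> + c + \<beta>) * \<beta>' + c * (c * E)"
  have H0: "0 \<le> H" unfolding H_def c_def using \<kappa>0 \<beta>0 E0 by (intro add_nonneg_nonneg mult_nonneg_nonneg) auto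
  \<comment> \<open>This threshold makes \<open>H / sqrt (2N+1)\<close> at most
    \<open>\<eta> / 2\<close>.\<close>
  obtain N0 :: nat where N0: "(2 * H / \<eta>)\<^sup>2 \<le> N0" using real_arch_simple by blast
  show "\<exists>N0. \<forall>N\<ge>N0. \<forall>n\<ge>2 * N + 1.
      expectation (\<lambda>\<omega>. norm (bohr_mean N (\<lambda>s. mesh_fourier n p s \<omega>) (\<lambda>s. mesh_fourier n p' s \<omega>) k - \<Xi> \<omega>)) \<le> \<eta>"
  proof (intro exI allI impI)
    fix N n :: nat assume N: "N0 \<le> N" and n: "2 * N + 1 \<le> n"
    let ?q = "sqrt (2 * real N + 1)" and ?I = "{- int N..int N}"
    have q0: "0 < ?q" by simp
    have Hq: "H / ?q \<le> \<eta> / 2"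
    proof -
      have "(2 * H / \<eta>)\<^sup>2 \<le> 2 * real N + 1" using N0 N by linarith
      then have "2 * H / \<eta> \<le> ?q" by (rule real_le_rsqrt)
      then show ?thesis using \<eta> q0 by (simp add: field_simps)
    qed
    define P where "P s = mesh_fourier n p s" for s
    define P' where "P' s = mesh_fourier n p' s" for s
    define J where "J l s = mesh_fourier n (step_integral (S l) (W l)) s" for l s
    define J' where "J' l s = mesh_fourier n (step_integral (S' l) (W l)) s" for l s
    define D where "D s \<omega> = P s \<omega> - (\<Sum>l\<in>L. J l s \<omega>)" for s \<omega>
    define D' where "D' s \<omega> = P' s \<omega> - (\<Sum>l\<in>L. J' l s \<omega>)" for s \<omega>
    define A where "A s = l2norm M (mesh_fourier n (\<lambda>t \<omega>. LINT s:{0..t}|lborel. b s \<omega>) s)" for s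
    define A' where "A' s = l2norm M (mesh_fourier n (\<lambda>t \<omega>. LINT s:{0..t}|lborel. b' s \<omega>) s)" for s
    have mart: "l2_martingale M F T (step_integral (S l) (W l))" "l2_martingale M F T (step_integral (S' l) (W l))" if "l \<in> L" for l
      using step_integral_l2_martingale[OF brownian_motion_l2_martingale[OF bm[OF that]] S(1)[OF that]]
        step_integral_l2_martingale[OF brownian_motion_l2_martingale[OF bm[OF that]] S'(1)[OF that]] by auto
    have Dsq: "sq_integrable M (D s)" "l2norm M (D s) \<le> c * \<epsilon> + A s" for s
      using residual_mesh_fourier[OF T p L _ \<kappa> mart(1) Q eq, of n s] n unfolding D_def P_def J_def A_def c_def by auto
    have D'sq: "sq_integrable M (D' s)" "l2norm M (D' s) \<le> c * \<epsilon> + A' s" for s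
      using residual_mesh_fourier[OF T p' L _ \<kappa>' mart(2) Q' eq', of n s] n unfolding D'_def P'_def J'_def A'_def c_def by auto
    have Jsq: "sq_integrable M (J l s)" "sq_integrable M (J' l s)" if "l \<in> L" for l s
      unfolding J_def J'_def
      by (rule l2_integrator_mesh_fourier(1)[OF l2_integrator_l2_martingale[OF mart(1)[OF that]] T]
          l2_integrator_mesh_fourier(1)[OF l2_integrator_l2_martingale[OF mart(2)[OF that]] T])+
    have Psq: "sq_integrable M (P s)" "l2norm M (P s) \<le> \<kappa>" for s
      unfolding P_def by (rule l2_integrator_mesh_fourier[OF \<kappa> T])+
    have P'sq: "sq_integrable M (P' s)" "l2norm M (P' s) \<le> \<kappa>'" for s
      unfolding P'_def by (rule l2_integrator_mesh_fourier[OF \<kappa>' T])+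
    have drift: "l2_integrator M F T (\<lambda>t \<omega>. LINT s:{0..t}|lborel. b s \<omega>) \<beta>" "l2_integrator M F T (\<lambda>t \<omega>. LINT s:{0..t}|lborel. b' s \<omega>) \<beta>'"
      unfolding \<beta>_def \<beta>'_def using p p' T0 by (auto intro!: l2_integrator_drift simp: ito_process_def)
    have A\<beta>: "A s \<le> \<beta>" for s unfolding A_def by (rule l2_integrator_mesh_fourier(2)[OF drift(1) T])
    let ?PJ = "\<lambda>s \<omega>. \<Sum>l\<in>L. J l s \<omega>" and ?PJ' = "\<lambda>s \<omega>. \<Sum>l\<in>L. J' l s \<omega>"
    have PJsq: "sq_integrable M (?PJ s)" "sq_integrable M (?PJ' s)" for s
      by (intro sq_integrable_sum Jsq; assumption)+
    have PJle: "l2norm M (?PJ s) \<le> \<kappa> + c + \<beta>" for s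
    proof -
      \<comment> \<open>The simple part is estimated through \<open>p\<close> and the residual.
        Their bounds are free of \<open>C\<close>, so that the coefficient of
        \<open>\<epsilon>\<close> does not depend on the approximation.\<close>
      have "?PJ s = (\<lambda>\<omega>. P s \<omega> - D s \<omega>)" by (simp add: D_def fun_eq_iff)
      then have "l2norm M (?PJ s) \<le> l2norm M (P s) + l2norm M (D s)"
        using l2norm_diff_le[OF Psq(1) Dsq(1), of s s] by simp
      moreover have "c * \<epsilon> \<le> c" using \<epsilon> by (simp add: c_def mult_left_le)
      ultimately show ?thesis using Psq(2)[of s] Dsq(2)[of s] A\<beta>[of s] by linarith
    qed
    have cardI: "card ?I = 2 * N + 1" by simp
    have meanA: "(\<Sum>s\<in>?I. A s) / (2 * real N + 1) \<le> \<beta> / ?q"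
      unfolding A_def \<beta>_def
      by (rule drift_mesh_fourier[OF T _ cardI]) (use p n l2_integrator_mesh_fourier(1)[OF drift(1) T] in \<open>auto simp: ito_process_def\<close>)
    \<comment> \<open>The second factor of the mean runs through the frequencies
      \<open>k - s\<close>, a reflected range of the same size and with the same pairwise
      distances.\<close>
    have meanA': "(\<Sum>s\<in>?I. A' (k - s)) / (2 * real N + 1) \<le> \<beta>' / ?q"
    proof -
      let ?I' = "(\<lambda>s. k - s) ` ?I"
      have "(\<Sum>s\<in>?I. A' (k - s)) = (\<Sum>s\<in>?I'. A' s)" by (subst sum.reindex) (auto simp: inj_on_def)
      moreover have "(\<Sum>s\<in>?I'. A' s) / (2 * real N + 1) \<le> \<beta>' / ?q"
        unfolding A'_def \<beta>'_def
      proof (rule drift_mesh_fourier[OF T])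
        show "card ?I' = 2 * N + 1" by (subst card_image) (auto simp: inj_on_def)
      qed (use p' n l2_integrator_mesh_fourier(1)[OF drift(2) T] in \<open>auto simp: ito_process_def\<close>)
      ultimately show ?thesis by simp
    qed
    have cancel: "(\<Sum>s\<in>?I. a) / (2 * real N + 1) = a" for a :: real
    proof -
      have e: "real (2 * N + 1) = 2 * real N + 1" by simp
      have ne: "2 * real N + 1 \<noteq> 0" using of_nat_0_le_iff[of N, where 'a=real] by linarith
      show ?thesis unfolding sum_constant cardI e by (rule nonzero_mult_div_cancel_left[OF ne])
    qed
    let ?B = "\<lambda>\<Phi> \<Psi> \<omega>. bohr_mean N (\<lambda>s. \<Phi> s \<omega>) (\<lambda>s. \<Psi> s \<omega>) k"
    have b1: "expectation (\<lambda>\<omega>. norm (?B D P' \<omega>)) \<le> \<kappa>' * (c * \<epsilon> + \<beta> / ?q)"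
    proof -
      have "expectation (\<lambda>\<omega>. norm (?B D P' \<omega>)) \<le> (\<Sum>s\<in>?I. l2norm M (D s) * l2norm M (P' (k - s))) / (2 * real N + 1)"
        by (rule bohr_mean_L1[OF Dsq(1) P'sq(1)])
      also have "\<dots> \<le> (\<Sum>s\<in>?I. (c * \<epsilon> + A s) * \<kappa>') / (2 * real N + 1)"
        using Dsq(2) P'sq(2) \<kappa>0 by (intro divide_right_mono sum_mono mult_mono) (auto intro: order_trans[OF l2norm_nonneg])
      also have "\<dots> = ((\<Sum>s\<in>?I. c * \<epsilon>) / (2 * real N + 1) + (\<Sum>s\<in>?I. A s) / (2 * real N + 1)) * \<kappa>'"
        unfolding sum_distrib_right[symmetric] sum.distrib
        by (simp only: add_divide_distrib[symmetric] times_divide_eq_left)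
      also have "\<dots> \<le> (c * \<epsilon> + \<beta> / ?q) * \<kappa>'"
        unfolding cancel using meanA \<kappa>0 by (intro mult_right_mono) auto
      finally show ?thesis by (simp add: mult.commute)
    qed
    have b2: "expectation (\<lambda>\<omega>. norm (?B ?PJ D' \<omega>)) \<le> (\<kappa> + c + \<beta>) * (c * \<epsilon> + \<beta>' / ?q)"
    proof -
      have nn: "0 \<le> \<kappa> + c + \<beta>" using \<kappa>0 \<beta>0 by (simp add: c_def)
      have "expectation (\<lambda>\<omega>. norm (?B ?PJ D' \<omega>)) \<le> (\<Sum>s\<in>?I. l2norm M (?PJ s) * l2norm M (D' (k - s))) / (2 * real N + 1)"
        by (rule bohr_mean_L1[OF PJsq(1) D'sq(1)])
      also have "\<dots> \<le> (\<Sum>s\<in>?I. (\<kappa> + c + \<beta>) * (c * \<epsilon> + A' (k - s))) / (2 * real N + 1)"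
        using D'sq(2) PJle nn by (intro divide_right_mono sum_mono mult_mono) auto
      also have "\<dots> = (\<kappa> + c + \<beta>) * ((\<Sum>s\<in>?I. c * \<epsilon>) / (2 * real N + 1) + (\<Sum>s\<in>?I. A' (k - s)) / (2 * real N + 1))"
        unfolding sum_distrib_left[symmetric] sum.distrib
        by (simp only: add_divide_distrib[symmetric] times_divide_eq_right)
      also have "\<dots> \<le> (\<kappa> + c + \<beta>) * (c * \<epsilon> + \<beta>' / ?q)"
        unfolding cancel using meanA' nn by (intro mult_left_mono) auto
      finally show ?thesis .
    qed
    define X where "X l \<omega> = (LINT t:{0..T}|lborel. fourier_char k t * of_real (step_value (S l) t \<omega> * step_value (S' l) t \<omega>))" for l \<omega>
    have sv: "sq_integrable ?\<mu> (\<lambda>(t, \<omega>). step_value (S l) t \<omega>)" "sq_integrable ?\<mu> (\<lambda>(t, \<omega>). step_value (S' l) t \<omega>)" if "l \<in> L" for l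
      using that S(1) S'(1) by (auto intro: sq_integrable_step_value)
    have Xint: "integrable M (X l)" if "l \<in> L" for l
      unfolding X_def by (rule time_integral_integrable[OF fourier_product_integrable[OF sv[OF that]]])
    have b3: "expectation (\<lambda>\<omega>. norm (X l \<omega> - Y l \<omega>)) \<le> \<epsilon> * V l" if l: "l \<in> L" for l
    proof -
      have "expectation (\<lambda>\<omega>. norm (X l \<omega> - Y l \<omega>)) \<le> \<epsilon> * (l2norm ?\<mu> (\<lambda>(t, \<omega>). \<sigma> l t \<omega>) + l2norm ?\<mu> (\<lambda>(t, \<omega>). \<sigma>' l t \<omega>) + \<epsilon>)"
        unfolding X_def Y_def by (rule fourier_product_L1[OF sv[OF l] \<sigma>[OF l] S(2)[OF l] S'(2)[OF l]])
      also have "\<dots> \<le> \<epsilon> * V l" unfolding V_def using \<epsilon> by (intro mult_left_mono) auto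
      finally show ?thesis .
    qed
    let ?X = "\<lambda>l l' \<omega>. if l = l' then X l \<omega> else 0"
    have b4: "integrable M (\<lambda>\<omega>. ?B (J l) (J' l') \<omega> - ?X l l' \<omega>)" "expectation (\<lambda>\<omega>. norm (?B (J l) (J' l') \<omega> - ?X l l' \<omega>)) \<le> E / ?q"
      if l: "l \<in> L" "l' \<in> L" for l l'
    proof -
      have eqX: "?X l l' \<omega> = (if l = l' then LINT t:{0..T}|lborel. fourier_char k t * of_real (step_value (S l) t \<omega> * step_value (S' l') t \<omega>) else 0)" for \<omega>
        by (simp add: X_def)
      note * = simple_bohr_mean[OF T W l S(1)[OF l(1)] S'(1)[OF l(2)] C(1) C(2)[OF l(1)] C(3)[OF l(2)] n, of k]
      show "integrable M (\<lambda>\<omega>. ?B (J l) (J' l') \<omega> - ?X l l' \<omega>)" "expectation (\<lambda>\<omega>. norm (?B (J l) (J' l') \<omega> - ?X l l' \<omega>)) \<le> E / ?q"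
        unfolding eqX J_def J'_def E_def using * by auto
    qed
    have BJ: "?B ?PJ ?PJ' \<omega> - (\<Sum>l\<in>L. X l \<omega>) = (\<Sum>l\<in>L. \<Sum>l'\<in>L. ?B (J l) (J' l') \<omega> - ?X l l' \<omega>)" for \<omega>
    proof -
      have "(\<Sum>l\<in>L. X l \<omega>) = (\<Sum>l\<in>L. \<Sum>l'\<in>L. ?X l l' \<omega>)" using L by simp
      then show ?thesis unfolding bohr_mean_sum by (simp only: sum_subtractf)
    qed
    let ?Z = "\<lambda>\<omega>. ?B P P' \<omega> - \<Xi> \<omega>"
    let ?R = "\<lambda>\<omega>. (\<Sum>l\<in>L. \<Sum>l'\<in>L. norm (?B (J l) (J' l') \<omega> - ?X l l' \<omega>)) + (\<Sum>l\<in>L. norm (X l \<omega> - Y l \<omega>)) + norm (?B D P' \<omega>) + norm (?B ?PJ D' \<omega>)"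
    have Zint: "integrable M ?Z"
      by (intro Bochner_Integration.integrable_diff bohr_mean_integrable Psq P'sq \<Xi>int)
    have Rint: "integrable M (\<lambda>\<omega>. \<Sum>l\<in>L. \<Sum>l'\<in>L. norm (?B (J l) (J' l') \<omega> - ?X l l' \<omega>))"
      "integrable M (\<lambda>\<omega>. \<Sum>l\<in>L. norm (X l \<omega> - Y l \<omega>))" "integrable M (\<lambda>\<omega>. norm (?B D P' \<omega>))" "integrable M (\<lambda>\<omega>. norm (?B ?PJ D' \<omega>))"
      by (intro Bochner_Integration.integrable_sum integrable_norm b4(1) Bochner_Integration.integrable_diff Xint Yint
          bohr_mean_integrable Dsq P'sq PJsq D'sq; assumption)+
    have norm_double_sum: "norm (\<Sum>l\<in>L. \<Sum>l'\<in>L. z l l') \<le> (\<Sum>l\<in>L. \<Sum>l'\<in>L. norm (z l l'))" for z :: "_ \<Rightarrow> _ \<Rightarrow> complex"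
      by (rule order_trans[OF norm_sum]) (intro sum_mono norm_sum)
    have gen: "u \<le> u' \<Longrightarrow> v \<le> v' \<Longrightarrow> u + v + y + z \<le> u' + v' + y + z" for u u' v v' y z :: real
      by simp
    have "expectation (\<lambda>\<omega>. norm (?Z \<omega>)) \<le> expectation ?R"
    proof (rule integral_mono_AE)
      show "integrable M (\<lambda>\<omega>. norm (?Z \<omega>))" using Zint by (rule integrable_norm)
      show "integrable M ?R" by (intro Bochner_Integration.integrable_add Rint)
      show "AE \<omega> in M. norm (?Z \<omega>) \<le> ?R \<omega>"
        using \<Xi>Y
      proof eventually_elim
        case (elim \<omega>)
        \<comment> \<open>The factors are replaced one after the other, so the first residual meets
          \<open>P'\<close> and the second meets the simple part of \<open>P\<close>.\<close>
        have 1: "?B P P' \<omega> - ?B ?PJ P' \<omega> = ?B D P' \<omega>" unfolding bohr_mean_diff_left D_def ..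
        have 2: "?B ?PJ P' \<omega> - ?B ?PJ ?PJ' \<omega> = ?B ?PJ D' \<omega>" unfolding bohr_mean_diff_right D'_def ..
        have XY: "(\<Sum>l\<in>L. X l \<omega>) - (\<Sum>l\<in>L. Y l \<omega>) = (\<Sum>l\<in>L. X l \<omega> - Y l \<omega>)" by (rule sum_subtractf[symmetric])
        have Z: "?Z \<omega> = (\<Sum>l\<in>L. \<Sum>l'\<in>L. ?B (J l) (J' l') \<omega> - ?X l l' \<omega>) + (\<Sum>l\<in>L. X l \<omega> - Y l \<omega>) + ?B D P' \<omega> + ?B ?PJ D' \<omega>"
          unfolding elim BJ[symmetric] 1[symmetric] 2[symmetric] XY[symmetric] by simp
        show ?case
          unfolding Z
          by (intro order_trans[OF norm_triangle_mono[OF norm_triangle_mono[OF norm_triangle_mono[OF order_refl order_refl] order_refl] order_refl]]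
              gen norm_double_sum norm_sum)
      qed
    qed
    also have "\<dots> = expectation (\<lambda>\<omega>. \<Sum>l\<in>L. \<Sum>l'\<in>L. norm (?B (J l) (J' l') \<omega> - ?X l l' \<omega>)) + expectation (\<lambda>\<omega>. \<Sum>l\<in>L. norm (X l \<omega> - Y l \<omega>))
        + expectation (\<lambda>\<omega>. norm (?B D P' \<omega>)) + expectation (\<lambda>\<omega>. norm (?B ?PJ D' \<omega>))"
      by (simp only: Bochner_Integration.integral_add Bochner_Integration.integrable_add Rint)
    also have "expectation (\<lambda>\<omega>. \<Sum>l\<in>L. \<Sum>l'\<in>L. norm (?B (J l) (J' l') \<omega> - ?X l l' \<omega>)) = (\<Sum>l\<in>L. \<Sum>l'\<in>L. expectation (\<lambda>\<omega>. norm (?B (J l) (J' l') \<omega> - ?X l l' \<omega>)))"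
      by (subst Bochner_Integration.integral_sum, intro Bochner_Integration.integrable_sum integrable_norm b4(1); assumption?)
        (intro sum.cong refl Bochner_Integration.integral_sum integrable_norm b4(1); assumption)
    also have "expectation (\<lambda>\<omega>. \<Sum>l\<in>L. norm (X l \<omega> - Y l \<omega>)) = (\<Sum>l\<in>L. expectation (\<lambda>\<omega>. norm (X l \<omega> - Y l \<omega>)))"
      by (intro Bochner_Integration.integral_sum integrable_norm Bochner_Integration.integrable_diff Xint Yint)
    also have "(\<Sum>l\<in>L. \<Sum>l'\<in>L. expectation (\<lambda>\<omega>. norm (?B (J l) (J' l') \<omega> - ?X l l' \<omega>))) + (\<Sum>l\<in>L. expectation (\<lambda>\<omega>. norm (X l \<omega> - Y l \<omega>)))
        + expectation (\<lambda>\<omega>. norm (?B D P' \<omega>)) + expectation (\<lambda>\<omega>. norm (?B ?PJ D' \<omega>))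
      \<le> (\<Sum>l\<in>L. \<Sum>l'\<in>L. E / ?q) + (\<Sum>l\<in>L. \<epsilon> * V l) + \<kappa>' * (c * \<epsilon> + \<beta> / ?q) + (\<kappa> + c + \<beta>) * (c * \<epsilon> + \<beta>' / ?q)"
      by (intro add_mono sum_mono b4(2) b3 b1 b2)
    also have "\<dots> = \<epsilon> * G + H / ?q"
    proof -
      have "(\<Sum>l\<in>L. \<Sum>l'\<in>L. E / ?q) = c * (c * E) / ?q" by (simp add: c_def)
      moreover have "(\<Sum>l\<in>L. \<epsilon> * V l) = \<epsilon> * (\<Sum>l\<in>L. V l)" by (rule sum_distrib_left[symmetric])
      ultimately show ?thesis unfolding G_def H_def by (simp add: algebra_simps add_divide_distrib)
    qed
    also have "\<dots> \<le> \<eta>" using \<epsilon>G Hq by linarith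
    finally show "expectation (\<lambda>\<omega>. norm (bohr_mean N (\<lambda>s. mesh_fourier n p s \<omega>) (\<lambda>s. mesh_fourier n p' s \<omega>) k - \<Xi> \<omega>)) \<le> \<eta>"
      unfolding P_def P'_def .
  qed
qed

text \<open>At fixed \<open>N\<close> only finitely many frequencies occur, and their mesh
  coefficients converge in \<open>L2\<close> to the stochastic integrals. The bound of
  \<open>mesh_bohr_convergence\<close> holds for all \<open>n \<ge> 2N+1\<close>, so it survives the
  limit in \<open>n\<close>; only then does \<open>N\<close> grow.\<close>

lemma stochastic_bohr_convergence:
  assumes T: "T = 2 * pi" and L: "finite L" and W: "independent_brownian_motions M F T L W"
    and p: "ito_process M F T L W p \<sigma> b" and p': "ito_process M F T L W p' \<sigma>' b'"
  shows "has_bohr_convolution_in_prob M (fourier_coeff_d M F p) (fourier_coeff_d M F p')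
    (\<lambda>\<omega> k. 1 / (2 * pi) * fourier_coeff (\<lambda>t. complex_of_real (\<Sum>l\<in>L. \<sigma> l t \<omega> * \<sigma>' l t \<omega>)) k)"
  unfolding has_bohr_convolution_in_prob_def
proof
  fix k
  let ?\<Psi> = "\<lambda>p s. stochastic_integral M F T p (\<lambda>t _. fourier_char s t)"
  define \<Xi> where "\<Xi> \<omega> = (LINT t:{0..T}|lborel. fourier_char k t * of_real (\<Sum>l\<in>L. \<sigma> l t \<omega> * \<sigma>' l t \<omega>))" for \<omega>
  let ?B = "\<lambda>N \<Phi> \<Psi> \<omega>. bohr_mean N (\<lambda>s. \<Phi> s \<omega>) (\<lambda>s. \<Psi> s \<omega>) k"
  have T0: "0 \<le> T" "0 < T" using T by auto
  have bm: "brownian_motion M F T (W l)" if "l \<in> L" for l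
    using W that by (simp add: independent_brownian_motions_def)
  obtain \<kappa> where \<kappa>: "l2_integrator M F T p \<kappa>" using ito_process_integrator[OF p bm L T0(1)] by blast
  obtain \<kappa>' where \<kappa>': "l2_integrator M F T p' \<kappa>'" using ito_process_integrator[OF p' bm L T0(1)] by blast
  have \<Psi>: "sq_integrable M (?\<Psi> X s)" "(\<lambda>n. l2norm M (\<lambda>\<omega>. mesh_fourier n X s \<omega> - ?\<Psi> X s \<omega>)) \<longlonglongrightarrow> 0"
    if X: "l2_integrator M F T X \<theta>" for X \<theta> s
    using stochastic_integral_mesh[OF X T0(2) fourier_char_Lipschitz[of s]] unfolding mesh_fourier_def T by auto
  have \<Xi>int: "integrable M \<Xi>"
    unfolding \<Xi>_def by (rule mesh_bohr_convergence(1)[OF T L W p p' zero_less_one])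
  have Zint: "integrable M (\<lambda>\<omega>. ?B N (?\<Psi> p) (?\<Psi> p') \<omega> - \<Xi> \<omega>)" for N
    by (intro Bochner_Integration.integrable_diff bohr_mean_integrable \<Psi>(1)[OF \<kappa>] \<Psi>(1)[OF \<kappa>'] \<Xi>int)
  have lim: "(\<lambda>N. expectation (\<lambda>\<omega>. norm (?B N (?\<Psi> p) (?\<Psi> p') \<omega> - \<Xi> \<omega>))) \<longlonglongrightarrow> 0"
  proof (rule tendstoI)
    fix \<eta> :: real assume "0 < \<eta>"
    then have \<eta>: "0 < \<eta> / 2" by simp
    obtain N0 where N0: "\<And>N n. N0 \<le> N \<Longrightarrow> 2 * N + 1 \<le> n \<Longrightarrow>
      expectation (\<lambda>\<omega>. norm (?B N (mesh_fourier n p) (mesh_fourier n p') \<omega> - \<Xi> \<omega>)) \<le> \<eta> / 2"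
      using mesh_bohr_convergence(2)[OF T L W p p' \<eta>, of k] unfolding \<Xi>_def by blast
    have "expectation (\<lambda>\<omega>. norm (?B N (?\<Psi> p) (?\<Psi> p') \<omega> - \<Xi> \<omega>)) \<le> \<eta> / 2" if N: "N0 \<le> N" for N
    proof -
      let ?I = "{- int N..int N}"
      let ?d = "\<lambda>X n s. l2norm M (\<lambda>\<omega>. mesh_fourier n X s \<omega> - ?\<Psi> X s \<omega>)"
      \<comment> \<open>Cost of exchanging the stochastic integrals for mesh sums in the two
        factors; it tends to 0 as \<open>n\<close> grows with \<open>N\<close> fixed.\<close>
      let ?r = "\<lambda>n. (\<Sum>s\<in>?I. ?d p n s * l2norm M (?\<Psi> p' (k - s))) / (2 * real N + 1) + (\<Sum>s\<in>?I. \<kappa> * ?d p' n (k - s)) / (2 * real N + 1)"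
      have "?r \<longlonglongrightarrow> (\<Sum>s\<in>?I. 0 * l2norm M (?\<Psi> p' (k - s))) / (2 * real N + 1) + (\<Sum>s\<in>?I. \<kappa> * 0) / (2 * real N + 1)"
        by (intro tendsto_add tendsto_divide tendsto_sum tendsto_mult tendsto_const \<Psi>(2)[OF \<kappa>] \<Psi>(2)[OF \<kappa>']) auto
      then have r0: "(\<lambda>n. ?r n + \<eta> / 2) \<longlonglongrightarrow> 0 + \<eta> / 2" by (intro tendsto_add tendsto_const) simp
      have "expectation (\<lambda>\<omega>. norm (?B N (?\<Psi> p) (?\<Psi> p') \<omega> - \<Xi> \<omega>)) \<le> ?r n + \<eta> / 2" if n: "2 * N + 1 \<le> n" for n
      proof -
        let ?P = "mesh_fourier n p" and ?P' = "mesh_fourier n p'"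
        let ?D = "\<lambda>s \<omega>. ?P s \<omega> - ?\<Psi> p s \<omega>" and ?D' = "\<lambda>s \<omega>. ?P' s \<omega> - ?\<Psi> p' s \<omega>"
        note P = l2_integrator_mesh_fourier[OF \<kappa> T] and P' = l2_integrator_mesh_fourier[OF \<kappa>' T]
        have D: "sq_integrable M (?D s)" "sq_integrable M (?D' s)" for s
          by (intro sq_integrable_diff P(1) P'(1) \<Psi>(1)[OF \<kappa>] \<Psi>(1)[OF \<kappa>'])+
        have i: "integrable M (\<lambda>\<omega>. norm (?B N ?D (?\<Psi> p') \<omega>))" "integrable M (\<lambda>\<omega>. norm (?B N ?P ?D' \<omega>))"
          "integrable M (\<lambda>\<omega>. norm (?B N ?P ?P' \<omega> - \<Xi> \<omega>))"
          by (intro integrable_norm Bochner_Integration.integrable_diff bohr_mean_integrable D P(1) P'(1) \<Psi>(1)[OF \<kappa>'] \<Xi>int)+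
        have "expectation (\<lambda>\<omega>. norm (?B N (?\<Psi> p) (?\<Psi> p') \<omega> - \<Xi> \<omega>))
          \<le> expectation (\<lambda>\<omega>. norm (?B N ?D (?\<Psi> p') \<omega>) + norm (?B N ?P ?D' \<omega>) + norm (?B N ?P ?P' \<omega> - \<Xi> \<omega>))"
        proof (rule integral_mono)
          show "integrable M (\<lambda>\<omega>. norm (?B N (?\<Psi> p) (?\<Psi> p') \<omega> - \<Xi> \<omega>))" using Zint by (rule integrable_norm)
          show "integrable M (\<lambda>\<omega>. norm (?B N ?D (?\<Psi> p') \<omega>) + norm (?B N ?P ?D' \<omega>) + norm (?B N ?P ?P' \<omega> - \<Xi> \<omega>))"
            by (intro Bochner_Integration.integrable_add i)
          show "norm (?B N (?\<Psi> p) (?\<Psi> p') \<omega> - \<Xi> \<omega>) \<le> norm (?B N ?D (?\<Psi> p') \<omega>) + norm (?B N ?P ?D' \<omega>) + norm (?B N ?P ?P' \<omega> - \<Xi> \<omega>)" for \<omega>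
          proof -
            have "?B N (?\<Psi> p) (?\<Psi> p') \<omega> - \<Xi> \<omega> = - ?B N ?D (?\<Psi> p') \<omega> + - ?B N ?P ?D' \<omega> + (?B N ?P ?P' \<omega> - \<Xi> \<omega>)"
              unfolding bohr_mean_diff_left[symmetric] bohr_mean_diff_right[symmetric] by simp
            then show ?thesis
              using norm_triangle_ineq[of "- ?B N ?D (?\<Psi> p') \<omega> + - ?B N ?P ?D' \<omega>" "?B N ?P ?P' \<omega> - \<Xi> \<omega>"]
                norm_triangle_ineq[of "- ?B N ?D (?\<Psi> p') \<omega>" "- ?B N ?P ?D' \<omega>"] by (simp only: norm_minus_cancel)
          qed
        qed
        also have "\<dots> = expectation (\<lambda>\<omega>. norm (?B N ?D (?\<Psi> p') \<omega>)) + expectation (\<lambda>\<omega>. norm (?B N ?P ?D' \<omega>)) + expectation (\<lambda>\<omega>. norm (?B N ?P ?P' \<omega> - \<Xi> \<omega>))"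
          by (simp only: Bochner_Integration.integral_add Bochner_Integration.integrable_add i)
        also have "\<dots> \<le> (\<Sum>s\<in>?I. ?d p n s * l2norm M (?\<Psi> p' (k - s))) / (2 * real N + 1) + (\<Sum>s\<in>?I. \<kappa> * ?d p' n (k - s)) / (2 * real N + 1) + \<eta> / 2"
        proof (intro add_mono)
          show "expectation (\<lambda>\<omega>. norm (?B N ?D (?\<Psi> p') \<omega>)) \<le> (\<Sum>s\<in>?I. ?d p n s * l2norm M (?\<Psi> p' (k - s))) / (2 * real N + 1)"
            by (rule bohr_mean_L1[OF D(1) \<Psi>(1)[OF \<kappa>']])
          have "expectation (\<lambda>\<omega>. norm (?B N ?P ?D' \<omega>)) \<le> (\<Sum>s\<in>?I. l2norm M (?P s) * ?d p' n (k - s)) / (2 * real N + 1)"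
            by (rule bohr_mean_L1[OF P(1) D(2)])
          also have "\<dots> \<le> (\<Sum>s\<in>?I. \<kappa> * ?d p' n (k - s)) / (2 * real N + 1)"
            using P(2) by (intro divide_right_mono sum_mono mult_right_mono) auto
          finally show "expectation (\<lambda>\<omega>. norm (?B N ?P ?D' \<omega>)) \<le> (\<Sum>s\<in>?I. \<kappa> * ?d p' n (k - s)) / (2 * real N + 1)" .
          show "expectation (\<lambda>\<omega>. norm (?B N ?P ?P' \<omega> - \<Xi> \<omega>)) \<le> \<eta> / 2" by (rule N0[OF N n])
        qed
        finally show ?thesis .
      qed
      then have "expectation (\<lambda>\<omega>. norm (?B N (?\<Psi> p) (?\<Psi> p') \<omega> - \<Xi> \<omega>)) \<le> 0 + \<eta> / 2"
        by (intro LIMSEQ_le_const[OF r0]) (auto intro: exI[of _ "2 * N + 1"])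
      then show ?thesis by simp
    qed
    moreover have "0 \<le> expectation (\<lambda>\<omega>. norm (?B N (?\<Psi> p) (?\<Psi> p') \<omega> - \<Xi> \<omega>))" for N
      by (rule Bochner_Integration.integral_nonneg) simp
    ultimately show "\<forall>\<^sub>F N in sequentially. dist (expectation (\<lambda>\<omega>. norm (?B N (?\<Psi> p) (?\<Psi> p') \<omega> - \<Xi> \<omega>))) 0 < \<eta>"
      using \<open>0 < \<eta>\<close> unfolding eventually_sequentially by (intro exI[of _ N0]) (force simp: dist_real_def)
  qed
  \<comment> \<open>On the left each of the two coefficients contributes
    \<open>1 / (2 * pi)\<close>; on the right one factor belongs to \<open>fourier_coeff\<close> and
    one stands in front of it.\<close>
  let ?c = "(1 / complex_of_real (2 * pi))\<^sup>2"
  have lhs: "bohr_mean N (fourier_coeff_d M F p \<omega>) (fourier_coeff_d M F p' \<omega>) k = ?c * ?B N (?\<Psi> p) (?\<Psi> p') \<omega>" for N \<omega>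
  proof -
    have "fourier_coeff_d M F X \<omega> s = 1 / complex_of_real (2 * pi) * ?\<Psi> X s \<omega>" for X s
      unfolding fourier_coeff_d_def fourier_char_def T by simp
    then show ?thesis unfolding bohr_mean_def
      by (simp add: sum_distrib_left power2_eq_square mult_ac)
  qed
  have rhs: "1 / (2 * pi) * fourier_coeff (\<lambda>t. complex_of_real (\<Sum>l\<in>L. \<sigma> l t \<omega> * \<sigma>' l t \<omega>)) k = ?c * \<Xi> \<omega>" for \<omega>
  proof -
    have comm: "z * fourier_char k t = fourier_char k t * z" for z t by (rule mult.commute)
    have "fourier_coeff (\<lambda>t. complex_of_real (\<Sum>l\<in>L. \<sigma> l t \<omega> * \<sigma>' l t \<omega>)) k = 1 / (2 * pi) * \<Xi> \<omega>"
      unfolding fourier_coeff_def \<Xi>_def T fourier_char_def[symmetric] by (simp only: comm)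
    then show ?thesis by (simp add: power2_eq_square)
  qed
  show "tendsto_in_prob M (\<lambda>N \<omega>. bohr_mean N (fourier_coeff_d M F p \<omega>) (fourier_coeff_d M F p' \<omega>) k)
      (\<lambda>\<omega>. 1 / (2 * pi) * fourier_coeff (\<lambda>t. complex_of_real (\<Sum>l\<in>L. \<sigma> l t \<omega> * \<sigma>' l t \<omega>)) k)"
    unfolding lhs rhs
  proof (rule L1_imp_tendsto_in_prob)
    have Bint: "integrable M (\<lambda>\<omega>. ?B N (?\<Psi> p) (?\<Psi> p') \<omega>)" for N
      by (intro bohr_mean_integrable \<Psi>(1)[OF \<kappa>] \<Psi>(1)[OF \<kappa>'])
    show "(\<lambda>\<omega>. ?c * ?B N (?\<Psi> p) (?\<Psi> p') \<omega>) \<in> borel_measurable M" for N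
      using Bint by (intro borel_measurable_times) auto
    show "(\<lambda>\<omega>. ?c * \<Xi> \<omega>) \<in> borel_measurable M" using \<Xi>int by (intro borel_measurable_times) auto
    show "integrable M (\<lambda>\<omega>. ?c * ?B N (?\<Psi> p) (?\<Psi> p') \<omega> - ?c * \<Xi> \<omega>)" for N
      unfolding right_diff_distrib[symmetric] by (intro integrable_mult_right Zint)
    have "(\<lambda>N. norm ?c * expectation (\<lambda>\<omega>. norm (?B N (?\<Psi> p) (?\<Psi> p') \<omega> - \<Xi> \<omega>))) \<longlonglongrightarrow> norm ?c * 0"
      by (intro tendsto_mult tendsto_const lim)
    then show "(\<lambda>N. expectation (\<lambda>\<omega>. norm (?c * ?B N (?\<Psi> p) (?\<Psi> p') \<omega> - ?c * \<Xi> \<omega>))) \<longlonglongrightarrow> 0"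
      unfolding right_diff_distrib[symmetric] norm_mult integral_mult_right_zero by simp
  qed
qed

end

theorem theorem2p1:
  fixes M :: "'a measure" and F :: "real \<Rightarrow> 'a measure" and d :: nat
    and W :: "nat \<Rightarrow> real \<Rightarrow> 'a \<Rightarrow> real"
    and \<sigma> :: "nat \<Rightarrow> nat \<Rightarrow> real \<Rightarrow> 'a \<Rightarrow> real"
    and b :: "nat \<Rightarrow> real \<Rightarrow> 'a \<Rightarrow> real"
    and p :: "nat \<Rightarrow> real \<Rightarrow> 'a \<Rightarrow> real"
    and \<Sigma> :: "nat \<Rightarrow> nat \<Rightarrow> real \<Rightarrow> 'a \<Rightarrow> real"
  assumes space: "usual_filtered_prob_space M F (2 * pi)"
    and W: "independent_brownian_motions M F (2 * pi) {1..d} W"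
    and \<sigma>_adapted: "\<And>j l. j \<in> {1, 2} \<Longrightarrow> l \<in> {1..d} \<Longrightarrow>
      adapted_process F (2 * pi) (\<sigma> j l) \<and> measurable_process M (2 * pi) (\<sigma> j l)"
    and b_adapted: "\<And>j. j \<in> {1, 2} \<Longrightarrow>
      adapted_process F (2 * pi) (b j) \<and> measurable_process M (2 * pi) (b j)"
    and b_L2: "\<And>j. j \<in> {1, 2} \<Longrightarrow>
      (\<integral>\<^sup>+\<omega>. (\<integral>\<^sup>+t\<in>{0..2*pi}. ennreal ((b j t \<omega>)^2) \<partial>lborel) \<partial>M) < \<infinity>"
    and \<sigma>_L4: "\<And>j l. j \<in> {1, 2} \<Longrightarrow> l \<in> {1..d} \<Longrightarrow>
      (\<integral>\<^sup>+\<omega>. (\<integral>\<^sup>+t\<in>{0..2*pi}. ennreal ((\<sigma> j l t \<omega>)^4) \<partial>lborel) \<partial>M) < \<infinity>"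
    and p_semimartingale: "\<And>j. j \<in> {1, 2} \<Longrightarrow> continuous_semimartingale M F (2 * pi) (p j)"
    and p_differential: "\<And>j. j \<in> {1, 2} \<Longrightarrow>
      has_ito_differential M F (2 * pi) {1..d} W (p j) (\<sigma> j) (b j)"
    and \<Sigma>_def: "\<And>i j t \<omega>. \<Sigma> i j t \<omega> = (\<Sum>l=1..d. \<sigma> i l t \<omega> * \<sigma> j l t \<omega>)"
  shows "\<forall>i\<in>{1, 2}. \<forall>j\<in>{1, 2}.
    has_bohr_convolution_in_prob M
      (fourier_coeff_d M F (p i)) (fourier_coeff_d M F (p j))
      (\<lambda>\<omega> k. 1 / (2 * pi) * fourier_coeff (\<lambda>t. complex_of_real (\<Sigma> i j t \<omega>)) k)"
proof (intro ballI)
  interpret usual_filtered_prob_space M F "2 * pi" by (rule space)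
  have ito: "ito_process M F (2 * pi) {1..d} W (p j) (\<sigma> j) (b j)" if j: "j \<in> {1, 2}" for j
    unfolding ito_process_def
  proof (intro conjI ballI)
    show "p j t \<in> borel_measurable M" if "t \<in> {0..2 * pi}" for t
      using p_semimartingale[OF j] that measurable_F[of "p j t" t]
      by (auto simp: continuous_semimartingale_def adapted_process_def)
    show "sq_integrable (time_measure (2 * pi) \<Otimes>\<^sub>M M) (\<lambda>(t, \<omega>). \<sigma> j l t \<omega>)" if "l \<in> {1..d}" for l
      using \<sigma>_adapted[OF j that] \<sigma>_L4[OF j that] by (intro sq_integrable_fourth_power) auto
    show "sq_integrable (time_measure (2 * pi) \<Otimes>\<^sub>M M) (\<lambda>(t, \<omega>). b j t \<omega>)"
      using b_adapted[OF j] b_L2[OF j] by (intro sq_integrable_time_product) auto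
    show "has_ito_differential M F (2 * pi) {1..d} W (p j) (\<sigma> j) (b j)" by (rule p_differential[OF j])
  qed
  fix i j :: nat assume ij: "i \<in> {1, 2}" "j \<in> {1, 2}"
  show "has_bohr_convolution_in_prob M (fourier_coeff_d M F (p i)) (fourier_coeff_d M F (p j))
      (\<lambda>\<omega> k. 1 / (2 * pi) * fourier_coeff (\<lambda>t. complex_of_real (\<Sigma> i j t \<omega>)) k)"
    unfolding \<Sigma>_def
    by (rule stochastic_bohr_convergence[OF refl finite_atLeastAtMost W ito[OF ij(1)] ito[OF ij(2)]])
qed

end
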